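(* Let $n\ge 3$ and let $\mathfrak R=\{\mathbf r_1,\mathbf r_2,\mathbf r_3\}$ be a non-rich partial frame in involution on an open neighborhood $\Omega\subset\mathbb R^n$ of $\bar u$ (with flat symmetric connection $\tilde\nabla$), such that for all $1\le i\neq j\le 3$ $$\tilde\nabla_{\mathbf r_i}\mathbf r_j\in\operatorname{span}_{C^\infty(\Omega)}\{\mathbf r_i,\mathbf r_j\}\iff[\mathbf r_i,\mathbf r_j]\in\operatorname{span}_{C^\infty(\Omega)}\{\mathbf r_i,\mathbf r_j\},\qquad\text{and}\qquad \tilde\nabla_{\mathbf r_i}\mathbf r_j\in\operatorname{span}_{C^\infty(\Omega)}\mathfrak R .$$ For $i,j,k\in\{1,2,3\}$ let $c_{ij}^k$ and $\Gamma_{ij}^k$ be defined by $[\mathbf r_i,\mathbf r_j]=\sum_{k=1}^3c_{ij}^k\mathbf r_k$ and $\tilde\nabla_{\mathbf r_i}\mathbf r_j=\sum_{k=1}^3\Gamma_{ij}^k\mathbf r_k$ (for $i\ne j$). Up to permutation of indices and by shrinking $\Omega$, assume that $c_{23}^1$ is nowhere zero on $\Omega$. Let $$A_\lambda=\begin{bmatrix}c_{23}^1&\Gamma_{32}^1&-\Gamma_{23}^1\\ \Gamma_{31}^2&c_{13}^2&-\Gamma_{13}^2\\ \Gamma_{21}^3&-\Gamma_{12}^3&c_{12}^3\end{bmatrix},$$ let $\phi_i^s$ ($i=1,2,3$, $s=2,3$) be the functions of the $c$'s and $\Gamma$'s given in the context, and consider the six conditions $$(\mathrm{C})\qquad \mathbf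 r_i(\phi_j^s)-\mathbf r_j(\phi_i^s)=\phi_j^2\phi_i^3-\phi_i^2\phi_j^3+\sum_{k=1}^3c_{ij}^k\phi_k^s,\qquad 1\le i<j\le3,\ s=2,3.$$ - If $A_\lambda$ has rank 1 and conditions (C) are satisfied in a neighborhood of $\bar u$, then the solution set $\mathcal F(\mathfrak R)$ of the system $\tilde\nabla_{\mathbf r_i}\mathbf f=\lambda^i\mathbf r_i$, $i=1,2,3$, depends on $n+2$ arbitrary functions of $n-3$ variables (2 of them determine the values of $\lambda^2$ and $\lambda^3$, and $n$ of them determine the values of $\mathbf f$, along an $(n-3)$-dimensional manifold passing through $\bar u$ and transverse to $\mathfrak R$). The set $\mathcal F(\mathfrak R)$ contains strictly hyperbolic fluxes. - If $A_\lambda$ has rank 2 at $\bar u$, or conditions (C) are not satisfied at $\bar u$, then the three eigenfunctions must coincide in a neighborhood of $\bar u$, i.e. $\lambda^1=\lambda^2=\lambda^3=\lambda$ for some function $\lambda$ that is constant along the integral manifolds of the involutive frame $\mathfrak R$ and can take arbitrary values along a manifold $\Xi$ transverse to $\mathfrak R$. The solution set $\mathcal F(\mathfrak R)$ depends on $n+1$ arbitrary functions of $n-3$ variables (1 of them determines the values of $\lambda$ and $n$ of them determine the values of $\mathbf f$ along an $(n-3)$-dimensional manifold passing through $\bar u$ and transverse to $\mathfrak R$). The set $\mathcal F(\mathfrak R)$ does not contain strictly hyperbolic fluxes.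
   Context: All objects are $C^\infty$-smooth. A connection $\tilde\nabla$ is symmetric if $\tilde\nabla_{\mathbf r}\mathbf s-\tilde\nabla_{\mathbf s}\mathbf r=[\mathbf r,\mathbf s]$ and flat if $\tilde\nabla_{\mathbf r}\tilde\nabla_{\mathbf s}\mathbf t-\tilde\nabla_{\mathbf s}\tilde\nabla_{\mathbf r}\mathbf t=\tilde\nabla_{[\mathbf r,\mathbf s]}\mathbf t$; concretely, $\tilde\nabla$ is the connection with $\tilde\nabla_{\partial/\partial u^i}\partial/\partial u^j=0$ for fixed coordinates $u^1,\dots,u^n$. A partial frame on $\Omega$ is a set of smooth vector fields linearly independent at every point; it is in involution if all brackets $[\mathbf r_i,\mathbf r_j]$ lie in $\operatorname{span}_{C^\infty(\Omega)}\mathfrak R$, and rich if $[\mathbf r_i,\mathbf r_j]\in\operatorname{span}_{C^\infty(\Omega)}\{\mathbf r_i,\mathbf r_j\}$ for all $i,j$. $\mathcal F(\mathfrak R)$ is the set of smooth vector fields $\mathbf f$ near $\bar u$ for which there exist smooth functions $\lambda^i$ ("eigenfunctions") near $\bar u$ with $\tilde\nabla_{\mathbf r_i}\mathbf f=\lambda^i\mathbf r_i$, $i=1,2,3$; its elements are called fluxes. A flux is strictly hyperbolic (near $\bar u$) if at each point of a neighborhood of $\bar u$ the operator $\mathbf v\mapsto\tilde\nabla_{\mathbf v}\mathbf f$ has $n$ distinct real eigenvalues. A submanifold is transverse to $\mathfrak R$ if at each of its points its tangent space is complementary to the span of $\mathfrak R$. "Depends on" functions means that the listed smooth data can be prescribed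 arbitrarily and parametrize the local solutions. The functions $\phi_i^s$ are: $\phi_1^2=\dfrac{\Gamma_{21}^2\Gamma_{23}^1}{c_{32}^1}$, $\phi_2^2=\dfrac{\Gamma_{23}^1}{\Gamma_{32}^1}(\Gamma_{32}^3-\Gamma_{12}^1)-\dfrac{c_{32}^1}{\Gamma_{32}^1}\,\mathbf r_2\!\left(\dfrac{\Gamma_{32}^1}{c_{32}^1}\right)$, $\phi_3^2=-\Gamma_{23}^2$, $\phi_1^3=\dfrac{\Gamma_{31}^3\Gamma_{32}^1}{c_{32}^1}$, $\phi_2^3=\Gamma_{32}^3$, $\phi_3^3=\dfrac{\Gamma_{32}^1}{\Gamma_{23}^1}(\Gamma_{13}^1-\Gamma_{23}^2)+\dfrac{c_{32}^1}{\Gamma_{23}^1}\,\mathbf r_3\!\left(\dfrac{\Gamma_{23}^1}{c_{32}^1}\right)$. Here it is assumed that $\Gamma_{23}^1$ and $\Gamma_{32}^1$ are nowhere zero on $\Omega$, so that these functions are well defined (in the paper this is regarded as a consequence of $c_{23}^1\neq0$ and the first hypothesis, which is read as: in each row of $A_\lambda$ either all three entries are zero or all three are non-zero). *)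

theory Defs
  imports "HOL-Analysis.Analysis"
begin

(* Class C^k and C^infinity on a set S. Only used with S open. *)
primrec class_C_on :: "nat \<Rightarrow> 'a::real_normed_vector set \<Rightarrow> ('a \<Rightarrow> 'b::real_normed_vector) \<Rightarrow> bool" where
  "class_C_on 0 S f \<longleftrightarrow> continuous_on S f"
| "class_C_on (Suc k) S f \<longleftrightarrow>
     (\<forall>x\<in>S. f differentiable (at x)) \<and>
     (\<forall>v. class_C_on k S (\<lambda>x. frechet_derivative f (at x) v))"

definition smooth_on :: "'a::real_normed_vector set \<Rightarrow> ('a \<Rightarrow> 'b::real_normed_vector) \<Rightarrow> bool" where
  "smooth_on S f \<longleftrightarrow> (\<forall>k. class_C_on k S f)"

text \<open>Vector fields are maps \<^typ>\<open>real^'n \<Rightarrow> real^'n\<close>, given by their components with respect to the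
  standard coordinate fields. \<open>along X h\<close> is the derivative \<open>X(h)\<close> of a scalar function.\<close>

definition along :: "(real^'n \<Rightarrow> real^'n) \<Rightarrow> (real^'n \<Rightarrow> real) \<Rightarrow> real^'n \<Rightarrow> real" where
  "along X h u = frechet_derivative h (at u) (X u)"

text \<open>The connection for which the standard coordinate fields are parallel.\<close>

definition nabla :: "(real^'n \<Rightarrow> real^'n) \<Rightarrow> (real^'n \<Rightarrow> real^'n) \<Rightarrow> real^'n \<Rightarrow> real^'n" where
  "nabla X Y u = (\<chi> j. along X (\<lambda>x. Y x $ j) u)"

definition lie_bracket :: "(real^'n \<Rightarrow> real^'n) \<Rightarrow> (real^'n \<Rightarrow> real^'n) \<Rightarrow> real^'n \<Rightarrow> real^'n" where
  "lie_bracket X Y u = (\<chi> j. along X (\<lambda>x. Y x $ j) u - along Y (\<lambda>x. X x $ j) u)"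

lemma nabla_coordinate_fields: "nabla (\<lambda>_. axis i 1) (\<lambda>_. axis j 1) u = 0"
  by (simp add: nabla_def along_def vec_eq_iff)

lemma nabla_symmetric: "nabla X Y u - nabla Y X u = lie_bracket X Y u"
  by (simp add: nabla_def lie_bracket_def vec_eq_iff)

text \<open>The span of the fields \<open>r i\<close>, \<open>i \<in> I\<close>, over the smooth functions on \<open>\<Omega>\<close>.\<close>

definition smooth_span ::
  "(real^'n) set \<Rightarrow> ('i \<Rightarrow> real^'n \<Rightarrow> real^'n) \<Rightarrow> 'i set \<Rightarrow> (real^'n \<Rightarrow> real^'n) set" where
  "smooth_span \<Omega> r I =
     {X. \<exists>a. (\<forall>i\<in>I. smooth_on \<Omega> (a i)) \<and> (\<forall>u\<in>\<Omega>. X u = (\<Sum>i\<in>I. a i u *\<^sub>R r i u))}"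

definition partial_frame :: "(real^'n) set \<Rightarrow> ('i \<Rightarrow> real^'n \<Rightarrow> real^'n) \<Rightarrow> 'i set \<Rightarrow> bool" where
  "partial_frame \<Omega> r I \<longleftrightarrow>
     (\<forall>i\<in>I. smooth_on \<Omega> (r i)) \<and>
     (\<forall>u\<in>\<Omega>. inj_on (\<lambda>i. r i u) I \<and> independent ((\<lambda>i. r i u) ` I))"

definition in_involution :: "(real^'n) set \<Rightarrow> ('i \<Rightarrow> real^'n \<Rightarrow> real^'n) \<Rightarrow> 'i set \<Rightarrow> bool" where
  "in_involution \<Omega> r I \<longleftrightarrow> (\<forall>i\<in>I. \<forall>j\<in>I. lie_bracket (r i) (r j) \<in> smooth_span \<Omega> r I)"

definition rich :: "(real^'n) set \<Rightarrow> ('i \<Rightarrow> real^'n \<Rightarrow> real^'n) \<Rightarrow> 'i set \<Rightarrow> bool" where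
  "rich \<Omega> r I \<longleftrightarrow> (\<forall>i\<in>I. \<forall>j\<in>I. lie_bracket (r i) (r j) \<in> smooth_span \<Omega> r {i, j})"

text \<open>\<open>f\<close> is a flux near \<open>p\<close> with eigenfunctions \<open>lam i\<close>. The functions are total, but only their
  values near \<open>p\<close> matter.\<close>

definition flux_with_eigenfunctions ::
  "(real^'n) set \<Rightarrow> ('i \<Rightarrow> real^'n \<Rightarrow> real^'n) \<Rightarrow> 'i set \<Rightarrow> real^'n \<Rightarrow>
   (real^'n \<Rightarrow> real^'n) \<Rightarrow> ('i \<Rightarrow> real^'n \<Rightarrow> real) \<Rightarrow> bool" where
  "flux_with_eigenfunctions \<Omega> r I p f lam \<longleftrightarrow>
     (\<exists>U. open U \<and> p \<in> U \<and> U \<subseteq> \<Omega> \<and> smooth_on U f \<and> (\<forall>i\<in>I. smooth_on U (lam i)) \<and>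
          (\<forall>i\<in>I. \<forall>u\<in>U. nabla (r i) f u = lam i u *\<^sub>R r i u))"

definition fluxes ::
  "(real^'n) set \<Rightarrow> ('i \<Rightarrow> real^'n \<Rightarrow> real^'n) \<Rightarrow> 'i set \<Rightarrow> real^'n \<Rightarrow> (real^'n \<Rightarrow> real^'n) set" where
  "fluxes \<Omega> r I p = {f. \<exists>lam. flux_with_eigenfunctions \<Omega> r I p f lam}"

definition strictly_hyperbolic_near :: "real^'n \<Rightarrow> (real^'n \<Rightarrow> real^'n) \<Rightarrow> bool" where
  "strictly_hyperbolic_near p f \<longleftrightarrow>
     (\<forall>\<^sub>F u in nhds p. card {e::real. \<exists>v. v \<noteq> 0 \<and> nabla (\<lambda>_. v) f u = e *\<^sub>R v} = CARD('n))"

text \<open>Embedded submanifolds of dimension \<open>k\<close>, by slice charts. The model space is a subspace \<open>L\<close>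
  of the ambient space, so that \<open>k = 0\<close> is included.\<close>

definition smooth_submanifold :: "nat \<Rightarrow> 'a::euclidean_space set \<Rightarrow> bool" where
  "smooth_submanifold k M \<longleftrightarrow>
     (\<forall>p\<in>M. \<exists>U V \<Phi> \<Psi> L. open U \<and> p \<in> U \<and> open V \<and> homeomorphism U V \<Phi> \<Psi> \<and>
        smooth_on U \<Phi> \<and> smooth_on V (\<Psi> :: 'a \<Rightarrow> 'a) \<and>
        subspace L \<and> dim L = k \<and> \<Phi> ` (U \<inter> M) = V \<inter> L)"

text \<open>Velocities at \<open>p\<close> of smooth curves in \<open>M\<close>.\<close>

definition tangent_space :: "'a::euclidean_space set \<Rightarrow> 'a \<Rightarrow> 'a set" where
  "tangent_space M p =
     {v. \<exists>\<gamma> e. 0 < e \<and> smooth_on {-e<..<e} \<gamma> \<and> \<gamma> ` {-e<..<e} \<subseteq> M \<and> \<gamma> 0 = p \<and>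
         (\<gamma> has_vector_derivative v) (at (0::real))}"

definition smooth_along ::
  "'a::euclidean_space set \<Rightarrow> ('a \<Rightarrow> 'b::real_normed_vector) \<Rightarrow> bool" where
  "smooth_along M d \<longleftrightarrow>
     (\<forall>p\<in>M. \<exists>U h. open U \<and> p \<in> U \<and> smooth_on U h \<and> (\<forall>x\<in>U \<inter> M. h x = d x))"

definition complementary :: "'a::real_vector set \<Rightarrow> 'a set \<Rightarrow> bool" where
  "complementary S T \<longleftrightarrow> S \<inter> T = {0} \<and> {x + y |x y. x \<in> S \<and> y \<in> T} = UNIV"

definition transversals ::
  "nat \<Rightarrow> (real^'n) set \<Rightarrow> ('i \<Rightarrow> real^'n \<Rightarrow> real^'n) \<Rightarrow> 'i set \<Rightarrow> real^'n \<Rightarrow> (real^'n) set set" where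
  "transversals k \<Omega> r I p =
     {\<Xi>. smooth_submanifold k \<Xi> \<and> p \<in> \<Xi> \<and> \<Xi> \<subseteq> \<Omega> \<and>
         (\<forall>x\<in>\<Xi>. complementary (tangent_space \<Xi> x) (span ((\<lambda>i. r i x) ` I)))}"

definition integral_manifold :: "('i \<Rightarrow> real^'n \<Rightarrow> real^'n) \<Rightarrow> 'i set \<Rightarrow> (real^'n) set \<Rightarrow> bool" where
  "integral_manifold r I N \<longleftrightarrow>
     smooth_submanifold (card I) N \<and> connected N \<and>
     (\<forall>x\<in>N. tangent_space N x = span ((\<lambda>i. r i x) ` I))"

text \<open>The family \<open>S\<close> of local solutions near \<open>p\<close> depends on arbitrary functions on \<open>\<Xi>\<close>: every smooth
  \<open>'b\<close>-valued datum on \<open>\<Xi>\<close> is attained by a solution, and the datum determines the solution near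
  \<open>p\<close>. For \<open>\<Xi>\<close> of dimension \<open>k\<close> a datum amounts to \<open>DIM('b)\<close> real functions of \<open>k\<close> variables.\<close>

definition freely_determined_along ::
  "'a::euclidean_space set \<Rightarrow> 'a \<Rightarrow> ('a \<Rightarrow> 'b::euclidean_space) set \<Rightarrow> bool" where
  "freely_determined_along \<Xi> p S \<longleftrightarrow>
     (\<forall>d. smooth_along \<Xi> d \<longrightarrow> (\<exists>s\<in>S. \<forall>\<^sub>F x in nhds p. x \<in> \<Xi> \<longrightarrow> s x = d x)) \<and>
     (\<forall>s\<in>S. \<forall>s'\<in>S. (\<forall>\<^sub>F x in nhds p. x \<in> \<Xi> \<longrightarrow> s x = s' x) \<longrightarrow>
                     (\<forall>\<^sub>F x in nhds p. s x = s' x))"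

text \<open>Below, \<open>c i j k\<close> and \<open>\<Gamma> i j k\<close> carry the lower indices \<open>i\<close>, \<open>j\<close> and the upper index \<open>k\<close>;
  \<open>phi r c \<Gamma> i s\<close> has lower index \<open>i\<close> and upper index \<open>s\<close>.\<close>

definition A_lambda ::
  "(nat \<Rightarrow> nat \<Rightarrow> nat \<Rightarrow> real^'n \<Rightarrow> real) \<Rightarrow> (nat \<Rightarrow> nat \<Rightarrow> nat \<Rightarrow> real^'n \<Rightarrow> real) \<Rightarrow>
   real^'n \<Rightarrow> real^3^3" where
  "A_lambda c \<Gamma> u = vector
     [vector [c 2 3 1 u,   \<Gamma> 3 2 1 u, - \<Gamma> 2 3 1 u],
      vector [\<Gamma> 3 1 2 u,   c 1 3 2 u, - \<Gamma> 1 3 2 u],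
      vector [\<Gamma> 2 1 3 u, - \<Gamma> 1 2 3 u,   c 1 2 3 u]]"

definition phi ::
  "(nat \<Rightarrow> real^'n \<Rightarrow> real^'n) \<Rightarrow> (nat \<Rightarrow> nat \<Rightarrow> nat \<Rightarrow> real^'n \<Rightarrow> real) \<Rightarrow>
   (nat \<Rightarrow> nat \<Rightarrow> nat \<Rightarrow> real^'n \<Rightarrow> real) \<Rightarrow> nat \<Rightarrow> nat \<Rightarrow> real^'n \<Rightarrow> real" where
  "phi r c \<Gamma> i s u =
    (if (i, s) = (1, 2) then \<Gamma> 2 1 2 u * \<Gamma> 2 3 1 u / c 3 2 1 u
     else if (i, s) = (2, 2) then
       \<Gamma> 2 3 1 u / \<Gamma> 3 2 1 u * (\<Gamma> 3 2 3 u - \<Gamma> 1 2 1 u)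
       - c 3 2 1 u / \<Gamma> 3 2 1 u * along (r 2) (\<lambda>x. \<Gamma> 3 2 1 x / c 3 2 1 x) u
     else if (i, s) = (3, 2) then - \<Gamma> 2 3 2 u
     else if (i, s) = (1, 3) then \<Gamma> 3 1 3 u * \<Gamma> 3 2 1 u / c 3 2 1 u
     else if (i, s) = (2, 3) then \<Gamma> 3 2 3 u
     else if (i, s) = (3, 3) then
       \<Gamma> 3 2 1 u / \<Gamma> 2 3 1 u * (\<Gamma> 1 3 1 u - \<Gamma> 2 3 2 u)
       + c 3 2 1 u / \<Gamma> 2 3 1 u * along (r 3) (\<lambda>x. \<Gamma> 2 3 1 x / c 3 2 1 x) u
     else 0)"

definition conditions_C ::
  "(nat \<Rightarrow> real^'n \<Rightarrow> real^'n) \<Rightarrow> (nat \<Rightarrow> nat \<Rightarrow> nat \<Rightarrow> real^'n \<Rightarrow> real) \<Rightarrow>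
   (nat \<Rightarrow> nat \<Rightarrow> nat \<Rightarrow> real^'n \<Rightarrow> real) \<Rightarrow> real^'n \<Rightarrow> bool" where
  "conditions_C r c \<Gamma> u \<longleftrightarrow>
     (\<forall>i j s. 1 \<le> i \<and> i < j \<and> j \<le> 3 \<and> s \<in> {2, 3} \<longrightarrow>
        along (r i) (phi r c \<Gamma> j s) u - along (r j) (phi r c \<Gamma> i s) u =
        phi r c \<Gamma> j 2 u * phi r c \<Gamma> i 3 u - phi r c \<Gamma> i 2 u * phi r c \<Gamma> j 3 u
        + (\<Sum>k=1..3. c i j k u * phi r c \<Gamma> k s u))"

end

theory Submission
  imports Defs
begin

text \<open>Differentiating \<open>r\<^sub>i f = \<lambda>\<^sup>i r\<^sub>i\<close> along \<open>r\<^sub>j\<close> and using flatness gives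
  \<open>A_lambda (\<lambda>\<^sup>1, \<lambda>\<^sup>2, \<lambda>\<^sup>3) = 0\<close> and formulas for \<open>r\<^sub>i(\<lambda>\<^sup>j)\<close>, \<open>i \<noteq> j\<close>. The first row of \<open>A_lambda\<close> expresses
  \<open>\<lambda>\<^sup>1\<close> by \<open>\<lambda>\<^sup>2\<close> and \<open>\<lambda>\<^sup>3\<close>; substituting yields the closed system \<open>r\<^sub>i(\<lambda>\<^sup>s) = \<phi>\<^sub>i\<^sup>s (\<lambda>\<^sup>2 - \<lambda>\<^sup>3)\<close>, \<open>s = 2, 3\<close>.
  Together with the equations for \<open>f\<close> this is a linear system prescribing the derivatives along the frame. If
  \<open>A_lambda\<close> has rank 1 and (C) holds, the lifts of the \<open>r\<^sub>i\<close> to the product with the space of unknowns are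
  in involution, so the data along a transversal can be prescribed. If one of these conditions fails, it fails
  on a neighbourhood, where it forces \<open>\<lambda>\<^sup>2 = \<lambda>\<^sup>3 = \<lambda>\<^sup>1\<close>; the system for \<open>(\<lambda>, f)\<close> that remains is always
  compatible. The linear systems are solved without Frobenius' theorem: multiplying the lifted fields by the
  inverse of the matrix of derivatives of a defining function of the transversal makes them commute, and
  transporting the data along their flows gives the solution. A strictly hyperbolic flux arises from data for
  which \<open>1\<close>, \<open>0\<close>, \<open>\<lambda>\<^sup>1\<close> and the eigenvalues along the transversal are all different at the base point.\<close>

section \<open>Calculus of smooth maps\<close>

text \<open>Adding \<open>a *\<^sub>R u\<close> with a real constant \<open>a\<close> to a flux adds
  \<open>a\<close> to all three eigenfunctions. Hence (1, 1, 1) always lies in the kernel of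
  \<open>A_lambda\<close>, only differences of eigenfunctions enter the equations, and the rank is 1
  or 2 because \<open>c 2 3 1\<close> has no zero. Failure of compatibility spreads to a
  neighbourhood because each compatibility condition is the vanishing of a smooth function. The
  analytic obstacle is that transporting data along flows yields smooth solutions only if flows
  depend smoothly on time and starting point. To get this, the Picard iteration is run for the
  triple of the flow, its first variation and the inverse of that variation. The derivatives of
  these three maps are expressions in the same three maps, so regularity climbs one order at a time.
  Flows exist only near the zero section of the space of unknowns. Since the systems are linear,
  arbitrary data can first be scaled down to fit there.\<close>

abbreviation FD :: "('a::real_normed_vector \<Rightarrow> 'b::real_normed_vector) \<Rightarrow> 'a \<Rightarrow> 'a \<Rightarrow> 'b" where
  "FD f x \<equiv> frechet_derivative f (at x)"

lemma FD_eq: "(f has_derivative f') (at x) \<Longrightarrow> FD f x = f'"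
  by (rule frechet_derivative_at[symmetric])

lemma has_derivative_FD: "f differentiable (at x) \<Longrightarrow> (f has_derivative FD f x) (at x)"
  by (simp add: frechet_derivative_works)

section \<open>Locality and closure properties of the classes C^k\<close>

lemma FD_cong_open:
  assumes "open S" "x \<in> S" "\<And>y. y \<in> S \<Longrightarrow> f y = g y"
  shows "FD f x = FD g x"
proof -
  have "(f has_derivative f') (at x) \<longleftrightarrow> (g has_derivative f') (at x)" for f'
    using has_derivative_transform_within_open[of f f' x UNIV S g]
      has_derivative_transform_within_open[of g f' x UNIV S f] assms by auto
  then show ?thesis by (simp add: frechet_derivative_def)
qed

lemma differentiable_cong_open:
  assumes "open S" "x \<in> S" "\<And>y. y \<in> S \<Longrightarrow> f y = g y" "f differentiable (at x)"
  shows "g differentiable (at x)"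
  using assms has_derivative_transform_within_open[of f _ x UNIV S g]
  unfolding differentiable_def by blast

lemma class_C_on_cong:
  assumes "open S" "\<And>y. y \<in> S \<Longrightarrow> f y = g y"
  shows "class_C_on k S f \<longleftrightarrow> class_C_on k S g"
  using assms(2)
proof (induction k arbitrary: f g)
  case 0 then show ?case by (auto cong: continuous_on_cong)
next
  case (Suc k)
  have "class_C_on k S (\<lambda>x. FD f x v) \<longleftrightarrow> class_C_on k S (\<lambda>x. FD g x v)" for v
    by (rule Suc.IH) (rule fun_cong[OF FD_cong_open[OF assms(1)]], use Suc.prems in auto)
  moreover have "(\<forall>x\<in>S. f differentiable at x) \<longleftrightarrow> (\<forall>x\<in>S. g differentiable at x)"
    using differentiable_cong_open[OF assms(1), of _ f g] differentiable_cong_open[OF assms(1), of _ g f] Suc.prems by auto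
  ultimately show ?case by simp
qed

lemma class_C_on_subset: "class_C_on k S f \<Longrightarrow> T \<subseteq> S \<Longrightarrow> class_C_on k T f"
  by (induction k arbitrary: f) (auto intro: continuous_on_subset)

text \<open>The form used in inductions on \<open>k\<close>: a differentiation rule produces
  \<open>f'\<close> as an explicit formula, and it remains to see that this formula is of class C^k
  in the point. Openness of \<open>S\<close> permits replacing the formula by
  \<open>frechet_derivative\<close>.\<close>

lemma class_C_on_SucI:
  assumes "open S" "\<And>x. x \<in> S \<Longrightarrow> (f has_derivative f' x) (at x)" "\<And>v. class_C_on k S (\<lambda>x. f' x v)"
  shows "class_C_on (Suc k) S f"
proof -
  have "class_C_on k S (\<lambda>x. FD f x v)" for v
    by (rule class_C_on_cong[OF assms(1), THEN iffD1, OF _ assms(3)]) (simp add: FD_eq[OF assms(2)])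
  then show ?thesis using assms(2) by (auto simp: differentiable_def)
qed

lemma class_C_on_SucD:
  "class_C_on (Suc k) S f \<Longrightarrow> x \<in> S \<Longrightarrow> (f has_derivative FD f x) (at x)"
  "class_C_on (Suc k) S f \<Longrightarrow> class_C_on k S (\<lambda>x. FD f x v)"
  by (auto simp: has_derivative_FD)

lemma class_C_on_pred: "class_C_on (Suc k) S f \<Longrightarrow> class_C_on k S f"
proof (induction k arbitrary: f)
  case 0
  then show ?case
    by (auto intro!: continuous_at_imp_continuous_on differentiable_imp_continuous_within)
next
  case (Suc k)
  then show ?case by (simp (no_asm_use)) blast
qed

lemma class_C_on_mono: "class_C_on k S f \<Longrightarrow> j \<le> k \<Longrightarrow> class_C_on j S f"
proof (induction k)
  case (Suc k)
  then show ?case by (cases "j = Suc k") (auto dest: class_C_on_pred simp del: class_C_on.simps)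
qed simp

lemma class_C_on_continuous: "class_C_on k S f \<Longrightarrow> continuous_on S f"
  using class_C_on_mono[of k S f 0] by simp

lemma class_C_on_const: "class_C_on k S (\<lambda>_. c)"
  by (induction k arbitrary: c) auto

lemma class_C_on_bounded_linear: "bounded_linear f \<Longrightarrow> open S \<Longrightarrow> class_C_on k S f"
proof (cases k)
  case 0
  then show "bounded_linear f \<Longrightarrow> ?thesis" by (simp add: linear_continuous_on)
next
  case (Suc j)
  assume "bounded_linear f" "open S"
  then show ?thesis unfolding Suc
    by (intro class_C_on_SucI[where f'="\<lambda>_. f"]) (auto intro: bounded_linear_imp_has_derivative class_C_on_const)
qed

lemma class_C_on_add:
  assumes "open S" "class_C_on k S f" "class_C_on k S g"
  shows "class_C_on k S (\<lambda>x. f x + g x)"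
  using assms(2,3)
proof (induction k arbitrary: f g)
  case 0 then show ?case by (auto intro: continuous_intros)
next
  case (Suc k)
  show ?case
    by (rule class_C_on_SucI[OF assms(1) has_derivative_add[OF class_C_on_SucD(1) class_C_on_SucD(1)]])
      (use Suc in \<open>auto intro!: Suc.IH\<close>)
qed

lemma class_C_on_sum:
  assumes "open S" "\<And>i. i \<in> I \<Longrightarrow> class_C_on k S (f i)"
  shows "class_C_on k S (\<lambda>x. \<Sum>i\<in>I. f i x)"
  using assms(2)
  by (induction I rule: infinite_finite_induct)
    (auto intro: class_C_on_const class_C_on_add[OF assms(1)] simp del: class_C_on.simps)

text \<open>The product rule reproduces products of the same kind, with one factor differentiated
  and the other not. The undifferentiated factor is needed at the lower order only, which
  \<open>class_C_on_pred\<close> provides.\<close>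

lemma (in bounded_bilinear) class_C_on:
  assumes "open S" "class_C_on k S f" "class_C_on k S g"
  shows "class_C_on k S (\<lambda>x. prod (f x) (g x))"
  using assms(2,3)
proof (induction k arbitrary: f g)
  case 0 then show ?case by (auto intro: continuous_on)
next
  case (Suc k)
  have "class_C_on k S f" "class_C_on k S g" using Suc.prems class_C_on_pred by blast+
  then show ?case
    by (intro class_C_on_SucI[OF assms(1) FDERIV[OF class_C_on_SucD(1) class_C_on_SucD(1)]])
      (use Suc in \<open>auto intro!: Suc.IH class_C_on_add[OF assms(1)]\<close>)
qed

lemma (in bounded_linear) class_C_on:
  assumes "open S" "class_C_on k S g"
  shows "class_C_on k S (\<lambda>x. f (g x))"
  using assms(2)
proof (induction k arbitrary: g)
  case 0 then show ?case by (auto intro: continuous_on)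
next
  case (Suc k)
  then show ?case
    by (intro class_C_on_SucI[OF assms(1) has_derivative[OF class_C_on_SucD(1)]]) auto
qed

text \<open>\<open>class_C_on\<close> speaks of derivatives in fixed directions only. This expansion
  turns a direction that varies with the point into finitely many fixed directions with varying
  coefficients.\<close>

lemma FD_Basis_expansion:
  fixes g :: "'b::euclidean_space \<Rightarrow> 'c::real_normed_vector"
  assumes "g differentiable (at y)"
  shows "FD g y v = (\<Sum>b\<in>Basis. (v \<bullet> b) *\<^sub>R FD g y b)"
proof -
  interpret linear "FD g y" by (rule has_derivative_linear[OF has_derivative_FD[OF assms]])
  have "FD g y v = FD g y (\<Sum>b\<in>Basis. (v \<bullet> b) *\<^sub>R b)" by (simp add: euclidean_representation)
  then show ?thesis by (simp add: sum scale)
qed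

text \<open>In the chain rule the direction \<open>FD f x v\<close> moves with \<open>x\<close>.
  After expansion in the basis, each summand is a product of a component of \<open>FD f x v\<close>
  with a fixed directional derivative of \<open>g\<close> composed with \<open>f\<close>, to which
  the induction hypothesis applies.\<close>

lemma class_C_on_compose:
  fixes g :: "'b::euclidean_space \<Rightarrow> 'c::real_normed_vector"
  assumes "open S" "open T" "class_C_on k T g" "class_C_on k S f" "f ` S \<subseteq> T"
  shows "class_C_on k S (\<lambda>x. g (f x))"
  using assms(3,4)
proof (induction k arbitrary: g)
  case 0
  then show ?case using assms(5) by (auto intro: continuous_on_compose2)
next
  case (Suc k)
  have f: "class_C_on k S f" using Suc.prems class_C_on_pred by blast
  show ?case
  proof (rule class_C_on_SucI[OF assms(1)])
    show "((\<lambda>x. g (f x)) has_derivative (\<lambda>v. \<Sum>b\<in>Basis. (FD f x v \<bullet> b) *\<^sub>R FD g (f x) b)) (at x)"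
      if "x \<in> S" for x
    proof -
      have g: "g differentiable (at (f x))" using that Suc.prems assms(5) by auto
      have "((\<lambda>x. g (f x)) has_derivative (\<lambda>v. FD g (f x) (FD f x v))) (at x)"
        by (rule has_derivative_compose[OF class_C_on_SucD(1)[OF Suc.prems(2) that]]) (rule has_derivative_FD[OF g])
      then show ?thesis by (subst (asm) FD_Basis_expansion[OF g])
    qed
    show "class_C_on k S (\<lambda>x. \<Sum>b\<in>Basis. (FD f x v \<bullet> b) *\<^sub>R FD g (f x) b)" for v
      by (intro class_C_on_sum bounded_bilinear.class_C_on[OF bounded_bilinear_scaleR]
          bounded_linear.class_C_on[OF bounded_linear_inner_left] assms(1) Suc.IH f)
        (use Suc.prems in auto)
  qed
qed

text \<open>The derivative of the reciprocal contains the reciprocal again, at one order less; the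
  induction hypothesis supplies exactly that.\<close>

lemma class_C_on_inverse:
  fixes f :: "'a::real_normed_vector \<Rightarrow> real"
  assumes "open S" "class_C_on k S f" "\<And>x. x \<in> S \<Longrightarrow> f x \<noteq> 0"
  shows "class_C_on k S (\<lambda>x. inverse (f x))"
  using assms(2)
proof (induction k)
  case 0
  then show ?case using assms(3) by (auto intro: continuous_intros)
next
  case (Suc k)
  then have k: "class_C_on k S f" "class_C_on k S (\<lambda>x. inverse (f x))" using class_C_on_pred by blast+
  have "class_C_on k S (\<lambda>x. - (inverse (f x) * FD f x v * inverse (f x)))" for v
    by (intro bounded_linear.class_C_on[OF bounded_linear_minus[OF bounded_linear_ident]]
        bounded_bilinear.class_C_on[OF bounded_bilinear_mult] assms k) (use Suc in auto)
  then show ?case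
    by (intro class_C_on_SucI[OF assms(1) Deriv.has_derivative_inverse[OF assms(3) class_C_on_SucD(1)[OF Suc.prems]]])
qed

section \<open>Closure properties of smooth maps\<close>

lemma smooth_on_cong: "open S \<Longrightarrow> (\<And>y. y \<in> S \<Longrightarrow> f y = g y) \<Longrightarrow> smooth_on S f \<longleftrightarrow> smooth_on S g"
  unfolding smooth_on_def by (intro all_cong1 class_C_on_cong)

lemma smooth_on_subset: "smooth_on S f \<Longrightarrow> T \<subseteq> S \<Longrightarrow> smooth_on T f"
  unfolding smooth_on_def by (blast intro: class_C_on_subset)

lemma smooth_on_has_derivative: "smooth_on S f \<Longrightarrow> x \<in> S \<Longrightarrow> (f has_derivative FD f x) (at x)"
  by (rule class_C_on_SucD(1)[of 0]) (simp_all only: smooth_on_def)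

lemma smooth_on_differentiable: "smooth_on S f \<Longrightarrow> x \<in> S \<Longrightarrow> f differentiable (at x)"
  by (rule differentiableI[OF smooth_on_has_derivative])

lemma smooth_on_continuous_on: "smooth_on S f \<Longrightarrow> continuous_on S f"
  by (rule class_C_on_continuous[of 0]) (simp only: smooth_on_def)

lemma smooth_on_FD_const: "smooth_on S f \<Longrightarrow> smooth_on S (\<lambda>x. FD f x v)"
  by (simp only: smooth_on_def) (blast intro: class_C_on_SucD(2))

lemma smooth_on_const: "smooth_on S (\<lambda>_. c)"
  by (simp add: smooth_on_def class_C_on_const)

lemma smooth_on_bounded_linear: "bounded_linear f \<Longrightarrow> open S \<Longrightarrow> smooth_on S f"
  by (simp add: smooth_on_def class_C_on_bounded_linear)

lemma smooth_on_ident: "open S \<Longrightarrow> smooth_on S (\<lambda>x. x)"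
  by (rule smooth_on_bounded_linear[OF bounded_linear_ident])

lemma (in bounded_linear) smooth_on: "open S \<Longrightarrow> smooth_on S g \<Longrightarrow> smooth_on S (\<lambda>x. f (g x))"
  by (simp add: smooth_on_def class_C_on)

lemma (in bounded_bilinear) smooth_on:
  "open S \<Longrightarrow> smooth_on S f \<Longrightarrow> smooth_on S g \<Longrightarrow> smooth_on S (\<lambda>x. prod (f x) (g x))"
  by (simp add: smooth_on_def class_C_on)

lemma smooth_on_add: "open S \<Longrightarrow> smooth_on S f \<Longrightarrow> smooth_on S g \<Longrightarrow> smooth_on S (\<lambda>x. f x + g x)"
  by (simp add: smooth_on_def class_C_on_add)

lemma smooth_on_sum:
  "open S \<Longrightarrow> (\<And>i. i \<in> I \<Longrightarrow> smooth_on S (f i)) \<Longrightarrow> smooth_on S (\<lambda>x. \<Sum>i\<in>I. f i x)"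
  by (simp add: smooth_on_def class_C_on_sum)

lemmas smooth_on_minus = bounded_linear.smooth_on[OF bounded_linear_minus[OF bounded_linear_ident]]
lemmas smooth_on_scaleR = bounded_bilinear.smooth_on[OF bounded_bilinear_scaleR]
lemmas smooth_on_mult = bounded_bilinear.smooth_on[OF bounded_bilinear_mult]
lemmas smooth_on_fst = bounded_linear.smooth_on[OF bounded_linear_fst]
lemmas smooth_on_snd = bounded_linear.smooth_on[OF bounded_linear_snd]
lemmas smooth_on_vec_nth = bounded_linear.smooth_on[OF bounded_linear_vec_nth]
lemmas smooth_on_inner_left = bounded_linear.smooth_on[OF bounded_linear_inner_left]

lemma smooth_on_diff: "open S \<Longrightarrow> smooth_on S f \<Longrightarrow> smooth_on S g \<Longrightarrow> smooth_on S (\<lambda>x. f x - g x)"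
  using smooth_on_add[OF _ _ smooth_on_minus, of S f g] by simp

lemma smooth_on_inverse:
  fixes f :: "'a::real_normed_vector \<Rightarrow> real"
  shows "open S \<Longrightarrow> smooth_on S f \<Longrightarrow> (\<And>x. x \<in> S \<Longrightarrow> f x \<noteq> 0) \<Longrightarrow> smooth_on S (\<lambda>x. inverse (f x))"
  by (simp add: smooth_on_def class_C_on_inverse)

lemma smooth_on_divide:
  fixes f g :: "'a::real_normed_vector \<Rightarrow> real"
  shows "open S \<Longrightarrow> smooth_on S f \<Longrightarrow> smooth_on S g \<Longrightarrow> (\<And>x. x \<in> S \<Longrightarrow> g x \<noteq> 0) \<Longrightarrow>
    smooth_on S (\<lambda>x. f x / g x)"
  unfolding divide_inverse by (rule smooth_on_mult[OF _ _ smooth_on_inverse])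

lemma smooth_on_prod:
  fixes f :: "'i \<Rightarrow> 'a::real_normed_vector \<Rightarrow> real"
  assumes "open S" "\<And>i. i \<in> I \<Longrightarrow> smooth_on S (f i)"
  shows "smooth_on S (\<lambda>x. \<Prod>i\<in>I. f i x)"
  using assms(2)
  by (induction I rule: infinite_finite_induct) (auto intro: smooth_on_const smooth_on_mult[OF assms(1)])

lemma class_C_on_Pair:
  assumes "open S" "class_C_on k S f" "class_C_on k S g"
  shows "class_C_on k S (\<lambda>x. (f x, g x))"
proof -
  have "class_C_on k S (\<lambda>x. (f x, 0) + (0, g x))"
    by (intro class_C_on_add assms bounded_linear.class_C_on[OF bounded_linear_Pair[OF bounded_linear_ident bounded_linear_zero]]
        bounded_linear.class_C_on[OF bounded_linear_Pair[OF bounded_linear_zero bounded_linear_ident]])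
  then show ?thesis by simp
qed

lemma smooth_on_Pair: "open S \<Longrightarrow> smooth_on S f \<Longrightarrow> smooth_on S g \<Longrightarrow> smooth_on S (\<lambda>x. (f x, g x))"
  unfolding smooth_on_def by (simp add: class_C_on_Pair)

lemma smooth_on_compose:
  fixes g :: "'b::euclidean_space \<Rightarrow> 'c::real_normed_vector"
  assumes "open S" "open T" "smooth_on T g" "smooth_on S f" "f ` S \<subseteq> T"
  shows "smooth_on S (\<lambda>x. g (f x))"
  unfolding smooth_on_def
proof
  fix k
  show "class_C_on k S (\<lambda>x. g (f x))"
    by (rule class_C_on_compose[OF assms(1,2) _ _ assms(5)]) (use assms(3,4) in \<open>auto simp: smooth_on_def\<close>)
qed

lemma smooth_on_FD:
  fixes f :: "'a::euclidean_space \<Rightarrow> 'b::real_normed_vector"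
  assumes "open S" "smooth_on S f" "smooth_on S X"
  shows "smooth_on S (\<lambda>x. FD f x (X x))"
proof -
  have "smooth_on S (\<lambda>x. \<Sum>b\<in>Basis. (X x \<bullet> b) *\<^sub>R FD f x b)"
    by (intro smooth_on_sum smooth_on_scaleR smooth_on_inner_left smooth_on_FD_const assms)
  then show ?thesis
    by (rule smooth_on_cong[OF assms(1), THEN iffD1, rotated])
      (rule FD_Basis_expansion[OF smooth_on_differentiable[OF assms(2)], symmetric])
qed

section \<open>Symmetry of second derivatives\<close>

lemma linear_FD: "f differentiable (at x) \<Longrightarrow> linear (FD f x)"
  by (rule has_derivative_linear[OF has_derivative_FD])

lemma FD_along_line:
  assumes "f differentiable (at (x + s *\<^sub>R u))"
  shows "((\<lambda>s. f (x + s *\<^sub>R u)) has_vector_derivative FD f (x + s *\<^sub>R u) u) (at s within S)"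
proof -
  have "((\<lambda>s. f (x + s *\<^sub>R u)) has_derivative (\<lambda>h. FD f (x + s *\<^sub>R u) (h *\<^sub>R u))) (at s within S)"
    by (rule has_derivative_compose[where g=f]) (auto intro!: derivative_eq_intros has_derivative_FD assms)
  then show ?thesis
    by (simp add: has_vector_derivative_def linear_cmul[OF linear_FD[OF assms]])
qed

text \<open>The mean value theorem is applied twice: to the step in direction \<open>u\<close>, and
  then to the resulting derivative along direction \<open>v\<close>.\<close>

lemma second_difference_quotient:
  fixes f :: "'a::real_normed_vector \<Rightarrow> real"
  assumes "open S" "class_C_on 2 S f" "0 < t"
    and S: "\<And>a b. 0 \<le> a \<Longrightarrow> a \<le> t \<Longrightarrow> 0 \<le> b \<Longrightarrow> b \<le> t \<Longrightarrow> x + a *\<^sub>R u + b *\<^sub>R v \<in> S"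
  obtains a b where "0 \<le> a" "a \<le> t" "0 \<le> b" "b \<le> t"
    "f (x + t *\<^sub>R u + t *\<^sub>R v) - f (x + t *\<^sub>R u) - f (x + t *\<^sub>R v) + f x
      = t * t * FD (\<lambda>y. FD f y u) (x + a *\<^sub>R u + b *\<^sub>R v) v"
proof -
  have f: "f differentiable (at y)" "(\<lambda>y. FD f y u) differentiable (at y)" if "y \<in> S" for y
    using assms(2) that by (auto simp: numeral_2_eq_2)
  \<comment> \<open>\<open>g\<close> is the increment of \<open>f\<close> in direction
    \<open>v\<close> after a step \<open>a\<close> in direction \<open>u\<close>; the second
    difference is \<open>g t - g 0\<close>.\<close>
  define g where "g a = f ((x + t *\<^sub>R v) + a *\<^sub>R u) - f (x + a *\<^sub>R u)" for a
  have "\<exists>a. 0 < a \<and> a < t \<and> g t - g 0 = (t - 0) * (FD f ((x + t *\<^sub>R v) + a *\<^sub>R u) u - FD f (x + a *\<^sub>R u) u)"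
  proof (rule MVT2[OF \<open>0 < t\<close>])
    fix a assume a: "0 \<le> a" "a \<le> t"
    have "x + t *\<^sub>R v + a *\<^sub>R u \<in> S" "x + a *\<^sub>R u \<in> S"
      using S[of a t] S[of a 0] a \<open>0 < t\<close> by (auto simp: algebra_simps)
    then show "(g has_real_derivative FD f ((x + t *\<^sub>R v) + a *\<^sub>R u) u - FD f (x + a *\<^sub>R u) u) (at a)"
      unfolding g_def has_real_derivative_iff_has_vector_derivative
      by (intro has_vector_derivative_diff FD_along_line f)
  qed
  then obtain a where a: "0 < a" "a < t" and
    ga: "g t - g 0 = t * (FD f ((x + t *\<^sub>R v) + a *\<^sub>R u) u - FD f (x + a *\<^sub>R u) u)" by auto
  define h where "h b = FD f ((x + a *\<^sub>R u) + b *\<^sub>R v) u" for b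
  have "\<exists>b. 0 < b \<and> b < t \<and> h t - h 0 = (t - 0) * FD (\<lambda>y. FD f y u) ((x + a *\<^sub>R u) + b *\<^sub>R v) v"
  proof (rule MVT2[OF \<open>0 < t\<close>])
    fix b assume "0 \<le> b" "b \<le> t"
    then show "(h has_real_derivative FD (\<lambda>y. FD f y u) ((x + a *\<^sub>R u) + b *\<^sub>R v) v) (at b)"
      unfolding h_def has_real_derivative_iff_has_vector_derivative
      using S[of a b] a by (intro FD_along_line[of "\<lambda>y. FD f y u"] f) auto
  qed
  then obtain b where "0 < b" "b < t"
    "h t - h 0 = t * FD (\<lambda>y. FD f y u) ((x + a *\<^sub>R u) + b *\<^sub>R v) v" by auto
  with a ga show ?thesis
    by (intro that[of a b]) (auto simp: g_def h_def algebra_simps)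
qed

text \<open>The second difference is symmetric in \<open>u\<close> and \<open>v\<close>. It
  therefore equals \<open>t * t\<close> times a value of either mixed derivative, at points that
  tend to \<open>x\<close> with \<open>t\<close>, and continuity makes the two limits agree.\<close>

lemma second_derivative_commute_real:
  fixes f :: "'a::real_normed_vector \<Rightarrow> real"
  assumes S: "open S" "x \<in> S" and f: "class_C_on 2 S f"
  shows "FD (\<lambda>y. FD f y u) x v = FD (\<lambda>y. FD f y v) x u"
proof (rule ccontr)
  define P where "P y = FD (\<lambda>y. FD f y u) y v" for y
  define Q where "Q y = FD (\<lambda>y. FD f y v) y u" for y
  assume "\<not> ?thesis"
  then have ne: "P x \<noteq> Q x" by (simp add: P_def Q_def)
  \<comment> \<open>Half the supposed gap: a value closer than \<open>e\<close> to
    \<open>P x\<close> cannot equal one closer than \<open>e\<close> to \<open>Q x\<close>.\<close>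
  define e where "e = \<bar>P x - Q x\<bar> / 2"
  have e: "e > 0" using ne by (simp add: e_def)
  have "continuous_on S P" "continuous_on S Q" using f by (auto simp: numeral_2_eq_2 P_def Q_def)
  then have "isCont P x" "isCont Q x" using S continuous_on_eq_continuous_at by blast+
  then have "\<forall>\<^sub>F y in nhds x. dist (P y) (P x) < e" "\<forall>\<^sub>F y in nhds x. dist (Q y) (Q x) < e"
    using e by (simp_all add: isCont_def tendsto_at_iff_tendsto_nhds tendstoD)
  moreover have "\<forall>\<^sub>F y in nhds x. y \<in> S" using S eventually_nhds by blast
  ultimately have "\<forall>\<^sub>F y in nhds x. dist (P y) (P x) < e \<and> dist (Q y) (Q x) < e \<and> y \<in> S"
    by eventually_elim auto
  then obtain d where d: "d > 0" and
    D: "\<And>y. dist y x < d \<Longrightarrow> dist (P y) (P x) < e \<and> dist (Q y) (Q x) < e \<and> y \<in> S"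
    unfolding eventually_nhds_metric by auto
  \<comment> \<open>Small enough that the whole parallelogram spanned by
    \<open>t *\<^sub>R u\<close> and \<open>t *\<^sub>R v\<close> lies within \<open>d / 2\<close>
    of \<open>x\<close>. The summand 1 covers the case that both vectors vanish.\<close>
  define t where "t = d / (2 * (norm u + norm v + 1))"
  have t: "t > 0" using d by (simp add: t_def add_nonneg_pos)
  have near: "dist (x + a *\<^sub>R u + b *\<^sub>R v) x < d" if "0 \<le> a" "a \<le> t" "0 \<le> b" "b \<le> t" for a b
  proof -
    have "dist (x + a *\<^sub>R u + b *\<^sub>R v) x \<le> a * norm u + b * norm v"
      using that norm_triangle_ineq[of "a *\<^sub>R u" "b *\<^sub>R v"] by (simp add: dist_norm add.assoc)
    also have "\<dots> \<le> t * norm u + t * norm v" using that by (intro add_mono mult_right_mono) auto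
    also have "\<dots> \<le> t * (norm u + norm v + 1)" using t by (simp add: algebra_simps)
    also have "\<dots> = d / 2"
    proof -
      have "norm u + norm v + 1 > 0" by (simp add: add_nonneg_pos)
      then show ?thesis by (simp add: t_def divide_simps)
    qed
    finally show ?thesis using d by simp
  qed
  have nearS: "x + a *\<^sub>R u + b *\<^sub>R v \<in> S" "x + a *\<^sub>R v + b *\<^sub>R u \<in> S"
    if "0 \<le> a" "a \<le> t" "0 \<le> b" "b \<le> t" for a b
    using D[OF near[of a b]] D[OF near[of b a]] that by (auto simp: algebra_simps)
  obtain a b where ab: "0 \<le> a" "a \<le> t" "0 \<le> b" "b \<le> t"
    "f (x + t *\<^sub>R u + t *\<^sub>R v) - f (x + t *\<^sub>R u) - f (x + t *\<^sub>R v) + f x = t * t * P (x + a *\<^sub>R u + b *\<^sub>R v)"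
    by (rule second_difference_quotient[OF S(1) f t, of x u v]) (use nearS that in \<open>simp_all add: P_def\<close>)
  obtain a' b' where ab': "0 \<le> a'" "a' \<le> t" "0 \<le> b'" "b' \<le> t"
    "f (x + t *\<^sub>R v + t *\<^sub>R u) - f (x + t *\<^sub>R v) - f (x + t *\<^sub>R u) + f x = t * t * Q (x + a' *\<^sub>R v + b' *\<^sub>R u)"
    by (rule second_difference_quotient[OF S(1) f t, of x v u]) (use nearS that in \<open>simp_all add: Q_def\<close>)
  have eq: "P (x + a *\<^sub>R u + b *\<^sub>R v) = Q (x + a' *\<^sub>R v + b' *\<^sub>R u)"
    using ab(5) ab'(5) t by (simp add: algebra_simps)
  have "dist (P (x + a *\<^sub>R u + b *\<^sub>R v)) (P x) < e" "dist (Q (x + a' *\<^sub>R v + b' *\<^sub>R u)) (Q x) < e"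
    using D[OF near[of a b]] D[OF near[of b' a']] ab ab' by (auto simp: algebra_simps)
  then show False using eq by (simp add: dist_real_def e_def abs_if split: if_splits)
qed

lemma second_derivative_commute:
  fixes f :: "'a::real_normed_vector \<Rightarrow> 'b::euclidean_space"
  assumes S: "open S" "x \<in> S" and f: "smooth_on S f"
  shows "FD (\<lambda>y. FD f y u) x v = FD (\<lambda>y. FD f y v) x u"
proof (rule euclidean_eqI)
  fix b :: 'b assume "b \<in> Basis"
  have *: "FD (\<lambda>y. g y \<bullet> b) y w = FD g y w \<bullet> b" if "smooth_on S g" "y \<in> S" for g :: "'a \<Rightarrow> 'b" and y w
    using FD_eq[OF has_derivative_inner_left[OF smooth_on_has_derivative[OF that]], of b] by simp
  have **: "FD (\<lambda>y. FD (\<lambda>y. f y \<bullet> b) y u) x v = FD (\<lambda>y. FD f y u) x v \<bullet> b" for u v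
  proof -
    have "FD (\<lambda>y. FD (\<lambda>y. f y \<bullet> b) y u) x = FD (\<lambda>y. FD f y u \<bullet> b) x"
      by (rule FD_cong_open[OF S]) (simp add: * f)
    then show ?thesis using *[OF smooth_on_FD_const[OF f] S(2)] by simp
  qed
  have "class_C_on 2 S (\<lambda>y. f y \<bullet> b)"
    using smooth_on_inner_left[OF S(1) f] by (auto simp: smooth_on_def)
  from second_derivative_commute_real[OF S this, of u v]
  show "FD (\<lambda>y. FD f y u) x v \<bullet> b = FD (\<lambda>y. FD f y v) x u \<bullet> b" by (simp add: **)
qed

section \<open>Differentiation along vector fields and the Lie bracket\<close>

text \<open>The product rule for the pairing of \<open>FD f y\<close> with \<open>X y\<close>. In
  the first term the field is frozen at \<open>x\<close>, which leaves a genuine second derivative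
  to which symmetry applies.\<close>

lemma FD_FD_field:
  fixes f :: "'a::euclidean_space \<Rightarrow> 'b::euclidean_space"
  assumes S: "open S" "x \<in> S" and f: "smooth_on S f" and X: "smooth_on S X"
  shows "FD (\<lambda>y. FD f y (X y)) x v = FD (\<lambda>y. FD f y (X x)) x v + FD f x (FD X x v)"
proof -
  have d: "f differentiable (at y)" if "y \<in> S" for y using smooth_on_differentiable[OF f that] .
  have "FD (\<lambda>y. FD f y (X y)) x = FD (\<lambda>y. \<Sum>b\<in>Basis. (X y \<bullet> b) *\<^sub>R FD f y b) x"
    by (rule FD_cong_open[OF S]) (rule FD_Basis_expansion[OF d])
  also have "\<dots> = (\<lambda>v. \<Sum>b\<in>Basis. (X x \<bullet> b) *\<^sub>R FD (\<lambda>y. FD f y b) x v + (FD X x v \<bullet> b) *\<^sub>R FD f x b)"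
    by (rule FD_eq, rule has_derivative_sum, rule has_derivative_scaleR, rule has_derivative_inner_left)
      (rule smooth_on_has_derivative[OF X S(2)] smooth_on_has_derivative[OF smooth_on_FD_const[OF f] S(2)])+
  finally have 1: "FD (\<lambda>y. FD f y (X y)) x v
      = (\<Sum>b\<in>Basis. (X x \<bullet> b) *\<^sub>R FD (\<lambda>y. FD f y b) x v) + (\<Sum>b\<in>Basis. (FD X x v \<bullet> b) *\<^sub>R FD f x b)"
    by (simp add: sum.distrib)
  have "FD (\<lambda>y. FD f y (X x)) x = FD (\<lambda>y. \<Sum>b\<in>Basis. (X x \<bullet> b) *\<^sub>R FD f y b) x"
    by (rule FD_cong_open[OF S]) (rule FD_Basis_expansion[OF d])
  also have "\<dots> = (\<lambda>v. \<Sum>b\<in>Basis. (X x \<bullet> b) *\<^sub>R FD (\<lambda>y. FD f y b) x v)"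
    by (rule FD_eq, rule has_derivative_sum, rule has_derivative_scaleR_right)
      (rule smooth_on_has_derivative[OF smooth_on_FD_const[OF f] S(2)])
  finally have 2: "FD (\<lambda>y. FD f y (X x)) x v = (\<Sum>b\<in>Basis. (X x \<bullet> b) *\<^sub>R FD (\<lambda>y. FD f y b) x v)"
    by simp
  show ?thesis unfolding 1 2 by (subst FD_Basis_expansion[OF d[OF S(2)], of "FD X x v"]) (rule refl)
qed

definition bracket :: "('a::real_normed_vector \<Rightarrow> 'a) \<Rightarrow> ('a \<Rightarrow> 'a) \<Rightarrow> 'a \<Rightarrow> 'a" where
  "bracket X Y u = FD Y u (X u) - FD X u (Y u)"

text \<open>The second order terms on the left cancel by symmetry; the first order terms that remain
  are those of the bracket.\<close>

lemma FD_bracket: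
  fixes f :: "'a::euclidean_space \<Rightarrow> 'b::euclidean_space"
  assumes S: "open S" "x \<in> S" and f: "smooth_on S f" and X: "smooth_on S X" and Y: "smooth_on S Y"
  shows "FD (\<lambda>y. FD f y (Y y)) x (X x) - FD (\<lambda>y. FD f y (X y)) x (Y x) = FD f x (bracket X Y x)"
  using second_derivative_commute[OF S f, of "Y x" "X x"]
    linear_diff[OF linear_FD[OF smooth_on_differentiable[OF f S(2)]]]
  by (simp add: FD_FD_field[OF S f X] FD_FD_field[OF S f Y] bracket_def)

section \<open>Integrals depending smoothly on a parameter\<close>

text \<open>Regularity is asked for on an open neighbourhood \<open>D\<close> of
  \<open>Q \<times> {0..1}\<close>, since \<open>FD\<close> is a full derivative also at the end
  points of the interval. The integrand of the derivative is the joint derivative in direction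
  \<open>(v, 0)\<close>, again a map on \<open>D\<close>, so the induction closes.\<close>

lemma class_C_on_integral:
  fixes f :: "'a::euclidean_space \<Rightarrow> real \<Rightarrow> 'b::banach"
  assumes "open Q" "open D" "Q \<times> {0..1} \<subseteq> D" "class_C_on k D (\<lambda>(x, t). f x t)"
  shows "class_C_on k Q (\<lambda>x. integral {0..1} (f x))"
  using assms(4)
proof (induction k arbitrary: f)
  case 0
  then have "continuous_on (Q \<times> cbox 0 1) (\<lambda>(x, t). f x t)"
    using assms(3) continuous_on_subset by (auto simp: cbox_interval)
  then show ?case using integral_continuous_on_param[of Q 0 1 f] by (simp add: cbox_interval)
next
  case (Suc k)
  let ?F = "\<lambda>(x, t). f x t"
  have d: "(?F has_derivative FD ?F q) (at q)" if "q \<in> D" for q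
    using class_C_on_SucD(1)[OF Suc.prems that] .
  have dx: "((\<lambda>x. f x t) has_derivative (\<lambda>v. FD ?F (x, t) (v, 0))) (at x)" if "(x, t) \<in> D" for x t
    using has_derivative_compose[OF has_derivative_Pair[OF has_derivative_ident has_derivative_const], of ?F _ x t UNIV] d[OF that]
    by simp
  \<comment> \<open>The Leibniz rule wants the partial derivative as an operator that depends
    continuously on both variables. Continuity in the operator norm is checked on basis
    vectors.\<close>
  define fx where "fx x t = Blinfun (\<lambda>v. FD ?F (x, t) (v, 0))" for x t
  have fx: "blinfun_apply (fx x t) = (\<lambda>v. FD ?F (x, t) (v, 0))" if "(x, t) \<in> D" for x t
    unfolding fx_def using has_derivative_bounded_linear[OF dx[OF that]] by (rule bounded_linear_Blinfun_apply)
  have contD: "continuous_on D (\<lambda>q. FD ?F q v)" for v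
    using class_C_on_continuous[OF class_C_on_SucD(2)[OF Suc.prems]] .
  have cfx: "continuous_on (Q \<times> {0..1}) (\<lambda>(x, t). fx x t)"
  proof (rule continuous_on_blinfun_componentwise)
    fix i :: 'a
    have "continuous_on (Q \<times> {0..1}) (\<lambda>q. FD ?F q (i, 0))"
      using contD assms(3) by (rule continuous_on_subset)
    then show "continuous_on (Q \<times> {0..1}) (\<lambda>q. blinfun_apply (case q of (x, t) \<Rightarrow> fx x t) i)"
      by (rule continuous_on_eq) (use fx assms(3) in auto)
  qed
  have contf: "continuous_on {0..1} (f x)" if "x \<in> Q" for x
  proof -
    have "continuous_on {0..1} (\<lambda>t. ?F (x, t))"
      by (rule continuous_on_compose2[OF class_C_on_continuous[OF Suc.prems]])
        (use assms(3) that in \<open>auto intro!: continuous_intros\<close>)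
    then show ?thesis by simp
  qed
  have cfx1: "continuous_on {0..1} (fx x)" if "x \<in> Q" for x
  proof -
    have "continuous_on {0..1} (\<lambda>t. case (x, t) of (x, t) \<Rightarrow> fx x t)"
      by (rule continuous_on_compose2[OF cfx]) (use that in \<open>auto intro!: continuous_intros\<close>)
    then show ?thesis by simp
  qed
  show ?case
  proof (rule class_C_on_SucI[OF assms(1)])
    fix x assume x: "x \<in> Q"
    obtain e where e: "e > 0" "ball x e \<subseteq> Q" using assms(1) x openE by blast
    have "((\<lambda>x. integral (cbox 0 1) (f x)) has_derivative integral (cbox 0 1) (fx x)) (at x within ball x e)"
    proof (rule leibniz_rule)
      show "((\<lambda>x. f x t) has_derivative blinfun_apply (fx y t)) (at y within ball x e)"
        if "y \<in> ball x e" "t \<in> cbox 0 1" for y t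
      proof -
        have "(y, t) \<in> D" using that e assms(3) by (intro subsetD[OF assms(3)]) (auto simp: cbox_interval)
        then show ?thesis using fx dx has_derivative_at_withinI by metis
      qed
      show "f y integrable_on cbox 0 1" if "y \<in> ball x e" for y
        using contf that e by (intro integrable_continuous) (auto simp: cbox_interval)
      show "continuous_on (ball x e \<times> cbox 0 1) (\<lambda>(x, t). fx x t)"
        using cfx by (rule continuous_on_subset) (use e in \<open>auto simp: cbox_interval\<close>)
    qed (use e in auto)
    then have "((\<lambda>x. integral {0..1} (f x)) has_derivative integral {0..1} (fx x)) (at x)"
      using at_within_open[of x "ball x e"] e by (simp add: cbox_interval)
    moreover have "blinfun_apply (integral {0..1} (fx x)) v = integral {0..1} (\<lambda>t. FD ?F (x, t) (v, 0))" for v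
    proof -
      have "fx x integrable_on {0..1}" using cfx1[OF x] by (rule integrable_continuous_interval)
      then have "integral {0..1} (\<lambda>t. blinfun_apply (fx x t) v) = blinfun_apply (integral {0..1} (fx x)) v"
        using integral_linear[OF _ blinfun.bounded_linear_left, of "fx x" "{0..1}" v]
        by (simp add: o_def)
      moreover have "integral {0..1} (\<lambda>t. blinfun_apply (fx x t) v) = integral {0..1} (\<lambda>t. FD ?F (x, t) (v, 0))"
        by (rule integral_cong) (subst fx, use x in \<open>auto intro!: subsetD[OF assms(3)]\<close>)
      ultimately show ?thesis by simp
    qed
    ultimately show "((\<lambda>x. integral {0..1} (f x)) has_derivative (\<lambda>v. integral {0..1} (\<lambda>t. FD ?F (x, t) (v, 0)))) (at x)"
      by (elim has_derivative_eq_rhs) (rule ext)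
  next
    fix v
    show "class_C_on k Q (\<lambda>x. integral {0..1} (\<lambda>t. FD ?F (x, t) (v, 0)))"
    proof (rule Suc.IH[of "\<lambda>x t. FD ?F (x, t) (v, 0)"])
      have "(\<lambda>(x, t). FD ?F (x, t) (v, 0)) = (\<lambda>q. FD ?F q (v, 0))" by (rule ext) (simp split: prod.split)
      then show "class_C_on k D (\<lambda>(x, t). FD ?F (x, t) (v, 0))"
        using class_C_on_SucD(2)[OF Suc.prems, of "(v, 0)"] by (simp only:)
    qed
  qed
qed

section \<open>Flows of smooth vector fields\<close>

text \<open>The substitution \<open>t * s\<close> makes this the integral of \<open>g\<close> from 0
  to \<open>s\<close>. The rescaled form treats both signs of \<open>s\<close> alike, and its fixed
  interval suits \<open>class_C_on_integral\<close>.\<close>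

lemma has_vector_derivative_scaled_integral:
  fixes g :: "real \<Rightarrow> 'a::banach"
  assumes g: "continuous_on {-e<..<e} g" and s: "\<bar>s\<bar> < e"
  shows "((\<lambda>s. s *\<^sub>R integral {0..1} (\<lambda>t. g (t * s))) has_vector_derivative g s) (at s)"
proof -
  obtain b where b: "\<bar>s\<bar> < b" "b < e" using s dense by blast
  have cont: "continuous_on {-b..b} g" using g by (rule continuous_on_subset) (use b in auto)
  \<comment> \<open>A primitive that starts at \<open>-b\<close> is defined on both sides of 0; only
    its differences matter.\<close>
  define F where "F u = integral {-b..u} g" for u
  have F: "(F has_vector_derivative g u) (at u within {-b..b})" if "\<bar>u\<bar> \<le> b" for u
    unfolding F_def by (rule integral_has_vector_derivative[OF cont]) (use that in auto)
  have eq: "F s - F 0 = s *\<^sub>R integral {0..1} (\<lambda>t. g (t * s))" if "s \<in> {-b<..<b}" for s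
  proof -
    have ts: "t * s \<in> {-b..b}" if "t \<in> {0..1}" for t
    proof -
      have "\<bar>t * s\<bar> \<le> 1 * \<bar>s\<bar>" unfolding abs_mult using that by (intro mult_right_mono) auto
      then show ?thesis using \<open>s \<in> _\<close> by auto
    qed
    have "((\<lambda>t. s *\<^sub>R g (t * s)) has_integral F (1 * s) - F (0 * s)) {0..1}"
    proof (rule fundamental_theorem_of_calculus)
      fix t :: real assume t: "t \<in> {0..1}"
      have "(F \<circ> (\<lambda>t. t * s) has_vector_derivative s *\<^sub>R g (t * s)) (at t within {0..1})"
      proof (rule vector_diff_chain_within)
        show "((\<lambda>t. t * s) has_vector_derivative s) (at t within {0..1})"
          by (auto intro!: derivative_eq_intros)
        show "(F has_vector_derivative g (t * s)) (at (t * s) within (\<lambda>t. t * s) ` {0..1})"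
          by (rule has_vector_derivative_within_subset[OF F]) (use ts t in force)+
      qed
      then show "((\<lambda>t. F (t * s)) has_vector_derivative s *\<^sub>R g (t * s)) (at t within {0..1})"
        by (simp add: o_def)
    qed simp
    from integral_unique[OF this] show ?thesis by simp
  qed
  have "((\<lambda>s. F s - F 0) has_vector_derivative g s) (at s)"
    using F[of s] b has_vector_derivative_diff_const[of F "F 0" "g s"]
    by (simp add: at_within_Icc_at)
  then show ?thesis
    by (rule has_vector_derivative_transform_within_open[of _ _ _ "{-b<..<b}"]) (use b eq in auto)
qed

text \<open>Often applied with \<open>B\<close> equal to 0, where it says that a curve with
  vanishing derivative is constant.\<close>

lemma norm_diff_le_of_derivative_bound:
  fixes f :: "real \<Rightarrow> 'a::real_normed_vector"
  assumes "\<And>t. \<bar>t\<bar> < e \<Longrightarrow> (f has_vector_derivative f' t) (at t)" "\<And>t. \<bar>t\<bar> < e \<Longrightarrow> norm (f' t) \<le> B" "\<bar>s\<bar> < e"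
  shows "norm (f s - f 0) \<le> B * e"
proof -
  have "0 \<le> B" using order_trans[OF norm_ge_zero assms(2)[OF assms(3)]] .
  have "norm (f s - f 0) \<le> B * norm (s - 0)"
  proof (rule differentiable_bound[of "{-e<..<e}" f "\<lambda>t h. h *\<^sub>R f' t"])
    fix t assume "t \<in> {-e<..<e}"
    then have t: "\<bar>t\<bar> < e" by auto
    show "(f has_derivative (\<lambda>h. h *\<^sub>R f' t)) (at t within {-e<..<e})"
      using assms(1)[OF t] by (simp add: has_vector_derivative_def has_derivative_at_withinI)
    show "onorm (\<lambda>h. h *\<^sub>R f' t) \<le> B"
      using assms(2)[OF t] onorm_scaleR_left[OF bounded_linear_ident, of "f' t"] by (simp add: onorm_id)
  qed (use assms in auto)
  also have "\<dots> \<le> B * e" using \<open>0 \<le> B\<close> assms(3) by (intro mult_left_mono) auto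
  finally show ?thesis .
qed

lemma quadratic_remainder_imp_has_derivative:
  fixes f :: "'a::real_normed_vector \<Rightarrow> 'b::real_normed_vector"
  assumes "open U" "x \<in> U" "bounded_linear f'"
    and "\<And>y. y \<in> U \<Longrightarrow> norm (f y - f x - f' (y - x)) \<le> K * (norm (y - x))\<^sup>2"
  shows "(f has_derivative f') (at x)"
proof (rule has_derivativeI[OF assms(3)])
  have "((\<lambda>y. K * norm (y - x)) \<longlongrightarrow> K * norm (x - x)) (at x)" by (intro tendsto_intros)
  then have "((\<lambda>y. K * norm (y - x)) \<longlongrightarrow> 0) (at x)" by simp
  then show "((\<lambda>y. ((f y - f x) - f' (y - x)) /\<^sub>R norm (y - x)) \<longlongrightarrow> 0) (at x)"
  proof (rule Lim_null_comparison[rotated])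
    have "\<forall>\<^sub>F y in at x. y \<in> U" using assms(1,2) by (auto simp: eventually_at_topological)
    then show "\<forall>\<^sub>F y in at x. norm (((f y - f x) - f' (y - x)) /\<^sub>R norm (y - x)) \<le> K * norm (y - x)"
    proof eventually_elim
      case (elim y)
      then show ?case using assms(4)[of y]
        by (cases "y = x") (simp_all add: divide_simps power2_eq_square mult_ac)
    qed
  qed
qed

section \<open>Existence of flows and Lipschitz dependence on the starting point\<close>

text \<open>Banach's fixed point theorem for the integral equation. The bound on
  \<open>e * B\<close> keeps curves that start in the half ball inside the ball. The bound on
  \<open>e * L\<close> makes the integral operator a contraction with factor 1/2, which also yields
  the Lipschitz constant 2 = 1 / (1 - 1/2).\<close>

lemma picard_flow:
  fixes X :: "'a::banach \<Rightarrow> 'a"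
  assumes "0 < R" "0 < e" "0 \<le> L"
    and bound: "\<And>x. x \<in> cball p R \<Longrightarrow> norm (X x) \<le> B" and eB: "e * B \<le> R / 2"
    and lip: "\<And>x y. x \<in> cball p R \<Longrightarrow> y \<in> cball p R \<Longrightarrow> norm (X x - X y) \<le> L * norm (x - y)"
    and eL: "e * L \<le> 1 / 2"
  obtains \<phi> :: "'a \<Rightarrow> real \<Rightarrow> 'a" where
    "\<And>x s. x \<in> cball p (R / 2) \<Longrightarrow> \<phi> x s \<in> cball p R"
    "\<And>x. x \<in> cball p (R / 2) \<Longrightarrow> \<phi> x 0 = x"
    "\<And>x s. x \<in> cball p (R / 2) \<Longrightarrow> \<bar>s\<bar> < e \<Longrightarrow> (\<phi> x has_vector_derivative X (\<phi> x s)) (at s)"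
    "\<And>x y s. x \<in> cball p (R / 2) \<Longrightarrow> y \<in> cball p (R / 2) \<Longrightarrow> norm (\<phi> x s - \<phi> y s) \<le> 2 * norm (x - y)"
    "continuous_on (cball p (R / 2) \<times> {-e<..<e}) (\<lambda>(x, s). \<phi> x s)"
proof -
  define S :: "(real \<Rightarrow>\<^sub>C 'a) set" where "S = PiC UNIV (\<lambda>_. cball p R)"
  have S: "\<gamma> \<in> S \<longleftrightarrow> (\<forall>t. apply_bcontfun \<gamma> t \<in> cball p R)" for \<gamma>
    by (simp add: S_def mem_PiC_iff Pi_iff)
  \<comment> \<open>Time is clamped to \<open>[-e, e]\<close>, so that curves become bounded
    continuous functions on the whole line and live in one complete space.\<close>
  define c where "c s = max (-e) (min e s)" for s
  have c: "\<bar>c s\<bar> \<le> e" for s using \<open>0 < e\<close> by (auto simp: c_def)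
  have cs: "c s = s" if "\<bar>s\<bar> \<le> e" for s using that by (auto simp: c_def)
  have cc[continuous_intros]: "continuous_on T c" for T unfolding c_def by (intro continuous_intros)
  have contX: "continuous_on (cball p R) X"
  proof (rule continuous_on_iff[THEN iffD2], safe)
    fix x d :: real and y assume "y \<in> cball p R" "0 < d"
    then show "\<exists>r>0. \<forall>x'\<in>cball p R. dist x' y < r \<longrightarrow> dist (X x') (X y) < d"
    proof (intro exI[of _ "d / (L + 1)"] conjI ballI impI)
      fix x' assume "x' \<in> cball p R" "dist x' y < d / (L + 1)"
      then have "(L + 1) * dist x' y < d" using \<open>0 \<le> L\<close> by (simp add: pos_less_divide_eq mult.commute)
      moreover have "dist (X x') (X y) \<le> L * dist x' y"
        using lip \<open>x' \<in> _\<close> \<open>y \<in> _\<close> by (simp add: dist_norm)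
      ultimately show "dist (X x') (X y) < d" using zero_le_dist[of x' y] by (simp add: distrib_right del: zero_le_dist)
    qed (use \<open>0 \<le> L\<close> in auto)
  qed
  define T where "T x \<gamma> s = x + c s *\<^sub>R integral {0..1} (\<lambda>t. X (apply_bcontfun \<gamma> (t * c s)))" for x \<gamma> s
  have cX: "continuous_on A (\<lambda>t. X (apply_bcontfun \<gamma> t))" if "\<gamma> \<in> S" for \<gamma> A
    by (rule continuous_on_compose2[OF contX]) (use that S in auto)
  have cX': "continuous_on A (\<lambda>t. X (apply_bcontfun \<gamma> (t * u)))" if "\<gamma> \<in> S" for \<gamma> A u
    by (rule continuous_on_compose2[OF cX[OF that, of UNIV]]) (auto intro!: continuous_intros)
  have T_S: "T x \<gamma> s \<in> cball p R" if "x \<in> cball p (R / 2)" "\<gamma> \<in> S" for x \<gamma> s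
  proof -
    have "norm (integral {0..1} (\<lambda>t. X (apply_bcontfun \<gamma> (t * c s)))) \<le> B * (1 - 0)"
      by (rule integral_bound) (use bound S that cX' in auto)
    then have "norm (c s *\<^sub>R integral {0..1} (\<lambda>t. X (apply_bcontfun \<gamma> (t * c s)))) \<le> e * B"
      using c \<open>0 < e\<close> by (auto intro!: mult_mono)
    then have "norm (T x \<gamma> s - x) \<le> R / 2" using eB by (simp add: T_def)
    moreover have "norm (x - p) \<le> R / 2" using that by (simp add: dist_norm norm_minus_commute)
    ultimately have "norm (T x \<gamma> s - p) \<le> R"
      using norm_triangle_ineq[of "T x \<gamma> s - x" "x - p"] by simp
    then show ?thesis by (simp add: dist_norm norm_minus_commute)
  qed
  have T_cont: "continuous_on UNIV (T x \<gamma>)" if "\<gamma> \<in> S" for x \<gamma>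
  proof -
    have "continuous_on UNIV (\<lambda>s. integral (cbox 0 1) (\<lambda>t. X (apply_bcontfun \<gamma> (t * c s))))"
    proof (rule integral_continuous_on_param)
      show "continuous_on (UNIV \<times> cbox 0 1) (\<lambda>(s, t). X (apply_bcontfun \<gamma> (t * c s)))"
        unfolding case_prod_beta
        by (rule continuous_on_compose2[OF cX[OF that, of UNIV]])
          (auto intro!: continuous_intros continuous_on_compose2[OF cc[of UNIV]])
    qed
    then show ?thesis unfolding T_def by (auto intro!: continuous_intros simp: cbox_interval)
  qed
  define TB where "TB x \<gamma> = Bcontfun (T x \<gamma>)" for x \<gamma>
  have TB: "apply_bcontfun (TB x \<gamma>) = T x \<gamma>" if "x \<in> cball p (R / 2)" "\<gamma> \<in> S" for x \<gamma>
  proof -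
    have "bounded (range (T x \<gamma>))" by (rule bounded_subset[OF bounded_cball]) (use T_S[OF that] in auto)
    then show ?thesis using T_cont[OF that(2)] unfolding TB_def
      by (intro Bcontfun_inverse) (simp add: bcontfun_def)
  qed
  \<comment> \<open>Allowing different starting points lets one estimate serve twice: with
    \<open>x\<close> equal to \<open>y\<close> it is the contraction property, and for two fixed
    points it is Lipschitz dependence.\<close>
  have contr: "dist (T x \<gamma> s) (T y \<delta> s) \<le> dist x y + 1/2 * dist \<gamma> \<delta>" if "\<gamma> \<in> S" "\<delta> \<in> S" for x y \<gamma> \<delta> s
  proof -
    let ?I = "\<lambda>\<gamma>. integral {0..1} (\<lambda>t. X (apply_bcontfun \<gamma> (t * c s)))"
    have i: "(\<lambda>t. X (apply_bcontfun \<gamma> (t * c s))) integrable_on {0..1}" if "\<gamma> \<in> S" for \<gamma>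
      using cX'[OF that] by (rule integrable_continuous_interval)
    have "norm (integral {0..1} (\<lambda>t. X (apply_bcontfun \<gamma> (t * c s)) - X (apply_bcontfun \<delta> (t * c s)))) \<le> L * dist \<gamma> \<delta> * (1 - 0)"
    proof (rule integral_bound)
      fix t
      have "norm (X (apply_bcontfun \<gamma> (t * c s)) - X (apply_bcontfun \<delta> (t * c s))) \<le> L * norm (apply_bcontfun \<gamma> (t * c s) - apply_bcontfun \<delta> (t * c s))"
        by (rule lip) (use that S in auto)
      also have "\<dots> \<le> L * dist \<gamma> \<delta>"
        using dist_bounded[of \<gamma> _ \<delta>] \<open>0 \<le> L\<close> by (intro mult_left_mono) (auto simp flip: dist_norm)
      finally show "norm (X (apply_bcontfun \<gamma> (t * c s)) - X (apply_bcontfun \<delta> (t * c s))) \<le> L * dist \<gamma> \<delta>" .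
    qed (use cX' that in \<open>auto intro!: continuous_intros\<close>)
    then have "norm (?I \<gamma> - ?I \<delta>) \<le> L * dist \<gamma> \<delta>" by (simp add: integral_diff i that)
    then have "norm (c s *\<^sub>R (?I \<gamma> - ?I \<delta>)) \<le> e * (L * dist \<gamma> \<delta>)"
      using c \<open>0 < e\<close> by (auto intro!: mult_mono)
    also have "\<dots> \<le> 1/2 * dist \<gamma> \<delta>" using mult_right_mono[OF eL zero_le_dist] by (simp add: mult.assoc)
    finally show ?thesis
      using norm_triangle_ineq[of "x - y" "c s *\<^sub>R (?I \<gamma> - ?I \<delta>)"]
      by (simp add: T_def dist_norm algebra_simps)
  qed
  have "\<exists>\<gamma>. \<gamma> \<in> S \<and> TB x \<gamma> = \<gamma>" if x: "x \<in> cball p (R / 2)" for x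
  proof -
    have "\<exists>!\<gamma>. \<gamma> \<in> S \<and> TB x \<gamma> = \<gamma>"
    proof (rule Banach_fix[where c="1/2"])
      show "complete S" unfolding S_def by (intro complete_eq_closed[THEN iffD2] closed_PiC) auto
      have "const_bcontfun p \<in> S" using \<open>0 < R\<close> by (simp add: S const_bcontfun.rep_eq)
      then show "S \<noteq> {}" by blast
      show "TB x ` S \<subseteq> S" using TB[OF x] T_S[OF x] S by auto
      show "dist (TB x \<gamma>) (TB x \<delta>) \<le> 1/2 * dist \<gamma> \<delta>" if "\<gamma> \<in> S" "\<delta> \<in> S" for \<gamma> \<delta>
        by (rule dist_bound) (use contr[OF that, of x _ x] in \<open>simp add: TB[OF x] that\<close>)
    qed auto
    then show ?thesis by blast
  qed
  then have ex: "\<forall>x\<in>cball p (R / 2). \<exists>\<gamma>. \<gamma> \<in> S \<and> TB x \<gamma> = \<gamma>" by blast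
  from bchoice[OF ex] obtain \<Gamma> where \<Gamma>: "\<And>x. x \<in> cball p (R / 2) \<Longrightarrow> \<Gamma> x \<in> S"
    "\<And>x. x \<in> cball p (R / 2) \<Longrightarrow> TB x (\<Gamma> x) = \<Gamma> x" by blast
  have GT: "apply_bcontfun (\<Gamma> x) = T x (\<Gamma> x)" if "x \<in> cball p (R / 2)" for x
    using TB[OF that \<Gamma>(1)[OF that]] unfolding \<Gamma>(2)[OF that] .
  define \<phi> where "\<phi> x = apply_bcontfun (\<Gamma> x)" for x
  have fixp: "\<phi> x s = x + c s *\<^sub>R integral {0..1} (\<lambda>t. X (\<phi> x (t * c s)))" if "x \<in> cball p (R / 2)" for x s
    using fun_cong[OF GT[OF that], of s] unfolding \<phi>_def T_def .
  have lipx: "norm (\<phi> x s - \<phi> y s) \<le> 2 * norm (x - y)" if "x \<in> cball p (R / 2)" "y \<in> cball p (R / 2)" for x y s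
  proof -
    have "dist (\<Gamma> x) (\<Gamma> y) \<le> dist x y + 1/2 * dist (\<Gamma> x) (\<Gamma> y)"
    proof (rule dist_bound)
      fix s
      show "dist (apply_bcontfun (\<Gamma> x) s) (apply_bcontfun (\<Gamma> y) s) \<le> dist x y + 1/2 * dist (\<Gamma> x) (\<Gamma> y)"
        unfolding fun_cong[OF GT[OF that(1)], of s] fun_cong[OF GT[OF that(2)], of s]
        by (rule contr[OF \<Gamma>(1)[OF that(1)] \<Gamma>(1)[OF that(2)]])
    qed
    then show ?thesis using dist_bounded[of "\<Gamma> x" s "\<Gamma> y"] by (simp add: \<phi>_def dist_norm)
  qed
  have contphi: "continuous_on A (\<phi> x)" for A x unfolding \<phi>_def by simp
  show ?thesis
  proof (rule that)
    show "\<phi> x s \<in> cball p R" if "x \<in> cball p (R / 2)" for x s using \<Gamma>(1)[OF that] S by (simp add: \<phi>_def)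
    show "\<phi> x 0 = x" if "x \<in> cball p (R / 2)" for x using fixp[OF that, of 0] cs[of 0] \<open>0 < e\<close> by simp
    show "norm (\<phi> x s - \<phi> y s) \<le> 2 * norm (x - y)" if "x \<in> cball p (R / 2)" "y \<in> cball p (R / 2)" for x y s
      using lipx that .
    show "(\<phi> x has_vector_derivative X (\<phi> x s)) (at s)" if x: "x \<in> cball p (R / 2)" and s: "\<bar>s\<bar> < e" for x s
    proof -
      have "continuous_on {-e<..<e} (\<lambda>s. X (\<phi> x s))" unfolding \<phi>_def by (rule cX[OF \<Gamma>(1)[OF x]])
      then have "((\<lambda>s. s *\<^sub>R integral {0..1} (\<lambda>t. X (\<phi> x (t * s)))) has_vector_derivative X (\<phi> x s)) (at s)"
        by (rule has_vector_derivative_scaled_integral) fact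
      then have "((\<lambda>s. x + s *\<^sub>R integral {0..1} (\<lambda>t. X (\<phi> x (t * s)))) has_vector_derivative X (\<phi> x s)) (at s)"
        using has_vector_derivative_add[OF has_vector_derivative_const, of _ _ "at s" x] by simp
      then show ?thesis
      proof (rule has_vector_derivative_transform_within_open[of _ _ _ "{-e<..<e}"])
        fix u assume "u \<in> {-e<..<e}"
        then have cu: "c u = u" using cs[of u] by auto
        show "x + u *\<^sub>R integral {0..1} (\<lambda>t. X (\<phi> x (t * u))) = \<phi> x u"
          using fixp[OF x, of u, unfolded cu] by (rule sym)
      qed (use s in auto)
    qed
    \<comment> \<open>Joint continuity: the dependence on the starting point is Lipschitz uniformly
      in time, and for a fixed starting point the curve is continuous. The radius
      \<open>d / 4\<close> compensates the Lipschitz constant 2.\<close>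
    show "continuous_on (cball p (R / 2) \<times> {-e<..<e}) (\<lambda>(x, s). \<phi> x s)"
    proof (rule continuous_on_iff[THEN iffD2], intro ballI allI impI)
      fix q\<^sub>0 and d :: real assume q\<^sub>0: "q\<^sub>0 \<in> cball p (R / 2) \<times> {-e<..<e}" and "0 < d"
      obtain x s where xs0: "q\<^sub>0 = (x, s)" by fastforce
      with q\<^sub>0 have xs: "x \<in> cball p (R / 2)" "s \<in> {-e<..<e}" by auto
      have "continuous_on UNIV (\<phi> x)" by (rule contphi)
      then have "\<exists>r>0. \<forall>s'\<in>UNIV. dist s' s < r \<longrightarrow> dist (\<phi> x s') (\<phi> x s) < d / 2"
        unfolding continuous_on_iff using half_gt_zero[OF \<open>0 < d\<close>] by fast
      then obtain r where r: "r > 0" "\<And>s'. dist s' s < r \<Longrightarrow> dist (\<phi> x s') (\<phi> x s) < d / 2" by auto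
      show "\<exists>r>0. \<forall>x'\<in>cball p (R / 2) \<times> {-e<..<e}. dist x' q\<^sub>0 < r \<longrightarrow>
          dist (case x' of (x, s) \<Rightarrow> \<phi> x s) (case q\<^sub>0 of (x, s) \<Rightarrow> \<phi> x s) < d"
      proof (intro exI[of _ "min r (d / 4)"] conjI ballI impI)
        fix q assume q: "q \<in> cball p (R / 2) \<times> {-e<..<e}" "dist q q\<^sub>0 < min r (d / 4)"
        obtain y t where yt: "q = (y, t)" by fastforce
        have "dist y x < d / 4" "dist t s < r"
          using q(2) dist_fst_le[of q "(x, s)"] dist_snd_le[of q "(x, s)"] by (auto simp: yt xs0)
        then have "dist (\<phi> y t) (\<phi> x t) < d / 2" "dist (\<phi> x t) (\<phi> x s) < d / 2"
          using lipx[of y x t] q(1) xs r by (auto simp: yt dist_norm)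
        then show "dist (case q of (x, s) \<Rightarrow> \<phi> x s) (case q\<^sub>0 of (x, s) \<Rightarrow> \<phi> x s) < d"
          using dist_triangle[of "\<phi> y t" "\<phi> x s" "\<phi> x t"] by (simp add: yt xs0)
      qed (use r \<open>0 < d\<close> in auto)
    qed
  qed
qed

section \<open>Uniform Taylor estimates on closed balls\<close>

text \<open>As a finite sum over the basis this is a bounded operator at every point, differentiable
  or not, and its smoothness in \<open>u\<close> is that of the directional derivatives of
  \<open>f\<close>.\<close>

definition blinfun_FD :: "('a::euclidean_space \<Rightarrow> 'b::real_normed_vector) \<Rightarrow> 'a \<Rightarrow> 'a \<Rightarrow>\<^sub>L 'b" where
  "blinfun_FD f u = (\<Sum>b\<in>Basis. blinfun_scaleR_left (FD f u b) o\<^sub>L blinfun_inner_left b)"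

lemma blinfun_FD_apply: "f differentiable (at u) \<Longrightarrow> blinfun_apply (blinfun_FD f u) v = FD f u v"
  by (subst FD_Basis_expansion[of f u v]) (simp_all add: blinfun_FD_def blinfun.sum_left)

lemma smooth_on_blinfun_FD:
  assumes "open S" "smooth_on S f"
  shows "smooth_on S (blinfun_FD f)"
  unfolding blinfun_FD_def[abs_def]
  by (rule smooth_on_sum[OF assms(1)], rule bounded_bilinear.smooth_on[OF bounded_bilinear_blinfun_compose assms(1)],
      rule bounded_linear.smooth_on[OF bounded_linear_blinfun_scaleR_left assms(1)],
      rule smooth_on_FD_const[OF assms(2)], rule smooth_on_const)

lemma smooth_on_bounded_cball:
  fixes f :: "'a::euclidean_space \<Rightarrow> 'b::real_normed_vector"
  assumes "open S" "cball p R \<subseteq> S" "smooth_on S f"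
  obtains K where "K > 0" "\<And>u. u \<in> cball p R \<Longrightarrow> norm (f u) \<le> K"
proof -
  have "continuous_on (cball p R) f"
    using smooth_on_continuous_on[OF smooth_on_subset[OF assms(3,2)]] .
  then have "bounded (f ` cball p R)" by (intro compact_imp_bounded compact_continuous_image) auto
  then show ?thesis using that by (auto simp: bounded_pos)
qed

lemma smooth_on_FD_bounded_cball:
  fixes f :: "'a::euclidean_space \<Rightarrow> 'b::real_normed_vector"
  assumes "open S" "cball p R \<subseteq> S" "smooth_on S f"
  obtains K where "K > 0" "\<And>u v. u \<in> cball p R \<Longrightarrow> norm (FD f u v) \<le> K * norm v"
    "\<And>u v. u \<in> cball p R \<Longrightarrow> v \<in> cball p R \<Longrightarrow> norm (f v - f u) \<le> K * norm (v - u)"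
proof -
  obtain K where K: "K > 0" "\<And>u. u \<in> cball p R \<Longrightarrow> norm (blinfun_FD f u) \<le> K"
    using smooth_on_bounded_cball[OF assms(1,2) smooth_on_blinfun_FD[OF assms(1,3)]] by metis
  have d: "f differentiable (at u)" if "u \<in> cball p R" for u
    using smooth_on_differentiable[OF assms(3)] assms(2) that by blast
  have 1: "norm (FD f u v) \<le> K * norm v" if "u \<in> cball p R" for u v
    using norm_blinfun[of "blinfun_FD f u" v] mult_right_mono[OF K(2)[OF that] norm_ge_zero[of v]]
    by (simp add: blinfun_FD_apply[OF d[OF that]])
  have "norm (f v - f u) \<le> K * norm (v - u)" if "u \<in> cball p R" "v \<in> cball p R" for u v
  proof (rule differentiable_bound[of "cball p R" f "FD f"])
    show "(f has_derivative FD f x) (at x within cball p R)" if "x \<in> cball p R" for x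
      using has_derivative_FD[OF d[OF that]] by (rule has_derivative_at_withinI)
    show "onorm (FD f x) \<le> K" if "x \<in> cball p R" for x
      by (rule onorm_le) (rule 1[OF that])
  qed (use that in auto)
  with 1 K(1) show ?thesis using that by blast
qed

text \<open>The quadratic remainder comes from the Lipschitz property of the derivative along the
  segment from \<open>u\<close> to \<open>v\<close>. Taking the sum of the two constants lets a
  single \<open>K\<close> serve all estimates.\<close>

lemma smooth_on_taylor_cball:
  fixes f :: "'a::euclidean_space \<Rightarrow> 'b::real_normed_vector"
  assumes "open S" "cball p R \<subseteq> S" "smooth_on S f"
  obtains K where "K > 0" "\<And>u v. u \<in> cball p R \<Longrightarrow> norm (FD f u v) \<le> K * norm v"
    "\<And>u v. u \<in> cball p R \<Longrightarrow> v \<in> cball p R \<Longrightarrow> norm (f v - f u) \<le> K * norm (v - u)"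
    "\<And>u v. u \<in> cball p R \<Longrightarrow> v \<in> cball p R \<Longrightarrow> norm (f v - f u - FD f u (v - u)) \<le> K * (norm (v - u))\<^sup>2"
proof -
  obtain K where K: "K > 0" "\<And>u v. u \<in> cball p R \<Longrightarrow> norm (FD f u v) \<le> K * norm v"
    "\<And>u v. u \<in> cball p R \<Longrightarrow> v \<in> cball p R \<Longrightarrow> norm (f v - f u) \<le> K * norm (v - u)"
    using smooth_on_FD_bounded_cball[OF assms] by metis
  obtain K' where K': "K' > 0"
    "\<And>u v. u \<in> cball p R \<Longrightarrow> v \<in> cball p R \<Longrightarrow> norm (blinfun_FD f v - blinfun_FD f u) \<le> K' * norm (v - u)"
    using smooth_on_FD_bounded_cball[OF assms(1,2) smooth_on_blinfun_FD[OF assms(1,3)]] by metis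
  have d: "f differentiable (at u)" if "u \<in> cball p R" for u
    using smooth_on_differentiable[OF assms(3)] assms(2) that by blast
  have T: "norm (f v - f u - FD f u (v - u)) \<le> K' * (norm (v - u))\<^sup>2" if uv: "u \<in> cball p R" "v \<in> cball p R" for u v
  proof -
    have seg: "closed_segment u v \<subseteq> cball p R" by (rule closed_segment_subset) (use uv in auto)
    have "norm (f v - f u - FD f u (v - u)) \<le> norm (v - u) * (K' * norm (v - u))"
    proof (rule differentiable_bound_linearization[of u v "closed_segment u v" f "FD f" u])
      show "u + t *\<^sub>R (v - u) \<in> closed_segment u v" if "t \<in> {0..1}" for t
        using that by (auto simp: in_segment algebra_simps intro!: exI[of _ t])
      show "(f has_derivative FD f x) (at x within closed_segment u v)" if "x \<in> closed_segment u v" for x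
        using has_derivative_FD[OF d] seg that by (blast intro: has_derivative_at_withinI)
      show "onorm (FD f x - FD f u) \<le> K' * norm (v - u)" if x: "x \<in> closed_segment u v" for x
      proof (rule onorm_le)
        fix w
        have xc: "x \<in> cball p R" using seg x by blast
        have "norm (x - u) \<le> norm (v - u)" using segment_bound(1)[OF x] .
        then have "K' * norm (x - u) \<le> K' * norm (v - u)" using K'(1) by simp
        then have "norm (blinfun_FD f x - blinfun_FD f u) \<le> K' * norm (v - u)"
          using K'(2)[OF uv(1) xc] by linarith
        then have "norm (blinfun_apply (blinfun_FD f x - blinfun_FD f u) w) \<le> K' * norm (v - u) * norm w"
          using norm_blinfun[of "blinfun_FD f x - blinfun_FD f u" w] mult_right_mono[OF _ norm_ge_zero[of w]]
            order_trans by blast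
        then show "norm ((FD f x - FD f u) w) \<le> K' * norm (v - u) * norm w"
          by (simp add: blinfun.diff_left blinfun_FD_apply[OF d[OF xc]] blinfun_FD_apply[OF d[OF uv(1)]])
      qed
    qed auto
    then show ?thesis by (simp add: power2_eq_square mult_ac)
  qed
  show ?thesis
  proof (rule that[of "K + K'"])
    show "norm (FD f u v) \<le> (K + K') * norm v" if "u \<in> cball p R" for u v
      by (rule order_trans[OF K(2)[OF that]]) (use K'(1) in \<open>simp add: mult_right_mono\<close>)
    show "norm (f v - f u) \<le> (K + K') * norm (v - u)" if "u \<in> cball p R" "v \<in> cball p R" for u v
      by (rule order_trans[OF K(3)[OF that]]) (use K'(1) in \<open>simp add: mult_right_mono\<close>)
    show "norm (f v - f u - FD f u (v - u)) \<le> (K + K') * (norm (v - u))\<^sup>2" if "u \<in> cball p R" "v \<in> cball p R" for u v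
      by (rule order_trans[OF T[OF that]]) (use K(1) in \<open>simp add: mult_right_mono\<close>)
  qed (use K K' in auto)
qed

section \<open>Smooth dependence of the flow on time and starting point\<close>

text \<open>\<open>M x s\<close> is going to be the derivative of the flow map in the starting point
  and \<open>N x s\<close> its inverse. \<open>N\<close> has its own adjoint equation, so its bound
  and its continuity come from the same fixed point argument as those of \<open>M\<close>. The
  constants \<open>C\<close> and \<open>K\<close> are uniform so that all remainders are quadratic
  in \<open>y - x\<close>.\<close>

locale variational_flow =
  fixes X :: "'a::euclidean_space \<Rightarrow> 'a" and S U :: "'a set" and e C K :: real
    and \<phi> :: "'a \<Rightarrow> real \<Rightarrow> 'a" and M N :: "'a \<Rightarrow> real \<Rightarrow> 'a \<Rightarrow>\<^sub>L 'a"
  assumes S: "open S" "smooth_on S X" and U: "open U" and e: "0 < e" and CK: "0 \<le> C" "0 \<le> K"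
    and phi_S: "\<And>x s. x \<in> U \<Longrightarrow> \<bar>s\<bar> < e \<Longrightarrow> \<phi> x s \<in> S"
    and init: "\<And>x. x \<in> U \<Longrightarrow> \<phi> x 0 = x" "\<And>x. x \<in> U \<Longrightarrow> M x 0 = id_blinfun" "\<And>x. x \<in> U \<Longrightarrow> N x 0 = id_blinfun"
    and phi': "\<And>x s. x \<in> U \<Longrightarrow> \<bar>s\<bar> < e \<Longrightarrow> (\<phi> x has_vector_derivative X (\<phi> x s)) (at s)"
    and M': "\<And>x s. x \<in> U \<Longrightarrow> \<bar>s\<bar> < e \<Longrightarrow> (M x has_vector_derivative blinfun_FD X (\<phi> x s) o\<^sub>L M x s) (at s)"
    and N': "\<And>x s. x \<in> U \<Longrightarrow> \<bar>s\<bar> < e \<Longrightarrow> (N x has_vector_derivative - (N x s o\<^sub>L blinfun_FD X (\<phi> x s))) (at s)"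
    and lip_phi: "\<And>x y s. x \<in> U \<Longrightarrow> y \<in> U \<Longrightarrow> \<bar>s\<bar> < e \<Longrightarrow> norm (\<phi> y s - \<phi> x s) \<le> C * norm (y - x)"
    and lip_M: "\<And>x y s. x \<in> U \<Longrightarrow> y \<in> U \<Longrightarrow> \<bar>s\<bar> < e \<Longrightarrow> norm (M y s - M x s) \<le> C * norm (y - x)"
    and bound_M: "\<And>x s. x \<in> U \<Longrightarrow> \<bar>s\<bar> < e \<Longrightarrow> norm (M x s) \<le> C"
    and bound_N: "\<And>x s. x \<in> U \<Longrightarrow> \<bar>s\<bar> < e \<Longrightarrow> norm (N x s) \<le> C"
    and taylor_X: "\<And>x y s. x \<in> U \<Longrightarrow> y \<in> U \<Longrightarrow> \<bar>s\<bar> < e \<Longrightarrow>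
      norm (X (\<phi> y s) - X (\<phi> x s) - FD X (\<phi> x s) (\<phi> y s - \<phi> x s)) \<le> K * (norm (\<phi> y s - \<phi> x s))\<^sup>2"
    and taylor_A: "\<And>x y s. x \<in> U \<Longrightarrow> y \<in> U \<Longrightarrow> \<bar>s\<bar> < e \<Longrightarrow>
      norm (blinfun_FD X (\<phi> y s) - blinfun_FD X (\<phi> x s) - FD (blinfun_FD X) (\<phi> x s) (\<phi> y s - \<phi> x s))
        \<le> K * (norm (\<phi> y s - \<phi> x s))\<^sup>2"
    and lip_A: "\<And>x y s. x \<in> U \<Longrightarrow> y \<in> U \<Longrightarrow> \<bar>s\<bar> < e \<Longrightarrow>
      norm (blinfun_FD X (\<phi> y s) - blinfun_FD X (\<phi> x s)) \<le> K * norm (\<phi> y s - \<phi> x s)"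
    and bound_DA: "\<And>x s v. x \<in> U \<Longrightarrow> \<bar>s\<bar> < e \<Longrightarrow> norm (FD (blinfun_FD X) (\<phi> x s) v) \<le> K * norm v"
    and cont: "continuous_on (U \<times> {-e<..<e}) (\<lambda>(x, s). \<phi> x s)" "continuous_on (U \<times> {-e<..<e}) (\<lambda>(x, s). M x s)"
      "continuous_on (U \<times> {-e<..<e}) (\<lambda>(x, s). N x s)"
begin

abbreviation "A \<equiv> blinfun_FD X"

lemma smooth_A: "smooth_on S A"
  by (rule smooth_on_blinfun_FD[OF S])

lemma A_apply: "u \<in> S \<Longrightarrow> blinfun_apply (A u) v = FD X u v"
  by (rule blinfun_FD_apply[OF smooth_on_differentiable[OF S(2)]])

text \<open>By the adjoint equation for \<open>N\<close> and the linearised equation for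
  \<open>z\<close>, the product has zero derivative in time.\<close>

lemma variational_solution:
  assumes x: "x \<in> U" and s: "\<bar>s\<bar> < e"
    and z: "\<And>t. \<bar>t\<bar> < e \<Longrightarrow> (z has_vector_derivative FD X (\<phi> x t) (z t)) (at t)"
  shows "blinfun_apply (N x s) (z s) = z 0"
proof -
  have "norm (blinfun_apply (N x s) (z s) - blinfun_apply (N x 0) (z 0)) \<le> 0 * e"
  proof (rule norm_diff_le_of_derivative_bound[OF _ _ s])
    fix t assume t: "\<bar>t\<bar> < e"
    show "((\<lambda>s. blinfun_apply (N x s) (z s)) has_vector_derivative
        blinfun_apply (N x t) (FD X (\<phi> x t) (z t)) + blinfun_apply (- (N x t o\<^sub>L A (\<phi> x t))) (z t)) (at t)"
      by (rule bounded_bilinear.has_vector_derivative[OF bounded_bilinear_blinfun_apply N'[OF x t] z[OF t]])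
    show "norm (blinfun_apply (N x t) (FD X (\<phi> x t) (z t)) + blinfun_apply (- (N x t o\<^sub>L A (\<phi> x t))) (z t)) \<le> 0"
      by (simp add: blinfun.minus_left A_apply[OF phi_S[OF x t]])
  qed
  then show ?thesis by (simp add: init x)
qed

lemma NM: "x \<in> U \<Longrightarrow> \<bar>s\<bar> < e \<Longrightarrow> N x s o\<^sub>L M x s = id_blinfun"
proof (rule blinfun_eqI)
  fix v assume x: "x \<in> U" and s: "\<bar>s\<bar> < e"
  have "blinfun_apply (N x s) (blinfun_apply (M x s) v) = blinfun_apply (M x 0) v"
  proof (rule variational_solution[OF x s])
    fix t assume t: "\<bar>t\<bar> < e"
    show "((\<lambda>s. blinfun_apply (M x s) v) has_vector_derivative FD X (\<phi> x t) (blinfun_apply (M x t) v)) (at t)"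
      using bounded_linear.has_vector_derivative[OF blinfun.bounded_linear_left M'[OF x t], of v]
      by (simp add: A_apply[OF phi_S[OF x t]])
  qed
  then show "blinfun_apply (N x s o\<^sub>L M x s) v = blinfun_apply id_blinfun v" by (simp add: init x)
qed

text \<open>In finite dimension the left inverse from \<open>NM\<close> is also a right
  inverse.\<close>

lemma MN:
  assumes "x \<in> U" "\<bar>s\<bar> < e"
  shows "M x s o\<^sub>L N x s = id_blinfun"
proof (rule blinfun_eqI)
  fix v
  have "blinfun_apply (N x s) \<circ> blinfun_apply (M x s) = id"
    using arg_cong[OF NM[OF assms], of blinfun_apply] by (simp add: fun_eq_iff)
  then have "blinfun_apply (M x s) \<circ> blinfun_apply (N x s) = id"
    using linear_inverse_left[of "blinfun_apply (M x s)" "blinfun_apply (N x s)"]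
    by (simp add: bounded_linear.linear[OF blinfun.bounded_linear_right])
  then show "blinfun_apply (M x s o\<^sub>L N x s) v = blinfun_apply id_blinfun v"
    by (simp add: fun_eq_iff)
qed

text \<open>Variation of constants: after pulling the difference of two orbits back by
  \<open>N\<close>, the linear parts cancel and its time derivative is \<open>N\<close> applied to
  the Taylor remainder of \<open>X\<close>, which is quadratic in \<open>y - x\<close>.\<close>

lemma phi_remainder:
  assumes x: "x \<in> U" and y: "y \<in> U" and s: "\<bar>s\<bar> < e"
  shows "norm (\<phi> y s - \<phi> x s - blinfun_apply (M x s) (y - x)) \<le> (C * (C * (K * C\<^sup>2) * e)) * (norm (y - x))\<^sup>2"
proof -
  let ?E = "\<lambda>t. blinfun_apply (N x t) (\<phi> y t - \<phi> x t)"
  let ?R = "\<lambda>t. X (\<phi> y t) - X (\<phi> x t) - FD X (\<phi> x t) (\<phi> y t - \<phi> x t)"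
  have "norm (?E s - ?E 0) \<le> (C * (K * (C * norm (y - x))\<^sup>2)) * e"
  proof (rule norm_diff_le_of_derivative_bound[OF _ _ s])
    fix t assume t: "\<bar>t\<bar> < e"
    have "(?E has_vector_derivative blinfun_apply (N x t) (X (\<phi> y t) - X (\<phi> x t)) +
        blinfun_apply (- (N x t o\<^sub>L A (\<phi> x t))) (\<phi> y t - \<phi> x t)) (at t)"
      by (intro bounded_bilinear.has_vector_derivative[OF bounded_bilinear_blinfun_apply N'[OF x t]]
          has_vector_derivative_diff phi' x y t)
    moreover have "blinfun_apply (N x t) (X (\<phi> y t) - X (\<phi> x t)) +
        blinfun_apply (- (N x t o\<^sub>L A (\<phi> x t))) (\<phi> y t - \<phi> x t) = blinfun_apply (N x t) (?R t)"
      unfolding blinfun.minus_left blinfun_apply_blinfun_compose A_apply[OF phi_S[OF x t]]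
      by (subst blinfun.diff_right[of _ "X (\<phi> y t) - X (\<phi> x t)"]) simp
    ultimately show "(?E has_vector_derivative blinfun_apply (N x t) (?R t)) (at t)" by (simp only:)
    have "norm (?R t) \<le> K * (norm (\<phi> y t - \<phi> x t))\<^sup>2" by (rule taylor_X[OF x y t])
    also have "\<dots> \<le> K * (C * norm (y - x))\<^sup>2"
      using CK lip_phi[OF x y t] by (intro mult_left_mono power_mono) auto
    finally show "norm (blinfun_apply (N x t) (?R t)) \<le> C * (K * (C * norm (y - x))\<^sup>2)"
      using norm_blinfun[of "N x t" "?R t"] mult_mono[OF bound_N[OF x t] _ CK(1), of "norm (?R t)"] by force
  qed
  moreover have "?E 0 = y - x" by (simp add: init x y)
  moreover have "\<phi> y s - \<phi> x s - blinfun_apply (M x s) (y - x) = blinfun_apply (M x s) (?E s - (y - x))"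
    using arg_cong[OF MN[OF x s], of "\<lambda>h. blinfun_apply h (\<phi> y s - \<phi> x s)"]
    by (simp add: blinfun.diff_right)
  ultimately have "norm (\<phi> y s - \<phi> x s - blinfun_apply (M x s) (y - x)) \<le> norm (M x s) * ((C * (K * (C * norm (y - x))\<^sup>2)) * e)"
    using norm_blinfun[of "M x s" "?E s - (y - x)"] mult_left_mono[of _ _ "norm (M x s)"] order_trans by fastforce
  also have "\<dots> \<le> C * ((C * (K * (C * norm (y - x))\<^sup>2)) * e)"
    using bound_M[OF x s] CK e by (intro mult_right_mono) auto
  finally show ?thesis by (simp add: power_mult_distrib mult_ac)
qed

lemma phi_derivative_x:
  assumes "x \<in> U" "\<bar>s\<bar> < e"
  shows "((\<lambda>x. \<phi> x s) has_derivative blinfun_apply (M x s)) (at x)"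
  using phi_remainder[OF assms(1) _ assms(2)]
  by (rule quadratic_remainder_imp_has_derivative[where f="\<lambda>x. \<phi> x s", OF U assms(1) blinfun.bounded_linear_right])

text \<open>Differentiating the equation of \<open>M\<close> in \<open>x\<close> along
  \<open>v\<close> gives the same linear equation with a forcing term, the derivative of
  \<open>A\<close> along \<open>M v\<close> composed with \<open>M\<close>. Here
  \<open>\<kappa>\<close> is that forcing pulled back by \<open>N\<close>, so by variation of
  constants the derivative of \<open>M\<close> is \<open>M\<close> composed with the time integral
  \<open>\<Lambda>\<close> of \<open>\<kappa>\<close>.\<close>

definition \<kappa> :: "'a \<Rightarrow> real \<Rightarrow> 'a \<Rightarrow> 'a \<Rightarrow>\<^sub>L 'a" where
  "\<kappa> x s v = N x s o\<^sub>L FD A (\<phi> x s) (blinfun_apply (M x s) v) o\<^sub>L M x s"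

definition \<Lambda> :: "'a \<Rightarrow> real \<Rightarrow> 'a \<Rightarrow> 'a \<Rightarrow>\<^sub>L 'a" where
  "\<Lambda> x s v = s *\<^sub>R integral {0..1} (\<lambda>t. \<kappa> x (t * s) v)"

end

lemma norm_blinfun_compose_le:
  "norm f \<le> a \<Longrightarrow> norm g \<le> b \<Longrightarrow> norm (f o\<^sub>L g) \<le> a * b"
  by (rule order_trans[OF norm_blinfun_compose]) (intro mult_mono, auto intro: order_trans[OF norm_ge_zero])

text \<open>A product rule in which the left factor need only be continuous: its increment is
  multiplied by a factor of first order, so the product of the two is negligible.\<close>

lemma (in bounded_bilinear) has_derivative_prod_zero_right:
  assumes f: "isCont f x" and g: "(g has_derivative g') (at x)" and g0: "g x = 0"
  shows "((\<lambda>y. prod (f y) (g y)) has_derivative (\<lambda>v. prod (f x) (g' v))) (at x)"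
proof -
  obtain K where K: "K > 0" "\<And>a b. norm (prod a b) \<le> norm a * norm b * K" using pos_bounded by blast
  obtain B where B: "B > 0" "\<And>v. norm (g' v) \<le> norm v * B"
    using bounded_linear.pos_bounded[OF has_derivative_bounded_linear[OF g]] by blast
  let ?q = "\<lambda>y. norm (g y - g x - g' (y - x)) / norm (y - x)"
  have "((\<lambda>y. prod (f y - f x) (g y)) has_derivative (\<lambda>v. 0)) (at x)"
    unfolding has_derivative_iff_norm
  proof (intro conjI bounded_linear_zero)
    have "((\<lambda>y. norm (f y - f x) * (?q y + B) * K) \<longlongrightarrow> norm (f x - f x) * (0 + B) * K) (at x)"
      using f g unfolding isCont_def has_derivative_iff_norm by (intro tendsto_intros) auto
    then have lim: "((\<lambda>y. norm (f y - f x) * (?q y + B) * K) \<longlongrightarrow> 0) (at x)" by simp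
    show "((\<lambda>y. norm (prod (f y - f x) (g y) - prod (f x - f x) (g x) - 0) / norm (y - x)) \<longlongrightarrow> 0) (at x)"
    proof (rule Lim_null_comparison[OF _ lim], rule eventually_at_filter[THEN iffD2], rule always_eventually, intro allI impI)
      fix y assume "y \<noteq> x"
      have "norm (g y) \<le> norm (g y - g x - g' (y - x)) + norm (g' (y - x))"
        using norm_triangle_ineq[of "g y - g x - g' (y - x)" "g' (y - x)"] g0 by simp
      also have "\<dots> \<le> norm (g y - g x - g' (y - x)) + norm (y - x) * B" using B(2) by simp
      finally have "norm (g y) / norm (y - x) \<le> ?q y + B"
        using \<open>y \<noteq> x\<close> by (simp add: divide_simps mult.commute)
      then have "norm (f y - f x) * (norm (g y) / norm (y - x)) * K \<le> norm (f y - f x) * (?q y + B) * K"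
        using K(1) by (intro mult_right_mono mult_left_mono) auto
      moreover have "norm (prod (f y - f x) (g y)) / norm (y - x) \<le> (norm (f y - f x) * norm (g y) * K) / norm (y - x)"
        using K(2) by (intro divide_right_mono) auto
      ultimately show "norm (norm (prod (f y - f x) (g y) - prod (f x - f x) (g x) - 0) / norm (y - x))
          \<le> norm (f y - f x) * (?q y + B) * K"
        by (simp add: zero_right zero_left)
    qed
  qed
  moreover have "((\<lambda>y. prod (f x) (g y)) has_derivative (\<lambda>v. prod (f x) (g' v))) (at x)"
    by (rule bounded_linear.has_derivative[OF bounded_linear_right g])
  ultimately have "((\<lambda>y. prod (f y - f x) (g y) + prod (f x) (g y)) has_derivative (\<lambda>v. 0 + prod (f x) (g' v))) (at x)"
    by (rule has_derivative_add)
  then show ?thesis by (simp add: diff_left)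
qed

context variational_flow
begin

abbreviation "J \<equiv> {-e<..<e}"

lemma open_UJ: "open (U \<times> J)"
  by (intro open_Times U open_greaterThanLessThan)

lemma class_C_kappa:
  assumes "class_C_on k (U \<times> J) (\<lambda>q. \<phi> (fst q) (snd q))" "class_C_on k (U \<times> J) (\<lambda>q. M (fst q) (snd q))"
    "class_C_on k (U \<times> J) (\<lambda>q. N (fst q) (snd q))"
  shows "class_C_on k (U \<times> J) (\<lambda>q. \<kappa> (fst q) (snd q) v)"
proof -
  let ?w = "\<lambda>q. blinfun_apply (M (fst q) (snd q)) v"
  have w: "class_C_on k (U \<times> J) ?w"
    by (rule bounded_bilinear.class_C_on[OF bounded_bilinear_blinfun_apply open_UJ assms(2) class_C_on_const])
  have "class_C_on k (U \<times> J) (\<lambda>q. \<Sum>b\<in>Basis. (?w q \<bullet> b) *\<^sub>R FD A (\<phi> (fst q) (snd q)) b)"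
  proof (rule class_C_on_sum[OF open_UJ], rule bounded_bilinear.class_C_on[OF bounded_bilinear_scaleR open_UJ],
      rule bounded_linear.class_C_on[OF bounded_linear_inner_left open_UJ w])
    fix b
    have "class_C_on k S (\<lambda>u. FD A u b)" using smooth_on_FD_const[OF smooth_A] by (simp add: smooth_on_def)
    then show "class_C_on k (U \<times> J) (\<lambda>q. FD A (\<phi> (fst q) (snd q)) b)"
      by (rule class_C_on_compose[OF open_UJ S(1) _ assms(1)]) (use phi_S in auto)
  qed
  then have "class_C_on k (U \<times> J) (\<lambda>q. FD A (\<phi> (fst q) (snd q)) (?w q))"
  proof (rule class_C_on_cong[OF open_UJ, THEN iffD1, rotated])
    fix q assume "q \<in> U \<times> J"
    then have "\<phi> (fst q) (snd q) \<in> S" using phi_S by auto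
    from FD_Basis_expansion[OF smooth_on_differentiable[OF smooth_A this], of "?w q"]
    show "(\<Sum>b\<in>Basis. (?w q \<bullet> b) *\<^sub>R FD A (\<phi> (fst q) (snd q)) b) = FD A (\<phi> (fst q) (snd q)) (?w q)" by (rule sym)
  qed
  then show ?thesis unfolding \<kappa>_def
    by (intro bounded_bilinear.class_C_on[OF bounded_bilinear_blinfun_compose open_UJ] assms)
qed

lemma class_C_Lambda:
  assumes "class_C_on k (U \<times> J) (\<lambda>q. \<kappa> (fst q) (snd q) v)"
  shows "class_C_on k (U \<times> J) (\<lambda>q. \<Lambda> (fst q) (snd q) v)"
proof -
  let ?g = "\<lambda>z :: ('a \<times> real) \<times> real. (fst (fst z), snd z * snd (fst z))"
  \<comment> \<open>The triples for which \<open>t * s\<close> is still an admissible time. This set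
    is open and contains all parameters \<open>t\<close> in \<open>{0..1}\<close>, as the lemma on
    parameter integrals requires.\<close>
  let ?D = "?g -` (U \<times> J)"
  have oD: "open ?D" by (rule open_vimage[OF open_UJ]) (intro continuous_intros)
  have "class_C_on k (U \<times> J) (\<lambda>q. integral {0..1} (\<lambda>t. \<kappa> (fst q) (t * snd q) v))"
  proof (rule class_C_on_integral[OF open_UJ oD])
    show "(U \<times> J) \<times> {0..1} \<subseteq> ?D"
    proof
      fix z :: "('a \<times> real) \<times> real" assume z: "z \<in> (U \<times> J) \<times> {0..1}"
      then have "\<bar>snd z * snd (fst z)\<bar> \<le> 1 * \<bar>snd (fst z)\<bar>" unfolding abs_mult by (intro mult_right_mono) auto
      with z show "z \<in> ?D" by auto
    qed
    have "class_C_on k ?D ?g"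
      by (rule class_C_on_Pair[OF oD bounded_linear.class_C_on[OF bounded_linear_fst oD class_C_on_bounded_linear[OF bounded_linear_fst oD]]
            bounded_bilinear.class_C_on[OF bounded_bilinear_mult oD class_C_on_bounded_linear[OF bounded_linear_snd oD]
              bounded_linear.class_C_on[OF bounded_linear_snd oD class_C_on_bounded_linear[OF bounded_linear_fst oD]]]])
    then have "class_C_on k ?D (\<lambda>z. \<kappa> (fst (?g z)) (snd (?g z)) v)"
      by (rule class_C_on_compose[OF oD open_UJ assms]) auto
    then show "class_C_on k ?D (\<lambda>(q, t). \<kappa> (fst q) (t * snd q) v)" by (simp add: case_prod_unfold)
  qed
  then show ?thesis unfolding \<Lambda>_def
    by (intro bounded_bilinear.class_C_on[OF bounded_bilinear_scaleR open_UJ class_C_on_bounded_linear[OF bounded_linear_snd open_UJ]])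
qed

lemma cont0:
  "class_C_on 0 (U \<times> J) (\<lambda>q. \<phi> (fst q) (snd q))" "class_C_on 0 (U \<times> J) (\<lambda>q. M (fst q) (snd q))"
  "class_C_on 0 (U \<times> J) (\<lambda>q. N (fst q) (snd q))"
  using cont by (simp_all add: case_prod_unfold)

lemma continuous_slice:
  assumes "continuous_on (U \<times> J) (\<lambda>q. f (fst q) (snd q))" "x \<in> U"
  shows "continuous_on J (f x)"
proof -
  have "continuous_on J (\<lambda>s. f (fst (x, s)) (snd (x, s)))"
    by (rule continuous_on_compose2[OF assms(1)]) (use assms(2) in \<open>auto intro!: continuous_intros\<close>)
  then show ?thesis by simp
qed

lemma continuous_kappa: "x \<in> U \<Longrightarrow> continuous_on J (\<lambda>s. \<kappa> x s v)"
  by (rule continuous_slice[of "\<lambda>x s. \<kappa> x s v"]) (use class_C_kappa[OF cont0] in auto)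

lemma Lambda_derivative:
  assumes "x \<in> U" "\<bar>s\<bar> < e"
  shows "((\<lambda>s. \<Lambda> x s v) has_vector_derivative \<kappa> x s v) (at s)"
  unfolding \<Lambda>_def
  by (rule has_vector_derivative_scaled_integral[where g="\<lambda>s. \<kappa> x s v", OF continuous_kappa[OF assms(1)] assms(2)])

lemma linear_DA: "x \<in> U \<Longrightarrow> \<bar>s\<bar> < e \<Longrightarrow> linear (FD A (\<phi> x s))"
  by (rule linear_FD[OF smooth_on_differentiable[OF smooth_A phi_S]])

lemma bounded_linear_M_Lambda:
  assumes x: "x \<in> U" and s: "\<bar>s\<bar> < e"
  shows "bounded_linear (\<lambda>v. M x s o\<^sub>L \<Lambda> x s v)"
proof -
  have ts: "\<bar>t * s\<bar> < e" if "t \<in> {0..1}" for t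
  proof -
    have "\<bar>t * s\<bar> \<le> 1 * \<bar>s\<bar>" unfolding abs_mult using that by (intro mult_right_mono) auto
    then show ?thesis using s by simp
  qed
  have tsJ: "t * s \<in> J" if "t \<in> {0..1}" for t using ts[OF that] by (simp add: abs_less_iff)
  have int: "(\<lambda>t. \<kappa> x (t * s) v) integrable_on {0..1}" for v
    by (rule integrable_continuous_interval, rule continuous_on_compose2[OF continuous_kappa[OF x]])
      (use tsJ in \<open>auto intro!: continuous_intros simp del: greaterThanLessThan_iff\<close>)
  have k: "\<kappa> x t (v + w) = \<kappa> x t v + \<kappa> x t w" "\<kappa> x t (r *\<^sub>R v) = r *\<^sub>R \<kappa> x t v" if "\<bar>t\<bar> < e" for t v w r
    using linear_add[OF linear_DA[OF x that]] linear_scale[OF linear_DA[OF x that]]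
    by (simp_all add: \<kappa>_def blinfun.add_right blinfun.scaleR_right bounded_bilinear.add_left[OF bounded_bilinear_blinfun_compose]
        bounded_bilinear.add_right[OF bounded_bilinear_blinfun_compose] bounded_bilinear.scaleR_left[OF bounded_bilinear_blinfun_compose]
        bounded_bilinear.scaleR_right[OF bounded_bilinear_blinfun_compose])
  have "linear (\<lambda>v. \<Lambda> x s v)"
  proof
    fix v w :: 'a and r :: real
    have "integral {0..1} (\<lambda>t. \<kappa> x (t * s) (v + w)) = integral {0..1} (\<lambda>t. \<kappa> x (t * s) v + \<kappa> x (t * s) w)"
      by (rule integral_cong) (rule k[OF ts])
    then show "\<Lambda> x s (v + w) = \<Lambda> x s v + \<Lambda> x s w"
      by (simp add: \<Lambda>_def integral_add[OF int int] scaleR_add_right)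
    have "integral {0..1} (\<lambda>t. \<kappa> x (t * s) (r *\<^sub>R v)) = integral {0..1} (\<lambda>t. r *\<^sub>R \<kappa> x (t * s) v)"
      by (rule integral_cong) (rule k[OF ts])
    then show "\<Lambda> x s (r *\<^sub>R v) = r *\<^sub>R \<Lambda> x s v" by (simp add: \<Lambda>_def)
  qed
  then have "bounded_linear (\<lambda>v. \<Lambda> x s v)" by (simp add: linear_conv_bounded_linear)
  then show ?thesis
    using bounded_linear_compose[OF bounded_bilinear.bounded_linear_right[OF bounded_bilinear_blinfun_compose]] by blast
qed

text \<open>The same pull-back by \<open>N\<close> as in \<open>phi_remainder\<close>. Three
  quadratic errors remain: \<open>?R1\<close> is a product of two increments, \<open>?R2\<close> is
  the Taylor remainder of \<open>A\<close>, and \<open>?R3\<close> comes from replacing the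
  increment of the flow by its linear part, controlled by the constant \<open>C1\<close> of
  \<open>phi_remainder\<close>.\<close>

lemma M_remainder:
  assumes x: "x \<in> U" and y: "y \<in> U" and s: "\<bar>s\<bar> < e"
  defines "C1 \<equiv> C * (C * (K * C\<^sup>2) * e)"
  shows "norm (M y s - M x s - (M x s o\<^sub>L \<Lambda> x s (y - x)))
    \<le> (C * (C * (K * C * C + K * C\<^sup>2 * C + K * C1 * C) * e)) * (norm (y - x))\<^sup>2"
proof -
  define h where "h = y - x"
  define d where "d = norm h"
  have d0: "0 \<le> d" by (simp add: d_def)
  let ?E = "\<lambda>t. (N x t o\<^sub>L M y t) - \<Lambda> x t h"
  let ?dA = "\<lambda>t. A (\<phi> y t) - A (\<phi> x t)"
  let ?R1 = "\<lambda>t. ?dA t o\<^sub>L (M y t - M x t)"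
  let ?R2 = "\<lambda>t. (?dA t - FD A (\<phi> x t) (\<phi> y t - \<phi> x t)) o\<^sub>L M x t"
  let ?R3 = "\<lambda>t. FD A (\<phi> x t) (\<phi> y t - \<phi> x t - blinfun_apply (M x t) h) o\<^sub>L M x t"
  have "norm (?E s - ?E 0) \<le> (C * (K * C * C + K * C\<^sup>2 * C + K * C1 * C) * d\<^sup>2) * e"
  proof (rule norm_diff_le_of_derivative_bound[OF _ _ s])
    fix t assume t: "\<bar>t\<bar> < e"
    have "(?E has_vector_derivative ((N x t o\<^sub>L (A (\<phi> y t) o\<^sub>L M y t)) + (- (N x t o\<^sub>L A (\<phi> x t)) o\<^sub>L M y t)) - \<kappa> x t h) (at t)"
      by (intro bounded_bilinear.has_vector_derivative[OF bounded_bilinear_blinfun_compose N'[OF x t] M'[OF y t]]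
          has_vector_derivative_diff Lambda_derivative x t)
    moreover have "((N x t o\<^sub>L (A (\<phi> y t) o\<^sub>L M y t)) + (- (N x t o\<^sub>L A (\<phi> x t)) o\<^sub>L M y t)) - \<kappa> x t h
        = N x t o\<^sub>L (?R1 t + ?R2 t + ?R3 t)"
      unfolding linear_diff[OF linear_DA[OF x t], of "\<phi> y t - \<phi> x t" "blinfun_apply (M x t) h"]
      by (intro blinfun_eqI) (simp add: \<kappa>_def blinfun.add_left blinfun.diff_left blinfun.minus_left blinfun.add_right blinfun.diff_right algebra_simps)
    ultimately show "(?E has_vector_derivative N x t o\<^sub>L (?R1 t + ?R2 t + ?R3 t)) (at t)" by (simp only:)
    have p: "norm (\<phi> y t - \<phi> x t) \<le> C * d" using lip_phi[OF x y t] by (simp add: d_def h_def)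
    have 1: "norm (?R1 t) \<le> (K * (C * d)) * (C * d)"
    proof (rule norm_blinfun_compose_le)
      show "norm (?dA t) \<le> K * (C * d)"
        by (rule order_trans[OF lip_A[OF x y t] mult_left_mono[OF p CK(2)]])
      show "norm (M y t - M x t) \<le> C * d" using lip_M[OF x y t] by (simp add: d_def h_def)
    qed
    have 2: "norm (?R2 t) \<le> (K * (C * d)\<^sup>2) * C"
    proof (rule norm_blinfun_compose_le[OF _ bound_M[OF x t]])
      show "norm (?dA t - FD A (\<phi> x t) (\<phi> y t - \<phi> x t)) \<le> K * (C * d)\<^sup>2"
        by (rule order_trans[OF taylor_A[OF x y t] mult_left_mono[OF power_mono[OF p norm_ge_zero] CK(2)]])
    qed
    have 3: "norm (?R3 t) \<le> (K * (C1 * d\<^sup>2)) * C"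
    proof (rule norm_blinfun_compose_le[OF _ bound_M[OF x t]])
      show "norm (FD A (\<phi> x t) (\<phi> y t - \<phi> x t - blinfun_apply (M x t) h)) \<le> K * (C1 * d\<^sup>2)"
        by (rule order_trans[OF bound_DA[OF x t] mult_left_mono[OF _ CK(2)]])
          (use phi_remainder[OF x y t] in \<open>simp add: C1_def d_def h_def\<close>)
    qed
    have "norm (?R1 t + ?R2 t + ?R3 t) \<le> norm (?R1 t) + norm (?R2 t) + norm (?R3 t)"
      by (rule order_trans[OF norm_triangle_ineq]) (rule add_right_mono[OF norm_triangle_ineq])
    also have "\<dots> \<le> (K * (C * d)) * (C * d) + (K * (C * d)\<^sup>2) * C + (K * (C1 * d\<^sup>2)) * C"
      using 1 2 3 by linarith
    also have "\<dots> = (K * C * C + K * C\<^sup>2 * C + K * C1 * C) * d\<^sup>2"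
      by (simp add: algebra_simps power2_eq_square)
    finally have "norm (N x t o\<^sub>L (?R1 t + ?R2 t + ?R3 t)) \<le> C * ((K * C * C + K * C\<^sup>2 * C + K * C1 * C) * d\<^sup>2)"
      by (rule norm_blinfun_compose_le[OF bound_N[OF x t]])
    then show "norm (N x t o\<^sub>L (?R1 t + ?R2 t + ?R3 t)) \<le> C * (K * C * C + K * C\<^sup>2 * C + K * C1 * C) * d\<^sup>2"
      by (simp only: mult.assoc)
  qed
  moreover have "?E 0 = id_blinfun" using x y by (intro blinfun_eqI) (simp add: init \<Lambda>_def)
  moreover have "M y s - M x s - (M x s o\<^sub>L \<Lambda> x s h) = M x s o\<^sub>L (?E s - id_blinfun)"
  proof (rule blinfun_eqI)
    fix v
    show "blinfun_apply (M y s - M x s - (M x s o\<^sub>L \<Lambda> x s h)) v = blinfun_apply (M x s o\<^sub>L (?E s - id_blinfun)) v"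
      using arg_cong[OF MN[OF x s], of "\<lambda>h. blinfun_apply h (blinfun_apply (M y s) v)"]
      by (simp add: blinfun.diff_right blinfun.diff_left)
  qed
  ultimately have "norm (M y s - M x s - (M x s o\<^sub>L \<Lambda> x s h)) \<le> C * ((C * (K * C * C + K * C\<^sup>2 * C + K * C1 * C) * d\<^sup>2) * e)"
    using norm_blinfun_compose_le[OF bound_M[OF x s]] by simp
  then show ?thesis by (simp add: h_def[symmetric] d_def[symmetric] mult_ac)
qed

lemma M_derivative_x:
  assumes "x \<in> U" "\<bar>s\<bar> < e"
  shows "((\<lambda>x. M x s) has_derivative (\<lambda>v. M x s o\<^sub>L \<Lambda> x s v)) (at x)"
  using M_remainder[OF assms(1) _ assms(2)]
  by (rule quadratic_remainder_imp_has_derivative[where f="\<lambda>x. M x s", OF U assms(1) bounded_linear_M_Lambda[OF assms]])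

text \<open>Of the two partial derivatives only the one in time has to be continuous in both
  variables. This matters because the partial derivative in \<open>x\<close> is known pointwise only
  at this stage.\<close>

lemma joint_derivative:
  fixes f :: "'a \<Rightarrow> real \<Rightarrow> 'c::real_normed_vector"
  assumes q: "q \<in> U \<times> J"
    and fx: "((\<lambda>x. f x (snd q)) has_derivative fx) (at (fst q))"
    and fs: "\<And>x s. x \<in> U \<Longrightarrow> \<bar>s\<bar> < e \<Longrightarrow> (f x has_vector_derivative f' x s) (at s)"
    and cf: "continuous_on (U \<times> J) (\<lambda>q. f' (fst q) (snd q))"
  shows "((\<lambda>q. f (fst q) (snd q)) has_derivative (\<lambda>v. fx (fst v) + snd v *\<^sub>R f' (fst q) (snd q))) (at q)"
proof -
  obtain x s where xs: "q = (x, s)" "x \<in> U" "s \<in> J" using q by auto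
  have "((\<lambda>(x, s). f x s) has_derivative (\<lambda>(tx, ty). fx tx + blinfun_apply (blinfun_scaleR_left (f' x s)) ty)) (at (x, s) within U \<times> J)"
  proof (rule has_derivative_partialsI)
    show "((\<lambda>x. f x s) has_derivative fx) (at x within U)" using fx xs by (simp add: has_derivative_at_withinI)
    show "(f x has_derivative blinfun_apply (blinfun_scaleR_left (f' x s))) (at s within J)" if "x \<in> U" "s \<in> J" for x s
      using fs[of x s] that by (simp add: has_vector_derivative_def has_derivative_at_withinI abs_less_iff)
    have "continuous_on (U \<times> J) (\<lambda>q. blinfun_scaleR_left (f' (fst q) (snd q)))"
      by (rule bounded_linear.continuous_on[OF bounded_linear_blinfun_scaleR_left cf])
    then show "continuous (at (x, s) within U \<times> J) (\<lambda>(x, s). blinfun_scaleR_left (f' x s))"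
      using xs unfolding continuous_on_eq_continuous_within by (simp add: case_prod_unfold)
  qed (use xs in auto)
  then show ?thesis
    using at_within_open[OF q open_UJ] by (simp add: xs case_prod_unfold)
qed

text \<open>All three maps gain an order together, since the derivative of each is built from
  \<open>X\<close>, \<open>A\<close> and the three maps themselves, partly through the integral
  \<open>\<Lambda>\<close>.\<close>

lemma class_C_flow:
  "class_C_on k (U \<times> J) (\<lambda>q. \<phi> (fst q) (snd q)) \<and> class_C_on k (U \<times> J) (\<lambda>q. M (fst q) (snd q)) \<and>
   class_C_on k (U \<times> J) (\<lambda>q. N (fst q) (snd q))"
proof (induction k)
  case 0
  show ?case using cont0 by blast
next
  case (Suc k)
  note phi = Suc.IH[THEN conjunct1] and m = Suc.IH[THEN conjunct2, THEN conjunct1] and n = Suc.IH[THEN conjunct2, THEN conjunct2]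
  have phi_S': "(\<lambda>q. \<phi> (fst q) (snd q)) ` (U \<times> J) \<subseteq> S" using phi_S by auto
  have Xp: "class_C_on k (U \<times> J) (\<lambda>q. X (\<phi> (fst q) (snd q)))"
    by (rule class_C_on_compose[OF open_UJ S(1) _ phi phi_S']) (use S(2) in \<open>simp add: smooth_on_def\<close>)
  have Ap: "class_C_on k (U \<times> J) (\<lambda>q. A (\<phi> (fst q) (snd q)))"
    by (rule class_C_on_compose[OF open_UJ S(1) _ phi phi_S']) (use smooth_A in \<open>simp add: smooth_on_def\<close>)
  have AM: "class_C_on k (U \<times> J) (\<lambda>q. A (\<phi> (fst q) (snd q)) o\<^sub>L M (fst q) (snd q))"
    by (rule bounded_bilinear.class_C_on[OF bounded_bilinear_blinfun_compose open_UJ Ap m])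
  have L: "class_C_on k (U \<times> J) (\<lambda>q. \<Lambda> (fst q) (snd q) v)" for v
    by (rule class_C_Lambda[OF class_C_kappa[OF phi m n]])
  have "class_C_on (Suc k) (U \<times> J) (\<lambda>q. \<phi> (fst q) (snd q))"
  proof (rule class_C_on_SucI[OF open_UJ])
    show "((\<lambda>q. \<phi> (fst q) (snd q)) has_derivative (\<lambda>v. blinfun_apply (M (fst q) (snd q)) (fst v) + snd v *\<^sub>R X (\<phi> (fst q) (snd q)))) (at q)"
      if "q \<in> U \<times> J" for q
      by (rule joint_derivative[where f'="\<lambda>x s. X (\<phi> x s)", OF that phi_derivative_x phi' class_C_on_continuous[OF Xp]]) (use that in auto)
    show "class_C_on k (U \<times> J) (\<lambda>q. blinfun_apply (M (fst q) (snd q)) (fst v) + snd v *\<^sub>R X (\<phi> (fst q) (snd q)))" for v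
      by (intro class_C_on_add[OF open_UJ] bounded_bilinear.class_C_on[OF bounded_bilinear_blinfun_apply open_UJ m class_C_on_const]
          bounded_bilinear.class_C_on[OF bounded_bilinear_scaleR open_UJ class_C_on_const Xp])
  qed
  moreover
  let ?DM = "\<lambda>q v. (M (fst q) (snd q) o\<^sub>L \<Lambda> (fst q) (snd q) (fst v)) + snd v *\<^sub>R (A (\<phi> (fst q) (snd q)) o\<^sub>L M (fst q) (snd q))"
  have DM: "((\<lambda>q. M (fst q) (snd q)) has_derivative ?DM q) (at q)" if "q \<in> U \<times> J" for q
    by (rule joint_derivative[where f'="\<lambda>x s. A (\<phi> x s) o\<^sub>L M x s", OF that M_derivative_x M' class_C_on_continuous[OF AM]]) (use that in auto)
  have CDM: "class_C_on k (U \<times> J) (\<lambda>q. ?DM q v)" for v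
    by (intro class_C_on_add[OF open_UJ] bounded_bilinear.class_C_on[OF bounded_bilinear_blinfun_compose open_UJ m L]
        bounded_bilinear.class_C_on[OF bounded_bilinear_scaleR open_UJ class_C_on_const AM])
  have CM: "class_C_on (Suc k) (U \<times> J) (\<lambda>q. M (fst q) (snd q))"
    by (rule class_C_on_SucI[OF open_UJ DM CDM])
  moreover have "class_C_on (Suc k) (U \<times> J) (\<lambda>q. N (fst q) (snd q))"
  proof (rule class_C_on_SucI[OF open_UJ])
    fix q assume q: "q \<in> U \<times> J"
    then have x: "fst q \<in> U" and s: "\<bar>snd q\<bar> < e" by auto
    \<comment> \<open>\<open>N\<close> satisfies the linear equation with respect to \<open>s\<close> only; its dependence on \<open>x\<close> is that of the inverse of \<open>M\<close>.\<close>
    have cN: "continuous (at q) (\<lambda>q. N (fst q) (snd q))"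
      using class_C_on_continuous[OF n] continuous_on_eq_continuous_at[OF open_UJ] q by blast
    let ?N = "\<lambda>q. N (fst q) (snd q)" and ?M = "\<lambda>q. M (fst q) (snd q)"
    \<comment> \<open>The identity behind the next lines is
      \<open>N q' = N q - N q' (M q' - M q) N q\<close>. The middle factor vanishes at
      \<open>q\<close>, so continuity of \<open>N\<close> is enough to differentiate the right-hand
      side.\<close>
    have "((\<lambda>q'. (?M q' - ?M q) o\<^sub>L ?N q) has_derivative (\<lambda>v. (?DM q v - 0) o\<^sub>L ?N q)) (at q)"
      by (rule bounded_linear.has_derivative[OF bounded_bilinear.bounded_linear_left[OF bounded_bilinear_blinfun_compose]
            has_derivative_diff[OF DM[OF q] has_derivative_const]])
    then have "((\<lambda>q'. ?N q' o\<^sub>L ((?M q' - ?M q) o\<^sub>L ?N q)) has_derivative (\<lambda>v. ?N q o\<^sub>L ((?DM q v - 0) o\<^sub>L ?N q))) (at q)"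
      by (rule bounded_bilinear.has_derivative_prod_zero_right[OF bounded_bilinear_blinfun_compose cN])
        (simp add: bounded_bilinear.zero_left[OF bounded_bilinear_blinfun_compose])
    from has_derivative_minus[OF this]
    have "((\<lambda>q'. - (?N q' o\<^sub>L ((?M q' - ?M q) o\<^sub>L ?N q))) has_derivative (\<lambda>v. - (?N q o\<^sub>L (?DM q v o\<^sub>L ?N q)))) (at q)"
      by simp
    then have "((\<lambda>q'. ?N q + - (?N q' o\<^sub>L ((?M q' - ?M q) o\<^sub>L ?N q))) has_derivative (\<lambda>v. 0 + - (?N q o\<^sub>L (?DM q v o\<^sub>L ?N q)))) (at q)"
      by (rule has_derivative_add[OF has_derivative_const])
    then have "((\<lambda>q'. ?N q + - (?N q' o\<^sub>L ((?M q' - ?M q) o\<^sub>L ?N q))) has_derivative (\<lambda>v. - (?N q o\<^sub>L (?DM q v o\<^sub>L ?N q)))) (at q)"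
      by simp
    then show "(?N has_derivative (\<lambda>v. - (?N q o\<^sub>L (?DM q v o\<^sub>L ?N q)))) (at q)"
    proof (rule has_derivative_transform_within_open[OF _ open_UJ q])
      fix q' assume q': "q' \<in> U \<times> J"
      show "?N q + - (?N q' o\<^sub>L ((?M q' - ?M q) o\<^sub>L ?N q)) = ?N q'"
      proof (rule blinfun_eqI)
        fix v
        have "blinfun_apply (?M q) (blinfun_apply (?N q) v) = v"
          using arg_cong[OF MN[OF x s], of "\<lambda>h. blinfun_apply h v"] by simp
        moreover have "blinfun_apply (?N q') (blinfun_apply (?M q') w) = w" for w
          using arg_cong[OF NM[of "fst q'" "snd q'"], of "\<lambda>h. blinfun_apply h w"] q' by auto
        ultimately show "blinfun_apply (?N q + - (?N q' o\<^sub>L ((?M q' - ?M q) o\<^sub>L ?N q))) v = blinfun_apply (?N q') v"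
          by (simp add: blinfun.add_left blinfun.minus_left blinfun.diff_left blinfun.diff_right)
      qed
    qed
  next
    show "class_C_on k (U \<times> J) (\<lambda>q. - (N (fst q) (snd q) o\<^sub>L (?DM q v o\<^sub>L N (fst q) (snd q))))" for v
      by (intro bounded_linear.class_C_on[OF bounded_linear_minus[OF bounded_linear_ident] open_UJ]
          bounded_bilinear.class_C_on[OF bounded_bilinear_blinfun_compose open_UJ] n CDM)
  qed
  ultimately show ?case by blast
qed

end

text \<open>The last clause describes the derivative of the flow map without naming
  \<open>M\<close>: whoever can write down a solution of the linearised equation along an orbit
  knows how the flow map acts on its initial value.\<close>

theorem smooth_local_flow:
  fixes X :: "'a::euclidean_space \<Rightarrow> 'a"
  assumes S: "open S" "smooth_on S X" and p: "p \<in> S"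
  obtains e U \<phi> where "e > 0" "open U" "p \<in> U"
    "smooth_on (U \<times> {-e<..<e}) (\<lambda>q. \<phi> (fst q) (snd q))"
    "\<And>x s. x \<in> U \<Longrightarrow> \<bar>s\<bar> < e \<Longrightarrow> \<phi> x s \<in> S"
    "\<And>x. x \<in> U \<Longrightarrow> \<phi> x 0 = x"
    "\<And>x s. x \<in> U \<Longrightarrow> \<bar>s\<bar> < e \<Longrightarrow> (\<phi> x has_vector_derivative X (\<phi> x s)) (at s)"
    "\<And>x s z. x \<in> U \<Longrightarrow> \<bar>s\<bar> < e \<Longrightarrow>
      (\<And>t. \<bar>t\<bar> < e \<Longrightarrow> (z has_vector_derivative FD X (\<phi> x t) (z t)) (at t)) \<Longrightarrow>
      FD (\<lambda>x. \<phi> x s) x (z 0) = z s"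
proof -
  obtain R where R: "R > 0" "cball p R \<subseteq> S" using S(1) p open_contains_cball by blast
  let ?A = "blinfun_FD X"
  have SA: "smooth_on S ?A" by (rule smooth_on_blinfun_FD[OF S])
  obtain KX where KX: "KX > 0" "\<And>u. u \<in> cball p R \<Longrightarrow> norm (X u) \<le> KX"
    using smooth_on_bounded_cball[OF S(1) R(2) S(2)] by metis
  obtain KA where KA: "KA > 0" "\<And>u. u \<in> cball p R \<Longrightarrow> norm (?A u) \<le> KA"
    using smooth_on_bounded_cball[OF S(1) R(2) SA] by metis
  obtain K1 where K1: "K1 > 0"
    "\<And>u v. u \<in> cball p R \<Longrightarrow> v \<in> cball p R \<Longrightarrow> norm (X v - X u) \<le> K1 * norm (v - u)"
    "\<And>u v. u \<in> cball p R \<Longrightarrow> v \<in> cball p R \<Longrightarrow> norm (X v - X u - FD X u (v - u)) \<le> K1 * (norm (v - u))\<^sup>2"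
    using smooth_on_taylor_cball[OF S(1) R(2) S(2)] by metis
  obtain K2 where K2: "K2 > 0"
    "\<And>u v. u \<in> cball p R \<Longrightarrow> norm (FD ?A u v) \<le> K2 * norm v"
    "\<And>u v. u \<in> cball p R \<Longrightarrow> v \<in> cball p R \<Longrightarrow> norm (?A v - ?A u) \<le> K2 * norm (v - u)"
    "\<And>u v. u \<in> cball p R \<Longrightarrow> v \<in> cball p R \<Longrightarrow> norm (?A v - ?A u - FD ?A u (v - u)) \<le> K2 * (norm (v - u))\<^sup>2"
    using smooth_on_taylor_cball[OF S(1) R(2) SA] by metis
  \<comment> \<open>Flow, variational equation and adjoint equation as one autonomous field. The
    integral curve from \<open>(x, id_blinfun, id_blinfun)\<close> yields \<open>\<phi>\<close>,
    \<open>M\<close> and \<open>N\<close> at once.\<close>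
  define Y :: "'a \<times> ('a \<Rightarrow>\<^sub>L 'a) \<times> ('a \<Rightarrow>\<^sub>L 'a) \<Rightarrow> 'a \<times> ('a \<Rightarrow>\<^sub>L 'a) \<times> ('a \<Rightarrow>\<^sub>L 'a)" where
    "Y z = (X (fst z), ?A (fst z) o\<^sub>L fst (snd z), - (snd (snd z) o\<^sub>L ?A (fst z)))" for z
  define p' :: "'a \<times> ('a \<Rightarrow>\<^sub>L 'a) \<times> ('a \<Rightarrow>\<^sub>L 'a)" where "p' = (p, id_blinfun, id_blinfun)"
  have comp: "norm (fst z) \<le> norm z" "norm (fst (snd z)) \<le> norm z" "norm (snd (snd z)) \<le> norm z"
    for z :: "'a \<times> ('a \<Rightarrow>\<^sub>L 'a) \<times> ('a \<Rightarrow>\<^sub>L 'a)"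
    using norm_fst_le[of "fst z" "snd z"] norm_snd_le[of "snd z" "fst z"] norm_fst_le[of "fst (snd z)" "snd (snd z)"]
      norm_snd_le[of "snd (snd z)" "fst (snd z)"] by auto
  have triple: "norm (a, b, c) \<le> norm a + norm b + norm c"
    for a :: 'a and b c :: "'a \<Rightarrow>\<^sub>L 'a"
    using norm_Pair_le[of a "(b, c)"] norm_Pair_le[of b c] by linarith
  have zR: "fst z \<in> cball p R" "norm (fst (snd z)) \<le> 1 + R" "norm (snd (snd z)) \<le> 1 + R" if "z \<in> cball p' R" for z
  proof -
    have *: "norm (z - p') \<le> R" using that by (simp add: dist_norm norm_minus_commute)
    show "fst z \<in> cball p R" using comp(1)[of "z - p'"] * by (simp add: p'_def dist_norm norm_minus_commute)
    have "norm (fst (snd z) - id_blinfun) \<le> R" "norm (snd (snd z) - id_blinfun) \<le> R"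
      using comp(2,3)[of "z - p'"] * by (simp_all add: p'_def)
    then show "norm (fst (snd z)) \<le> 1 + R" "norm (snd (snd z)) \<le> 1 + R"
      using norm_triangle_ineq[of "fst (snd z) - id_blinfun" id_blinfun] norm_triangle_ineq[of "snd (snd z) - id_blinfun" id_blinfun]
        norm_blinfun_id_le[where 'a='a] by auto
  qed
  define B where "B = KX + KA * (1 + R) + (1 + R) * KA"
  define L where "L = K1 + (K2 * (1 + R) + KA) + (KA + (1 + R) * K2)"
  \<comment> \<open>Chosen to meet both smallness conditions of \<open>picard_flow\<close>; the
    added 1 prevents division by zero.\<close>
  define e where "e = min (R / (2 * (B + 1))) (1 / (2 * (L + 1)))"
  have BL: "0 \<le> B" "0 \<le> L" using KX KA K1 K2 R by (auto simp: B_def L_def)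
  have e: "e > 0" using BL R by (simp add: e_def)
  have eB: "e * B \<le> R / 2"
  proof -
    have "e * B \<le> R / (2 * (B + 1)) * (B + 1)" using BL R by (intro mult_mono) (auto simp: e_def)
    also have "\<dots> = R / 2" using BL by (simp add: divide_simps)
    finally show ?thesis .
  qed
  have eL: "e * L \<le> 1 / 2"
  proof -
    have "e * L \<le> 1 / (2 * (L + 1)) * (L + 1)" using BL by (intro mult_mono) (auto simp: e_def)
    also have "\<dots> = 1 / 2" using BL by (simp add: divide_simps)
    finally show ?thesis .
  qed
  have bY: "norm (Y z) \<le> B" if z: "z \<in> cball p' R" for z
  proof -
    have "norm (Y z) \<le> norm (X (fst z)) + norm (?A (fst z) o\<^sub>L fst (snd z)) + norm (snd (snd z) o\<^sub>L ?A (fst z))"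
      using triple[of "X (fst z)" "?A (fst z) o\<^sub>L fst (snd z)" "- (snd (snd z) o\<^sub>L ?A (fst z))"] by (simp add: Y_def)
    also have "\<dots> \<le> KX + KA * (1 + R) + (1 + R) * KA"
      by (intro add_mono norm_blinfun_compose_le KX(2) KA(2) zR z)
    finally show ?thesis by (simp add: B_def)
  qed
  have lY: "norm (Y z - Y w) \<le> L * norm (z - w)" if z: "z \<in> cball p' R" and w: "w \<in> cball p' R" for z w
  proof -
    define d where "d = norm (z - w)"
    have d: "norm (fst z - fst w) \<le> d" "norm (fst (snd z) - fst (snd w)) \<le> d" "norm (snd (snd z) - snd (snd w)) \<le> d"
      using comp[of "z - w"] by (simp_all add: d_def)
    have A: "norm (?A (fst z) - ?A (fst w)) \<le> K2 * d"
      by (rule order_trans[OF K2(3)[OF zR(1)[OF w] zR(1)[OF z]] mult_left_mono[OF d(1)]]) (use K2 in simp)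
    have "norm (X (fst z) - X (fst w)) \<le> K1 * d"
      by (rule order_trans[OF K1(2)[OF zR(1)[OF w] zR(1)[OF z]] mult_left_mono[OF d(1)]]) (use K1 in simp)
    moreover have "norm ((?A (fst z) o\<^sub>L fst (snd z)) - (?A (fst w) o\<^sub>L fst (snd w))) \<le> K2 * d * (1 + R) + KA * d"
    proof -
      have "(?A (fst z) o\<^sub>L fst (snd z)) - (?A (fst w) o\<^sub>L fst (snd w))
          = ((?A (fst z) - ?A (fst w)) o\<^sub>L fst (snd z)) + (?A (fst w) o\<^sub>L (fst (snd z) - fst (snd w)))"
        by (intro blinfun_eqI) (simp add: blinfun.diff_left blinfun.add_left blinfun.diff_right)
      also have "norm \<dots> \<le> K2 * d * (1 + R) + KA * d"
        by (intro order_trans[OF norm_triangle_ineq] add_mono norm_blinfun_compose_le A zR z KA(2) w d)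
      finally show ?thesis .
    qed
    moreover have "norm (- (snd (snd z) o\<^sub>L ?A (fst z)) - - (snd (snd w) o\<^sub>L ?A (fst w))) \<le> d * KA + (1 + R) * (K2 * d)"
    proof -
      have "- (snd (snd z) o\<^sub>L ?A (fst z)) - - (snd (snd w) o\<^sub>L ?A (fst w))
          = - (((snd (snd z) - snd (snd w)) o\<^sub>L ?A (fst z)) + (snd (snd w) o\<^sub>L (?A (fst z) - ?A (fst w))))"
        by (intro blinfun_eqI) (simp add: blinfun.diff_left blinfun.add_left blinfun.diff_right blinfun.minus_left)
      also have "norm \<dots> \<le> d * KA + (1 + R) * (K2 * d)"
        unfolding norm_minus_cancel
        by (intro order_trans[OF norm_triangle_ineq] add_mono norm_blinfun_compose_le A zR z KA(2) w d)
      finally show ?thesis .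
    qed
    ultimately have "norm (Y z - Y w) \<le> K1 * d + (K2 * d * (1 + R) + KA * d) + (d * KA + (1 + R) * (K2 * d))"
      unfolding Y_def diff_Pair by (intro order_trans[OF triple] add_mono)
    also have "\<dots> = L * d" by (simp add: L_def algebra_simps)
    finally show ?thesis by (simp add: d_def)
  qed
  show ?thesis
  proof (rule picard_flow[OF R(1) e BL(2) bY eB lY eL])
  fix \<Phi>
  assume Phi_ball: "\<And>z s. z \<in> cball p' (R / 2) \<Longrightarrow> \<Phi> z s \<in> cball p' R"
    and Phi0: "\<And>z. z \<in> cball p' (R / 2) \<Longrightarrow> \<Phi> z 0 = z"
    and Phi': "\<And>z s. z \<in> cball p' (R / 2) \<Longrightarrow> \<bar>s\<bar> < e \<Longrightarrow> (\<Phi> z has_vector_derivative Y (\<Phi> z s)) (at s)"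
    and Phi_lip: "\<And>z w s. z \<in> cball p' (R / 2) \<Longrightarrow> w \<in> cball p' (R / 2) \<Longrightarrow> norm (\<Phi> z s - \<Phi> w s) \<le> 2 * norm (z - w)"
    and Phi_cont: "continuous_on (cball p' (R / 2) \<times> {-e<..<e}) (\<lambda>(z, s). \<Phi> z s)"
  define E :: "'a \<Rightarrow> 'a \<times> ('a \<Rightarrow>\<^sub>L 'a) \<times> ('a \<Rightarrow>\<^sub>L 'a)" where "E x = (x, id_blinfun, id_blinfun)" for x
  define U where "U = ball p (R / 2)"
  have EU: "E x \<in> cball p' (R / 2)" if "x \<in> U" for x
    using that by (simp add: E_def p'_def U_def dist_Pair_Pair)
  have EE: "norm (E x - E y) = norm (x - y)" for x y by (simp add: E_def norm_Pair)
  define \<phi> where "\<phi> x s = fst (\<Phi> (E x) s)" for x s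
  define M where "M x s = fst (snd (\<Phi> (E x) s))" for x s
  define N where "N x s = snd (snd (\<Phi> (E x) s))" for x s
  have UR: "\<phi> x s \<in> cball p R" if "x \<in> U" for x s
    unfolding \<phi>_def by (rule zR(1)[OF Phi_ball[OF EU[OF that]]])
  have lip: "norm (\<Phi> (E y) s - \<Phi> (E x) s) \<le> 2 * norm (y - x)" if "x \<in> U" "y \<in> U" for x y s
    using Phi_lip[OF EU[OF that(2)] EU[OF that(1)], of s] by (simp add: EE)
  have contE: "continuous_on (U \<times> {-e<..<e}) (\<lambda>q. \<Phi> (E (fst q)) (snd q))"
  proof -
    have "continuous_on (U \<times> {-e<..<e}) (\<lambda>q. case (E (fst q), snd q) of (z, s) \<Rightarrow> \<Phi> z s)"
      by (rule continuous_on_compose2[OF Phi_cont]) (use EU in \<open>auto simp: E_def intro!: continuous_intros\<close>)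
    then show ?thesis by simp
  qed
  have vd: "(\<phi> x has_vector_derivative X (\<phi> x s)) (at s)"
    "(M x has_vector_derivative ?A (\<phi> x s) o\<^sub>L M x s) (at s)"
    "(N x has_vector_derivative - (N x s o\<^sub>L ?A (\<phi> x s))) (at s)" if "x \<in> U" "\<bar>s\<bar> < e" for x s
    using bounded_linear.has_vector_derivative[OF bounded_linear_fst Phi'[OF EU[OF that(1)] that(2)]]
      bounded_linear.has_vector_derivative[OF bounded_linear_fst bounded_linear.has_vector_derivative[OF bounded_linear_snd Phi'[OF EU[OF that(1)] that(2)]]]
      bounded_linear.has_vector_derivative[OF bounded_linear_snd bounded_linear.has_vector_derivative[OF bounded_linear_snd Phi'[OF EU[OF that(1)] that(2)]]]
    unfolding Y_def \<phi>_def[abs_def] M_def[abs_def] N_def[abs_def] fst_conv snd_conv .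
  have C2: "2 * d \<le> (2 + R) * d" "K1 * d \<le> (K1 + K2) * d" "K2 * d \<le> (K1 + K2) * d" if "d \<ge> 0" for d :: real
    using R K1 K2 that by (auto intro!: mult_right_mono)
  \<comment> \<open>The constant \<open>2 + R\<close> dominates both the Lipschitz constant 2 of the
    Picard flow and the operator bound \<open>1 + R\<close>; \<open>K1 + K2\<close> dominates the
    Taylor constants of \<open>X\<close> and of its derivative.\<close>
  interpret variational_flow X S U e "2 + R" "K1 + K2" \<phi> M N
  proof
    show "norm (\<phi> y s - \<phi> x s) \<le> (2 + R) * norm (y - x)" "norm (M y s - M x s) \<le> (2 + R) * norm (y - x)"
      if "x \<in> U" "y \<in> U" "\<bar>s\<bar> < e" for x y s
      using order_trans[OF comp(1) order_trans[OF lip[OF that(1,2), of s] C2(1)[OF norm_ge_zero]]]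
        order_trans[OF comp(2) order_trans[OF lip[OF that(1,2), of s] C2(1)[OF norm_ge_zero]]]
      by (simp_all add: \<phi>_def M_def)
    show "norm (M x s) \<le> 2 + R" "norm (N x s) \<le> 2 + R" if "x \<in> U" "\<bar>s\<bar> < e" for x s
      using zR(2,3)[OF Phi_ball[OF EU[OF that(1)], of s]] by (simp_all add: M_def N_def)
    show "continuous_on (U \<times> {- e<..<e}) (\<lambda>(x, s). \<phi> x s)" "continuous_on (U \<times> {- e<..<e}) (\<lambda>(x, s). M x s)"
      "continuous_on (U \<times> {- e<..<e}) (\<lambda>(x, s). N x s)"
      using continuous_on_fst[OF contE] continuous_on_fst[OF continuous_on_snd[OF contE]] continuous_on_snd[OF continuous_on_snd[OF contE]]
      by (simp_all add: \<phi>_def M_def N_def case_prod_unfold)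
    show "norm (X (\<phi> y s) - X (\<phi> x s) - FD X (\<phi> x s) (\<phi> y s - \<phi> x s)) \<le> (K1 + K2) * (norm (\<phi> y s - \<phi> x s))\<^sup>2"
      if "x \<in> U" "y \<in> U" "\<bar>s\<bar> < e" for x y s
      by (rule order_trans[OF K1(3)[OF UR[OF that(1)] UR[OF that(2)]] C2(2)[OF zero_le_power2]])
    show "norm (?A (\<phi> y s) - ?A (\<phi> x s) - FD ?A (\<phi> x s) (\<phi> y s - \<phi> x s)) \<le> (K1 + K2) * (norm (\<phi> y s - \<phi> x s))\<^sup>2"
      if "x \<in> U" "y \<in> U" "\<bar>s\<bar> < e" for x y s
      by (rule order_trans[OF K2(4)[OF UR[OF that(1)] UR[OF that(2)]] C2(3)[OF zero_le_power2]])
    show "norm (?A (\<phi> y s) - ?A (\<phi> x s)) \<le> (K1 + K2) * norm (\<phi> y s - \<phi> x s)"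
      if "x \<in> U" "y \<in> U" "\<bar>s\<bar> < e" for x y s
      by (rule order_trans[OF K2(3)[OF UR[OF that(1)] UR[OF that(2)]] C2(3)[OF norm_ge_zero]])
    show "norm (FD ?A (\<phi> x s) v) \<le> (K1 + K2) * norm v" if "x \<in> U" "\<bar>s\<bar> < e" for x s v
      by (rule order_trans[OF K2(2)[OF UR[OF that(1)]] C2(3)[OF norm_ge_zero]])
    show "\<phi> x s \<in> S" if "x \<in> U" "\<bar>s\<bar> < e" for x s using UR[OF that(1)] R(2) by blast
    show "\<phi> x 0 = x" "M x 0 = id_blinfun" "N x 0 = id_blinfun" if "x \<in> U" for x
      using Phi0[OF EU[OF that]] by (simp_all add: \<phi>_def M_def N_def E_def)
  qed (use S vd e R K1 K2 in \<open>auto simp: U_def\<close>)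
  show ?thesis
  proof (rule that[of e U \<phi>])
    show "smooth_on (U \<times> {-e<..<e}) (\<lambda>q. \<phi> (fst q) (snd q))"
      using class_C_flow by (simp add: smooth_on_def)
    show "FD (\<lambda>x. \<phi> x s) x (z 0) = z s"
      if x: "x \<in> U" and s: "\<bar>s\<bar> < e" and z: "\<And>t. \<bar>t\<bar> < e \<Longrightarrow> (z has_vector_derivative FD X (\<phi> x t) (z t)) (at t)" for x s z
    proof -
      have "FD (\<lambda>x. \<phi> x s) x (z 0) = blinfun_apply (M x s) (blinfun_apply (N x s) (z s))"
        using FD_eq[OF phi_derivative_x[OF x s]] variational_solution[OF x s z] by simp
      also have "\<dots> = z s" using arg_cong[OF MN[OF x s], of "\<lambda>h. blinfun_apply h (z s)"] by simp
      finally show ?thesis .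
    qed
    show "p \<in> U" "open U" using R by (auto simp: U_def)
  qed (use e phi_S init phi' in auto)
  qed
qed

section \<open>Linear systems along an involutive frame\<close>

text \<open>The squared norm of \<open>f\<close>, damped by \<open>exp (- 2 * C * s)\<close>, is
  nonincreasing and starts at 0.\<close>

lemma gronwall_zero:
  fixes f :: "real \<Rightarrow> 'a::real_inner"
  assumes f': "\<And>s. 0 \<le> s \<Longrightarrow> s \<le> 1 \<Longrightarrow> (f has_vector_derivative f' s) (at s)"
    and bound: "\<And>s. 0 \<le> s \<Longrightarrow> s \<le> 1 \<Longrightarrow> norm (f' s) \<le> C * norm (f s)" and f0: "f 0 = 0"
  shows "f 1 = 0"
proof -
  let ?g = "\<lambda>s. exp (- 2 * C * s) * (f s \<bullet> f s)"
  have "?g 1 \<le> ?g 0"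
  proof (rule DERIV_nonpos_imp_nonincreasing[of 0 1 ?g])
    fix s :: real assume s: "0 \<le> s" "s \<le> 1"
    have fd: "(f has_derivative (\<lambda>h. h *\<^sub>R f' s)) (at s)" using f'[OF s] by (simp add: has_vector_derivative_def)
    have d: "(?g has_real_derivative exp (- 2 * C * s) * (2 * (f s \<bullet> f' s) - 2 * C * (f s \<bullet> f s))) (at s)"
      unfolding has_field_derivative_def
      by (rule has_derivative_eq_rhs[OF has_derivative_mult[OF _ has_derivative_inner[OF fd fd]]])
        (auto intro!: derivative_eq_intros simp: algebra_simps inner_commute)
    have "f s \<bullet> f' s \<le> norm (f s) * norm (f' s)" by (rule norm_cauchy_schwarz)
    also have "\<dots> \<le> norm (f s) * (C * norm (f s))" by (rule mult_left_mono[OF bound[OF s] norm_ge_zero])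
    also have "\<dots> = C * (f s \<bullet> f s)" by (simp add: dot_square_norm power2_eq_square)
    finally have "2 * (f s \<bullet> f' s) - 2 * C * (f s \<bullet> f s) \<le> 0" by simp
    then have "exp (- 2 * C * s) * (2 * (f s \<bullet> f' s) - 2 * C * (f s \<bullet> f s)) \<le> 0"
      by (simp add: mult_le_0_iff)
    with d show "\<exists>y. (?g has_real_derivative y) (at s) \<and> y \<le> 0" by blast
  qed simp
  then have "exp (- 2 * C) * (f 1 \<bullet> f 1) \<le> 0" using f0 by simp
  then have "f 1 \<bullet> f 1 \<le> 0" by (simp add: mult_le_0_iff)
  then show ?thesis using inner_ge_zero[of "f 1"] by (simp add: antisym)
qed

lemma has_vector_derivative_FD_compose:
  assumes "(g has_vector_derivative g') (at s)" "f differentiable (at (g s))"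
  shows "((\<lambda>s. f (g s)) has_vector_derivative FD f (g s) g') (at s)"
proof -
  have "((\<lambda>s. f (g s)) has_derivative (\<lambda>h. FD f (g s) (h *\<^sub>R g'))) (at s)"
    by (rule has_derivative_compose[OF assms(1)[unfolded has_vector_derivative_def] has_derivative_FD[OF assms(2)]])
  then show ?thesis by (simp add: has_vector_derivative_def linear_scale[OF linear_FD[OF assms(2)]])
qed

lemma sum_axis_scaleR:
  fixes f :: "'i::finite \<Rightarrow> 'a::real_vector"
  shows "(\<Sum>k\<in>UNIV. (axis i (a::real) :: real^'i) $ k *\<^sub>R f k) = a *\<^sub>R f i"
proof -
  have "(axis i a :: real^'i) $ k *\<^sub>R f k = (if k = i then a *\<^sub>R f k else 0)" for k by (simp add: axis_def)
  then show ?thesis by simp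
qed

lemma FD_compose_eq:
  assumes "(f has_derivative f') (at x)" "g differentiable (at (f x))"
  shows "((\<lambda>x. g (f x)) has_derivative (\<lambda>v. FD g (f x) (f' v))) (at x)"
  by (rule has_derivative_compose[OF assms(1) has_derivative_FD[OF assms(2)]])

section \<open>The joint flow of commuting vector fields\<close>

text \<open>\<open>G t w\<close> follows the combination of the \<open>X i\<close> with constant
  coefficients \<open>t\<close> for unit time. Carrying \<open>t\<close> as a frozen part of the
  state makes this the flow of a single field \<open>T\<close>, hence smooth in \<open>t\<close> and
  \<open>w\<close> together. Both derivative formulas come from explicit solutions of the linearised
  equation of \<open>T\<close>.\<close>

lemma commuting_flows:
  fixes X :: "'i::finite \<Rightarrow> 'a::euclidean_space \<Rightarrow> 'a"
  assumes S: "open S" "\<And>i. smooth_on S (X i)" and p: "p \<in> S"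
    and comm: "\<And>i j w. w \<in> S \<Longrightarrow> FD (X j) w (X i w) = FD (X i) w (X j w)"
  obtains e U and G :: "real^'i \<Rightarrow> 'a \<Rightarrow> 'a" where "e > 0" "open U" "p \<in> U"
    "smooth_on (ball 0 e \<times> U) (\<lambda>q. G (fst q) (snd q))"
    "\<And>t w. t \<in> ball 0 e \<Longrightarrow> w \<in> U \<Longrightarrow> G t w \<in> S"
    "\<And>w. w \<in> U \<Longrightarrow> G 0 w = w"
    "\<And>t w i. t \<in> ball 0 e \<Longrightarrow> w \<in> U \<Longrightarrow> FD (\<lambda>q. G (fst q) (snd q)) (t, w) (axis i 1, 0) = X i (G t w)"
    "\<And>t w i. t \<in> ball 0 e \<Longrightarrow> w \<in> U \<Longrightarrow> FD (\<lambda>q. G (fst q) (snd q)) (t, w) (0, X i w) = X i (G t w)"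
proof -
  define T :: "'a \<times> (real^'i) \<Rightarrow> 'a \<times> (real^'i)" where "T q = (\<Sum>i\<in>UNIV. snd q $ i *\<^sub>R X i (fst q), 0)" for q
  let ?S = "S \<times> (UNIV :: (real^'i) set)"
  have oS: "open ?S" using S(1) by (simp add: open_Times)
  have sT: "smooth_on ?S T"
    unfolding T_def[abs_def]
    by (rule smooth_on_Pair[OF oS _ smooth_on_const], rule smooth_on_sum[OF oS], rule smooth_on_scaleR[OF oS])
      (rule smooth_on_vec_nth[OF oS smooth_on_bounded_linear[OF bounded_linear_snd oS]],
       rule smooth_on_compose[OF oS S(1) S(2) smooth_on_bounded_linear[OF bounded_linear_fst oS]], auto)
  have pS: "(p, 0) \<in> ?S" using p by simp
  have Xd: "X i differentiable (at w)" if "w \<in> S" for i w by (rule smooth_on_differentiable[OF S(2) that])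
  have FDT: "FD T (w, t) (v, k) = (\<Sum>i\<in>UNIV. t $ i *\<^sub>R FD (X i) w v + k $ i *\<^sub>R X i w, 0)" if "w \<in> S" for w t v k
  proof -
    have "(T has_derivative (\<lambda>h. (\<Sum>i\<in>UNIV. t $ i *\<^sub>R FD (X i) w (fst h) + snd h $ i *\<^sub>R X i w, 0))) (at (w, t))"
      unfolding T_def[abs_def]
    proof (rule has_derivative_Pair[OF has_derivative_sum has_derivative_const])
      fix i
      have 1: "((\<lambda>q :: 'a \<times> (real^'i). X i (fst q)) has_derivative (\<lambda>h. FD (X i) w (fst h))) (at (w, t))"
        using FD_compose_eq[OF bounded_linear_imp_has_derivative[OF bounded_linear_fst], of "X i" "(w, t)"] Xd[OF that] by simp
      have 2: "((\<lambda>q :: 'a \<times> (real^'i). snd q $ i) has_derivative (\<lambda>h. snd h $ i)) (at (w, t))"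
        by (intro bounded_linear_imp_has_derivative bounded_linear_compose[OF bounded_linear_vec_nth bounded_linear_snd])
      show "((\<lambda>q :: 'a \<times> (real^'i). snd q $ i *\<^sub>R X i (fst q)) has_derivative (\<lambda>h. t $ i *\<^sub>R FD (X i) w (fst h) + snd h $ i *\<^sub>R X i w)) (at (w, t))"
        using has_derivative_scaleR[OF 2 1] by simp
    qed
    from FD_eq[OF this] show ?thesis by simp
  qed
  show ?thesis
  proof (rule smooth_local_flow[OF oS sT pS])
    fix e U' \<phi>
    assume e: "e > 0" and U': "open U'" "(p, 0) \<in> U'"
      and sphi: "smooth_on (U' \<times> {-e<..<e}) (\<lambda>q. \<phi> (fst q) (snd q))"
      and phiS: "\<And>x s. x \<in> U' \<Longrightarrow> \<bar>s\<bar> < e \<Longrightarrow> \<phi> x s \<in> ?S"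
      and phi0: "\<And>x. x \<in> U' \<Longrightarrow> \<phi> x 0 = x"
      and phi': "\<And>x s. x \<in> U' \<Longrightarrow> \<bar>s\<bar> < e \<Longrightarrow> (\<phi> x has_vector_derivative T (\<phi> x s)) (at s)"
      and var: "\<And>x s z. x \<in> U' \<Longrightarrow> \<bar>s\<bar> < e \<Longrightarrow>
        (\<And>t. \<bar>t\<bar> < e \<Longrightarrow> (z has_vector_derivative FD T (\<phi> x t) (z t)) (at t)) \<Longrightarrow>
        FD (\<lambda>x. \<phi> x s) x (z 0) = z s"
    obtain V B where V: "open V" "p \<in> V" "open B" "0 \<in> B" "V \<times> B \<subseteq> U'"
    proof (rule open_prod_elim[OF U'])
      fix V B assume "open V" "open B" "(p, 0) \<in> V \<times> B" "V \<times> B \<subseteq> U'"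
      then show thesis by (intro that[of V B]) auto
    qed
    obtain \<rho> where rho: "\<rho> > 0" "ball 0 \<rho> \<subseteq> B" using openE[OF V(3,4)] by blast
    \<comment> \<open>Orbits are available only for times below \<open>e\<close>, so unit time with
      coefficients \<open>t\<close> is replaced by time \<open>s0\<close> with coefficients
      \<open>t / s0\<close>.\<close>
    define s0 where "s0 = e / 2"
    have s0: "0 < s0" "\<bar>s0\<bar> < e" using e by (auto simp: s0_def)
    define l :: "(real^'i) \<times> 'a \<Rightarrow> 'a \<times> (real^'i)" where "l q = (snd q, (1 / s0) *\<^sub>R fst q)" for q
    have bl: "bounded_linear l" unfolding l_def[abs_def]
      by (intro bounded_linear_Pair bounded_linear_snd bounded_linear_compose[OF bounded_linear_scaleR_right bounded_linear_fst])
    define G where "G t w = fst (\<phi> (l (t, w)) s0)" for t w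
    define d where "d = s0 * \<rho>"
    let ?D = "ball 0 d \<times> V :: ((real^'i) \<times> 'a) set"
    have oD: "open ?D" using V by (simp add: open_Times)
    have lU: "l q \<in> U'" if "q \<in> ?D" for q
    proof -
      have "(1 / s0) *\<^sub>R fst q \<in> ball 0 \<rho>" using that s0 by (auto simp: d_def divide_simps mult.commute)
      then have "(1 / s0) *\<^sub>R fst q \<in> B" using rho(2) by blast
      moreover have "snd q \<in> V" using that by auto
      ultimately show ?thesis unfolding l_def by (intro subsetD[OF V(5)] SigmaI)
    qed
    have sndphi: "snd (\<phi> x s) = snd x" if x: "x \<in> U'" and s: "\<bar>s\<bar> < e" for x s
    proof -
      have "norm (snd (\<phi> x s) - snd (\<phi> x 0)) \<le> 0 * e"
      proof (rule norm_diff_le_of_derivative_bound[OF _ _ s])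
        show "((\<lambda>s. snd (\<phi> x s)) has_vector_derivative 0) (at t)" if "\<bar>t\<bar> < e" for t
          using bounded_linear.has_vector_derivative[OF bounded_linear_snd phi'[OF x that]] by (simp add: T_def)
      qed simp
      then show ?thesis using phi0[OF x] by simp
    qed
    have fstS: "fst (\<phi> x s) \<in> S" if "x \<in> U'" "\<bar>s\<bar> < e" for x s using phiS[OF that] by auto
    have sphi0: "smooth_on U' (\<lambda>x. \<phi> x s0)"
    proof -
      have "(\<lambda>x. (x, s0)) ` U' \<subseteq> U' \<times> {-e<..<e}" using s0 by (auto simp: abs_less_iff)
      then show ?thesis
      using smooth_on_compose[OF U'(1) open_Times[OF U'(1) open_greaterThanLessThan] sphi
          smooth_on_Pair[OF U'(1) smooth_on_ident[OF U'(1)] smooth_on_const[of _ s0]]] by simp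
    qed
    have sG: "smooth_on ?D (\<lambda>q. G (fst q) (snd q))"
      unfolding G_def
      by (rule smooth_on_fst[OF oD], rule smooth_on_compose[OF oD U'(1) sphi0])
        (use lU smooth_on_bounded_linear[OF bl oD] in auto)
    have FDG: "FD (\<lambda>q. G (fst q) (snd q)) q v = fst (FD (\<lambda>x. \<phi> x s0) (l q) (l v))" if "q \<in> ?D" for q v
    proof -
      have "((\<lambda>q. fst (\<phi> (l q) s0)) has_derivative (\<lambda>v. fst (FD (\<lambda>x. \<phi> x s0) (l q) (l v)))) (at q)"
        by (rule has_derivative_fst,
            rule FD_compose_eq[OF bounded_linear_imp_has_derivative[OF bl], of "\<lambda>x. \<phi> x s0"])
          (rule smooth_on_differentiable[OF sphi0 lU[OF that]])
      from FD_eq[OF this] show ?thesis by (simp add: G_def)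
    qed
    have Xphi: "((\<lambda>s. X i (fst (\<phi> x s))) has_vector_derivative
        FD (X i) (fst (\<phi> x s)) (\<Sum>k\<in>UNIV. snd x $ k *\<^sub>R X k (fst (\<phi> x s)))) (at s)"
      if "x \<in> U'" "\<bar>s\<bar> < e" for x s i
      using has_vector_derivative_FD_compose[OF bounded_linear.has_vector_derivative[OF bounded_linear_fst phi'[OF that]] Xd[OF fstS[OF that]]]
      by (simp add: T_def sndphi[OF that])
    \<comment> \<open>This is where commutation enters: the change of \<open>X i\<close> along an
      orbit is the linearised field applied to \<open>X i\<close>, so each \<open>X i\<close> is
      itself a variational solution.\<close>
    have FX: "FD (X i) w (\<Sum>k\<in>UNIV. t $ k *\<^sub>R X k w) = (\<Sum>k\<in>UNIV. t $ k *\<^sub>R FD (X k) w (X i w))" if "w \<in> S" for i w and t :: "real^'i"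
    proof -
      interpret linear "FD (X i) w" by (rule linear_FD[OF Xd[OF that]])
      show ?thesis by (simp add: sum scale comm[OF that])
    qed
    show ?thesis
    proof (rule that[of d V G])
      show "d > 0" using s0 rho by (simp add: d_def)
      show "G t w \<in> S" if "t \<in> ball 0 d" "w \<in> V" for t w
        unfolding G_def by (rule fstS[OF lU s0(2)]) (use that in simp)
      show "G 0 w = w" if "w \<in> V" for w
      proof -
        have q: "(0, w) \<in> ?D" using that s0 rho by (simp add: d_def)
        define x where "x = l (0, w)"
        have x: "x \<in> U'" "x = (w, 0)" using lU[OF q] by (simp_all add: x_def l_def)
        have "norm (fst (\<phi> x s0) - fst (\<phi> x 0)) \<le> 0 * e"
        proof (rule norm_diff_le_of_derivative_bound[OF _ _ s0(2)])
          show "((\<lambda>s. fst (\<phi> x s)) has_vector_derivative 0) (at t)" if "\<bar>t\<bar> < e" for t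
          proof -
            have "snd (\<phi> x t) = 0" using sndphi[OF x(1) that] x(2) by simp
            then show ?thesis
              using bounded_linear.has_vector_derivative[OF bounded_linear_fst phi'[OF x(1) that]] by (simp add: T_def)
          qed
        qed simp
        then show ?thesis using phi0[OF x(1)] by (simp add: G_def x_def[symmetric] x(2))
      qed
      fix t :: "real^'i" and w :: 'a and i
      assume t: "t \<in> ball 0 d" and w: "w \<in> V"
      then have q: "(t, w) \<in> ?D" by simp
      let ?x = "l (t, w)"
      have x: "?x \<in> U'" by (rule lU[OF q])
      \<comment> \<open>The variational solution for a change of the coefficient
        \<open>t $ i\<close>: it starts at zero, and the derivative of the factor
        \<open>s / s0\<close> produces exactly the forcing that the constant second component exerts
        on the first.\<close>
      have "FD (\<lambda>x. \<phi> x s0) ?x ((0 / s0) *\<^sub>R X i (fst (\<phi> ?x 0)), axis i (1 / s0)) = ((s0 / s0) *\<^sub>R X i (fst (\<phi> ?x s0)), axis i (1 / s0))"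
      proof (rule var[of ?x s0 "\<lambda>s. ((s / s0) *\<^sub>R X i (fst (\<phi> ?x s)), axis i (1 / s0))", OF x s0(2)])
        fix s assume s: "\<bar>s\<bar> < e"
        let ?w = "fst (\<phi> ?x s)"
        let ?d = "\<Sum>k\<in>UNIV. snd ?x $ k *\<^sub>R FD (X k) ?w ((s / s0) *\<^sub>R X i ?w) + axis i (1 / s0) $ k *\<^sub>R X k ?w"
        have phieq: "\<phi> ?x s = (?w, snd ?x)" using sndphi[OF x s] by (simp add: prod_eq_iff)
        have "((\<lambda>s. s / s0) has_real_derivative 1 / s0) (at s)"
          using s0(1) by (auto intro!: derivative_eq_intros)
        then have "((\<lambda>s. (s / s0) *\<^sub>R X i (fst (\<phi> ?x s))) has_vector_derivative
            (s / s0) *\<^sub>R FD (X i) ?w (\<Sum>k\<in>UNIV. snd ?x $ k *\<^sub>R X k ?w) + (1 / s0) *\<^sub>R X i ?w) (at s)"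
          by (rule has_vector_derivative_scaleR[OF _ Xphi[OF x s]])
        also have "(s / s0) *\<^sub>R FD (X i) ?w (\<Sum>k\<in>UNIV. snd ?x $ k *\<^sub>R X k ?w) + (1 / s0) *\<^sub>R X i ?w = ?d"
          by (simp add: FX[OF fstS[OF x s]] sum.distrib sum_axis_scaleR linear_scale[OF linear_FD[OF Xd[OF fstS[OF x s]]]]
              scaleR_sum_right mult.commute)
        finally have d: "((\<lambda>s. (s / s0) *\<^sub>R X i (fst (\<phi> ?x s))) has_vector_derivative ?d) (at s)" .
        have "((\<lambda>s. ((s / s0) *\<^sub>R X i (fst (\<phi> ?x s)), axis i (1 / s0) :: real^'i)) has_vector_derivative (?d, 0)) (at s)"
          by (rule has_vector_derivative_Pair[OF d has_vector_derivative_const])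
        also have "(?d, 0) = FD T (?w, snd ?x) ((s / s0) *\<^sub>R X i ?w, axis i (1 / s0))"
          by (rule FDT[OF fstS[OF x s], symmetric])
        finally show "((\<lambda>s. ((s / s0) *\<^sub>R X i (fst (\<phi> ?x s)), axis i (1 / s0) :: real^'i)) has_vector_derivative
            FD T (\<phi> ?x s) ((s / s0) *\<^sub>R X i (fst (\<phi> ?x s)), axis i (1 / s0))) (at s)"
          unfolding phieq[symmetric] .
      qed
      moreover have laxis: "l (axis i 1, 0) = (0, axis i (1 / s0))" by (simp add: l_def vec_eq_iff axis_def)
      ultimately have "FD (\<lambda>x. \<phi> x s0) ?x (l (axis i 1, 0)) = (X i (G t w), axis i (1 / s0))"
        using s0 unfolding laxis by (simp add: G_def)
      then show "FD (\<lambda>q. G (fst q) (snd q)) (t, w) (axis i 1, 0) = X i (G t w)"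
        by (simp add: FDG[OF q])
      have "FD (\<lambda>x. \<phi> x s0) ?x (X i (fst (\<phi> ?x 0)), 0) = (X i (fst (\<phi> ?x s0)), 0)"
      proof (rule var[of ?x s0 "\<lambda>s. (X i (fst (\<phi> ?x s)), 0)", OF x s0(2)])
        fix s assume s: "\<bar>s\<bar> < e"
        let ?w = "fst (\<phi> ?x s)"
        have phieq: "\<phi> ?x s = (?w, snd ?x)" using sndphi[OF x s] by (simp add: prod_eq_iff)
        have "((\<lambda>s. (X i (fst (\<phi> ?x s)), 0 :: real^'i)) has_vector_derivative (FD (X i) ?w (\<Sum>k\<in>UNIV. snd ?x $ k *\<^sub>R X k ?w), 0)) (at s)"
          by (rule has_vector_derivative_Pair[OF Xphi[OF x s] has_vector_derivative_const])
        also have "(FD (X i) ?w (\<Sum>k\<in>UNIV. snd ?x $ k *\<^sub>R X k ?w), 0) = FD T (?w, snd ?x) (X i ?w, 0)"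
          unfolding FDT[OF fstS[OF x s]] FX[OF fstS[OF x s]] by simp
        finally show "((\<lambda>s. (X i (fst (\<phi> ?x s)), 0 :: real^'i)) has_vector_derivative FD T (\<phi> ?x s) (X i (fst (\<phi> ?x s)), 0)) (at s)"
          unfolding phieq[symmetric] .
      qed
      then show "FD (\<lambda>q. G (fst q) (snd q)) (t, w) (0, X i w) = X i (G t w)"
      proof -
        assume *: "FD (\<lambda>x. \<phi> x s0) ?x (X i (fst (\<phi> ?x 0)), 0) = (X i (fst (\<phi> ?x s0)), 0)"
        have "fst (\<phi> ?x 0) = w" using phi0[OF x] by (simp add: l_def)
        moreover have "l (0, X i w) = (X i w, 0)" by (simp add: l_def)
        ultimately show ?thesis using * by (simp add: FDG[OF q]) (simp add: G_def)
      qed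
    qed (use V sG in auto)
  qed
qed

section \<open>Normalising an involutive frame\<close>

lemma smooth_on_det:
  assumes "open S" "\<And>i j. smooth_on S (\<lambda>x. A x $ i $ j)"
  shows "smooth_on S (\<lambda>x. det (A x :: real^'i^'i))"
  unfolding det_def
  by (rule smooth_on_sum[OF assms(1)], rule smooth_on_mult[OF assms(1) smooth_on_const], rule smooth_on_prod[OF assms])

text \<open>\<open>g\<close> is the transposed inverse of the matrix of derivatives of
  \<open>\<tau>\<close> along the frame. Cramer's rule writes it as quotients of determinants, so it
  is smooth wherever the determinant does not vanish.\<close>

lemma dual_frame:
  fixes R :: "'i::finite \<Rightarrow> 'a::euclidean_space \<Rightarrow> 'a" and \<tau> :: "'a \<Rightarrow> real^'i"
  assumes S: "open S" "p \<in> S" and R: "\<And>i. smooth_on S (R i)" and \<tau>: "smooth_on S \<tau>"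
    and inj: "\<And>a :: real^'i. (\<Sum>i\<in>UNIV. a $ i *\<^sub>R FD \<tau> p (R i p)) = 0 \<Longrightarrow> a = 0"
  obtains S' g where "open S'" "p \<in> S'" "S' \<subseteq> S" "\<And>i j. smooth_on S' (g i j)"
    "\<And>i w. w \<in> S' \<Longrightarrow> (\<Sum>j\<in>UNIV. g i j w *\<^sub>R FD \<tau> w (R j w)) = axis i 1"
    "\<And>i k w. w \<in> S' \<Longrightarrow> (\<Sum>j\<in>UNIV. FD \<tau> w (R i w) $ j * g j k w) = (if i = k then 1 else 0)"
proof -
  define A :: "'a \<Rightarrow> real^'i^'i" where "A w = (\<chi> i j. FD \<tau> w (R j w) $ i)" for w
  have sA: "smooth_on S (\<lambda>w. A w $ i $ j)" for i j
    using smooth_on_vec_nth[OF S(1) smooth_on_FD[OF S(1) \<tau> R]] by (simp add: A_def)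
  have Av: "A w *v a = (\<Sum>j\<in>UNIV. a $ j *\<^sub>R FD \<tau> w (R j w))" for w a
    by (simp add: A_def matrix_vector_mult_def vec_eq_iff mult.commute)
  have sdet: "smooth_on S (\<lambda>w. det (A w))" by (rule smooth_on_det[OF S(1) sA])
  have "det (A p) \<noteq> 0"
  proof -
    have "\<And>a. A p *v a = 0 \<Longrightarrow> a = 0" unfolding Av by (rule inj)
    then have "inj ((*v) (A p))"
      using linear_injective_0[OF matrix_vector_mul_linear] by blast
    then show ?thesis
      using invertible_det_nz[of "A p"] matrix_left_invertible_injective[of "A p"] invertible_left_inverse by blast
  qed
  define S' where "S' = {w\<in>S. det (A w) \<noteq> 0}"
  have oS': "open S'"
  proof -
    have "open (S \<inter> (\<lambda>w. det (A w)) -` (- {0}))"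
      by (rule continuous_open_preimage[OF smooth_on_continuous_on[OF sdet] S(1)]) auto
    then show ?thesis by (simp add: S'_def vimage_def Int_def)
  qed
  have sub: "S' \<subseteq> S" by (auto simp: S'_def)
  define C :: "'i \<Rightarrow> 'i \<Rightarrow> 'a \<Rightarrow> real^'i^'i" where
    "C i j w = (\<chi> k l. if l = j then axis i 1 $ k else A w $ k $ l)" for i j w
  define g where "g i j w = det (C i j w) / det (A w)" for i j w
  have g: "A w *v (\<chi> j. g i j w) = axis i 1" if "w \<in> S'" for i w
    using cramer[of "A w" "\<chi> j. g i j w" "axis i 1"] that by (simp add: S'_def g_def C_def)
  show ?thesis
  proof (rule that[of S' g])
    show "open S'" "p \<in> S'" "S' \<subseteq> S" using oS' sub \<open>det (A p) \<noteq> 0\<close> S by (auto simp: S'_def)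
    show "smooth_on S' (g i j)" for i j
    proof -
      have "smooth_on S' (\<lambda>w. C i j w $ k $ l)" for k l
      proof (cases "l = j")
        case True
        then show ?thesis by (simp add: C_def smooth_on_const)
      next
        case False
        then show ?thesis using smooth_on_subset[OF sA sub] by (simp add: C_def)
      qed
      then have "smooth_on S' (\<lambda>w. det (C i j w))" by (rule smooth_on_det[OF oS'])
      then show ?thesis unfolding g_def
        by (rule smooth_on_divide[OF oS' _ smooth_on_subset[OF sdet sub]]) (simp add: S'_def)
    qed
    fix w assume w: "w \<in> S'"
    show 1: "(\<Sum>j\<in>UNIV. g i j w *\<^sub>R FD \<tau> w (R j w)) = axis i 1" for i
      using g[OF w, of i] unfolding Av by simp
    let ?B = "\<chi> j i. g i j w"
    have "A w ** ?B = mat 1"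
    proof (rule matrix_eq[THEN iffD2], rule allI)
      have "(A w ** ?B) $ k $ i = mat 1 $ k $ i" for k i
        using arg_cong[OF g[OF w, of i], of "\<lambda>v. v $ k"]
        by (simp add: matrix_matrix_mult_def matrix_vector_mult_def mat_def axis_def)
      then have "A w ** ?B = mat 1" by (simp add: vec_eq_iff)
      then show "(A w ** ?B) *v x = mat 1 *v x" for x by simp
    qed
    then have "?B ** A w = mat 1" by (rule matrix_left_right_inverse[THEN iffD1])
    then have "(?B ** A w) $ k $ i = mat 1 $ k $ i" for i k by simp
    then show "(\<Sum>j\<in>UNIV. FD \<tau> w (R i w) $ j * g j k w) = (if i = k then 1 else 0)" for i k
      by (simp add: matrix_matrix_mult_def mat_def A_def mult.commute eq_commute[of i])
  qed
qed

lemma FD_combination: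
  fixes R :: "'i::finite \<Rightarrow> 'a::euclidean_space \<Rightarrow> 'a"
  assumes "\<And>j. R j differentiable (at w)" "\<And>j. g j differentiable (at w)"
  shows "FD (\<lambda>w. \<Sum>j\<in>UNIV. g j w *\<^sub>R R j w) w v = (\<Sum>j\<in>UNIV. g j w *\<^sub>R FD (R j) w v + FD (g j) w v *\<^sub>R R j w)"
proof -
  have "((\<lambda>w. \<Sum>j\<in>UNIV. g j w *\<^sub>R R j w) has_derivative (\<lambda>v. \<Sum>j\<in>UNIV. g j w *\<^sub>R FD (R j) w v + FD (g j) w v *\<^sub>R R j w)) (at w)"
    by (rule has_derivative_sum, rule has_derivative_scaleR) (rule has_derivative_FD assms)+
  from FD_eq[OF this] show ?thesis by simp
qed

lemma span_range_sum:
  fixes f :: "'i::finite \<Rightarrow> 'a::real_vector"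
  assumes "x \<in> span (range f)"
  obtains b where "x = (\<Sum>k\<in>UNIV. b k *\<^sub>R f k)"
proof -
  have "subspace (range (\<lambda>b. \<Sum>k\<in>UNIV. b k *\<^sub>R f k))"
  proof (rule subspaceI)
    show "0 \<in> range (\<lambda>b. \<Sum>k\<in>UNIV. b k *\<^sub>R f k)" by (rule range_eqI[of _ _ "\<lambda>_. 0"]) simp
    fix x y c assume "x \<in> range (\<lambda>b. \<Sum>k\<in>UNIV. b k *\<^sub>R f k)" "y \<in> range (\<lambda>b. \<Sum>k\<in>UNIV. b k *\<^sub>R f k)"
    then obtain a b where ab: "x = (\<Sum>k\<in>UNIV. a k *\<^sub>R f k)" "y = (\<Sum>k\<in>UNIV. b k *\<^sub>R f k)" by blast
    show "x + y \<in> range (\<lambda>b. \<Sum>k\<in>UNIV. b k *\<^sub>R f k)"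
      by (rule range_eqI[of _ _ "\<lambda>k. a k + b k"]) (simp add: ab scaleR_add_left sum.distrib)
    show "c *\<^sub>R x \<in> range (\<lambda>b. \<Sum>k\<in>UNIV. b k *\<^sub>R f k)"
      by (rule range_eqI[of _ _ "\<lambda>k. c * a k"]) (simp add: ab scaleR_sum_right)
  qed
  moreover have "f i \<in> range (\<lambda>b. \<Sum>k\<in>UNIV. b k *\<^sub>R f k)" for i
    by (rule range_eqI[of _ _ "\<lambda>k. axis i 1 $ k"]) (simp add: sum_axis_scaleR)
  ultimately have "span (range f) \<subseteq> range (\<lambda>b. \<Sum>k\<in>UNIV. b k *\<^sub>R f k)" by (intro span_minimal) auto
  then show ?thesis using assms that by blast
qed

text \<open>By involutivity the bracket of two normalised fields is again a combination of the
  \<open>X k\<close>. Its coefficients are read off by applying it to \<open>\<tau>\<close>, and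
  they vanish because every \<open>X i\<close> differentiates \<open>\<tau>\<close> to a constant
  vector.\<close>

lemma normalized_frame_commutes:
  fixes R :: "'i::finite \<Rightarrow> 'a::euclidean_space \<Rightarrow> 'a" and \<tau> :: "'a \<Rightarrow> real^'i"
  assumes S: "open S" "w \<in> S" and R: "\<And>i. smooth_on S (R i)" and \<tau>: "smooth_on S \<tau>" and g: "\<And>i j. smooth_on S (g i j)"
    and inv: "\<And>i j. bracket (R i) (R j) w \<in> span (range (\<lambda>k. R k w))"
    and X: "\<And>i. X i = (\<lambda>w. \<Sum>j\<in>UNIV. g i j w *\<^sub>R R j w)"
    and tauX: "\<And>i w. w \<in> S \<Longrightarrow> FD \<tau> w (X i w) = axis i 1"
    and RX: "\<And>i. R i w \<in> span (range (\<lambda>k. X k w))"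
  shows "FD (X j) w (X i w) = FD (X i) w (X j w)"
proof -
  have Rd: "R i differentiable (at w)" and gd: "g i j differentiable (at w)" for i j
    using smooth_on_differentiable[OF R S(2)] smooth_on_differentiable[OF g S(2)] by auto
  have sX: "smooth_on S (X i)" for i unfolding X
    by (rule smooth_on_sum[OF S(1)]) (rule smooth_on_scaleR[OF S(1) g R])
  let ?V = "span (range (\<lambda>k. R k w))"
  have lin: "FD (R l) w (\<Sum>k\<in>UNIV. g i k w *\<^sub>R R k w) = (\<Sum>k\<in>UNIV. g i k w *\<^sub>R FD (R l) w (R k w))" for i l
    by (simp add: linear_sum[OF linear_FD[OF Rd[of l]]] linear_scale[OF linear_FD[OF Rd[of l]]])
  have D: "FD (X j) w (X i w) = (\<Sum>l\<in>UNIV. \<Sum>k\<in>UNIV. (g j l w * g i k w) *\<^sub>R FD (R l) w (R k w)) + (\<Sum>l\<in>UNIV. FD (g j l) w (X i w) *\<^sub>R R l w)" for i j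
  proof -
    have "FD (X j) w (X i w) = (\<Sum>l\<in>UNIV. g j l w *\<^sub>R FD (R l) w (X i w) + FD (g j l) w (X i w) *\<^sub>R R l w)"
      unfolding X[of j] by (rule FD_combination[OF Rd gd])
    also have "\<dots> = (\<Sum>l\<in>UNIV. g j l w *\<^sub>R FD (R l) w (X i w)) + (\<Sum>l\<in>UNIV. FD (g j l) w (X i w) *\<^sub>R R l w)"
      by (rule sum.distrib)
    also have "(\<Sum>l\<in>UNIV. g j l w *\<^sub>R FD (R l) w (X i w)) = (\<Sum>l\<in>UNIV. \<Sum>k\<in>UNIV. (g j l w * g i k w) *\<^sub>R FD (R l) w (R k w))"
      unfolding X[of i] lin scaleR_sum_right by simp
    finally show ?thesis .
  qed
  have swap: "(\<Sum>l\<in>UNIV. \<Sum>k\<in>UNIV. (g i l w * g j k w) *\<^sub>R FD (R l) w (R k w)) =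
      (\<Sum>l\<in>UNIV. \<Sum>k\<in>UNIV. (g j l w * g i k w) *\<^sub>R FD (R k) w (R l w))"
    by (subst sum.swap) (simp add: mult.commute)
  have "bracket (X i) (X j) w = (\<Sum>l\<in>UNIV. \<Sum>k\<in>UNIV. (g j l w * g i k w) *\<^sub>R bracket (R k) (R l) w)
      + (\<Sum>l\<in>UNIV. FD (g j l) w (X i w) *\<^sub>R R l w) - (\<Sum>l\<in>UNIV. FD (g i l) w (X j w) *\<^sub>R R l w)"
    unfolding bracket_def[of "X i"] D swap by (simp add: bracket_def sum_subtractf scaleR_diff_right)
  also have "\<dots> \<in> ?V"
    by (intro span_add span_diff span_sum span_scale inv) (auto intro: span_base)
  also have "?V \<subseteq> span (range (\<lambda>k. X k w))"
    by (rule span_minimal) (use RX in auto)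
  finally have "bracket (X i) (X j) w \<in> span (range (\<lambda>k. X k w))" .
  then obtain b where b: "bracket (X i) (X j) w = (\<Sum>k\<in>UNIV. b k *\<^sub>R X k w)"
    by (rule span_range_sum)
  have "FD \<tau> w (bracket (X i) (X j) w) = FD (\<lambda>y. FD \<tau> y (X j y)) w (X i w) - FD (\<lambda>y. FD \<tau> y (X i y)) w (X j w)"
    by (rule FD_bracket[OF S \<tau> sX sX, symmetric])
  also have "\<dots> = 0"
  proof -
    have "FD (\<lambda>y. FD \<tau> y (X i y)) w = FD (\<lambda>y. axis i 1) w" for i
      by (rule FD_cong_open[OF S]) (rule tauX)
    then show ?thesis by simp
  qed
  finally have "FD \<tau> w (\<Sum>k\<in>UNIV. b k *\<^sub>R X k w) = 0" unfolding b .
  then have "(\<Sum>k\<in>UNIV. b k *\<^sub>R axis k 1 :: real^'i) = 0"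
    by (simp add: linear_sum[OF linear_FD[OF smooth_on_differentiable[OF \<tau> S(2)]]]
      linear_scale[OF linear_FD[OF smooth_on_differentiable[OF \<tau> S(2)]]] tauX[OF S(2)])
  then have "b k = 0" for k
    by (simp add: vec_eq_iff axis_def if_distrib cong: if_cong)
  then have "bracket (X i) (X j) w = 0" unfolding b by simp
  then show ?thesis by (simp add: bracket_def)
qed

lemma sum_scaleR_axis: "(\<Sum>k\<in>UNIV. t $ k *\<^sub>R (axis k 1 :: real^'i)) = t"
  by (simp add: vec_eq_iff axis_def if_distrib cong: if_cong)

section \<open>Existence and uniqueness for linear systems along a frame\<close>

lemma linear_bounded_on_cball:
  fixes f :: "'a::euclidean_space \<Rightarrow> 'b::euclidean_space \<Rightarrow> 'c::real_normed_vector"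
  assumes cont: "continuous_on (cball p \<rho> \<times> UNIV) (\<lambda>q. f (fst q) (snd q))" and lin: "\<And>u. u \<in> cball p \<rho> \<Longrightarrow> linear (f u)"
  obtains K where "K > 0" "\<And>u y. u \<in> cball p \<rho> \<Longrightarrow> norm (f u y) \<le> K * norm y"
proof -
  have "compact ((\<lambda>q. f (fst q) (snd q)) ` (cball p \<rho> \<times> cball 0 1))"
    by (rule compact_continuous_image[OF continuous_on_subset[OF cont]]) (auto intro: compact_Times)
  then obtain K where K: "K > 0" "\<And>q. q \<in> cball p \<rho> \<times> cball 0 1 \<Longrightarrow> norm (f (fst q) (snd q)) \<le> K"
    using compact_imp_bounded[of "(\<lambda>q. f (fst q) (snd q)) ` (cball p \<rho> \<times> cball 0 1)"] unfolding bounded_pos by auto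
  have "norm (f u y) \<le> K * norm y" if u: "u \<in> cball p \<rho>" for u y
  proof (cases "y = 0")
    case True
    then show ?thesis using linear_0[OF lin[OF u]] by simp
  next
    case False
    have "f u y = norm y *\<^sub>R f u ((1 / norm y) *\<^sub>R y)"
      using False by (simp add: linear_scale[OF lin[OF u], symmetric])
    then have "norm (f u y) = norm y * norm (f u ((1 / norm y) *\<^sub>R y))" by simp
    also have "\<dots> \<le> norm y * K"
      using K(2)[of "(u, (1 / norm y) *\<^sub>R y)"] u False by (intro mult_left_mono) auto
    finally show ?thesis by (simp add: mult.commute)
  qed
  with K(1) show ?thesis using that by blast
qed

text \<open>A solution is a map whose graph is tangent to the lifted fields \<open>R i\<close>. The
  graph is swept out from the data over the zero set of \<open>\<tau>\<close> by the commuting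
  normalised lifts. The normalised base fields raise the components of \<open>\<tau>\<close> at unit
  speed, so the value \<open>\<tau> u\<close> is precisely the time needed to reach \<open>u\<close>
  from the zero set.\<close>

theorem linear_system_along_frame:
  fixes r :: "'i::finite \<Rightarrow> 'a::euclidean_space \<Rightarrow> 'a" and B :: "'i \<Rightarrow> 'a \<Rightarrow> 'b::euclidean_space \<Rightarrow> 'b"
    and \<tau> :: "'a \<Rightarrow> real^'i"
  defines "R \<equiv> \<lambda>i q. (r i (fst q), B i (fst q) (snd q))"
  assumes S: "open S" "p \<in> S" and r: "\<And>i. smooth_on S (r i)" and \<tau>: "smooth_on S \<tau>" "\<tau> p = 0"
    and inj: "\<And>a :: real^'i. (\<Sum>i\<in>UNIV. a $ i *\<^sub>R FD \<tau> p (r i p)) = 0 \<Longrightarrow> a = 0"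
    and B: "\<And>i. smooth_on (S \<times> UNIV) (\<lambda>q. B i (fst q) (snd q))" "\<And>i u. u \<in> S \<Longrightarrow> linear (B i u)"
    and inv: "\<And>i j q. q \<in> S \<times> UNIV \<Longrightarrow> bracket (R i) (R j) q \<in> span (range (\<lambda>k. R k q))"
  shows linear_system_exists: "smooth_on S h \<Longrightarrow> \<exists>W y. open W \<and> p \<in> W \<and> W \<subseteq> S \<and> smooth_on W y \<and>
      (\<forall>u\<in>W. \<forall>i. FD y u (r i u) = B i u (y u)) \<and> (\<forall>u\<in>W. \<tau> u = 0 \<longrightarrow> y u = h u)"
    and linear_system_unique: "open W \<Longrightarrow> p \<in> W \<Longrightarrow> W \<subseteq> S \<Longrightarrow> smooth_on W y \<Longrightarrow>
      (\<And>u i. u \<in> W \<Longrightarrow> FD y u (r i u) = B i u (y u)) \<Longrightarrow> (\<And>u. u \<in> W \<Longrightarrow> \<tau> u = 0 \<Longrightarrow> y u = 0) \<Longrightarrow>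
      \<forall>\<^sub>F u in nhds p. y u = 0"
proof -
  \<comment> \<open>Existence and uniqueness are proved together because both use the same
    normalised frame and the same flow \<open>G\<close>.\<close>
  have main: "(\<forall>h. smooth_on S h \<longrightarrow> (\<exists>W y. open W \<and> p \<in> W \<and> W \<subseteq> S \<and> smooth_on W y \<and>
      (\<forall>u\<in>W. \<forall>i. FD y u (r i u) = B i u (y u)) \<and> (\<forall>u\<in>W. \<tau> u = 0 \<longrightarrow> y u = h u))) \<and>
    (\<forall>W y. open W \<longrightarrow> p \<in> W \<longrightarrow> W \<subseteq> S \<longrightarrow> smooth_on W y \<longrightarrow> (\<forall>u\<in>W. \<forall>i. FD y u (r i u) = B i u (y u)) \<longrightarrow>
      (\<forall>u\<in>W. \<tau> u = 0 \<longrightarrow> y u = 0) \<longrightarrow> (\<forall>\<^sub>F u in nhds p. y u = 0))"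
  proof (rule dual_frame[OF S r \<tau>(1) inj])
    fix S1 g
    assume S1: "open S1" "p \<in> S1" "S1 \<subseteq> S" and sg: "\<And>i j. smooth_on S1 (g i j)"
      and g1: "\<And>i w. w \<in> S1 \<Longrightarrow> (\<Sum>j\<in>UNIV. g i j w *\<^sub>R FD \<tau> w (r j w)) = axis i 1"
      and g2: "\<And>i k w. w \<in> S1 \<Longrightarrow> (\<Sum>j\<in>UNIV. FD \<tau> w (r i w) $ j * g j k w) = (if i = k then 1 else 0)"
    obtain \<rho> where rho: "\<rho> > 0" "cball p \<rho> \<subseteq> S1" using open_contains_cball[of S1] S1 by blast
    \<comment> \<open>The base and fibre parts of the normalised lifts: the fields
      \<open>r j\<close> and the right-hand sides \<open>B j\<close> are combined with the same
      coefficients.\<close>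
    define \<xi> where "\<xi> i u = (\<Sum>j\<in>UNIV. g i j u *\<^sub>R r j u)" for i u
    define \<beta> where "\<beta> i u y = (\<Sum>j\<in>UNIV. g i j u *\<^sub>R B j u y)" for i u y
    have dtau: "\<tau> differentiable (at u)" if "u \<in> S1" for u
      using smooth_on_differentiable[OF \<tau>(1)] S1(3) that by blast
    have s\<xi>: "smooth_on S1 (\<xi> i)" for i unfolding \<xi>_def[abs_def]
      by (rule smooth_on_sum[OF S1(1)]) (rule smooth_on_scaleR[OF S1(1) sg smooth_on_subset[OF r S1(3)]])
    have tau\<xi>: "FD \<tau> u (\<xi> i u) = axis i 1" if "u \<in> S1" for u i
      using g1[OF that, of i] by (simp add: \<xi>_def linear_sum[OF linear_FD[OF dtau[OF that]]] linear_scale[OF linear_FD[OF dtau[OF that]]])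
    have recombine: "(\<Sum>j\<in>UNIV. FD \<tau> u (r i u) $ j *\<^sub>R (\<Sum>k\<in>UNIV. g j k u *\<^sub>R z k)) = z i"
      if "u \<in> S1" for u i and z :: "'i \<Rightarrow> 'z::real_vector"
    proof -
      have "(\<Sum>j\<in>UNIV. FD \<tau> u (r i u) $ j *\<^sub>R (\<Sum>k\<in>UNIV. g j k u *\<^sub>R z k))
          = (\<Sum>k\<in>UNIV. (\<Sum>j\<in>UNIV. FD \<tau> u (r i u) $ j * g j k u) *\<^sub>R z k)"
        by (simp add: scaleR_sum_right scaleR_sum_left) (rule sum.swap)
      also have "\<dots> = (\<Sum>k\<in>UNIV. if k = i then z k else 0)"
        by (rule sum.cong) (simp_all add: g2[OF that])
      finally show ?thesis by simp
    qed
    have "\<exists>K. \<forall>u\<in>cball p \<rho>. \<forall>v\<in>cball p \<rho>. norm (\<xi> i v - \<xi> i u) \<le> K * norm (v - u)" for i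
      by (rule smooth_on_FD_bounded_cball[OF S1(1) rho(2) s\<xi>[of i]]) blast
    then obtain K where K: "\<And>i u v. u \<in> cball p \<rho> \<Longrightarrow> v \<in> cball p \<rho> \<Longrightarrow> norm (\<xi> i v - \<xi> i u) \<le> K i * norm (v - u)"
      by metis
    \<comment> \<open>A ball with closure inside \<open>S1\<close>, on which the Lipschitz constants
      \<open>K\<close> of the base fields are valid.\<close>
    define S2 where "S2 = ball p \<rho>"
    have S2: "open S2" "p \<in> S2" "S2 \<subseteq> cball p \<rho>" using rho by (auto simp: S2_def)
    then have S2': "S2 \<subseteq> S1" "S2 \<subseteq> S" using rho S1 by blast+
    note S2 = S2 S2'
    define Sh where "Sh = S2 \<times> (UNIV :: 'b set)"
    have oSh: "open Sh" and Sh_S: "Sh \<subseteq> S \<times> UNIV" and fstSh: "\<And>q. q \<in> Sh \<Longrightarrow> fst q \<in> S1" "\<And>q. q \<in> Sh \<Longrightarrow> fst q \<in> S2"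
      using S2 by (auto simp: Sh_def open_Times)
    define Xh where "Xh i q = (\<Sum>j\<in>UNIV. g i j (fst q) *\<^sub>R R j q)" for i q
    have Xh: "Xh i q = (\<xi> i (fst q), \<beta> i (fst q) (snd q))" for i q
      by (simp add: Xh_def \<xi>_def \<beta>_def R_def prod_eq_iff fst_sum snd_sum)
    have sfst: "smooth_on Sh fst" by (rule smooth_on_bounded_linear[OF bounded_linear_fst oSh])
    have sR: "smooth_on Sh (R i)" for i unfolding R_def
      by (rule smooth_on_Pair[OF oSh smooth_on_compose[OF oSh S(1) r sfst] smooth_on_subset[OF B(1) Sh_S]])
        (use Sh_S in auto)
    have sg': "smooth_on Sh (\<lambda>q. g i j (fst q))" for i j
      by (rule smooth_on_compose[OF oSh S1(1) sg sfst]) (use fstSh in auto)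
    have sXh: "smooth_on Sh (Xh i)" for i unfolding Xh_def[abs_def]
      by (rule smooth_on_sum[OF oSh]) (rule smooth_on_scaleR[OF oSh sg' sR])
    have stau: "smooth_on Sh (\<lambda>q. \<tau> (fst q))"
      by (rule smooth_on_compose[OF oSh S(1) \<tau>(1) sfst]) (use Sh_S in auto)
    have tauXh: "FD (\<lambda>q. \<tau> (fst q)) q (Xh i q) = axis i 1" if q: "q \<in> Sh" for q i
    proof -
      have "FD (\<lambda>q. \<tau> (fst q)) q = (\<lambda>v. FD \<tau> (fst q) (fst v))"
        by (rule FD_eq[OF FD_compose_eq[OF bounded_linear_imp_has_derivative[OF bounded_linear_fst] dtau[OF fstSh(1)[OF q]]]])
      then show ?thesis by (simp add: Xh tau\<xi>[OF fstSh(1)[OF q]])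
    qed
    have RX: "R i q \<in> span (range (\<lambda>k. Xh k q))" if q: "q \<in> Sh" for i q
    proof -
      have "R i q = (\<Sum>j\<in>UNIV. FD \<tau> (fst q) (r i (fst q)) $ j *\<^sub>R Xh j q)"
        using recombine[OF fstSh(1)[OF q], of i "\<lambda>k. R k q"] by (simp add: Xh_def)
      then show ?thesis by (simp add: span_sum span_scale span_base)
    qed
    have comm: "FD (Xh j) q (Xh i q) = FD (Xh i) q (Xh j q)" if q: "q \<in> Sh" for i j q
      by (rule normalized_frame_commutes[where g="\<lambda>i j q. g i j (fst q)" and R=R and \<tau>="\<lambda>q. \<tau> (fst q)" and X=Xh and S=Sh,
            OF oSh q sR stau sg' inv _ tauXh RX[OF q]])
        (use q Sh_S in \<open>auto simp: Xh_def[abs_def]\<close>)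
    have pSh: "(p, 0) \<in> Sh" using S2 by (simp add: Sh_def)
    have lin\<beta>: "linear (\<beta> i u)" if "u \<in> S1" for i u
      unfolding \<beta>_def[abs_def] by (rule linear_compose_sum, intro ballI, rule linear_compose_scale_right) (use B(2) S1(3) that in auto)
    show ?thesis
    proof (rule commuting_flows[OF oSh sXh pSh comm])
      fix e U and G :: "real^'i \<Rightarrow> 'a \<times> 'b \<Rightarrow> 'a \<times> 'b"
      assume e: "e > 0" and U: "open U" "(p, 0) \<in> U" and sG: "smooth_on (ball 0 e \<times> U) (\<lambda>q. G (fst q) (snd q))"
        and GSh: "\<And>t w. t \<in> ball 0 e \<Longrightarrow> w \<in> U \<Longrightarrow> G t w \<in> Sh" and G0: "\<And>w. w \<in> U \<Longrightarrow> G 0 w = w"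
        and Gt: "\<And>t w i. t \<in> ball 0 e \<Longrightarrow> w \<in> U \<Longrightarrow> FD (\<lambda>q. G (fst q) (snd q)) (t, w) (axis i 1, 0) = Xh i (G t w)"
        and Gw: "\<And>t w i. t \<in> ball 0 e \<Longrightarrow> w \<in> U \<Longrightarrow> FD (\<lambda>q. G (fst q) (snd q)) (t, w) (0, Xh i w) = Xh i (G t w)"
      let ?G = "\<lambda>q. G (fst q) (snd q)"
      have dG: "?G differentiable (at (t, w))" if "t \<in> ball 0 e" "w \<in> U" for t w
        using smooth_on_differentiable[OF sG] that by auto
      have oD: "open (ball (0 :: real^'i) e \<times> U)" using U by (simp add: open_Times)
      \<comment> \<open>The base component of the flow obeys an equation that does not involve the
        fibre. The shift \<open>c\<close> is 0 for a curve starting at \<open>w\<close> and -1 for a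
        curve arriving at \<open>w\<close> at time 1.\<close>
      have curve: "((\<lambda>s. fst (G ((s + c) *\<^sub>R t) w)) has_vector_derivative (\<Sum>k\<in>UNIV. t $ k *\<^sub>R \<xi> k (fst (G ((s + c) *\<^sub>R t) w)))) (at s)"
        if st: "(s + c) *\<^sub>R t \<in> ball 0 e" and w: "w \<in> U" for s c t w
      proof -
        have lin: "linear (FD ?G ((s + c) *\<^sub>R t, w))" by (rule linear_FD[OF dG[OF st w]])
        have "(t, 0) = (\<Sum>k\<in>UNIV. t $ k *\<^sub>R (axis k 1 :: real^'i, 0 :: 'a \<times> 'b))"
          by (simp add: prod_eq_iff fst_sum snd_sum sum_scaleR_axis)
        then have "FD ?G ((s + c) *\<^sub>R t, w) (t, 0) = (\<Sum>k\<in>UNIV. t $ k *\<^sub>R Xh k (G ((s + c) *\<^sub>R t) w))"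
          by (simp only: linear_sum[OF lin] linear_scale[OF lin] Gt[OF st w])
        moreover have "((\<lambda>s. ((s + c) *\<^sub>R t, w)) has_vector_derivative (t, 0)) (at s)"
          by (auto intro!: derivative_eq_intros has_vector_derivative_Pair)
        ultimately have "((\<lambda>s. G ((s + c) *\<^sub>R t) w) has_vector_derivative (\<Sum>k\<in>UNIV. t $ k *\<^sub>R Xh k (G ((s + c) *\<^sub>R t) w))) (at s)"
          using has_vector_derivative_FD_compose[of "\<lambda>s. ((s + c) *\<^sub>R t, w)" "(t, 0)" s ?G] dG[OF st w] by simp
        from bounded_linear.has_vector_derivative[OF bounded_linear_fst this]
        show ?thesis by (simp add: fst_sum Xh)
      qed
      have seg: "s *\<^sub>R t \<in> ball 0 e" if "t \<in> ball 0 e" "\<bar>s\<bar> \<le> 1" for s and t :: "real^'i"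
      proof -
        have "\<bar>s\<bar> * norm t \<le> 1 * norm t" using that by (intro mult_right_mono) auto
        then show ?thesis using that by simp
      qed
      have tauG: "\<tau> (fst (G t w)) = \<tau> (fst w) + t" if t: "t \<in> ball 0 e" and w: "w \<in> U" for t w
      proof -
        let ?f = "\<lambda>s. \<tau> (fst (G ((s + 0) *\<^sub>R t) w)) - \<tau> (fst w) - s *\<^sub>R t"
        have "?f 1 = 0"
        proof (rule gronwall_zero[where f="?f" and f'="\<lambda>_. 0" and C=0])
          fix s :: real assume s: "0 \<le> s" "s \<le> 1"
          have st: "(s + 0) *\<^sub>R t \<in> ball 0 e" using seg[OF t, of s] s by simp
          have S1': "fst (G ((s + 0) *\<^sub>R t) w) \<in> S1" using fstSh(1)[OF GSh[OF st w]] .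
          have "((\<lambda>s. \<tau> (fst (G ((s + 0) *\<^sub>R t) w))) has_vector_derivative t) (at s)"
            using has_vector_derivative_FD_compose[OF curve[OF st w] dtau[OF S1']]
            by (simp only: linear_sum[OF linear_FD[OF dtau[OF S1']]] linear_scale[OF linear_FD[OF dtau[OF S1']]] tau\<xi>[OF S1'] sum_scaleR_axis)
          then have "(?f has_vector_derivative t - 0 - t) (at s)"
            by (intro has_vector_derivative_diff) (auto intro!: derivative_eq_intros)
          then show "(?f has_vector_derivative 0) (at s)" by simp
        qed (use G0[OF w] in simp_all)
        then show ?thesis by (simp add: algebra_simps)
      qed
      have unique: "\<gamma> 1 = \<gamma>' 1"
        if "\<gamma> 0 = \<gamma>' 0" and "\<And>s. 0 \<le> s \<Longrightarrow> s \<le> 1 \<Longrightarrow> \<gamma> s \<in> S2" "\<And>s. 0 \<le> s \<Longrightarrow> s \<le> 1 \<Longrightarrow> \<gamma>' s \<in> S2"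
          and "\<And>s. 0 \<le> s \<Longrightarrow> s \<le> 1 \<Longrightarrow> (\<gamma> has_vector_derivative (\<Sum>k\<in>UNIV. t $ k *\<^sub>R \<xi> k (\<gamma> s))) (at s)"
            "\<And>s. 0 \<le> s \<Longrightarrow> s \<le> 1 \<Longrightarrow> (\<gamma>' has_vector_derivative (\<Sum>k\<in>UNIV. t $ k *\<^sub>R \<xi> k (\<gamma>' s))) (at s)"
        for \<gamma> \<gamma>' :: "real \<Rightarrow> 'a" and t
      proof -
        have "(\<lambda>s. \<gamma> s - \<gamma>' s) 1 = 0"
        proof (rule gronwall_zero[where C="\<Sum>k\<in>UNIV. \<bar>t $ k\<bar> * K k"])
          fix s :: real assume s: "0 \<le> s" "s \<le> 1"
          show "((\<lambda>s. \<gamma> s - \<gamma>' s) has_vector_derivative (\<Sum>k\<in>UNIV. t $ k *\<^sub>R \<xi> k (\<gamma> s)) - (\<Sum>k\<in>UNIV. t $ k *\<^sub>R \<xi> k (\<gamma>' s))) (at s)"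
            by (intro has_vector_derivative_diff that s)
          have c: "\<gamma> s \<in> cball p \<rho>" "\<gamma>' s \<in> cball p \<rho>" using that(2,3)[OF s] S2(3) by blast+
          have "norm ((\<Sum>k\<in>UNIV. t $ k *\<^sub>R \<xi> k (\<gamma> s)) - (\<Sum>k\<in>UNIV. t $ k *\<^sub>R \<xi> k (\<gamma>' s))) = norm (\<Sum>k\<in>UNIV. t $ k *\<^sub>R (\<xi> k (\<gamma> s) - \<xi> k (\<gamma>' s)))"
            by (simp add: sum_subtractf scaleR_diff_right)
          also have "\<dots> \<le> (\<Sum>k\<in>UNIV. \<bar>t $ k\<bar> * (K k * norm (\<gamma> s - \<gamma>' s)))"
            by (rule order_trans[OF norm_sum], rule sum_mono) (simp add: mult_left_mono K[OF c(2) c(1)])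
          finally show "norm ((\<Sum>k\<in>UNIV. t $ k *\<^sub>R \<xi> k (\<gamma> s)) - (\<Sum>k\<in>UNIV. t $ k *\<^sub>R \<xi> k (\<gamma>' s))) \<le> (\<Sum>k\<in>UNIV. \<bar>t $ k\<bar> * K k) * norm (\<gamma> s - \<gamma>' s)"
            by (simp add: sum_distrib_right mult.assoc)
        qed (use that in simp)
        then show ?thesis by simp
      qed
      obtain V \<rho>1 where V: "open V" "p \<in> V" "V \<subseteq> S2" and rho1: "\<rho>1 > 0" and VU: "V \<times> ball 0 \<rho>1 \<subseteq> U"
      proof (rule open_prod_elim[OF U])
        fix V B assume VB: "open V" "open B" "(p, 0) \<in> V \<times> B" "V \<times> B \<subseteq> U"
        then obtain d where d: "d > 0" "ball 0 d \<subseteq> B" using openE[of B 0] by auto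
        show thesis by (rule that[of "V \<inter> S2" d]) (use VB d S2 in auto)
      qed
      define U1 where "U1 = {u\<in>V. \<tau> u \<in> ball 0 e}"
      have contau: "continuous_on V \<tau>"
        using smooth_on_continuous_on[OF smooth_on_subset[OF \<tau>(1)]] V S2 by blast
      have oU1: "open U1"
      proof -
        have "open (V \<inter> \<tau> -` ball 0 e)" by (rule continuous_open_preimage[OF contau V(1)]) simp
        then show ?thesis by (simp add: U1_def vimage_def Int_def)
      qed
      have U1: "U1 \<subseteq> V" "p \<in> U1" "U1 \<subseteq> S" using \<tau>(2) e V S2 by (auto simp: U1_def)
      have mt: "- \<tau> u \<in> ball 0 e" "\<tau> u \<in> ball 0 e" if "u \<in> U1" for u using that by (auto simp: U1_def)
      have u0U: "(u, 0) \<in> U" if "u \<in> V" for u using VU rho1 that by auto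
      \<comment> \<open>Flowing back by \<open>\<tau> u\<close> lands on the zero set of
        \<open>\<tau>\<close>. The fibre coordinate 0 is chosen because the zero section lies in the
        domain of \<open>G\<close> and is invariant, the right-hand sides being linear.\<close>
      define \<pi> where "\<pi> u = fst (G (- \<tau> u) (u, 0))" for u
      have s\<tau>U1: "smooth_on U1 \<tau>" by (rule smooth_on_subset[OF \<tau>(1) U1(3)])
      have s\<pi>: "smooth_on U1 \<pi>"
      proof -
        have "smooth_on U1 (\<lambda>u. ?G (- \<tau> u, (u, 0)))"
          by (rule smooth_on_compose[OF oU1 oD sG smooth_on_Pair[OF oU1 smooth_on_minus[OF oU1 s\<tau>U1]
                smooth_on_Pair[OF oU1 smooth_on_ident[OF oU1] smooth_on_const]]])
            (use mt u0U U1 in auto)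
        from smooth_on_fst[OF oU1 this] show ?thesis by (simp add: \<pi>_def[abs_def])
      qed
      have \<pi>S2: "\<pi> u \<in> S2" if "u \<in> U1" for u
        unfolding \<pi>_def by (rule fstSh(2)[OF GSh[OF mt(1)[OF that] u0U]]) (use that U1 in auto)
      have tau\<pi>: "\<tau> (\<pi> u) = 0" if "u \<in> U1" for u
        using tauG[OF mt(1)[OF that] u0U] that U1 by (auto simp: \<pi>_def)
      \<comment> \<open>Moving \<open>u\<close> along \<open>\<xi> i\<close> lengthens the backward
        time by the same amount, and the two effects cancel; thus \<open>\<pi>\<close> is constant
        along the frame.\<close>
      have d\<pi>: "FD \<pi> u (\<xi> i u) = 0" if u: "u \<in> U1" for u i
      proof -
        have uV: "u \<in> V" and uS1: "u \<in> S1" using u U1 V S2 by auto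
        have "((\<lambda>u. (- \<tau> u, (u, 0 :: 'b))) has_derivative (\<lambda>v. (- FD \<tau> u v, (v, 0)))) (at u)"
          by (intro has_derivative_Pair has_derivative_minus has_derivative_FD dtau uS1 has_derivative_ident has_derivative_const)
        from has_derivative_fst[OF FD_compose_eq[OF this dG[OF mt(1)[OF u] u0U[OF uV]]]]
        have "(\<pi> has_derivative (\<lambda>v. fst (FD ?G (- \<tau> u, (u, 0)) (- FD \<tau> u v, (v, 0))))) (at u)"
          by (simp add: \<pi>_def[abs_def])
        then have "FD \<pi> u (\<xi> i u) = fst (FD ?G (- \<tau> u, (u, 0)) (- axis i 1, (\<xi> i u, 0)))"
          by (simp add: FD_eq tau\<xi>[OF uS1])
        also have "(- axis i 1 :: real^'i, (\<xi> i u, 0 :: 'b)) = - (axis i 1, 0) + (0, Xh i (u, 0))"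
          by (simp add: Xh linear_0[OF lin\<beta>[OF uS1]])
        also have "FD ?G (- \<tau> u, (u, 0)) (- (axis i 1, 0) + (0, Xh i (u, 0))) = 0"
          by (simp only: linear_add[OF linear_FD[OF dG[OF mt(1)[OF u] u0U[OF uV]]]] linear_neg[OF linear_FD[OF dG[OF mt(1)[OF u] u0U[OF uV]]]] Gt[OF mt(1)[OF u] u0U[OF uV]] Gw[OF mt(1)[OF u] u0U[OF uV]]) simp
        finally show ?thesis by simp
      qed
      have \<pi>tau0: "\<pi> u = u" if "u \<in> U1" "\<tau> u = 0" for u
        using G0[OF u0U, of u] that U1 by (auto simp: \<pi>_def)
      \<comment> \<open>\<open>G\<close> is available only for starting points near
        \<open>(p, 0)\<close>, so the data must at first be small at \<open>p\<close>.\<close>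
      have small: "\<exists>W y. open W \<and> p \<in> W \<and> W \<subseteq> S \<and> smooth_on W y \<and>
          (\<forall>u\<in>W. \<forall>i. FD y u (r i u) = B i u (y u)) \<and> (\<forall>u\<in>W. \<tau> u = 0 \<longrightarrow> y u = h u)"
        if h: "smooth_on S h" and hp: "norm (h p) < \<rho>1" for h
      proof -
        have sh\<pi>: "smooth_on U1 (\<lambda>u. h (\<pi> u))"
          by (rule smooth_on_compose[OF oU1 S(1) h s\<pi>]) (use \<pi>S2 S2 in auto)
        define W where "W = {u\<in>U1. \<pi> u \<in> V \<and> h (\<pi> u) \<in> ball 0 \<rho>1}"
        have oW: "open W"
        proof -
          have "open (U1 \<inter> (\<lambda>u. (\<pi> u, h (\<pi> u))) -` (V \<times> ball 0 \<rho>1))"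
            by (rule continuous_open_preimage[OF continuous_on_Pair[OF smooth_on_continuous_on[OF s\<pi>] smooth_on_continuous_on[OF sh\<pi>]] oU1])
              (simp add: V open_Times)
          moreover have "U1 \<inter> (\<lambda>u. (\<pi> u, h (\<pi> u))) -` (V \<times> ball 0 \<rho>1) = W" by (auto simp: W_def)
          ultimately show ?thesis by simp
        qed
        have W: "W \<subseteq> U1" "p \<in> W" "W \<subseteq> S" using \<pi>tau0[OF U1(2) \<tau>(2)] hp V U1 by (auto simp: W_def)
        have WU: "(\<pi> u, h (\<pi> u)) \<in> U" if "u \<in> W" for u using VU that by (auto simp: W_def)
        \<comment> \<open>Project to the zero set, lift by the data there, and flow forward again.
          The fibre part of \<open>Y\<close> is the solution.\<close>
        define Y where "Y u = G (\<tau> u) (\<pi> u, h (\<pi> u))" for u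
        have inner: "smooth_on W (\<lambda>u. (\<tau> u, (\<pi> u, h (\<pi> u))))"
          by (intro smooth_on_Pair oW smooth_on_subset[OF s\<tau>U1 W(1)] smooth_on_subset[OF s\<pi> W(1)] smooth_on_subset[OF sh\<pi> W(1)])
        have sY: "smooth_on W Y"
        proof -
          have "smooth_on W (\<lambda>u. ?G (\<tau> u, (\<pi> u, h (\<pi> u))))"
            by (rule smooth_on_compose[OF oW oD sG inner]) (use WU mt W in auto)
          then show ?thesis by (simp add: Y_def[abs_def])
        qed
        have fstY: "fst (Y u) = u" if u: "u \<in> W" for u
        proof -
          have uU1: "u \<in> U1" and uV: "u \<in> V" using u W U1 by auto
          note t = mt(2)[OF uU1]
          have 1: "(s + - 1) *\<^sub>R \<tau> u \<in> ball 0 e" "(s + 0) *\<^sub>R \<tau> u \<in> ball 0 e" if "0 \<le> s" "s \<le> 1" for s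
            using seg[OF t, of "s + - 1"] seg[OF t, of "s + 0"] that by auto
          \<comment> \<open>Both base curves start at \<open>\<pi> u\<close> and solve the same
            equation, one with fibre value \<open>h (\<pi> u)\<close> and one on the zero section.
            The second arrives at \<open>u\<close>, so \<open>Y u\<close> lies over
            \<open>u\<close>.\<close>
          have "fst (G ((1 + 0) *\<^sub>R \<tau> u) (\<pi> u, h (\<pi> u))) = fst (G ((1 + - 1) *\<^sub>R \<tau> u) (u, 0))"
          proof (rule unique[of "\<lambda>s. fst (G ((s + 0) *\<^sub>R \<tau> u) (\<pi> u, h (\<pi> u)))" "\<lambda>s. fst (G ((s + - 1) *\<^sub>R \<tau> u) (u, 0))" "\<tau> u"])
            fix s :: real assume s: "0 \<le> s" "s \<le> 1"
            show "fst (G ((s + 0) *\<^sub>R \<tau> u) (\<pi> u, h (\<pi> u))) \<in> S2" by (rule fstSh(2)[OF GSh[OF 1(2)[OF s] WU[OF u]]])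
            show "fst (G ((s + - 1) *\<^sub>R \<tau> u) (u, 0)) \<in> S2" by (rule fstSh(2)[OF GSh[OF 1(1)[OF s] u0U[OF uV]]])
          next
            show "fst (G ((0 + 0) *\<^sub>R \<tau> u) (\<pi> u, h (\<pi> u))) = fst (G ((0 + - 1) *\<^sub>R \<tau> u) (u, 0))"
              using G0[OF WU[OF u]] by (simp add: \<pi>_def)
          qed (rule curve[OF 1(2) WU[OF u]] curve[OF 1(1) u0U[OF uV]]; assumption)+
          then show ?thesis using G0[OF u0U[OF uV]] by (simp add: Y_def)
        qed
        have dY: "FD Y u (\<xi> i u) = Xh i (Y u)" if u: "u \<in> W" for u i
        proof -
          have uU1: "u \<in> U1" and uS1: "u \<in> S1" using u W(1) U1(1) V(3) S2(4) by blast+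
          have d1: "((\<lambda>u. (\<tau> u, (\<pi> u, h (\<pi> u)))) has_derivative (\<lambda>v. (FD \<tau> u v, (FD \<pi> u v, FD h (\<pi> u) (FD \<pi> u v))))) (at u)"
            by (intro has_derivative_Pair has_derivative_FD dtau uS1 smooth_on_differentiable[OF s\<pi> uU1]
                FD_compose_eq smooth_on_differentiable[OF h]) (use \<pi>S2[OF uU1] S2 in auto)
          from FD_compose_eq[OF this dG[OF mt(2)[OF uU1] WU[OF u]]]
          have "(Y has_derivative (\<lambda>v. FD ?G (\<tau> u, (\<pi> u, h (\<pi> u))) (FD \<tau> u v, (FD \<pi> u v, FD h (\<pi> u) (FD \<pi> u v))))) (at u)"
            by (simp add: Y_def[abs_def])
          moreover have "h differentiable (at (\<pi> u))" using smooth_on_differentiable[OF h] \<pi>S2[OF uU1] S2 by blast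
          ultimately have "FD Y u (\<xi> i u) = FD ?G (\<tau> u, (\<pi> u, h (\<pi> u))) (axis i 1, 0)"
            by (simp add: FD_eq tau\<xi>[OF uS1] d\<pi>[OF uU1] linear_0[OF linear_FD] zero_prod_def)
          then show ?thesis using Gt[OF mt(2)[OF uU1] WU[OF u]] by (simp add: Y_def)
        qed
        define y where "y u = snd (Y u)" for u
        have dy: "FD y u v = snd (FD Y u v)" if "u \<in> W" for u v
          using FD_eq[OF has_derivative_snd[OF smooth_on_has_derivative[OF sY that]]] by (simp add: y_def[abs_def])
        show ?thesis
        proof (intro exI[of _ W] exI[of _ y] conjI ballI allI impI)
          show "open W" "p \<in> W" "W \<subseteq> S" by (rule oW W)+
          show "smooth_on W y" unfolding y_def[abs_def] by (rule smooth_on_snd[OF oW sY])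
          fix u assume u: "u \<in> W"
          then have uU1: "u \<in> U1" and uS1: "u \<in> S1" using W(1) U1(1) V(3) S2(4) by blast+
          show "y u = h u" if "\<tau> u = 0"
            using G0[OF WU[OF u]] that \<pi>tau0[OF uU1] by (simp add: y_def Y_def)
          fix i
          have dyu: "linear (FD y u)" by (rule linear_FD[OF smooth_on_differentiable[OF smooth_on_snd[OF oW sY] u, folded y_def]])
          have ri: "r i u = (\<Sum>j\<in>UNIV. FD \<tau> u (r i u) $ j *\<^sub>R \<xi> j u)"
            unfolding \<xi>_def by (rule recombine[OF uS1, symmetric])
          have "FD y u (r i u) = (\<Sum>j\<in>UNIV. FD \<tau> u (r i u) $ j *\<^sub>R FD y u (\<xi> j u))"
            by (subst ri) (simp add: linear_sum[OF dyu] linear_scale[OF dyu])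
          also have "\<dots> = (\<Sum>j\<in>UNIV. FD \<tau> u (r i u) $ j *\<^sub>R \<beta> j u (y u))"
            by (simp add: dy[OF u] dY[OF u] Xh fstY[OF u] y_def[symmetric])
          also have "\<dots> = B i u (y u)" unfolding \<beta>_def by (rule recombine[OF uS1])
          finally show "FD y u (r i u) = B i u (y u)" .
        qed
      qed
      show ?thesis
      proof (intro conjI allI impI)
        fix h :: "'a \<Rightarrow> 'b" assume h: "smooth_on S h"
        define n where "n = norm (h p)"
        \<comment> \<open>Scaling factor that makes the data at \<open>p\<close> smaller than
          \<open>\<rho>1\<close>; by linearity the solution is scaled back afterwards.\<close>
        define c where "c = \<rho>1 / (2 * (n + 1))"
        have n: "0 \<le> n" by (simp add: n_def)
        then have c: "c > 0" using rho1 by (simp add: c_def)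
        have "norm (c *\<^sub>R h p) = c * n" using c by (simp add: n_def)
        also have "\<dots> < c * (2 * (n + 1))" using c n by (intro mult_strict_left_mono) auto
        also have "\<dots> = \<rho>1" using n by (simp add: c_def)
        finally obtain W y where W: "open W" "p \<in> W" "W \<subseteq> S" "smooth_on W y"
          "\<And>u i. u \<in> W \<Longrightarrow> FD y u (r i u) = B i u (y u)" "\<And>u. u \<in> W \<Longrightarrow> \<tau> u = 0 \<Longrightarrow> y u = c *\<^sub>R h u"
          using small[OF smooth_on_scaleR[OF S(1) smooth_on_const h], of c] by blast
        let ?y = "\<lambda>u. (1 / c) *\<^sub>R y u"
        have dy: "FD ?y u v = (1 / c) *\<^sub>R FD y u v" if "u \<in> W" for u v
          using FD_eq[OF has_derivative_scaleR_right[OF smooth_on_has_derivative[OF W(4) that], of "1 / c"]] by simp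
        show "\<exists>W y. open W \<and> p \<in> W \<and> W \<subseteq> S \<and> smooth_on W y \<and>
          (\<forall>u\<in>W. \<forall>i. FD y u (r i u) = B i u (y u)) \<and> (\<forall>u\<in>W. \<tau> u = 0 \<longrightarrow> y u = h u)"
        proof (intro exI[of _ W] exI[of _ ?y] conjI ballI allI impI W(1,2,3))
          show "smooth_on W ?y" by (rule smooth_on_scaleR[OF W(1) smooth_on_const W(4)])
          fix u assume u: "u \<in> W"
          show "?y u = h u" if "\<tau> u = 0" using W(6)[OF u that] c by simp
          show "FD ?y u (r i u) = B i u (?y u)" for i
            using linear_scale[OF B(2), of u i "1 / c" "y u"] u W(3) by (auto simp: dy[OF u] W(5)[OF u])
        qed
      next
        fix W and y :: "'a \<Rightarrow> 'b"
        assume W: "open W" "p \<in> W" "W \<subseteq> S" and y: "smooth_on W y"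
          and eq: "\<forall>u\<in>W. \<forall>i. FD y u (r i u) = B i u (y u)" and zero: "\<forall>u\<in>W. \<tau> u = 0 \<longrightarrow> y u = 0"
        have "\<exists>K. \<forall>u\<in>cball p \<rho>. \<forall>y. norm (\<beta> i u y) \<le> K * norm y" for i
        proof (rule linear_bounded_on_cball[of p \<rho> "\<beta> i"])
          have sS: "cball p \<rho> \<times> UNIV \<subseteq> S1 \<times> (UNIV :: 'b set)" using rho by auto
          have oS1: "open (S1 \<times> (UNIV :: 'b set))" using S1 by (simp add: open_Times)
          have "smooth_on (S1 \<times> UNIV) (\<lambda>q. \<beta> i (fst q) (snd q))"
            unfolding \<beta>_def
            by (rule smooth_on_sum[OF oS1], rule smooth_on_scaleR[OF oS1 smooth_on_compose[OF oS1 S1(1) sg smooth_on_bounded_linear[OF bounded_linear_fst oS1]]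
                    smooth_on_subset[OF B(1)]]) (use S1(3) in auto)
          then show "continuous_on (cball p \<rho> \<times> UNIV) (\<lambda>q. \<beta> i (fst q) (snd q))"
            using continuous_on_subset[OF smooth_on_continuous_on sS] by blast
          show "linear (\<beta> i u)" if "u \<in> cball p \<rho>" for u using lin\<beta> rho(2) that by blast
        qed blast
        then have "\<forall>i. \<exists>K. \<forall>u\<in>cball p \<rho>. \<forall>y. norm (\<beta> i u y) \<le> K * norm y" by simp
        from choice[OF this] obtain K' where K': "\<And>i u y. u \<in> cball p \<rho> \<Longrightarrow> norm (\<beta> i u y) \<le> K' i * norm y" by blast
        have d\<xi>y: "FD y u (\<xi> i u) = \<beta> i u (y u)" if u: "u \<in> W" for u i
          using linear_FD[OF smooth_on_differentiable[OF y u]] eq u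
          by (simp add: \<xi>_def \<beta>_def linear_sum[OF linear_FD[OF smooth_on_differentiable[OF y u]]]
              linear_scale[OF linear_FD[OF smooth_on_differentiable[OF y u]]])
        let ?P = "\<lambda>q :: (real^'i) \<times> 'a. fst (?G (fst q, (snd q, 0)))"
        let ?DV = "ball (0 :: real^'i) e \<times> V"
        have oDV: "open ?DV" using V by (simp add: open_Times)
        have "smooth_on ?DV (\<lambda>q. ?G (fst q, (snd q, 0)))"
          by (rule smooth_on_compose[OF oDV oD sG smooth_on_Pair[OF oDV smooth_on_bounded_linear[OF bounded_linear_fst oDV]
                smooth_on_Pair[OF oDV smooth_on_bounded_linear[OF bounded_linear_snd oDV] smooth_on_const]]])
            (use u0U in auto)
        then have "continuous_on ?DV ?P" by (intro smooth_on_continuous_on smooth_on_fst oDV)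
        then have oN: "open (?DV \<inter> ?P -` W)" by (rule continuous_open_preimage[OF _ oDV W(1)])
        have pN: "(0, p) \<in> ?DV \<inter> ?P -` W" using e V W G0[OF u0U[OF V(2)]] by simp
        obtain e' V' where e': "e' > 0" and V': "open V'" "p \<in> V'" and N: "ball 0 e' \<times> V' \<subseteq> ?DV \<inter> ?P -` W"
        proof (rule open_prod_elim[OF oN pN])
          fix B V' assume VB: "open B" "open V'" "(0, p) \<in> B \<times> V'" "B \<times> V' \<subseteq> ?DV \<inter> ?P -` W"
          then obtain d where d: "d > 0" "ball 0 d \<subseteq> B" using openE[of B 0] by auto
          have "ball 0 d \<times> V' \<subseteq> B \<times> V'" using d(2) by auto
          then show thesis using that[of d V'] VB d by blast
        qed
        \<comment> \<open>For \<open>u\<close> in this neighbourhood of \<open>p\<close> the whole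
          curve from \<open>\<pi> u\<close> to \<open>u\<close> stays in the domain \<open>W\<close>
          of the given solution.\<close>
        define M where "M = U1 \<inter> V' \<inter> \<tau> -` ball 0 e'"
        have "open M"
        proof -
          have "open (U1 \<inter> \<tau> -` ball 0 e')"
            by (rule continuous_open_preimage[OF continuous_on_subset[OF contau U1(1)] oU1]) simp
          then have "open ((U1 \<inter> \<tau> -` ball 0 e') \<inter> V')" using V' by blast
          moreover have "(U1 \<inter> \<tau> -` ball 0 e') \<inter> V' = M" by (auto simp: M_def)
          ultimately show ?thesis by simp
        qed
        moreover have "p \<in> M" using U1 V' \<tau>(2) e' by (simp add: M_def)
        moreover have yM: "y u = 0" if u: "u \<in> M" for u
        proof -
          have uU1: "u \<in> U1" and uV: "u \<in> V" and uV': "u \<in> V'" and te: "\<tau> u \<in> ball 0 e'" using u U1 by (auto simp: M_def)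
          \<comment> \<open>Starts at \<open>\<pi> u\<close>, where the solution vanishes, and
            arrives at \<open>u\<close>. Along it \<open>y\<close> satisfies a linear differential
            inequality.\<close>
          let ?\<gamma> = "\<lambda>s. fst (G ((s + - 1) *\<^sub>R \<tau> u) (u, 0))"
          have st: "(s + - 1) *\<^sub>R \<tau> u \<in> ball 0 e" "?\<gamma> s \<in> W" if "0 \<le> s" "s \<le> 1" for s
          proof -
            have "\<bar>s + - 1\<bar> * norm (\<tau> u) \<le> 1 * norm (\<tau> u)" using that by (intro mult_right_mono) auto
            then have "((s + - 1) *\<^sub>R \<tau> u, u) \<in> ball 0 e' \<times> V'" using te uV' by simp
            then have "((s + - 1) *\<^sub>R \<tau> u, u) \<in> ?DV \<inter> ?P -` W" using N by blast
            then show "(s + - 1) *\<^sub>R \<tau> u \<in> ball 0 e" "?\<gamma> s \<in> W" by auto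
          qed
          have "(\<lambda>s. y (?\<gamma> s)) 1 = 0"
          proof (rule gronwall_zero[where f="\<lambda>s. y (?\<gamma> s)" and C="\<Sum>k\<in>UNIV. \<bar>\<tau> u $ k\<bar> * K' k"
                and f'="\<lambda>s. \<Sum>k\<in>UNIV. \<tau> u $ k *\<^sub>R \<beta> k (?\<gamma> s) (y (?\<gamma> s))"])
            fix s :: real assume s: "0 \<le> s" "s \<le> 1"
            have c: "?\<gamma> s \<in> cball p \<rho>" using fstSh(2)[OF GSh[OF st(1)[OF s] u0U[OF uV]]] S2(3) by blast
            note dy = smooth_on_differentiable[OF y st(2)[OF s]]
            show "((\<lambda>s. y (?\<gamma> s)) has_vector_derivative (\<Sum>k\<in>UNIV. \<tau> u $ k *\<^sub>R \<beta> k (?\<gamma> s) (y (?\<gamma> s)))) (at s)"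
              using has_vector_derivative_FD_compose[OF curve[OF st(1)[OF s] u0U[OF uV]] dy]
              by (simp only: linear_sum[OF linear_FD[OF dy]] linear_scale[OF linear_FD[OF dy]] d\<xi>y[OF st(2)[OF s]])
            have "norm (\<Sum>k\<in>UNIV. \<tau> u $ k *\<^sub>R \<beta> k (?\<gamma> s) (y (?\<gamma> s))) \<le> (\<Sum>k\<in>UNIV. \<bar>\<tau> u $ k\<bar> * (K' k * norm (y (?\<gamma> s))))"
              by (rule order_trans[OF norm_sum], rule sum_mono)
                (unfold norm_scaleR, rule mult_left_mono[OF K'[OF c] abs_ge_zero])
            then show "norm (\<Sum>k\<in>UNIV. \<tau> u $ k *\<^sub>R \<beta> k (?\<gamma> s) (y (?\<gamma> s))) \<le> (\<Sum>k\<in>UNIV. \<bar>\<tau> u $ k\<bar> * K' k) * norm (y (?\<gamma> s))"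
              by (simp add: sum_distrib_right mult.assoc)
          next
            have "?\<gamma> 0 = \<pi> u" by (simp add: \<pi>_def)
            then show "y (?\<gamma> 0) = 0" using zero st(2)[of 0] tau\<pi>[OF uU1] by auto
          qed
          then show ?thesis using G0[OF u0U[OF uV]] by simp
        qed
        ultimately show "\<forall>\<^sub>F u in nhds p. y u = 0" by (intro eventually_nhds[THEN iffD2] exI[of _ M]) simp
      qed
    qed
  qed
  show "smooth_on S h \<Longrightarrow> \<exists>W y. open W \<and> p \<in> W \<and> W \<subseteq> S \<and> smooth_on W y \<and>
      (\<forall>u\<in>W. \<forall>i. FD y u (r i u) = B i u (y u)) \<and> (\<forall>u\<in>W. \<tau> u = 0 \<longrightarrow> y u = h u)"
    using main by blast
  show "open W \<Longrightarrow> p \<in> W \<Longrightarrow> W \<subseteq> S \<Longrightarrow> smooth_on W y \<Longrightarrow>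
      (\<And>u i. u \<in> W \<Longrightarrow> FD y u (r i u) = B i u (y u)) \<Longrightarrow> (\<And>u. u \<in> W \<Longrightarrow> \<tau> u = 0 \<Longrightarrow> y u = 0) \<Longrightarrow>
      \<forall>\<^sub>F u in nhds p. y u = 0"
    using main by blast
qed

section \<open>Transversals and integral manifolds\<close>

text \<open>The coordinates are inner products with a basis of the orthogonal complement; a vector
  orthogonal to the complement is back in \<open>L\<close>.\<close>

lemma linear_map_with_kernel:
  fixes L :: "'a::euclidean_space set"
  assumes L: "subspace L" and dim: "dim L + CARD('i::finite) = DIM('a)"
  obtains P :: "'a \<Rightarrow> real^'i" where "bounded_linear P" "\<And>x. P x = 0 \<longleftrightarrow> x \<in> L"
proof -
  have perp: "orthogonal_comp L = {y \<in> UNIV. \<forall>x\<in>L. orthogonal x y}"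
    by (auto simp: orthogonal_comp_def orthogonal_commute)
  have "dim (orthogonal_comp L) = CARD('i)"
    using dim_subspace_orthogonal_to_vectors[OF L subspace_UNIV subset_UNIV] dim unfolding perp by simp
  then obtain C where C: "C \<subseteq> orthogonal_comp L" "independent C" "orthogonal_comp L \<subseteq> span C" "card C = CARD('i)"
    using basis_exists[of "orthogonal_comp L"] by metis
  have "finite C" using C(2) independent_imp_finite by blast
  then obtain b :: "'i \<Rightarrow> 'a" where b: "bij_betw b UNIV C"
    using finite_same_card_bij[of "UNIV :: 'i set" C] C(4) by auto
  define P where "P x = (\<chi> i. x \<bullet> b i)" for x
  show ?thesis
  proof (rule that[of P])
    have "linear P" by (rule linearI) (simp_all add: P_def vec_eq_iff inner_add_left)
    then show "bounded_linear P" by (simp add: linear_conv_bounded_linear)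
    show "P x = 0 \<longleftrightarrow> x \<in> L" for x
    proof
      assume "P x = 0"
      then have "x \<bullet> b i = 0" for i by (simp add: P_def vec_eq_iff)
      then have "\<forall>y\<in>C. orthogonal x y" using b by (auto simp: bij_betw_def orthogonal_def)
      then have "orthogonal x y" if "y \<in> span C" for y using orthogonal_to_span that by blast
      then have "x \<in> orthogonal_comp (orthogonal_comp L)" using C(3)
        by (auto simp: orthogonal_comp_def orthogonal_commute)
      then show "x \<in> L" by (simp add: orthogonal_comp_self[OF L])
    next
      assume x: "x \<in> L"
      have "b i \<in> orthogonal_comp L" for i using b C(1) by (auto simp: bij_betw_def)
      then show "P x = 0" using x by (auto simp: P_def vec_eq_iff orthogonal_comp_def orthogonal_def inner_commute)
    qed
  qed
qed

text \<open>The inverse chart maps a short piece of the line through \<open>z\<close> in direction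
  \<open>w\<close> to a curve in \<open>M\<close> with the required velocity.\<close>

lemma chart_FD_tangent:
  fixes \<Phi> \<Psi> :: "'a::euclidean_space \<Rightarrow> 'a"
  assumes V: "open V" and h: "homeomorphism U V \<Phi> \<Psi>" and \<Psi>: "smooth_on V \<Psi>"
    and L: "subspace L" and M: "\<Phi> ` (U \<inter> M) = V \<inter> L" and z: "z \<in> V \<inter> L" and w: "w \<in> L"
  shows "FD \<Psi> z w \<in> tangent_space M (\<Psi> z)"
proof -
  have zV: "z \<in> V" using z by simp
  obtain d where d: "d > 0" "ball z d \<subseteq> V" using openE[OF V zV] by blast
  define e where "e = d / (norm w + 1)"
  have nw: "norm w + 1 > 0" by (simp add: add_nonneg_pos)
  have e: "e > 0" using d(1) nw by (simp add: e_def)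
  have VL: "z + t *\<^sub>R w \<in> V \<inter> L" if "t \<in> {-e<..<e}" for t
  proof -
    have "\<bar>t\<bar> * norm w \<le> e * norm w" using that by (intro mult_right_mono) auto
    also have "\<dots> < e * (norm w + 1)" using e by simp
    also have "\<dots> = d" using nw by (simp add: e_def)
    finally have "z + t *\<^sub>R w \<in> ball z d" by (simp add: dist_norm)
    then show ?thesis using d(2) z w L by (auto simp: subspace_add subspace_scale)
  qed
  have img: "\<Psi> (z + t *\<^sub>R w) \<in> M" if t: "t \<in> {-e<..<e}" for t
  proof -
    obtain x where "x \<in> U \<inter> M" "z + t *\<^sub>R w = \<Phi> x" using VL[OF t] unfolding M[symmetric] by (rule imageE)
    then show ?thesis using h by (auto simp: homeomorphism_def)
  qed
  have oe: "open {-e<..<e}" by simp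
  have "smooth_on {-e<..<e} (\<lambda>t. z + t *\<^sub>R w)"
    by (intro smooth_on_add smooth_on_scaleR smooth_on_ident smooth_on_const oe)
  then have s: "smooth_on {-e<..<e} (\<lambda>t. \<Psi> (z + t *\<^sub>R w))"
    by (rule smooth_on_compose[OF oe V \<Psi>]) (use VL in auto)
  have "((\<lambda>t. \<Psi> (z + t *\<^sub>R w)) has_vector_derivative FD \<Psi> (z + 0 *\<^sub>R w) w) (at 0)"
    by (rule FD_along_line) (use smooth_on_differentiable[OF \<Psi> zV] in simp)
  then show ?thesis unfolding tangent_space_def
    by (intro CollectI exI[of _ "\<lambda>t. \<Psi> (z + t *\<^sub>R w)"] exI[of _ e]) (use e s img in auto)
qed

text \<open>The statement indexes the frame by the naturals 1, 2, 3, whereas vectors in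
  \<open>real^3\<close> are indexed by the type \<open>3\<close>, in which the numeral 3 is the same
  as 0. The case distinction matches the two.\<close>

definition idx :: "3 \<Rightarrow> nat" where "idx i = (if i = 1 then 1 else if i = 2 then 2 else 3)"

lemma idx_simps [simp]: "idx 1 = 1" "idx 2 = 2" "idx 3 = 3"
  by (simp_all add: idx_def)

lemma range_idx: "range idx = {1..3}"
proof -
  have "{1..3::nat} = {1, 2, 3}" by auto
  then show ?thesis by (simp add: UNIV_3)
qed

lemma idx_range: "idx i \<in> {1..3}"
  using range_idx by blast

lemma image_idx: "(\<lambda>i. f i) ` {1..3} = range (\<lambda>i. f (idx i))"
  unfolding range_idx[symmetric] image_image by simp

lemma inj_idx: "inj idx"
proof (rule injI)
  fix i j assume "idx i = idx j"
  then show "i = j" using exhaust_3[of i] exhaust_3[of j] by (elim disjE) simp_all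
qed

lemma frame_independent:
  assumes "partial_frame \<Omega> r {1..3}" "u \<in> \<Omega>" "(\<Sum>i\<in>(UNIV :: 3 set). a i *\<^sub>R r (idx i) u) = 0"
  shows "a i = 0"
proof -
  let ?f = "\<lambda>i. r (idx i) u"
  have inj: "inj ?f"
  proof (rule injI)
    fix i j assume "r (idx i) u = r (idx j) u"
    moreover have "inj_on (\<lambda>i. r i u) {1..3}" using assms(1,2) unfolding partial_frame_def by blast
    ultimately have "idx i = idx j" using idx_range by (simp only: inj_on_def)
    then show "i = j" using inj_idx by (simp only: inj_eq)
  qed
  have "independent (range ?f)" using assms(1,2) unfolding partial_frame_def image_idx by blast
  \<comment> \<open>Independence is a property of a set of vectors, so the coefficients are carried
    over from indices to vectors by the inverse of \<open>?f\<close>.\<close>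
  moreover have "(\<Sum>v\<in>range ?f. a (inv ?f v) *\<^sub>R v) = 0"
    using assms(3) by (simp add: sum.reindex[OF inj] inv_f_f[OF inj])
  ultimately have "a (inv ?f (?f i)) = 0"
    by (intro independentD[of "range ?f" "range ?f" "\<lambda>v. a (inv ?f v)"]) auto
  then show ?thesis by (simp add: inv_f_f[OF inj])
qed

section \<open>Transversals as zero sets, and their existence\<close>

text \<open>\<open>\<tau>\<close> is the slice chart followed by a linear map with kernel
  \<open>L\<close>. If a combination of frame vectors is annihilated by the derivative of
  \<open>\<tau>\<close>, the chart sends it into \<open>L\<close>, so it is tangent to the
  transversal; complementarity then makes it zero.\<close>

lemma transversal_defining_function:
  fixes \<Omega> :: "(real^'n) set"
  assumes n: "CARD('n) \<ge> 3" and \<Omega>: "open \<Omega>" and frame: "partial_frame \<Omega> r {1..3}"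
    and \<Xi>: "\<Xi> \<in> transversals (CARD('n) - 3) \<Omega> r {1..3} p"
  obtains U and \<tau> :: "real^'n \<Rightarrow> real^3" where "open U" "p \<in> U" "U \<subseteq> \<Omega>" "smooth_on U \<tau>" "\<tau> p = 0"
    "\<And>u. u \<in> U \<Longrightarrow> \<tau> u = 0 \<longleftrightarrow> u \<in> \<Xi>"
    "\<And>a :: real^3. (\<Sum>i\<in>UNIV. a $ i *\<^sub>R FD \<tau> p (r (idx i) p)) = 0 \<Longrightarrow> a = 0"
proof -
  have p: "p \<in> \<Xi>" "p \<in> \<Omega>" using \<Xi> by (auto simp: transversals_def)
  have sub: "smooth_submanifold (CARD('n) - 3) \<Xi>" and comp: "complementary (tangent_space \<Xi> p) (span ((\<lambda>i. r i p) ` {1..3}))"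
    using \<Xi> p(1) unfolding transversals_def by blast+
  from sub p(1) obtain U V \<Phi> \<Psi> L where U: "open U" "p \<in> U" "open V" and h: "homeomorphism U V \<Phi> \<Psi>"
    and s: "smooth_on U \<Phi>" "smooth_on V (\<Psi> :: real^'n \<Rightarrow> real^'n)" and L: "subspace L" "dim L = CARD('n) - 3"
    and M: "\<Phi> ` (U \<inter> \<Xi>) = V \<inter> L"
    unfolding smooth_submanifold_def by meson
  obtain P :: "real^'n \<Rightarrow> real^3" where P: "bounded_linear P" "\<And>x. P x = 0 \<longleftrightarrow> x \<in> L"
  proof -
    have "dim L + CARD(3) = DIM(real^'n)" using L(2) n by simp
    from linear_map_with_kernel[OF L(1) this] show thesis using that by metis
  qed
  define \<tau> where "\<tau> u = P (\<Phi> u)" for u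
  have \<Psi>\<Phi>: "\<Psi> (\<Phi> u) = u" "\<Phi> u \<in> V" if "u \<in> U" for u using h that by (auto simp: homeomorphism_def)
  have iff: "\<tau> u = 0 \<longleftrightarrow> u \<in> \<Xi>" if u: "u \<in> U" for u
  proof -
    have "\<Phi> u \<in> L \<longleftrightarrow> u \<in> \<Xi>"
    proof
      assume "\<Phi> u \<in> L"
      then have "\<Phi> u \<in> \<Phi> ` (U \<inter> \<Xi>)" unfolding M using \<Psi>\<Phi>(2)[OF u] by simp
      then obtain x where x: "x \<in> U" "x \<in> \<Xi>" "\<Phi> u = \<Phi> x" by auto
      have "\<Psi> (\<Phi> u) = \<Psi> (\<Phi> x)" by (rule arg_cong[OF x(3)])
      then have "u = x" unfolding \<Psi>\<Phi>(1)[OF u] \<Psi>\<Phi>(1)[OF x(1)] .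
      then show "u \<in> \<Xi>" using x(2) by simp
    next
      assume "u \<in> \<Xi>"
      then have "\<Phi> u \<in> \<Phi> ` (U \<inter> \<Xi>)" using u by simp
      then show "\<Phi> u \<in> L" unfolding M by simp
    qed
    then show ?thesis by (simp add: \<tau>_def P(2))
  qed
  have s\<tau>: "smooth_on U \<tau>" unfolding \<tau>_def[abs_def] by (rule bounded_linear.smooth_on[OF P(1) U(1) s(1)])
  have \<Phi>p: "\<Phi> p \<in> V \<inter> L" unfolding M[symmetric] using U(2) p(1) by simp
  show ?thesis
  proof (rule that[of "U \<inter> \<Omega>" \<tau>])
    show "smooth_on (U \<inter> \<Omega>) \<tau>" by (rule smooth_on_subset[OF s\<tau>]) simp
    show "\<tau> p = 0" using iff[OF U(2)] p(1) by simp
    show "open (U \<inter> \<Omega>)" using U(1) \<Omega> by (rule open_Int)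
    show "p \<in> U \<inter> \<Omega>" "U \<inter> \<Omega> \<subseteq> \<Omega>" using U(2) p(2) by simp_all
    show "\<tau> u = 0 \<longleftrightarrow> u \<in> \<Xi>" if "u \<in> U \<inter> \<Omega>" for u by (rule iff) (use that in simp)
    fix a :: "real^3"
    assume a: "(\<Sum>i\<in>UNIV. a $ i *\<^sub>R FD \<tau> p (r (idx i) p)) = 0"
    define v where "v = (\<Sum>i\<in>UNIV. a $ i *\<^sub>R r (idx i) p)"
    note d\<tau> = smooth_on_differentiable[OF s\<tau> U(2)] and d\<Phi> = smooth_on_has_derivative[OF s(1) U(2)]
    have "FD \<tau> p v = 0"
      using a by (simp add: v_def linear_sum[OF linear_FD[OF d\<tau>]] linear_scale[OF linear_FD[OF d\<tau>]])
    moreover have "FD \<tau> p = (\<lambda>v. P (FD \<Phi> p v))"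
      unfolding \<tau>_def[abs_def] by (rule FD_eq[OF bounded_linear.has_derivative[OF P(1) d\<Phi>]])
    ultimately have w: "FD \<Phi> p v \<in> L" by (simp add: P(2))
    have "((\<lambda>u. \<Psi> (\<Phi> u)) has_derivative (\<lambda>v. FD \<Psi> (\<Phi> p) (FD \<Phi> p v))) (at p)"
      by (rule FD_compose_eq[OF d\<Phi> smooth_on_differentiable[OF s(2)]]) (use \<Phi>p in simp)
    then have "((\<lambda>u. u) has_derivative (\<lambda>v. FD \<Psi> (\<Phi> p) (FD \<Phi> p v))) (at p)"
      by (rule has_derivative_transform_within_open[OF _ U(1,2)]) (rule \<Psi>\<Phi>(1))
    from FD_eq[OF this] FD_eq[OF has_derivative_ident, of p]
    have "(\<lambda>v. v) = (\<lambda>v. FD \<Psi> (\<Phi> p) (FD \<Phi> p v))" by (simp only:)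
    from fun_cong[OF this, of v] have "FD \<Psi> (\<Phi> p) (FD \<Phi> p v) = v" by simp
    then have "v \<in> tangent_space \<Xi> p"
      using chart_FD_tangent[OF U(3) h s(2) L(1) M \<Phi>p w] \<Psi>\<Phi>(1)[OF U(2)] by simp
    moreover have "v \<in> span ((\<lambda>i. r i p) ` {1..3})"
      unfolding v_def image_idx by (intro span_sum span_scale span_base) simp
    ultimately have "v = 0" using comp unfolding complementary_def by blast
    then have "a $ i = 0" for i
      unfolding v_def by (rule frame_independent[OF frame p(2), where a="\<lambda>i. a $ i"])
    then show "a = 0" by (simp add: vec_eq_iff)
  qed
qed

text \<open>A small piece of the affine subspace through \<open>p\<close> with direction
  \<open>L\<close>. Its tangent space is \<open>L\<close> everywhere, and being complementary to the
  frame is an open condition, witnessed by the inverse matrix \<open>g\<close> near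
  \<open>p\<close>.\<close>

lemma transversals_nonempty:
  fixes \<Omega> :: "(real^'n) set"
  assumes n: "CARD('n) \<ge> 3" and \<Omega>: "open \<Omega>" "p \<in> \<Omega>" and frame: "partial_frame \<Omega> r {1..3}"
    and P: "bounded_linear (P :: real^'n \<Rightarrow> real^3)" "\<And>x. P x = 0 \<longleftrightarrow> x \<in> L" and L: "subspace L" "dim L = CARD('n) - 3"
    and inj: "\<And>a :: real^3. (\<Sum>i\<in>UNIV. a $ i *\<^sub>R P (r (idx i) p)) = 0 \<Longrightarrow> a = 0"
  obtains d where "d > 0" "{x \<in> ball p d. x - p \<in> L} \<in> transversals (CARD('n) - 3) \<Omega> r {1..3} p"
proof -
  have sr: "smooth_on \<Omega> (r (idx i))" for i using frame idx_range by (simp add: partial_frame_def)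
  have FDP: "FD (\<lambda>u. P (u - p)) u = P" for u
    by (rule FD_eq) (auto intro!: derivative_eq_intros bounded_linear.has_derivative[OF P(1)])
  have sP: "smooth_on \<Omega> (\<lambda>u. P (u - p))"
    by (rule bounded_linear.smooth_on[OF P(1) \<Omega>(1) smooth_on_diff[OF \<Omega>(1) smooth_on_ident[OF \<Omega>(1)] smooth_on_const]])
  show ?thesis
  proof (rule dual_frame[OF \<Omega> sr sP])
    show "a = 0" if "(\<Sum>i\<in>UNIV. a $ i *\<^sub>R FD (\<lambda>u. P (u - p)) p (r (idx i) p)) = 0" for a :: "real^3"
      using inj that unfolding FDP by blast
    fix S' g assume S': "open S'" "p \<in> S'" "S' \<subseteq> \<Omega>"
      and g: "\<And>i k w. w \<in> S' \<Longrightarrow> (\<Sum>j\<in>UNIV. FD (\<lambda>u. P (u - p)) w (r (idx i) w) $ j * g j k w) = (if i = k then 1 else (0::real))"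
    have inj': "a k = 0" if w: "w \<in> S'" and a: "(\<Sum>i\<in>UNIV. a i *\<^sub>R P (r (idx i) w)) = 0" for a w k
    proof -
      have "a k = (\<Sum>i\<in>UNIV. a i * (if i = k then 1 else 0))" by (simp add: if_distrib cong: if_cong)
      also have "\<dots> = (\<Sum>i\<in>UNIV. a i * (\<Sum>j\<in>UNIV. P (r (idx i) w) $ j * g j k w))"
        using g[OF w, unfolded FDP] by simp
      also have "\<dots> = (\<Sum>j\<in>UNIV. (\<Sum>i\<in>UNIV. a i *\<^sub>R P (r (idx i) w)) $ j * g j k w)"
        by (simp add: sum_distrib_left sum_distrib_right mult.assoc) (rule sum.swap)
      finally show ?thesis using a by simp
    qed
    obtain d where d: "d > 0" "ball p d \<subseteq> S'" using openE[OF S'(1,2)] by blast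
    define \<Xi> where "\<Xi> = {x \<in> ball p d. x - p \<in> L}"
    define \<Phi> where "\<Phi> u = u - p" for u :: "real^'n"
    define \<Psi> where "\<Psi> v = v + p" for v :: "real^'n"
    have h: "homeomorphism (ball p d) (ball 0 d) \<Phi> \<Psi>"
      unfolding \<Phi>_def \<Psi>_def
      by (rule homeomorphismI) (auto simp: dist_norm norm_minus_commute intro!: continuous_intros)
    have s: "smooth_on (ball p d) \<Phi>" "smooth_on (ball 0 d) \<Psi>"
      unfolding \<Phi>_def[abs_def] \<Psi>_def[abs_def]
      by (intro smooth_on_diff smooth_on_add smooth_on_ident smooth_on_const open_ball)+
    have M: "\<Phi> ` (ball p d \<inter> \<Xi>) = ball 0 d \<inter> L"
    proof
      show "\<Phi> ` (ball p d \<inter> \<Xi>) \<subseteq> ball 0 d \<inter> L" by (auto simp: \<Phi>_def \<Xi>_def dist_norm norm_minus_commute)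
      show "ball 0 d \<inter> L \<subseteq> \<Phi> ` (ball p d \<inter> \<Xi>)"
      proof
        fix z assume "z \<in> ball 0 d \<inter> L"
        then show "z \<in> \<Phi> ` (ball p d \<inter> \<Xi>)"
          by (intro image_eqI[of _ _ "z + p"]) (auto simp: \<Phi>_def \<Xi>_def dist_norm)
      qed
    qed
    have tan: "tangent_space \<Xi> x = L" if x: "x \<in> \<Xi>" for x
    proof
      show "tangent_space \<Xi> x \<subseteq> L"
      proof
        fix v assume "v \<in> tangent_space \<Xi> x"
        then obtain \<gamma> e where e: "0 < e" "\<gamma> ` {-e<..<e} \<subseteq> \<Xi>" "(\<gamma> has_vector_derivative v) (at (0::real))"
          unfolding tangent_space_def by blast
        have "((\<lambda>t. P (\<gamma> t - p)) has_vector_derivative P (v - 0)) (at 0)"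
          by (rule bounded_linear.has_vector_derivative[OF P(1)], rule has_vector_derivative_diff[OF e(3) has_vector_derivative_const])
        moreover have "((\<lambda>t. P (\<gamma> t - p)) has_vector_derivative 0) (at 0)"
        proof (rule has_vector_derivative_transform_within_open[OF has_vector_derivative_const[of 0], of "{-e<..<e}"])
          fix t assume "t \<in> {-e<..<e}"
          then have "\<gamma> t \<in> \<Xi>" using e(2) by blast
          then show "0 = P (\<gamma> t - p)" using P(2)[of "\<gamma> t - p"] by (simp add: \<Xi>_def)
        qed (use e in auto)
        ultimately have "P (v - 0) = 0" by (rule vector_derivative_unique_at)
        then show "v \<in> L" by (simp add: P(2))
      qed
      show "L \<subseteq> tangent_space \<Xi> x"
      proof
        fix w assume w: "w \<in> L"
        have "FD \<Psi> (\<Phi> x) = (\<lambda>v. v)" unfolding \<Psi>_def[abs_def]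
          by (rule FD_eq) (auto intro!: derivative_eq_intros)
        moreover have "\<Phi> x \<in> ball 0 d \<inter> L" unfolding M[symmetric] using x by (simp add: \<Xi>_def)
        ultimately show "w \<in> tangent_space \<Xi> x"
          using chart_FD_tangent[OF open_ball h s(2) L(1) M _ w, of "\<Phi> x"] by (simp add: \<Phi>_def \<Psi>_def)
      qed
    qed
    have comp: "complementary (tangent_space \<Xi> x) (span ((\<lambda>i. r i x) ` {1..3}))" if x: "x \<in> \<Xi>" for x
    proof -
      have xS: "x \<in> S'" using x d by (auto simp: \<Xi>_def)
      have x\<Omega>: "x \<in> \<Omega>" using xS S'(3) by blast
      let ?E = "span ((\<lambda>i. r i x) ` {1..3})"
      have int: "L \<inter> ?E = {0}"
      proof (rule antisym, rule subsetI)
        fix v assume v: "v \<in> L \<inter> ?E"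
        then obtain b where b: "v = (\<Sum>i\<in>UNIV. b i *\<^sub>R r (idx i) x)"
          unfolding image_idx by (auto elim: span_range_sum)
        have "P v = 0" using v P(2) by blast
        then have "(\<Sum>i\<in>UNIV. b i *\<^sub>R P (r (idx i) x)) = 0"
          by (simp add: b linear_sum[OF bounded_linear.linear[OF P(1)]] linear_scale[OF bounded_linear.linear[OF P(1)]])
        then have "b i = 0" for i by (rule inj'[OF xS])
        then show "v \<in> {0}" by (simp add: b)
      qed (simp add: subspace_0[OF L(1)] span_zero)
      have "dim ?E = 3"
        using frame x\<Omega> unfolding partial_frame_def by (simp add: dim_eq_card_independent card_image)
      \<comment> \<open>Since the intersection is trivial, a dimension count shows that the sum of
        the two subspaces is the whole space.\<close>
      moreover have "dim {a + b |a b. a \<in> L \<and> b \<in> ?E} + dim (L \<inter> ?E) = dim L + dim ?E"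
        by (rule dim_sums_Int[OF L(1) subspace_span])
      ultimately have "dim {a + b |a b. a \<in> L \<and> b \<in> ?E} = DIM(real^'n)" using L(2) n int by simp
      then have "span {a + b |a b. a \<in> L \<and> b \<in> ?E} = UNIV" by (simp only: dim_eq_full)
      then have "{a + b |a b. a \<in> L \<and> b \<in> ?E} = UNIV"
        using span_eq_iff[THEN iffD2, OF subspace_sums[OF L(1) subspace_span]] by simp
      with int show ?thesis by (simp add: complementary_def tan[OF x])
    qed
    have "\<Xi> \<in> transversals (CARD('n) - 3) \<Omega> r {1..3} p"
      unfolding transversals_def
    proof (intro CollectI conjI ballI comp)
      show "smooth_submanifold (CARD('n) - 3) \<Xi>"
        unfolding smooth_submanifold_def
      proof
        fix q assume "q \<in> \<Xi>"
        then have "q \<in> ball p d" by (simp add: \<Xi>_def)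
        then show "\<exists>U V (\<Phi> :: real^'n \<Rightarrow> real^'n) \<Psi> L'. open U \<and> q \<in> U \<and> open V \<and> homeomorphism U V \<Phi> \<Psi> \<and> smooth_on U \<Phi> \<and> smooth_on V \<Psi> \<and>
            subspace L' \<and> dim L' = CARD('n) - 3 \<and> \<Phi> ` (U \<inter> \<Xi>) = V \<inter> L'"
          by (intro exI[of _ "ball p d"] exI[of _ "ball 0 d"] exI[of _ \<Phi>] exI[of _ \<Psi>] exI[of _ L] conjI open_ball h s L M)
      qed
      show "p \<in> \<Xi>" using d(1) subspace_0[OF L(1)] by (simp add: \<Xi>_def)
      show "\<Xi> \<subseteq> \<Omega>" using d(2) S'(3) by (auto simp: \<Xi>_def)
    qed
    then show ?thesis using that[OF d(1)] by (simp add: \<Xi>_def)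
  qed
qed

text \<open>In a slice chart the manifold is a subspace, and along segments in it \<open>l\<close>
  has zero derivative, because the velocities are combinations of the frame. So \<open>l\<close> is
  locally constant on a connected set.\<close>

lemma constant_on_integral_manifold:
  fixes l :: "real^'n \<Rightarrow> real" and r :: "nat \<Rightarrow> real^'n \<Rightarrow> real^'n"
  assumes V: "open V" and l: "smooth_on V l" and zero: "\<And>u i. u \<in> V \<Longrightarrow> i \<in> {1..3} \<Longrightarrow> FD l u (r i u) = 0"
    and N: "integral_manifold r {1..3} N" "N \<subseteq> V"
  shows "l constant_on N"
proof (rule locally_constant_imp_constant)
  show "connected N" using N(1) by (simp add: integral_manifold_def)
  fix x assume x: "x \<in> N"
  have sub: "smooth_submanifold 3 N" and tan: "\<And>x. x \<in> N \<Longrightarrow> tangent_space N x = span ((\<lambda>i. r i x) ` {1..3})"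
    using N(1) by (simp_all add: integral_manifold_def)
  from sub x obtain U W \<Phi> \<Psi> L where U: "open U" "x \<in> U" "open W" and h: "homeomorphism U W \<Phi> \<Psi>"
    and s: "smooth_on U \<Phi>" "smooth_on W (\<Psi> :: real^'n \<Rightarrow> real^'n)" and L: "subspace L"
    and M: "\<Phi> ` (U \<inter> N) = W \<inter> L"
    unfolding smooth_submanifold_def by meson
  have hU: "\<And>u. u \<in> U \<Longrightarrow> \<Psi> (\<Phi> u) = u" "continuous_on U \<Phi>" using h by (auto simp: homeomorphism_def)
  have \<Phi>x: "\<Phi> x \<in> W \<inter> L" unfolding M[symmetric] using U(2) x by simp
  obtain d where d: "d > 0" "ball (\<Phi> x) d \<subseteq> W" using openE[OF U(3) IntD1[OF \<Phi>x]] by blast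
  have \<Psi>N: "\<Psi> z \<in> N" if z: "z \<in> W \<inter> L" for z
  proof -
    obtain y where y: "y \<in> U \<inter> N" "z = \<Phi> y" using z unfolding M[symmetric] by (rule imageE)
    have "\<Psi> z = y" unfolding y(2) by (rule hU(1)[OF IntD1[OF y(1)]])
    then show ?thesis using y(1) by simp
  qed
  have const: "l (\<Psi> z) = l x" if z: "z \<in> ball (\<Phi> x) d" "z \<in> L" for z
  proof -
    let ?C = "ball (\<Phi> x) d \<inter> L"
    have "l (\<Psi> z) = l (\<Psi> (\<Phi> x))"
    proof -
      \<comment> \<open>The velocity of the image of the segment is tangent to \<open>N\<close>,
        hence in the span of the frame, where the derivative of \<open>l\<close> vanishes.\<close>
      have D: "((\<lambda>s. l (\<Psi> (\<Phi> x + s *\<^sub>R (z - \<Phi> x)))) has_vector_derivative 0) (at s)" if sI: "0 \<le> s" "s \<le> 1" for s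
      proof -
        let ?y = "\<Phi> x + s *\<^sub>R (z - \<Phi> x)"
        have "?y = (1 - s) *\<^sub>R \<Phi> x + s *\<^sub>R z" by (simp add: algebra_simps)
        moreover have "(1 - s) *\<^sub>R \<Phi> x + s *\<^sub>R z \<in> ball (\<Phi> x) d"
          by (rule convexD[OF convex_ball]) (use z d sI in auto)
        ultimately have y: "?y \<in> W \<inter> L"
          using d(2) \<Phi>x z(2) L by (auto simp: subspace_add subspace_diff subspace_scale)
        have w: "z - \<Phi> x \<in> L" using \<Phi>x z(2) L by (auto simp: subspace_diff)
        have yV: "\<Psi> ?y \<in> V" using \<Psi>N[OF y] N(2) by blast
        have "FD \<Psi> ?y (z - \<Phi> x) \<in> span ((\<lambda>i. r i (\<Psi> ?y)) ` {1..3})"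
          using chart_FD_tangent[OF U(3) h s(2) L M y w] tan[OF \<Psi>N[OF y]] by simp
        then obtain b where b: "FD \<Psi> ?y (z - \<Phi> x) = (\<Sum>i\<in>UNIV. b i *\<^sub>R r (idx i) (\<Psi> ?y))"
          unfolding image_idx by (rule span_range_sum)
        note dl = linear_FD[OF smooth_on_differentiable[OF l yV]]
        have "FD l (\<Psi> ?y) (FD \<Psi> ?y (z - \<Phi> x)) = 0"
          unfolding b using zero[OF yV idx_range] by (simp add: linear_sum[OF dl] linear_scale[OF dl])
        moreover have "((\<lambda>s. \<Psi> (\<Phi> x + s *\<^sub>R (z - \<Phi> x))) has_vector_derivative FD \<Psi> ?y (z - \<Phi> x)) (at s)"
          by (rule FD_along_line, rule smooth_on_differentiable[OF s(2)]) (use y in simp)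
        ultimately show ?thesis
          using has_vector_derivative_FD_compose[of "\<lambda>s. \<Psi> (\<Phi> x + s *\<^sub>R (z - \<Phi> x))" "FD \<Psi> ?y (z - \<Phi> x)" s l]
            smooth_on_differentiable[OF l yV] by simp
      qed
      have "(\<lambda>s. l (\<Psi> (\<Phi> x + s *\<^sub>R (z - \<Phi> x))) - l (\<Psi> (\<Phi> x))) 1 = 0"
        by (rule gronwall_zero[where f="\<lambda>s. l (\<Psi> (\<Phi> x + s *\<^sub>R (z - \<Phi> x))) - l (\<Psi> (\<Phi> x))" and f'="\<lambda>_. 0" and C=0])
          (use has_vector_derivative_diff[OF D has_vector_derivative_const] in auto)
      then show ?thesis by simp
    qed
    then show ?thesis using hU(1)[OF U(2)] by simp
  qed
  have "open (U \<inter> \<Phi> -` ball (\<Phi> x) d)" by (rule continuous_open_preimage[OF hU(2) U(1) open_ball])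
  then have "openin (top_of_set N) (N \<inter> (U \<inter> \<Phi> -` ball (\<Phi> x) d))" by (rule openin_open_Int)
  moreover have lx: "l y = l x" if "y \<in> N \<inter> (U \<inter> \<Phi> -` ball (\<Phi> x) d)" for y
  proof -
    have "\<Phi> y \<in> W \<inter> L" unfolding M[symmetric] using that by simp
    then show ?thesis using const[of "\<Phi> y"] that hU(1)[of y] by simp
  qed
  moreover have "x \<in> N \<inter> (U \<inter> \<Phi> -` ball (\<Phi> x) d)" using x U(2) d(1) by simp
  ultimately show "\<exists>T. openin (top_of_set N) T \<and> x \<in> T \<and> (\<forall>y\<in>T. l y = l x)"
    by (intro exI[of _ "N \<inter> (U \<inter> \<Phi> -` ball (\<Phi> x) d)"] conjI ballI)
qed

section \<open>Distinct real eigenvalues\<close>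

text \<open>Applying \<open>A\<close> minus \<open>e0\<close> to the relation removes the term of
  \<open>e0\<close> and multiplies each remaining coefficient by the nonzero number
  \<open>e - e0\<close>.\<close>

lemma eigenvectors_independent:
  fixes A :: "'a::real_vector \<Rightarrow> 'a"
  assumes "linear A" "finite F" "\<And>e. e \<in> F \<Longrightarrow> A (v e) = e *\<^sub>R v e" "\<And>e. e \<in> F \<Longrightarrow> v e \<noteq> 0"
    "(\<Sum>e\<in>F. c e *\<^sub>R v e) = 0" "e \<in> F"
  shows "c e = 0"
  using assms(2-)
proof (induction F arbitrary: c e rule: finite_induct)
  case (insert e0 F)
  interpret linear A by fact
  have "A (\<Sum>e\<in>insert e0 F. c e *\<^sub>R v e) - e0 *\<^sub>R (\<Sum>e\<in>insert e0 F. c e *\<^sub>R v e) = (\<Sum>e\<in>insert e0 F. (c e * (e - e0)) *\<^sub>R v e)"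
    unfolding sum scale scaleR_sum_right sum_subtractf[symmetric]
    by (rule sum.cong) (simp_all add: insert.prems(1) algebra_simps)
  then have "(\<Sum>e\<in>F. (c e * (e - e0)) *\<^sub>R v e) = 0" using insert.prems(3) insert.hyps by (simp add: zero)
  then have *: "c e * (e - e0) = 0" if "e \<in> F" for e
    using insert.IH[of "\<lambda>e. c e * (e - e0)" e] insert.prems that by blast
  have F0: "c e = 0" if "e \<in> F" for e
    using *[OF that] insert.hyps(2) that by auto
  then have "c e0 *\<^sub>R v e0 = 0" using insert.prems(3) insert.hyps by simp
  then have "c e0 = 0" using insert.prems(2)[of e0] by simp
  then show ?case using F0 insert.prems(4) by auto
qed simp

lemma eigenbasis:
  fixes A :: "'a::euclidean_space \<Rightarrow> 'a"
  assumes A: "linear A" and F: "finite F" "\<And>e. e \<in> F \<Longrightarrow> A (v e) = e *\<^sub>R v e" "\<And>e. e \<in> F \<Longrightarrow> v e \<noteq> 0"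
  shows "inj_on v F" "independent (v ` F)" "card F \<le> DIM('a)"
proof -
  show inj: "inj_on v F"
  proof (rule inj_onI)
    fix e e' assume e: "e \<in> F" "e' \<in> F" "v e = v e'"
    have "e' *\<^sub>R v e' = e *\<^sub>R v e'" using F(2)[OF e(1)] unfolding e(3) F(2)[OF e(2)] .
    then show "e = e'" using F(3)[OF e(2)] by simp
  qed
  show ind: "independent (v ` F)"
  proof (rule independent_if_scalars_zero)
    fix f x assume *: "(\<Sum>x\<in>v ` F. f x *\<^sub>R x) = 0" and "x \<in> v ` F"
    from \<open>x \<in> v ` F\<close> obtain e where e: "x = v e" "e \<in> F" by (rule imageE)
    have "(\<Sum>e\<in>F. f (v e) *\<^sub>R v e) = 0" using * unfolding sum.reindex[OF inj] o_def .
    from eigenvectors_independent[OF A F(1,2,3) this e(2)] show "f x = 0" unfolding e(1) .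
  qed (simp add: F(1))
  show "card F \<le> DIM('a)" using independent_bound[OF ind] card_image[OF inj] by simp
qed

lemma finite_eigenvalues:
  fixes A :: "'a::euclidean_space \<Rightarrow> 'a"
  assumes A: "linear A"
  shows "finite {e. \<exists>v. v \<noteq> 0 \<and> A v = e *\<^sub>R v}" "card {e. \<exists>v. v \<noteq> 0 \<and> A v = e *\<^sub>R v} \<le> DIM('a)"
proof -
  let ?E = "{e. \<exists>v. v \<noteq> 0 \<and> A v = e *\<^sub>R v}"
  have "\<forall>e\<in>?E. \<exists>v. v \<noteq> 0 \<and> A v = e *\<^sub>R v" by simp
  from bchoice[OF this] obtain v where v: "\<And>e. e \<in> ?E \<Longrightarrow> v e \<noteq> 0 \<and> A (v e) = e *\<^sub>R v e" by blast
  have bound: "card F \<le> DIM('a)" if "finite F" "F \<subseteq> ?E" for F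
    by (rule eigenbasis(3)[OF A that(1), of v]) (use v that in blast)+
  show fin: "finite ?E"
  proof (rule ccontr)
    assume "infinite ?E"
    then obtain F where "F \<subseteq> ?E" "finite F" "card F = Suc (DIM('a))" using infinite_arbitrarily_large by blast
    then show False using bound[of F] by simp
  qed
  show "card ?E \<le> DIM('a)" by (rule bound[OF fin]) simp
qed

text \<open>With as many eigenvalues as dimensions the eigenvectors form a basis and every
  eigenspace is a line, which cannot contain two independent vectors.\<close>

lemma multiple_eigenvalue_card:
  fixes A :: "'a::euclidean_space \<Rightarrow> 'a"
  assumes A: "linear A" and x: "A x = l *\<^sub>R x" and y: "A y = l *\<^sub>R y"
    and ind: "\<And>a b. a *\<^sub>R x + b *\<^sub>R y = 0 \<Longrightarrow> a = 0 \<and> b = 0"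
  shows "card {e. \<exists>v. v \<noteq> 0 \<and> A v = e *\<^sub>R v} \<noteq> DIM('a)"
proof
  define E where "E = {e. \<exists>v. v \<noteq> 0 \<and> A v = e *\<^sub>R v}"
  assume "card {e. \<exists>v. v \<noteq> 0 \<and> A v = e *\<^sub>R v} = DIM('a)"
  then have card: "card E = DIM('a)" by (simp only: E_def)
  have fin: "finite E" unfolding E_def by (rule finite_eigenvalues(1)[OF A])
  have "\<forall>e\<in>E. \<exists>v. v \<noteq> 0 \<and> A v = e *\<^sub>R v" by (simp add: E_def)
  from bchoice[OF this] obtain v where v: "\<And>e. e \<in> E \<Longrightarrow> v e \<noteq> 0" "\<And>e. e \<in> E \<Longrightarrow> A (v e) = e *\<^sub>R v e" by blast
  note basis = eigenbasis[OF A fin v(2) v(1)]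
  have "x \<noteq> 0" using ind[of 1 0] by auto
  then have l: "l \<in> E" using x by (auto simp: E_def)
  have "card (v ` E) = DIM('a)" using card_image[OF basis(1)] card by simp
  then have span: "span (v ` E) = UNIV"
    using card_ge_dim_independent[of "v ` E" UNIV] basis(2) by auto
  interpret linear A by fact
  have multiple: "\<exists>c. z = c *\<^sub>R v l" if z: "A z = l *\<^sub>R z" for z
  proof -
    have "z \<in> span (v ` E)" unfolding span by simp
    then obtain u where "z = (\<Sum>w\<in>v ` E. u w *\<^sub>R w)" using span_finite[of "v ` E"] fin by auto
    then have zu: "z = (\<Sum>e\<in>E. u (v e) *\<^sub>R v e)" by (simp add: sum.reindex[OF basis(1)])
    have "A z - l *\<^sub>R z = (\<Sum>e\<in>E. (u (v e) * (e - l)) *\<^sub>R v e)"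
      unfolding zu sum scale scaleR_sum_right sum_subtractf[symmetric]
      by (rule sum.cong) (simp_all add: v(2) algebra_simps)
    then have "(\<Sum>e\<in>E. (u (v e) * (e - l)) *\<^sub>R v e) = 0" using z by simp
    from eigenvectors_independent[OF A fin v(2) v(1) this]
    have "u (v e) = 0" if "e \<in> E" "e \<noteq> l" for e using that by fastforce
    then have "z = (\<Sum>e\<in>E. if e = l then u (v l) *\<^sub>R v l else 0)"
      by (subst zu) (rule sum.cong, auto)
    then have "z = u (v l) *\<^sub>R v l" using fin l by simp
    then show ?thesis by blast
  qed
  obtain a b where ab: "x = a *\<^sub>R v l" "y = b *\<^sub>R v l" using multiple[OF x] multiple[OF y] by blast
  have "b *\<^sub>R x + (- a) *\<^sub>R y = 0" by (simp add: ab)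
  from ind[OF this] have "a = 0" by simp
  with ab(1) \<open>x \<noteq> 0\<close> show False by simp
qed

section \<open>Persistence of simple real eigenvalues\<close>

lemma matrix_apply:
  fixes A :: "real^'n \<Rightarrow> real^'n"
  assumes "linear A"
  shows "matrix A *v x = A x"
proof -
  have "A x = A (\<Sum>k\<in>UNIV. x $ k *\<^sub>R axis k 1)" by (simp only: sum_scaleR_axis)
  also have "\<dots> = (\<Sum>k\<in>UNIV. x $ k *\<^sub>R A (axis k 1))"
    by (simp add: linear_sum[OF assms] linear_scale[OF assms])
  finally show ?thesis by (simp add: vec_eq_iff matrix_vector_mult_def matrix_def mult.commute)
qed

lemma eigenvalue_iff_det:
  fixes A :: "real^'n \<Rightarrow> real^'n"
  assumes "linear A"
  shows "(\<exists>v. v \<noteq> 0 \<and> A v = e *\<^sub>R v) \<longleftrightarrow> det (matrix A - mat e) = 0"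
proof -
  have "(matrix A - mat e) *v v = A v - e *\<^sub>R v" for v
  proof -
    have "mat e *v v = e *\<^sub>R v" by (simp add: vec_eq_iff matrix_vector_mult_def mat_def if_distrib if_distribR cong: if_cong)
    then show ?thesis by (simp add: matrix_vector_mult_diff_rdistrib matrix_apply[OF assms])
  qed
  then have "(\<exists>v. v \<noteq> 0 \<and> A v = e *\<^sub>R v) \<longleftrightarrow> \<not> (\<forall>v. (matrix A - mat e) *v v = 0 \<longrightarrow> v = 0)" by auto
  also have "\<dots> \<longleftrightarrow> det (matrix A - mat e) = 0"
    using matrix_left_invertible_ker[of "matrix A - mat e"] invertible_det_nz[of "matrix A - mat e"] invertible_left_inverse by blast
  finally show ?thesis .
qed

text \<open>The matrix \<open>S\<close> of eigenvectors conjugates \<open>A\<close> to a diagonal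
  matrix, whose determinant is the stated product.\<close>

lemma characteristic_determinant:
  fixes A :: "real^'n \<Rightarrow> real^'n"
  assumes A: "linear A" and F: "finite F" "card F = CARD('n)" "\<And>e. e \<in> F \<Longrightarrow> \<exists>v. v \<noteq> 0 \<and> A v = e *\<^sub>R v"
  shows "det (matrix A - mat x) = (\<Prod>e\<in>F. e - x)"
proof -
  have "\<forall>e\<in>F. \<exists>v. v \<noteq> 0 \<and> A v = e *\<^sub>R v" using F(3) by simp
  from bchoice[OF this] obtain v where v: "\<And>e. e \<in> F \<Longrightarrow> v e \<noteq> 0" "\<And>e. e \<in> F \<Longrightarrow> A (v e) = e *\<^sub>R v e" by blast
  obtain b :: "'n \<Rightarrow> real" where b: "bij_betw b UNIV F" using finite_same_card_bij[of "UNIV :: 'n set" F] F by auto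
  have bF: "b i \<in> F" for i using b by (auto simp: bij_betw_def)
  define S :: "real^'n^'n" where "S = (\<chi> i j. v (b j) $ i)"
  define D :: "real^'n^'n" where "D = (\<chi> i j. if i = j then b i - x else 0)"
  have S: "S *v z = (\<Sum>j\<in>UNIV. z $ j *\<^sub>R v (b j))" for z
    by (simp add: S_def matrix_vector_mult_def vec_eq_iff mult.commute)
  have "inj ((*v) S)"
  proof (rule linear_injective_0[OF matrix_vector_mul_linear, THEN iffD2], intro allI impI)
    fix z assume "S *v z = 0"
    moreover have "(\<Sum>j\<in>UNIV. z $ j *\<^sub>R v (b j)) = (\<Sum>j\<in>UNIV. z $ (inv b (b j)) *\<^sub>R v (b j))"
      by (rule sum.cong) (simp_all add: inv_f_f[OF bij_betw_imp_inj_on[OF b]])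
    moreover have "\<dots> = (\<Sum>e\<in>F. z $ (inv b e) *\<^sub>R v e)"
      by (rule sum.reindex_bij_betw[OF b])
    ultimately have z0: "(\<Sum>e\<in>F. z $ (inv b e) *\<^sub>R v e) = 0" unfolding S by simp
    have "z $ (inv b (b i)) = 0" for i
      by (rule eigenvectors_independent[OF A F(1) v(2) v(1) z0 bF])
    then have "z $ i = 0" for i by (simp add: inv_f_f[OF bij_betw_imp_inj_on[OF b]])
    then show "z = 0" by (simp add: vec_eq_iff)
  qed
  then have detS: "det S \<noteq> 0"
    using invertible_det_nz[of S] matrix_left_invertible_injective[of S] invertible_left_inverse by blast
  have "(matrix A - mat x) ** S = S ** D"
  proof -
    have "((matrix A - mat x) ** S) *v axis j 1 = (S ** D) *v axis j 1" for j
    proof -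
      have mx: "mat x *v z = x *\<^sub>R z" for z :: "real^'n"
        by (simp add: vec_eq_iff matrix_vector_mult_def mat_def if_distrib if_distribR cong: if_cong)
      have Sj: "S *v axis j 1 = v (b j)" unfolding S by (simp add: sum_axis_scaleR)
      have "(D *v z) $ i = (b i - x) * z $ i" for z i
      proof -
        have "(D *v z) $ i = (\<Sum>k\<in>UNIV. if k = i then (b i - x) * z $ i else 0)"
          unfolding matrix_vector_mult_def vec_lambda_beta by (rule sum.cong) (auto simp: D_def)
        then show ?thesis by simp
      qed
      then have Dj: "D *v axis j 1 = (b j - x) *\<^sub>R axis j 1"
        by (simp add: vec_eq_iff axis_def)
      have "((matrix A - mat x) ** S) *v axis j 1 = (b j - x) *\<^sub>R v (b j)"
        by (simp add: matrix_vector_mul_assoc[symmetric] Sj matrix_vector_mult_diff_rdistrib matrix_apply[OF A] mx v(2)[OF bF] algebra_simps)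
      also have "\<dots> = (S ** D) *v axis j 1"
        by (simp add: matrix_vector_mul_assoc[symmetric] Dj Sj matrix_vector_mult_scaleR)
      finally show ?thesis .
    qed
    then show ?thesis
      by (simp add: vec_eq_iff matrix_vector_mult_basis column_def)
  qed
  then have "det (matrix A - mat x) * det S = det S * det D" unfolding det_mul[symmetric] by (rule arg_cong)
  then have "det (matrix A - mat x) = det D" using detS by (simp only: mult.commute[of "det S"] mult_right_cancel[OF detS])
  also have "\<dots> = (\<Prod>i\<in>UNIV. D $ i $ i)" by (rule det_diagonal) (simp add: D_def)
  also have "\<dots> = (\<Prod>i\<in>UNIV. b i - x)" by (simp add: D_def)
  also have "\<dots> = (\<Prod>e\<in>F. e - x)" by (rule prod.reindex_bij_betw[OF b])
  finally show ?thesis .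
qed

text \<open>At \<open>p\<close> the characteristic determinant changes sign across every eigenvalue.
  The sign changes persist at nearby points by continuity, and the intermediate value theorem
  produces a real root close to each old one.\<close>

lemma distinct_eigenvalues_open:
  fixes f :: "real^'n \<Rightarrow> real^'n"
  assumes U: "open U" "p \<in> U" and f: "smooth_on U f"
    and F: "F \<subseteq> {e. \<exists>v. v \<noteq> 0 \<and> FD f p v = e *\<^sub>R v}" "card F = CARD('n)"
  shows "\<forall>\<^sub>F u in nhds p. card {e. \<exists>v. v \<noteq> 0 \<and> FD f u v = e *\<^sub>R v} = CARD('n)"
proof -
  have lin: "linear (FD f u)" if "u \<in> U" for u by (rule linear_FD[OF smooth_on_differentiable[OF f that]])
  have finF: "finite F" using F(2) card.infinite by fastforce
  define q where "q u x = det (matrix (FD f u) - mat x)" for u x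
  have qp: "q p x = (\<Prod>e\<in>F. e - x)" for x
    unfolding q_def by (rule characteristic_determinant[OF lin[OF U(2)] finF F(2)]) (use F(1) in auto)
  have q0: "(\<exists>v. v \<noteq> 0 \<and> FD f u v = e *\<^sub>R v) \<longleftrightarrow> q u e = 0" if "u \<in> U" for u e
    unfolding q_def by (rule eigenvalue_iff_det[OF lin[OF that]])
  define G where "G = {\<bar>e - e'\<bar> |e e'. e \<in> F \<and> e' \<in> F \<and> e \<noteq> e'}"
  have "finite G"
  proof (rule finite_subset)
    show "G \<subseteq> (\<lambda>q. \<bar>fst q - snd q\<bar>) ` (F \<times> F)" by (force simp: G_def)
    show "finite ((\<lambda>q. \<bar>fst q - snd q\<bar>) ` (F \<times> F))" using finF by simp
  qed
  \<comment> \<open>At most half the smallest gap between eigenvalues, so that the open intervals of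
    radius \<open>\<delta>\<close> around them are disjoint. Inserting 1 keeps the minimum defined
    when there is only one eigenvalue.\<close>
  define \<delta> where "\<delta> = Min (insert 1 G) / 2"
  have d0: "\<delta> > 0" using \<open>finite G\<close> by (auto simp: \<delta>_def G_def)
  have gap: "2 * \<delta> \<le> \<bar>e - e'\<bar>" if "e \<in> F" "e' \<in> F" "e \<noteq> e'" for e e'
  proof -
    have "\<bar>e - e'\<bar> \<in> insert 1 G" using that by (auto simp: G_def)
    then show ?thesis using \<open>finite G\<close> by (simp add: \<delta>_def Min_le)
  qed
  \<comment> \<open>For every other eigenvalue the two factors at \<open>e - \<delta>\<close> and
    \<open>e + \<delta>\<close> have the same sign; only the pair belonging to \<open>e\<close>
    itself contributes a negative product.\<close>
  have sign: "q p (e - \<delta>) * q p (e + \<delta>) < 0" if e: "e \<in> F" for e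
  proof -
    have "q p (e - \<delta>) * q p (e + \<delta>) = (\<Prod>e'\<in>F. (e' - (e - \<delta>)) * (e' - (e + \<delta>)))" by (simp add: qp prod.distrib)
    also have "\<dots> = (e - (e - \<delta>)) * (e - (e + \<delta>)) * (\<Prod>e'\<in>F - {e}. (e' - (e - \<delta>)) * (e' - (e + \<delta>)))"
      by (rule prod.remove[OF finF e])
    also have "\<dots> < 0"
    proof -
      have "0 < (\<Prod>e'\<in>F - {e}. (e' - (e - \<delta>)) * (e' - (e + \<delta>)))"
      proof (rule prod_pos)
        fix e' assume "e' \<in> F - {e}"
        then have "2 * \<delta> \<le> \<bar>e' - e\<bar>" using gap e by auto
        then have "(e' - (e - \<delta>) > 0 \<and> e' - (e + \<delta>) > 0) \<or> (e' - (e - \<delta>) < 0 \<and> e' - (e + \<delta>) < 0)"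
          using d0 by (auto simp: abs_if split: if_splits)
        then show "0 < (e' - (e - \<delta>)) * (e' - (e + \<delta>))" by (auto intro: mult_neg_neg)
      qed
      moreover have "(e - (e - \<delta>)) * (e - (e + \<delta>)) < 0" using d0 by (simp add: mult_pos_neg)
      ultimately show ?thesis by (simp add: mult_neg_pos)
    qed
    finally show ?thesis .
  qed
  have sq: "smooth_on U (\<lambda>u. q u x)" for x
    unfolding q_def
  proof (rule smooth_on_det[OF U(1)])
    fix i j
    have "smooth_on U (\<lambda>u. FD f u (axis j 1) $ i - mat x $ i $ j)"
      by (intro smooth_on_diff smooth_on_vec_nth smooth_on_FD_const f smooth_on_const U(1))
    then show "smooth_on U (\<lambda>u. (matrix (FD f u) - mat x) $ i $ j)" by (simp add: matrix_def)
  qed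
  have near: "\<forall>\<^sub>F u in nhds p. q u (e - \<delta>) * q u (e + \<delta>) < 0" if e: "e \<in> F" for e
  proof -
    have "continuous_on U (\<lambda>u. q u (e - \<delta>) * q u (e + \<delta>))"
      by (intro continuous_on_mult smooth_on_continuous_on sq)
    then have "open (U \<inter> (\<lambda>u. q u (e - \<delta>) * q u (e + \<delta>)) -` {..<0})"
      by (rule continuous_open_preimage[OF _ U(1)]) simp
    from eventually_nhds_in_open[OF this, of p] sign[OF e] U(2)
    show ?thesis by (auto elim!: eventually_mono)
  qed
  have "\<forall>\<^sub>F u in nhds p. \<forall>e\<in>F. q u (e - \<delta>) * q u (e + \<delta>) < 0"
    by (rule eventually_ball_finite[OF finF]) (use near in blast)
  moreover have "\<forall>\<^sub>F u in nhds p. u \<in> U" by (rule eventually_nhds_in_open[OF U])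
  ultimately show ?thesis
  proof eventually_elim
    case (elim u)
    have "\<exists>x. e - \<delta> < x \<and> x < e + \<delta> \<and> q u x = 0" if e: "e \<in> F" for e
    proof -
      have cont: "continuous_on T (q u)" for T
      proof -
        have "smooth_on UNIV (\<lambda>x. det (matrix (FD f u) - mat x))"
        proof (rule smooth_on_det[OF open_UNIV])
          fix i j :: 'n
          have "smooth_on UNIV (\<lambda>x :: real. (mat x :: real^'n^'n) $ i $ j)"
            by (cases "i = j") (simp_all add: mat_def smooth_on_ident smooth_on_const)
          then have "smooth_on UNIV (\<lambda>x. matrix (FD f u) $ i $ j - mat x $ i $ j)"
            by (rule smooth_on_diff[OF open_UNIV smooth_on_const])
          then show "smooth_on UNIV (\<lambda>x. (matrix (FD f u) - mat x) $ i $ j)" by simp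
        qed
        then show ?thesis unfolding q_def[abs_def]
          by (rule continuous_on_subset[OF smooth_on_continuous_on subset_UNIV])
      qed
      have s: "q u (e - \<delta>) * q u (e + \<delta>) < 0" using elim(1) e by blast
      have "\<exists>x. e - \<delta> \<le> x \<and> x \<le> e + \<delta> \<and> q u x = 0"
      proof (cases "q u (e - \<delta>) < 0")
        case True
        then have "q u (e + \<delta>) > 0" using s by (simp add: mult_less_0_iff)
        then show ?thesis using IVT'[of "q u" "e - \<delta>" 0 "e + \<delta>"] True cont d0 by auto
      next
        case False
        then have "q u (e + \<delta>) < 0" "q u (e - \<delta>) > 0" using s by (auto simp: mult_less_0_iff)
        then show ?thesis using IVT2'[of "q u" "e + \<delta>" 0 "e - \<delta>"] cont d0 by auto
      qed
      then obtain x where x: "e - \<delta> \<le> x" "x \<le> e + \<delta>" "q u x = 0" by blast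
      have "x \<noteq> e - \<delta>"
      proof
        assume "x = e - \<delta>"
        then have "q u (e - \<delta>) = 0" using x(3) by (simp only:)
        then show False using s by simp
      qed
      moreover have "x \<noteq> e + \<delta>"
      proof
        assume "x = e + \<delta>"
        then have "q u (e + \<delta>) = 0" using x(3) by (simp only:)
        then show False using s by simp
      qed
      ultimately have "e - \<delta> < x \<and> x < e + \<delta>" using x(1,2) by linarith
      then show ?thesis using x(3) by blast
    qed
    then have "\<forall>e\<in>F. \<exists>x. e - \<delta> < x \<and> x < e + \<delta> \<and> q u x = 0" by blast
    from bchoice[OF this] obtain \<rho> where rho: "\<And>e. e \<in> F \<Longrightarrow> e - \<delta> < \<rho> e \<and> \<rho> e < e + \<delta> \<and> q u (\<rho> e) = 0" by blast
    have "inj_on \<rho> F"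
    proof (rule inj_onI, rule ccontr)
      fix e e' assume e: "e \<in> F" "e' \<in> F" "\<rho> e = \<rho> e'" "e \<noteq> e'"
      then show False using gap[of e e'] rho[of e] rho[of e'] by (auto simp: abs_if split: if_splits)
    qed
    then have "CARD('n) = card (\<rho> ` F)" using F(2) by (simp only: card_image)
    moreover have "\<rho> ` F \<subseteq> {e. \<exists>v. v \<noteq> 0 \<and> FD f u v = e *\<^sub>R v}"
      using rho q0[OF elim(2)] by (intro image_subsetI) simp
    then have "card (\<rho> ` F) \<le> card {e. \<exists>v. v \<noteq> 0 \<and> FD f u v = e *\<^sub>R v}"
      by (rule card_mono[OF finite_eigenvalues(1)[OF lin[OF elim(2)]]])
    ultimately have "CARD('n) \<le> card {e. \<exists>v. v \<noteq> 0 \<and> FD f u v = e *\<^sub>R v}" by simp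
    then show ?case using finite_eigenvalues(2)[OF lin[OF elim(2)]] by simp
  qed
qed

section \<open>The eigenfunctions of a flux\<close>

declare One_nat_def [simp del]

lemma sum_1_3: "sum f {1..3::nat} = f 1 + f 2 + (f 3 :: 'a::comm_monoid_add)"
proof -
  have "{1..3::nat} = {1, 2, 3}" by auto
  then show ?thesis by (simp add: add.assoc)
qed

lemma cases_1_3: "i \<in> {1..3::nat} \<Longrightarrow> i = 1 \<or> i = 2 \<or> i = 3"
  by auto

text \<open>The hypotheses are rephrased by derivatives of maps. Smoothness of \<open>c\<close> and
  \<open>\<Gamma>\<close> is supplied at the interpretation by
  \<open>smooth_span_coefficients\<close>.\<close>

locale frame3 =
  fixes \<Omega> :: "(real^'n) set" and r :: "nat \<Rightarrow> real^'n \<Rightarrow> real^'n"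
    and c \<Gamma> :: "nat \<Rightarrow> nat \<Rightarrow> nat \<Rightarrow> real^'n \<Rightarrow> real"
  assumes open_\<Omega>: "open \<Omega>" and frame: "partial_frame \<Omega> r {1..3}"
    and bracket_c: "\<And>i j u. i \<in> {1..3} \<Longrightarrow> j \<in> {1..3} \<Longrightarrow> u \<in> \<Omega> \<Longrightarrow> bracket (r i) (r j) u = (\<Sum>k=1..3. c i j k u *\<^sub>R r k u)"
    and nabla_\<Gamma>: "\<And>i j u. i \<in> {1..3} \<Longrightarrow> j \<in> {1..3} \<Longrightarrow> i \<noteq> j \<Longrightarrow> u \<in> \<Omega> \<Longrightarrow> FD (r j) u (r i u) = (\<Sum>k=1..3. \<Gamma> i j k u *\<^sub>R r k u)"
    and smooth_c: "\<And>i j k. i \<in> {1..3} \<Longrightarrow> j \<in> {1..3} \<Longrightarrow> k \<in> {1..3} \<Longrightarrow> smooth_on \<Omega> (c i j k)"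
    and smooth_\<Gamma>: "\<And>i j k. i \<in> {1..3} \<Longrightarrow> j \<in> {1..3} \<Longrightarrow> k \<in> {1..3} \<Longrightarrow> i \<noteq> j \<Longrightarrow> smooth_on \<Omega> (\<Gamma> i j k)"
    and c231: "\<And>u. u \<in> \<Omega> \<Longrightarrow> c 2 3 1 u \<noteq> 0"
    and \<Gamma>_nonzero: "\<And>u. u \<in> \<Omega> \<Longrightarrow> \<Gamma> 2 3 1 u \<noteq> 0" "\<And>u. u \<in> \<Omega> \<Longrightarrow> \<Gamma> 3 2 1 u \<noteq> 0"
begin

lemma smooth_r: "i \<in> {1..3} \<Longrightarrow> smooth_on \<Omega> (r i)"
  using frame by (simp add: partial_frame_def)

lemma coefficients_zero:
  assumes u: "u \<in> \<Omega>" and a: "(\<Sum>k=1..3. a k *\<^sub>R r k u) = 0" and k: "k \<in> {1..3}"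
  shows "a k = 0"
proof -
  have "(\<Sum>i\<in>(UNIV :: 3 set). a (idx i) *\<^sub>R r (idx i) u) = 0" using a by (simp add: sum_3 sum_1_3)
  then have "a (idx i) = 0" for i by (rule frame_independent[OF frame u, of "\<lambda>i. a (idx i)"])
  from this[of 1] this[of 2] this[of 3] cases_1_3[OF k] show ?thesis by auto
qed

text \<open>Symmetry of the connection, read off coefficientwise.\<close>

lemma c_eq:
  assumes "i \<in> {1..3}" "j \<in> {1..3}" "i \<noteq> j" "k \<in> {1..3}" "u \<in> \<Omega>"
  shows "c i j k u = \<Gamma> i j k u - \<Gamma> j i k u"
proof -
  have "(\<Sum>k=1..3. (c i j k u - (\<Gamma> i j k u - \<Gamma> j i k u)) *\<^sub>R r k u) = 0"
    using bracket_c[OF assms(1,2,5)] nabla_\<Gamma>[OF assms(1,2,3,5)] nabla_\<Gamma>[OF assms(2,1) _ assms(5)] assms(3)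
    by (simp add: bracket_def scaleR_diff_left sum_subtractf)
  from coefficients_zero[OF assms(5) this assms(4)] show ?thesis by simp
qed

text \<open>Up to an additive multiple of \<open>(1, 1, 1)\<close>, the eigenvalues are a multiple of \<open>(\<alpha> 1, \<alpha> 2, \<alpha> 3)\<close>,
  which spans the kernel of the first row of \<open>A_lambda\<close> modulo \<open>(1, 1, 1)\<close>.\<close>

definition \<alpha> :: "nat \<Rightarrow> real^'n \<Rightarrow> real" where
  "\<alpha> j u = (if j = 1 then \<Gamma> 3 2 1 u / c 3 2 1 u else if j = 2 then 1 else 0)"

lemma \<alpha>_simps: "\<alpha> 2 = (\<lambda>_. 1)" "\<alpha> 3 = (\<lambda>_. 0)" "\<alpha> 1 = (\<lambda>u. \<Gamma> 3 2 1 u / c 3 2 1 u)"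
  by (auto simp: \<alpha>_def)

lemma c321:
  assumes "u \<in> \<Omega>"
  shows "c 3 2 1 u = \<Gamma> 3 2 1 u - \<Gamma> 2 3 1 u" "c 3 2 1 u = - c 2 3 1 u" "c 3 2 1 u \<noteq> 0"
  using c_eq[of 3 2 1 u] c_eq[of 2 3 1 u] c231[OF assms] assms by auto

text \<open>The two exclusions permit division by \<open>\<alpha> 1\<close> and by
  \<open>1 - \<alpha> 1\<close> when the derivatives of the eigenfunctions are solved for. They also
  keep \<open>\<alpha> 1\<close>, 1 and 0 distinct as eigenvalues.\<close>

lemma \<alpha>1: 
  assumes "u \<in> \<Omega>"
  shows "\<alpha> 1 u \<noteq> 0" "\<alpha> 1 u \<noteq> 1" "\<Gamma> 2 3 1 u / c 3 2 1 u = \<alpha> 1 u - 1"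
  using c321[OF assms] \<Gamma>_nonzero[OF assms] by (auto simp: \<alpha>_simps field_simps)

lemma smooth_\<alpha>: "j \<in> {1..3} \<Longrightarrow> smooth_on \<Omega> (\<alpha> j)"
  using cases_1_3[of j] smooth_on_divide[OF open_\<Omega> smooth_\<Gamma>[of 3 2 1] smooth_c[of 3 2 1]] c321(3)
  by (auto simp: \<alpha>_simps smooth_on_const)

abbreviation "\<phi> \<equiv> phi r c \<Gamma>"

lemma phi_simps:
  "\<phi> 1 2 u = \<Gamma> 2 1 2 u * \<Gamma> 2 3 1 u / c 3 2 1 u"
  "\<phi> 2 2 u = \<Gamma> 2 3 1 u / \<Gamma> 3 2 1 u * (\<Gamma> 3 2 3 u - \<Gamma> 1 2 1 u) - c 3 2 1 u / \<Gamma> 3 2 1 u * FD (\<alpha> 1) u (r 2 u)"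
  "\<phi> 3 2 u = - \<Gamma> 2 3 2 u"
  "\<phi> 1 3 u = \<Gamma> 3 1 3 u * \<Gamma> 3 2 1 u / c 3 2 1 u"
  "\<phi> 2 3 u = \<Gamma> 3 2 3 u"
  "\<phi> 3 3 u = \<Gamma> 3 2 1 u / \<Gamma> 2 3 1 u * (\<Gamma> 1 3 1 u - \<Gamma> 2 3 2 u) + c 3 2 1 u / \<Gamma> 2 3 1 u * FD (\<lambda>x. \<Gamma> 2 3 1 x / c 3 2 1 x) u (r 3 u)"
  by (simp_all add: phi_def along_def \<alpha>_simps)

lemma smooth_phi:
  assumes "i \<in> {1..3}" "s \<in> {2, 3}"
  shows "smooth_on \<Omega> (\<phi> i s)"
proof -
  note G = smooth_\<Gamma> and q = smooth_on_divide[OF open_\<Omega>] and m = smooth_on_mult[OF open_\<Omega>]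
  have C: "smooth_on \<Omega> (c 3 2 1)" by (rule smooth_c) simp_all
  have b: "smooth_on \<Omega> (\<lambda>u. \<Gamma> 2 3 1 u / c 3 2 1 u)" by (rule q[OF G C c321(3)]) simp_all
  have "smooth_on \<Omega> (\<lambda>u. \<phi> 1 2 u)" unfolding phi_simps by (intro q m G C c321(3)) simp_all
  moreover have "smooth_on \<Omega> (\<lambda>u. \<phi> 2 2 u)" unfolding phi_simps
    by (intro smooth_on_diff smooth_on_FD q m G C \<Gamma>_nonzero open_\<Omega> smooth_\<alpha> smooth_r) simp_all
  moreover have "smooth_on \<Omega> (\<lambda>u. \<phi> 3 2 u)" unfolding phi_simps by (intro smooth_on_minus G open_\<Omega>) simp_all
  moreover have "smooth_on \<Omega> (\<lambda>u. \<phi> 1 3 u)" unfolding phi_simps by (intro q m G C c321(3)) simp_all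
  moreover have "smooth_on \<Omega> (\<lambda>u. \<phi> 2 3 u)" unfolding phi_simps by (intro G) simp_all
  moreover have "smooth_on \<Omega> (\<lambda>u. \<phi> 3 3 u)" unfolding phi_simps
    by (intro smooth_on_add smooth_on_diff smooth_on_FD q m G C b \<Gamma>_nonzero open_\<Omega> smooth_r) simp_all
  ultimately show ?thesis using cases_1_3[OF assms(1)] assms(2) by auto
qed

text \<open>The identity from which the formulas in \<open>phi\<close> are solved. With
  \<open>w\<close> denoting the second minus the third eigenfunction, the left side times
  \<open>w\<close> is the derivative along \<open>r i\<close> of the third eigenfunction plus
  \<open>\<alpha> j * w\<close>, computed by the closed system; the right side times
  \<open>w\<close> is the value forced by flatness. For \<open>j\<close> equal to 2 or 3 it gives
  the entries with \<open>i \<noteq> s\<close>, and for \<open>j\<close> equal to 1 the remaining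
  \<open>\<phi> 2 2\<close> and \<open>\<phi> 3 3\<close>.\<close>

lemma phi_identity:
  assumes i: "i \<in> {1..3}" and j: "j \<in> {1..3}" and ij: "i \<noteq> j" and u: "u \<in> \<Omega>"
  shows "\<phi> i 3 u + FD (\<alpha> j) u (r i u) + \<alpha> j u * (\<phi> i 2 u - \<phi> i 3 u) = \<Gamma> j i j u * (\<alpha> i u - \<alpha> j u)"
proof -
  have FDb: "FD (\<lambda>x. \<Gamma> 2 3 1 x / c 3 2 1 x) u v = FD (\<alpha> 1) u v" for v
  proof -
    have "FD (\<lambda>x. \<Gamma> 2 3 1 x / c 3 2 1 x) u = FD (\<lambda>x. \<alpha> 1 x - 1) u"
      by (rule FD_cong_open[OF open_\<Omega> u]) (rule \<alpha>1(3))
    also have "\<dots> = (\<lambda>v. FD (\<alpha> 1) u v - 0)"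
      by (rule FD_eq[OF has_derivative_diff[OF smooth_on_has_derivative[OF smooth_\<alpha> u] has_derivative_const]]) simp
    finally show ?thesis by simp
  qed
  note nz = c321(3)[OF u] \<Gamma>_nonzero[OF u]
  have a: "\<alpha> 1 u = \<Gamma> 3 2 1 u / c 3 2 1 u" by (simp add: \<alpha>_simps)
  consider "i = 1" "j = 2" | "i = 1" "j = 3" | "i = 2" "j = 1" | "i = 2" "j = 3" | "i = 3" "j = 1" | "i = 3" "j = 2"
    using cases_1_3[OF i] cases_1_3[OF j] ij by auto
  then show ?thesis
  proof cases
    case 1
    have "\<phi> 1 2 u = \<Gamma> 2 1 2 u * (\<alpha> 1 u - 1)" unfolding phi_simps \<alpha>1(3)[OF u, symmetric] by simp
    with 1 show ?thesis by (simp add: \<alpha>_simps(1,2))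
  next
    case 2
    then show ?thesis by (simp add: \<alpha>_simps(1,2) phi_simps a)
  next
    case 3
    let ?F = "FD (\<alpha> 1) u (r 2 u)"
    have "\<alpha> 1 u * \<phi> 2 2 u = (\<alpha> 1 u - 1) * (\<Gamma> 3 2 3 u - \<Gamma> 1 2 1 u) - ?F"
      unfolding \<alpha>1(3)[OF u, symmetric] unfolding phi_simps(2) a using nz by (simp add: right_diff_distrib)
    with 3 show ?thesis by (simp add: \<alpha>_simps(1,2) phi_simps(5) algebra_simps)
  next
    case 4
    then show ?thesis by (simp add: \<alpha>_simps(1,2) phi_simps)
  next
    case 5
    let ?F = "FD (\<alpha> 1) u (r 3 u)"
    have "(\<alpha> 1 u - 1) * \<phi> 3 3 u = \<alpha> 1 u * (\<Gamma> 1 3 1 u - \<Gamma> 2 3 2 u) + ?F"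
      unfolding \<alpha>1(3)[OF u, symmetric] unfolding phi_simps(6) FDb a using nz by (simp add: distrib_left)
    with 5 show ?thesis by (simp add: \<alpha>_simps(1,2) phi_simps(3) algebra_simps)
  next
    case 6
    then show ?thesis by (simp add: \<alpha>_simps(1,2) phi_simps)
  qed
qed

lemma sum_if_scaleR:
  assumes "j \<in> {1..3::nat}"
  shows "(\<Sum>k=1..3. (if k = j then x else 0) *\<^sub>R r k u) = x *\<^sub>R r j u"
  using cases_1_3[OF assms] by (auto simp: sum_1_3)

text \<open>Compare the coefficients of the frame in the identity expressing the bracket of
  \<open>r i\<close> and \<open>r j\<close>, applied to \<open>f\<close>, as a commutator of
  derivatives. The coefficient of \<open>r j\<close> gives the differential relation; the
  coefficient of the third field gives an algebraic one, a row of \<open>A_lambda\<close>.\<close>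

lemma flux_relations:
  assumes U: "open U" "U \<subseteq> \<Omega>" and f: "smooth_on U f" and lam: "\<And>i. i \<in> {1..3} \<Longrightarrow> smooth_on U (lam i)"
    and flux: "\<And>i u. i \<in> {1..3} \<Longrightarrow> u \<in> U \<Longrightarrow> FD f u (r i u) = lam i u *\<^sub>R r i u"
    and ij: "i \<in> {1..3}" "j \<in> {1..3}" "i \<noteq> j" and u: "u \<in> U"
  shows "FD (lam j) u (r i u) = \<Gamma> j i j u * (lam i u - lam j u)"
    and "k \<in> {1..3} \<Longrightarrow> k \<noteq> i \<Longrightarrow> k \<noteq> j \<Longrightarrow> lam j u * \<Gamma> i j k u - lam i u * \<Gamma> j i k u = c i j k u * lam k u"
proof -
  have u\<Omega>: "u \<in> \<Omega>" using u U by blast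
  have sr: "smooth_on U (r i)" if "i \<in> {1..3}" for i using smooth_on_subset[OF smooth_r[OF that] U(2)] .
  have D: "FD (\<lambda>y. FD f y (r j y)) u v = lam j u *\<^sub>R FD (r j) u v + FD (lam j) u v *\<^sub>R r j u" if j: "j \<in> {1..3}" for j v
  proof -
    have "FD (\<lambda>y. FD f y (r j y)) u = FD (\<lambda>y. lam j y *\<^sub>R r j y) u"
      by (rule FD_cong_open[OF U(1) u]) (rule flux[OF j])
    also have "\<dots> = (\<lambda>v. lam j u *\<^sub>R FD (r j) u v + FD (lam j) u v *\<^sub>R r j u)"
      by (rule FD_eq[OF has_derivative_scaleR[OF smooth_on_has_derivative[OF lam[OF j] u] smooth_on_has_derivative[OF sr[OF j] u]]])
    finally show ?thesis by simp
  qed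
  let ?a = "\<lambda>k. lam j u * \<Gamma> i j k u + (if k = j then FD (lam j) u (r i u) else 0)
    - (lam i u * \<Gamma> j i k u + (if k = i then FD (lam i) u (r j u) else 0)) - c i j k u * lam k u"
  have "(lam j u *\<^sub>R FD (r j) u (r i u) + FD (lam j) u (r i u) *\<^sub>R r j u) - (lam i u *\<^sub>R FD (r i) u (r j u) + FD (lam i) u (r j u) *\<^sub>R r i u)
      = FD f u (bracket (r i) (r j) u)"
    using FD_bracket[OF U(1) u f sr[OF ij(1)] sr[OF ij(2)]] D[OF ij(1)] D[OF ij(2)] by simp
  also have "\<dots> = (\<Sum>k=1..3. c i j k u *\<^sub>R FD f u (r k u))"
    using linear_FD[OF smooth_on_differentiable[OF f u]] bracket_c[OF ij(1,2) u\<Omega>] by (simp add: linear_sum linear_scale)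
  also have "\<dots> = (\<Sum>k=1..3. (c i j k u * lam k u) *\<^sub>R r k u)"
    by (rule sum.cong) (simp_all add: flux[OF _ u])
  finally have "(\<Sum>k=1..3. ?a k *\<^sub>R r k u) = 0"
    using nabla_\<Gamma>[OF ij u\<Omega>] nabla_\<Gamma>[OF ij(2,1) _ u\<Omega>] ij(3)
    by (simp only: scaleR_diff_left scaleR_add_left sum_subtractf sum.distrib sum_if_scaleR[OF ij(1)] sum_if_scaleR[OF ij(2)])
      (simp add: scaleR_sum_right algebra_simps)
  note a = coefficients_zero[OF u\<Omega> this]
  show "FD (lam j) u (r i u) = \<Gamma> j i j u * (lam i u - lam j u)"
    using a[OF ij(2)] ij c_eq[OF ij ij(2) u\<Omega>] by (simp add: algebra_simps)
  show "lam j u * \<Gamma> i j k u - lam i u * \<Gamma> j i k u = c i j k u * lam k u" if "k \<in> {1..3}" "k \<noteq> i" "k \<noteq> j"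
    using a[OF that(1)] that by simp
qed

text \<open>For \<open>i \<noteq> s\<close> the derivative is one of the relations of flatness. The
  two diagonal ones are not among them; they are recovered by differentiating the algebraic formula
  for \<open>lam 1\<close> along \<open>r i\<close>.\<close>

lemma eigenfunction_system:
  assumes U: "open U" "U \<subseteq> \<Omega>" and f: "smooth_on U f" and lam: "\<And>i. i \<in> {1..3} \<Longrightarrow> smooth_on U (lam i)"
    and flux: "\<And>i u. i \<in> {1..3} \<Longrightarrow> u \<in> U \<Longrightarrow> FD f u (r i u) = lam i u *\<^sub>R r i u"
  shows lam_\<alpha>: "\<And>j u. j \<in> {1..3} \<Longrightarrow> u \<in> U \<Longrightarrow> lam j u = lam 3 u + \<alpha> j u * (lam 2 u - lam 3 u)"
    and lam_\<phi>: "\<And>i s u. i \<in> {1..3} \<Longrightarrow> s \<in> {2, 3} \<Longrightarrow> u \<in> U \<Longrightarrow> FD (lam s) u (r i u) = \<phi> i s u * (lam 2 u - lam 3 u)"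
proof -
  note rel = flux_relations[where U=U and f=f and lam=lam, OF U f lam flux]
  have L1: "lam 1 u = lam 3 u + \<alpha> 1 u * (lam 2 u - lam 3 u)" if u: "u \<in> U" for u
  proof -
    have u\<Omega>: "u \<in> \<Omega>" using u U by blast
    have "lam 3 u * \<Gamma> 2 3 1 u - lam 2 u * \<Gamma> 3 2 1 u = c 2 3 1 u * lam 1 u"
      by (rule rel(2)) (use u in auto)
    then have "c 3 2 1 u * lam 1 u = c 3 2 1 u * (lam 3 u + \<alpha> 1 u * (lam 2 u - lam 3 u))"
      using c321[OF u\<Omega>] by (simp add: \<alpha>_simps field_simps)
    then show ?thesis using c321(3)[OF u\<Omega>] by simp
  qed
  show lam_\<alpha>: "lam j u = lam 3 u + \<alpha> j u * (lam 2 u - lam 3 u)" if "j \<in> {1..3}" "u \<in> U" for j u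
    using cases_1_3[OF that(1)] L1[OF that(2)] by (auto simp: \<alpha>_simps(1,2))
  fix i s :: nat and u assume i: "i \<in> {1..3}" and s: "s \<in> {2, 3 :: nat}" and u: "u \<in> U"
  have u\<Omega>: "u \<in> \<Omega>" using u U by blast
  let ?w = "lam 2 u - lam 3 u"
  have s3: "s \<in> {1..3}" using s by auto
  have R: "FD (lam j) u (r i u) = (\<phi> i 3 u + FD (\<alpha> j) u (r i u) + \<alpha> j u * (\<phi> i 2 u - \<phi> i 3 u)) * ?w" if j: "j \<in> {1..3}" "i \<noteq> j" for j
  proof -
    have "FD (lam j) u (r i u) = \<Gamma> j i j u * (lam i u - lam j u)" by (rule rel(1)) (use i j u in auto)
    also have "lam i u - lam j u = (\<alpha> i u - \<alpha> j u) * ?w"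
      using lam_\<alpha>[OF i u] lam_\<alpha>[OF j(1) u] by (simp add: algebra_simps)
    finally show ?thesis unfolding phi_identity[OF i j u\<Omega>] by simp
  qed
  have D1: "FD (lam 1) u v = FD (lam 3) u v + (\<alpha> 1 u * (FD (lam 2) u v - FD (lam 3) u v) + FD (\<alpha> 1) u v * ?w)" for v
  proof -
    have d: "(lam j has_derivative FD (lam j) u) (at u)" if "j \<in> {1..3}" for j
      using smooth_on_has_derivative[OF lam[OF that] u] .
    have a: "(\<alpha> 1 has_derivative FD (\<alpha> 1) u) (at u)" by (rule smooth_on_has_derivative[OF smooth_\<alpha> u\<Omega>]) simp
    have "FD (lam 1) u = FD (\<lambda>u. lam 3 u + \<alpha> 1 u * (lam 2 u - lam 3 u)) u"
      by (rule FD_cong_open[OF U(1) u]) (rule L1)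
    also have "\<dots> = (\<lambda>v. FD (lam 3) u v + (\<alpha> 1 u * (FD (lam 2) u v - FD (lam 3) u v) + FD (\<alpha> 1) u v * ?w))"
      by (rule FD_eq, intro has_derivative_add has_derivative_mult has_derivative_diff d a) simp_all
    finally show ?thesis by simp
  qed
  \<comment> \<open>In the diagonal cases the derivative of \<open>lam 1\<close> is known in two
    ways. Comparing them determines the missing derivative up to the factor
    \<open>\<alpha> 1\<close> or \<open>1 - \<alpha> 1\<close>, neither of which vanishes.\<close>
  consider "i \<noteq> s" | "i = 2" "s = 2" | "i = 3" "s = 3" using s by auto
  then show "FD (lam s) u (r i u) = \<phi> i s u * ?w"
  proof cases
    case 1
    then show ?thesis using R[OF s3 1] s by (auto simp: \<alpha>_simps(1,2))
  next
    case 2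
    have L: "FD (lam 3) u (r 2 u) = \<phi> 2 3 u * ?w" using R[of 3] 2 by (simp add: \<alpha>_simps(1,2))
    have "\<alpha> 1 u * FD (lam 2) u (r 2 u) = \<alpha> 1 u * (\<phi> 2 2 u * ?w)"
      using R[of 1] D1[of "r 2 u"] 2 unfolding L by (simp add: algebra_simps)
    then show ?thesis using \<alpha>1(1)[OF u\<Omega>] 2 by simp
  next
    case 3
    have L: "FD (lam 2) u (r 3 u) = \<phi> 3 2 u * ?w" using R[of 2] 3 by (simp add: \<alpha>_simps(1,2))
    have "(1 - \<alpha> 1 u) * FD (lam 3) u (r 3 u) = (1 - \<alpha> 1 u) * (\<phi> 3 3 u * ?w)"
      using R[of 1] D1[of "r 3 u"] 3 unfolding L by (simp add: algebra_simps)
    then show ?thesis using \<alpha>1(2)[OF u\<Omega>] 3 by simp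
  qed
qed

lemma FD_lam_difference:
  assumes "open U" "u \<in> U" "smooth_on U (lam 2)" "smooth_on U (lam (3 :: nat))" "smooth_on U (g :: real^'n \<Rightarrow> real)"
  shows "FD (\<lambda>u. g u * (lam 2 u - lam 3 u)) u v = g u * (FD (lam 2) u v - FD (lam 3) u v) + FD g u v * (lam 2 u - lam 3 u)"
  using FD_eq[OF has_derivative_mult[OF smooth_on_has_derivative[OF assms(5,2)]
      has_derivative_diff[OF smooth_on_has_derivative[OF assms(3,2)] smooth_on_has_derivative[OF assms(4,2)]]]] by simp

text \<open>Apply the bracket formula to \<open>lam s\<close> and insert the closed system twice.
  Every term carries the factor \<open>lam 2 - lam 3\<close>, and cancelling it leaves the
  condition.\<close>

lemma distinct_eigenfunctions_imp_conditions_C: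
  assumes U: "open U" "U \<subseteq> \<Omega>" and f: "smooth_on U f" and lam: "\<And>i. i \<in> {1..3} \<Longrightarrow> smooth_on U (lam i)"
    and flux: "\<And>i u. i \<in> {1..3} \<Longrightarrow> u \<in> U \<Longrightarrow> FD f u (r i u) = lam i u *\<^sub>R r i u"
    and u: "u \<in> U" and w: "lam 2 u \<noteq> lam 3 u"
  shows "conditions_C r c \<Gamma> u"
  unfolding conditions_C_def along_def
proof (intro allI impI)
  fix i j s :: nat assume "1 \<le> i \<and> i < j \<and> j \<le> 3 \<and> s \<in> {2, 3}"
  then have i: "i \<in> {1..3}" and j: "j \<in> {1..3}" and s: "s \<in> {2, 3}" and s3: "s \<in> {1..3}" by auto
  have u\<Omega>: "u \<in> \<Omega>" using u U by blast
  have sr: "smooth_on U (r i)" if "i \<in> {1..3}" for i using smooth_on_subset[OF smooth_r[OF that] U(2)] .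
  have sp: "smooth_on U (\<phi> i s)" if "i \<in> {1..3}" for i using smooth_on_subset[OF smooth_phi[OF that s] U(2)] .
  note L = eigenfunction_system(2)[where U=U and f=f and lam=lam, OF U f lam flux]
  let ?w = "lam 2 u - lam 3 u"
  have D: "FD (\<lambda>y. FD (lam s) y (r j y)) u (r i u) = \<phi> j s u * (\<phi> i 2 u * ?w - \<phi> i 3 u * ?w) + FD (\<phi> j s) u (r i u) * ?w"
    if i: "i \<in> {1..3}" and j: "j \<in> {1..3}" for i j
  proof -
    have "FD (\<lambda>y. FD (lam s) y (r j y)) u = FD (\<lambda>y. \<phi> j s y * (lam 2 y - lam 3 y)) u"
      by (rule FD_cong_open[OF U(1) u]) (use L j s in simp)
    then have "FD (\<lambda>y. FD (lam s) y (r j y)) u (r i u) = \<phi> j s u * (FD (lam 2) u (r i u) - FD (lam 3) u (r i u)) + FD (\<phi> j s) u (r i u) * ?w"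
      using FD_lam_difference[OF U(1) u lam[of 2] lam[of 3] sp[OF j]] by simp
    then show ?thesis using L[of i 2 u] L[of i 3 u] i u by simp
  qed
  have "FD (lam s) u (bracket (r i) (r j) u) = (\<Sum>k=1..3. c i j k u * (\<phi> k s u * ?w))"
  proof -
    note lin = linear_FD[OF smooth_on_differentiable[OF lam[OF s3] u]]
    have "FD (lam s) u (bracket (r i) (r j) u) = (\<Sum>k=1..3. c i j k u * FD (lam s) u (r k u))"
      unfolding bracket_c[OF i j u\<Omega>] by (simp add: linear_sum[OF lin] linear_scale[OF lin])
    also have "\<dots> = (\<Sum>k=1..3. c i j k u * (\<phi> k s u * ?w))"
      by (rule sum.cong) (use L s u in auto)
    finally show ?thesis .
  qed
  then have "\<phi> j s u * (\<phi> i 2 u * ?w - \<phi> i 3 u * ?w) + FD (\<phi> j s) u (r i u) * ?w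
      - (\<phi> i s u * (\<phi> j 2 u * ?w - \<phi> j 3 u * ?w) + FD (\<phi> i s) u (r j u) * ?w) = (\<Sum>k=1..3. c i j k u * \<phi> k s u) * ?w"
    using FD_bracket[OF U(1) u lam[OF s3] sr[OF i] sr[OF j]] D[OF i j] D[OF j i]
    by (simp add: sum_distrib_right mult.assoc)
  then have "(\<phi> j s u * (\<phi> i 2 u - \<phi> i 3 u) + FD (\<phi> j s) u (r i u)
      - (\<phi> i s u * (\<phi> j 2 u - \<phi> j 3 u) + FD (\<phi> i s) u (r j u))) * ?w = (\<Sum>k=1..3. c i j k u * \<phi> k s u) * ?w"
    by (simp add: algebra_simps)
  then have "\<phi> j s u * (\<phi> i 2 u - \<phi> i 3 u) + FD (\<phi> j s) u (r i u)
      - (\<phi> i s u * (\<phi> j 2 u - \<phi> j 3 u) + FD (\<phi> i s) u (r j u)) = (\<Sum>k=1..3. c i j k u * \<phi> k s u)"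
    using w by simp
  then show "FD (\<phi> j s) u (r i u) - FD (\<phi> i s) u (r j u)
      = \<phi> j 2 u * \<phi> i 3 u - \<phi> i 2 u * \<phi> j 3 u + (\<Sum>k=1..3. c i j k u * \<phi> k s u)"
    using s by (auto simp: algebra_simps)
qed

section \<open>The rank of the algebraic system\<close>

text \<open>The second and third rows of \<open>A_lambda\<close> annihilate the vector with entries
  \<open>\<alpha> 1 u\<close>, 1, 0. The first row does so by the choice of \<open>\<alpha>\<close>,
  and all rows annihilate (1, 1, 1) by symmetry of the connection. So this says that the kernel is
  at least two-dimensional.\<close>

definition row_relations :: "real^'n \<Rightarrow> bool" where
  "row_relations u \<longleftrightarrow> \<Gamma> 3 1 2 u * \<alpha> 1 u + c 1 3 2 u = 0 \<and> \<Gamma> 2 1 3 u * \<alpha> 1 u - \<Gamma> 1 2 3 u = 0"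

lemma distinct_eigenfunctions_imp_row_relations:
  assumes U: "open U" "U \<subseteq> \<Omega>" and f: "smooth_on U f" and lam: "\<And>i. i \<in> {1..3} \<Longrightarrow> smooth_on U (lam i)"
    and flux: "\<And>i u. i \<in> {1..3} \<Longrightarrow> u \<in> U \<Longrightarrow> FD f u (r i u) = lam i u *\<^sub>R r i u"
    and u: "u \<in> U" and w: "lam 2 u \<noteq> lam 3 u"
  shows "row_relations u"
proof -
  have u\<Omega>: "u \<in> \<Omega>" using u U by blast
  note rel = flux_relations(2)[where U=U and f=f and lam=lam, OF U f lam flux]
  have L1: "lam 1 u = lam 3 u + \<alpha> 1 u * (lam 2 u - lam 3 u)"
    by (rule eigenfunction_system(1)[where U=U and f=f, OF U f lam flux]) (use u in auto)
  let ?w = "lam 2 u - lam 3 u"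
  have "lam 3 u * \<Gamma> 1 3 2 u - lam 1 u * \<Gamma> 3 1 2 u = c 1 3 2 u * lam 2 u" by (rule rel) (use u in auto)
  then have "lam 3 u * (\<Gamma> 1 3 2 u - \<Gamma> 3 1 2 u) - \<Gamma> 3 1 2 u * \<alpha> 1 u * ?w = c 1 3 2 u * lam 2 u"
    by (simp add: L1 algebra_simps)
  moreover have c2: "\<Gamma> 1 3 2 u - \<Gamma> 3 1 2 u = c 1 3 2 u" by (rule c_eq[symmetric]) (use u\<Omega> in auto)
  ultimately have "(\<Gamma> 3 1 2 u * \<alpha> 1 u + c 1 3 2 u) * ?w = 0"
    unfolding c2 by (simp add: algebra_simps)
  then have 2: "\<Gamma> 3 1 2 u * \<alpha> 1 u + c 1 3 2 u = 0" using w by simp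
  have "lam 2 u * \<Gamma> 1 2 3 u - lam 1 u * \<Gamma> 2 1 3 u = c 1 2 3 u * lam 3 u" by (rule rel) (use u in auto)
  then have "(\<Gamma> 2 1 3 u * \<alpha> 1 u - \<Gamma> 1 2 3 u) * ?w = lam 3 u * (\<Gamma> 1 2 3 u - \<Gamma> 2 1 3 u) - c 1 2 3 u * lam 3 u"
    by (simp add: L1 algebra_simps)
  also have "\<Gamma> 1 2 3 u - \<Gamma> 2 1 3 u = c 1 2 3 u" by (rule c_eq[symmetric]) (use u\<Omega> in auto)
  finally have "\<Gamma> 2 1 3 u * \<alpha> 1 u - \<Gamma> 1 2 3 u = 0" using w by simp
  then show ?thesis using 2 by (simp add: row_relations_def)
qed

lemma A_lambda_nth:
  "A_lambda c \<Gamma> u $ 1 = vector [c 2 3 1 u, \<Gamma> 3 2 1 u, - \<Gamma> 2 3 1 u]"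
  "A_lambda c \<Gamma> u $ 2 = vector [\<Gamma> 3 1 2 u, c 1 3 2 u, - \<Gamma> 1 3 2 u]"
  "A_lambda c \<Gamma> u $ 3 = vector [\<Gamma> 2 1 3 u, - \<Gamma> 1 2 3 u, c 1 2 3 u]"
  by (simp_all add: A_lambda_def vector_3)

lemma rows_A: "rows (A_lambda c \<Gamma> u) = {A_lambda c \<Gamma> u $ 1, A_lambda c \<Gamma> u $ 2, A_lambda c \<Gamma> u $ 3}"
proof -
  have "rows (A_lambda c \<Gamma> u) = (\<lambda>i. A_lambda c \<Gamma> u $ i) ` UNIV" by (auto simp: rows_def row_def)
  then show ?thesis by (simp add: UNIV_3)
qed

lemma vec3_eq_iff: "x = y \<longleftrightarrow> x $ 1 = y $ 1 \<and> x $ 2 = y $ 2 \<and> x $ 3 = y $ (3 :: 3)" for x y :: "real^3"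
  by (simp add: vec_eq_iff forall_3)

text \<open>In rank 1 the second and third rows are multiples of the first, which is nonzero, and
  thus inherit its kernel.\<close>

lemma rank_1_imp_row_relations:
  assumes u: "u \<in> \<Omega>" and rank: "rank (A_lambda c \<Gamma> u) = 1"
  shows "row_relations u"
proof -
  let ?A = "A_lambda c \<Gamma> u"
  have nz: "?A $ 1 \<noteq> 0" using c231[OF u] by (simp add: vec3_eq_iff A_lambda_nth vector_3)
  have "dim (span {?A $ 1}) = 1" using nz by (simp add: dim_eq_card_independent)
  moreover have "dim (span (rows ?A)) = 1" using rank by (simp add: row_rank_def)
  ultimately have eq: "span {?A $ 1} = span (rows ?A)"
    by (intro subspace_dim_equal subspace_span span_mono) (simp_all add: rows_A)
  have mult: "\<exists>t. ?A $ k = t *\<^sub>R ?A $ 1" if "k = 2 \<or> k = 3" for k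
  proof -
    have "?A $ k \<in> span (rows ?A)" using that by (intro span_base) (auto simp: rows_A)
    then have "?A $ k \<in> span {?A $ 1}" by (simp only: eq)
    then show ?thesis by (auto simp: span_singleton)
  qed
  have a: "c 2 3 1 u * \<alpha> 1 u + \<Gamma> 3 2 1 u = 0" using c321[OF u] by (simp add: \<alpha>_simps field_simps)
  obtain t where "?A $ 2 = t *\<^sub>R ?A $ 1" using mult[of 2] by blast
  then have t: "\<Gamma> 3 1 2 u = t * c 2 3 1 u" "c 1 3 2 u = t * \<Gamma> 3 2 1 u"
    by (simp_all add: vec3_eq_iff A_lambda_nth vector_3)
  have 1: "\<Gamma> 3 1 2 u * \<alpha> 1 u + c 1 3 2 u = t * (c 2 3 1 u * \<alpha> 1 u + \<Gamma> 3 2 1 u)"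
    by (simp add: t algebra_simps)
  obtain t where "?A $ 3 = t *\<^sub>R ?A $ 1" using mult[of 3] by blast
  then have t: "\<Gamma> 2 1 3 u = t * c 2 3 1 u" "- \<Gamma> 1 2 3 u = t * \<Gamma> 3 2 1 u"
    by (simp_all add: vec3_eq_iff A_lambda_nth vector_3)
  have 2: "\<Gamma> 2 1 3 u * \<alpha> 1 u - \<Gamma> 1 2 3 u = t * (c 2 3 1 u * \<alpha> 1 u + \<Gamma> 3 2 1 u)"
    using t by (simp add: algebra_simps)
  show ?thesis using 1 2 unfolding a by (simp add: row_relations_def)
qed

text \<open>Together with the vanishing row sums the relations determine each row from its first
  entry, so all rows are multiples of the first.\<close>

lemma row_relations_imp_rank:
  assumes u: "u \<in> \<Omega>" and rel: "row_relations u"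
  shows "rank (A_lambda c \<Gamma> u) \<noteq> 2"
proof -
  let ?A = "A_lambda c \<Gamma> u"
  have a: "\<Gamma> 3 2 1 u = - c 2 3 1 u * \<alpha> 1 u" using c321[OF u] by (simp add: \<alpha>_simps field_simps)
  have c1: "c 2 3 1 u = \<Gamma> 2 3 1 u - \<Gamma> 3 2 1 u" by (rule c_eq) (use u in auto)
  have c2: "c 1 3 2 u = \<Gamma> 1 3 2 u - \<Gamma> 3 1 2 u" by (rule c_eq) (use u in auto)
  have c3: "c 1 2 3 u = \<Gamma> 1 2 3 u - \<Gamma> 2 1 3 u" by (rule c_eq) (use u in auto)
  have nz: "c 2 3 1 u \<noteq> 0" by (rule c231[OF u])
  have b: "\<Gamma> 2 3 1 u = c 2 3 1 u * (1 - \<alpha> 1 u)" using c1 a by (simp add: algebra_simps)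
  have 2: "?A $ 2 = (\<Gamma> 3 1 2 u / c 2 3 1 u) *\<^sub>R ?A $ 1"
  proof -
    have e: "c 1 3 2 u = - (\<Gamma> 3 1 2 u * \<alpha> 1 u)" using rel by (simp add: row_relations_def)
    have "\<Gamma> 1 3 2 u = \<Gamma> 3 1 2 u * (1 - \<alpha> 1 u)" using c2 e by (simp add: algebra_simps)
    then show ?thesis using nz by (simp add: vec3_eq_iff A_lambda_nth vector_3 a b e)
  qed
  have 3: "?A $ 3 = (\<Gamma> 2 1 3 u / c 2 3 1 u) *\<^sub>R ?A $ 1"
  proof -
    have e: "\<Gamma> 1 2 3 u = \<Gamma> 2 1 3 u * \<alpha> 1 u" using rel by (simp add: row_relations_def)
    have "c 1 2 3 u = - (\<Gamma> 2 1 3 u * (1 - \<alpha> 1 u))" using c3 e by (simp add: algebra_simps)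
    then show ?thesis using nz by (simp add: vec3_eq_iff A_lambda_nth vector_3 a b e)
  qed
  have "?A $ 1 \<in> span {?A $ 1}" by (rule span_base) simp
  then have "rows ?A \<subseteq> span {?A $ 1}" unfolding rows_A 2 3 by (auto intro: span_scale)
  then have "dim (rows ?A) \<le> dim (span {?A $ 1})" by (rule dim_subset)
  also have "\<dots> \<le> 1" using dim_le_card'[of "{?A $ 1}"] by simp
  finally show ?thesis by (simp add: row_rank_def)
qed

text \<open>The unknown \<open>y\<close> is \<open>(\<lambda>\<^sup>2, \<lambda>\<^sup>3, f)\<close> in the first system and \<open>(\<lambda>, f)\<close> in the second.\<close>

definition flux_system :: "nat \<Rightarrow> real^'n \<Rightarrow> real \<times> real \<times> (real^'n) \<Rightarrow> real \<times> real \<times> (real^'n)" where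
  "flux_system i u y = (\<phi> i 2 u * (fst y - fst (snd y)), \<phi> i 3 u * (fst y - fst (snd y)),
     (fst (snd y) + \<alpha> i u * (fst y - fst (snd y))) *\<^sub>R r i u)"

definition scalar_flux_system :: "nat \<Rightarrow> real^'n \<Rightarrow> real \<times> (real^'n) \<Rightarrow> real \<times> (real^'n)" where
  "scalar_flux_system i u y = (0, fst y *\<^sub>R r i u)"

lemma linear_flux_system: "linear (flux_system i u)"
  by (rule linearI) (simp_all add: flux_system_def algebra_simps)

lemma linear_scalar_flux_system: "linear (scalar_flux_system i u)"
  by (rule linearI) (simp_all add: scalar_flux_system_def algebra_simps)

lemma smooth_flux_system:
  assumes i: "i \<in> {1..3}"
  shows "smooth_on (\<Omega> \<times> UNIV) (\<lambda>q. flux_system i (fst q) (snd q))"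
proof -
  have o: "open (\<Omega> \<times> (UNIV :: (real \<times> real \<times> (real^'n)) set))" using open_\<Omega> by (simp add: open_Times)
  have F: "smooth_on (\<Omega> \<times> (UNIV :: (real \<times> real \<times> (real^'n)) set)) (\<lambda>q. g (fst q))" if "smooth_on \<Omega> g" for g :: "real^'n \<Rightarrow> 'c::real_normed_vector"
    by (rule smooth_on_compose[OF o open_\<Omega> that smooth_on_bounded_linear[OF bounded_linear_fst o]]) auto
  have x: "smooth_on (\<Omega> \<times> (UNIV :: (real \<times> real \<times> (real^'n)) set)) (\<lambda>q. fst (snd q))"
    by (rule smooth_on_fst[OF o smooth_on_bounded_linear[OF bounded_linear_snd o]])
  have y: "smooth_on (\<Omega> \<times> (UNIV :: (real \<times> real \<times> (real^'n)) set)) (\<lambda>q. fst (snd (snd q)))"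
    by (rule smooth_on_fst[OF o smooth_on_snd[OF o smooth_on_bounded_linear[OF bounded_linear_snd o]]])
  note w = smooth_on_diff[OF o x y]
  have "smooth_on (\<Omega> \<times> UNIV) (\<lambda>q. (\<phi> i 2 (fst q) * (fst (snd q) - fst (snd (snd q))), \<phi> i 3 (fst q) * (fst (snd q) - fst (snd (snd q))),
      (fst (snd (snd q)) + \<alpha> i (fst q) * (fst (snd q) - fst (snd (snd (q :: (real^'n) \<times> real \<times> real \<times> (real^'n)))))) *\<^sub>R r i (fst q)))"
    by (rule smooth_on_Pair[OF o smooth_on_mult[OF o F[OF smooth_phi[OF i]] w] smooth_on_Pair[OF o smooth_on_mult[OF o F[OF smooth_phi[OF i]] w]
          smooth_on_scaleR[OF o smooth_on_add[OF o y smooth_on_mult[OF o F[OF smooth_\<alpha>[OF i]] w]] F[OF smooth_r[OF i]]]]]) simp_all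
  then show ?thesis by (simp add: flux_system_def)
qed

lemma smooth_scalar_flux_system:
  assumes i: "i \<in> {1..3}"
  shows "smooth_on (\<Omega> \<times> UNIV) (\<lambda>q. scalar_flux_system i (fst q) (snd q))"
proof -
  have o: "open (\<Omega> \<times> (UNIV :: (real \<times> (real^'n)) set))" using open_\<Omega> by (simp add: open_Times)
  have r: "smooth_on (\<Omega> \<times> (UNIV :: (real \<times> (real^'n)) set)) (\<lambda>q. r i (fst q))"
    by (rule smooth_on_compose[OF o open_\<Omega> smooth_r[OF i] smooth_on_bounded_linear[OF bounded_linear_fst o]]) auto
  show ?thesis unfolding scalar_flux_system_def
    by (rule smooth_on_Pair[OF o smooth_on_const smooth_on_scaleR[OF o smooth_on_fst[OF o smooth_on_bounded_linear[OF bounded_linear_snd o]] r]])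
qed

section \<open>Involutivity of the lifted frames\<close>

lemma sum_Pair: "(\<Sum>k\<in>K. (f k, g k)) = (\<Sum>k\<in>K. f k, \<Sum>k\<in>K. g k)"
  by (simp add: prod_eq_iff fst_sum snd_sum)

lemma bracket_swap: "bracket X Y u = - bracket Y X u"
  by (simp add: bracket_def)

lemma involutive_by_ordered_pairs:
  fixes R :: "nat \<Rightarrow> 'a::real_normed_vector \<Rightarrow> 'a"
  assumes "\<And>i j. i \<in> {1..3} \<Longrightarrow> j \<in> {1..3} \<Longrightarrow> i < j \<Longrightarrow> bracket (R i) (R j) q = (\<Sum>k=1..3. d i j k *\<^sub>R R k q)"
  shows "bracket (R (idx i)) (R (idx j)) q \<in> span (range (\<lambda>k. R (idx k) q))"
proof -
  have *: "bracket (R a) (R b) q \<in> span (range (\<lambda>k. R (idx k) q))" if ab: "a \<in> {1..3}" "b \<in> {1..3}" "a < b" for a b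
    unfolding assms[OF ab] image_idx[of "\<lambda>k. R k q", symmetric] by (intro span_sum span_scale span_base imageI)
  consider "idx i < idx j" | "idx i = idx j" | "idx j < idx i" by linarith
  then show ?thesis
  proof cases
    case 1
    then show ?thesis using *[OF idx_range idx_range] by blast
  next
    case 2
    then show ?thesis by (simp add: bracket_def span_zero)
  next
    case 3
    then show ?thesis using *[OF idx_range idx_range 3] by (subst bracket_swap) (rule span_neg)
  qed
qed

text \<open>No integrability condition arises: the eigenfunction is constant along the frame and
  multiplies the \<open>r i\<close> only as a scalar, so the lifts have the same structure functions
  \<open>c\<close> as the frame.\<close>

lemma scalar_flux_system_involutive:
  assumes q: "q \<in> \<Omega> \<times> UNIV"
  defines "R \<equiv> \<lambda>i q. (r i (fst q), scalar_flux_system i (fst q) (snd q))"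
  shows "bracket (R (idx i)) (R (idx j)) q \<in> span (range (\<lambda>k. R (idx k) q))"
proof (rule involutive_by_ordered_pairs[where d="\<lambda>i j k. c i j k (fst q)"])
  fix i j :: nat assume i: "i \<in> {1..3}" and j: "j \<in> {1..3}"
  have u: "fst q \<in> \<Omega>" using q by auto
  have D: "FD (R j) q (R i q) = (FD (r j) (fst q) (r i (fst q)), 0, fst (snd q) *\<^sub>R FD (r j) (fst q) (r i (fst q)))"
    if j: "j \<in> {1..3}" for i j
  proof -
    have 1: "((\<lambda>q. r j (fst q)) has_derivative (\<lambda>v. FD (r j) (fst q) (fst v))) (at q)"
      by (rule FD_compose_eq[OF bounded_linear_imp_has_derivative[OF bounded_linear_fst] smooth_on_differentiable[OF smooth_r[OF j] u]])
    have 2: "((\<lambda>q :: (real^'n) \<times> real \<times> (real^'n). fst (snd q)) has_derivative (\<lambda>v. fst (snd v))) (at q)"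
      by (intro has_derivative_fst has_derivative_snd has_derivative_ident)
    have "(R j has_derivative (\<lambda>v. (FD (r j) (fst q) (fst v), 0, fst (snd q) *\<^sub>R FD (r j) (fst q) (fst v) + fst (snd v) *\<^sub>R r j (fst q)))) (at q)"
      unfolding R_def scalar_flux_system_def by (intro has_derivative_Pair 1 has_derivative_const has_derivative_scaleR 2)
    from FD_eq[OF this] show ?thesis by (simp add: R_def scalar_flux_system_def)
  qed
  have "bracket (R i) (R j) q = (bracket (r i) (r j) (fst q), 0, fst (snd q) *\<^sub>R bracket (r i) (r j) (fst q))"
    unfolding bracket_def[of "R i"] D[OF i] D[OF j] by (simp add: bracket_def scaleR_diff_right)
  also have "\<dots> = (\<Sum>k=1..3. c i j k (fst q) *\<^sub>R R k q)"
    unfolding bracket_c[OF i j u] by (simp add: R_def scalar_flux_system_def sum_Pair scaleR_sum_right mult.commute)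
  finally show "bracket (R i) (R j) q = (\<Sum>k=1..3. c i j k (fst q) *\<^sub>R R k q)" .
qed

text \<open>The lifts have the same structure functions \<open>c\<close> as the frame. The
  components for the two eigenfunctions amount to the conditions (C), and the component for the flux
  reverses the comparison of coefficients in \<open>flux_relations\<close>.\<close>

lemma flux_system_involutive:
  assumes q: "q \<in> \<Omega> \<times> UNIV" and rel: "row_relations (fst q)" and C: "conditions_C r c \<Gamma> (fst q)"
  defines "R \<equiv> \<lambda>i q. (r i (fst q), flux_system i (fst q) (snd q))"
  shows "bracket (R (idx i)) (R (idx j)) q \<in> span (range (\<lambda>k. R (idx k) q))"
proof (rule involutive_by_ordered_pairs[where d="\<lambda>i j k. c i j k (fst q)"])
  fix i j :: nat assume i: "i \<in> {1..3}" and j: "j \<in> {1..3}" and ij: "i < j"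
  define u where "u = fst q"
  define w where "w = fst (snd q) - fst (snd (snd q))"
  \<comment> \<open>The eigenfunction with index \<open>k\<close> as encoded in the unknowns at
    \<open>q\<close>.\<close>
  define \<Lambda> where "\<Lambda> k = fst (snd (snd q)) + \<alpha> k u * w" for k
  have u: "u \<in> \<Omega>" using q by (auto simp: u_def)
  have D: "FD (R j) q (R i q) = (FD (r j) u (r i u),
      \<phi> j 2 u * (\<phi> i 2 u * w - \<phi> i 3 u * w) + FD (\<phi> j 2) u (r i u) * w,
      \<phi> j 3 u * (\<phi> i 2 u * w - \<phi> i 3 u * w) + FD (\<phi> j 3) u (r i u) * w,
      \<Lambda> j *\<^sub>R FD (r j) u (r i u) + (\<Gamma> j i j u * (\<alpha> i u - \<alpha> j u) * w) *\<^sub>R r j u)"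
    if i: "i \<in> {1..3}" and j: "j \<in> {1..3}" and ij: "i \<noteq> j" for i j
  proof -
    have F: "((\<lambda>q. g (fst q)) has_derivative (\<lambda>v. FD g u (fst v))) (at q)" if "smooth_on \<Omega> g" for g :: "real^'n \<Rightarrow> 'c::real_normed_vector"
      unfolding u_def by (rule FD_compose_eq[OF bounded_linear_imp_has_derivative[OF bounded_linear_fst] smooth_on_differentiable[OF that u[unfolded u_def]]])
    have y: "((\<lambda>q :: (real^'n) \<times> real \<times> real \<times> (real^'n). fst (snd (snd q))) has_derivative (\<lambda>v. fst (snd (snd v)))) (at q)"
      by (intro has_derivative_fst has_derivative_snd has_derivative_ident)
    have x: "((\<lambda>q :: (real^'n) \<times> real \<times> real \<times> (real^'n). fst (snd q)) has_derivative (\<lambda>v. fst (snd v))) (at q)"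
      by (intro has_derivative_fst has_derivative_snd has_derivative_ident)
    note W = has_derivative_diff[OF x y]
    have p: "smooth_on \<Omega> (\<phi> j 2)" "smooth_on \<Omega> (\<phi> j 3)" by (rule smooth_phi[OF j], simp)+
    have "(R j has_derivative (\<lambda>v. (FD (r j) u (fst v),
        \<phi> j 2 (fst q) * (fst (snd v) - fst (snd (snd v))) + FD (\<phi> j 2) u (fst v) * (fst (snd q) - fst (snd (snd q))),
        \<phi> j 3 (fst q) * (fst (snd v) - fst (snd (snd v))) + FD (\<phi> j 3) u (fst v) * (fst (snd q) - fst (snd (snd q))),
        (fst (snd (snd q)) + \<alpha> j (fst q) * (fst (snd q) - fst (snd (snd q)))) *\<^sub>R FD (r j) u (fst v)
        + (fst (snd (snd v)) + (\<alpha> j (fst q) * (fst (snd v) - fst (snd (snd v))) + FD (\<alpha> j) u (fst v) * (fst (snd q) - fst (snd (snd q))))) *\<^sub>R r j (fst q)))) (at q)"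
      unfolding R_def flux_system_def
      by (intro has_derivative_Pair has_derivative_mult has_derivative_scaleR has_derivative_add W y F p smooth_r[OF j] smooth_\<alpha>[OF j])
    from FD_eq[OF this]
    have "FD (R j) q (R i q) = (FD (r j) u (r i u),
        \<phi> j 2 u * (\<phi> i 2 u * w - \<phi> i 3 u * w) + FD (\<phi> j 2) u (r i u) * w,
        \<phi> j 3 u * (\<phi> i 2 u * w - \<phi> i 3 u * w) + FD (\<phi> j 3) u (r i u) * w,
        \<Lambda> j *\<^sub>R FD (r j) u (r i u) + (\<phi> i 3 u * w + (\<alpha> j u * (\<phi> i 2 u * w - \<phi> i 3 u * w) + FD (\<alpha> j) u (r i u) * w)) *\<^sub>R r j u)"
      by (simp add: R_def flux_system_def \<Lambda>_def u_def[symmetric] w_def[symmetric])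
    moreover have "\<phi> i 3 u * w + (\<alpha> j u * (\<phi> i 2 u * w - \<phi> i 3 u * w) + FD (\<alpha> j) u (r i u) * w) = \<Gamma> j i j u * (\<alpha> i u - \<alpha> j u) * w"
      unfolding phi_identity[OF i j ij u, symmetric] by (simp add: algebra_simps)
    ultimately show ?thesis by simp
  qed
  have ne: "i \<noteq> j" "j \<noteq> i" using ij by auto
  have comp: "(\<phi> j s u * (\<phi> i 2 u * w - \<phi> i 3 u * w) + FD (\<phi> j s) u (r i u) * w)
      - (\<phi> i s u * (\<phi> j 2 u * w - \<phi> j 3 u * w) + FD (\<phi> i s) u (r j u) * w) = (\<Sum>k=1..3. c i j k u * (\<phi> k s u * w))"
    if s: "s \<in> {2, 3}" for s
  proof -
    have "FD (\<phi> j s) u (r i u) - FD (\<phi> i s) u (r j u) = \<phi> j 2 u * \<phi> i 3 u - \<phi> i 2 u * \<phi> j 3 u + (\<Sum>k=1..3. c i j k u * \<phi> k s u)"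
      using C i j ij s unfolding conditions_C_def along_def u_def[symmetric] by auto
    then have "(FD (\<phi> j s) u (r i u) - FD (\<phi> i s) u (r j u)) * w = (\<phi> j 2 u * \<phi> i 3 u - \<phi> i 2 u * \<phi> j 3 u + (\<Sum>k=1..3. c i j k u * \<phi> k s u)) * w"
      by simp
    moreover have "(\<Sum>k=1..3. c i j k u * \<phi> k s u) * w = (\<Sum>k=1..3. c i j k u * (\<phi> k s u * w))"
      by (simp add: sum_distrib_right mult.assoc)
    ultimately show ?thesis using s by (auto simp: algebra_simps)
  qed
  let ?g = "\<Gamma> j i j u * (\<alpha> i u - \<alpha> j u) * w" and ?h = "\<Gamma> i j i u * (\<alpha> j u - \<alpha> i u) * w"
  \<comment> \<open>For \<open>k\<close> equal to \<open>i\<close> or \<open>j\<close> this is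
    symmetry of the connection. For the third index it is the row of \<open>A_lambda\<close>
    belonging to \<open>k\<close>: the first row holds by the choice of \<open>\<alpha>\<close>, the
    others by \<open>row_relations\<close>.\<close>
  have coef: "\<Lambda> j * \<Gamma> i j k u + (if k = j then ?g else 0) - (\<Lambda> i * \<Gamma> j i k u + (if k = i then ?h else 0)) = c i j k u * \<Lambda> k"
    if k: "k \<in> {1..3}" for k
  proof -
    have ce: "c i j k u = \<Gamma> i j k u - \<Gamma> j i k u" by (rule c_eq[OF i j ne(1) k u])
    consider "k = i" | "k = j" | "k \<noteq> i" "k \<noteq> j" by blast
    then show ?thesis
    proof cases
      case 1
      then show ?thesis using ne unfolding ce by (simp add: \<Lambda>_def algebra_simps)
    next
      case 2
      then show ?thesis using ne unfolding ce by (simp add: \<Lambda>_def algebra_simps)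
    next
      case 3
      have "\<alpha> j u * \<Gamma> i j k u - \<alpha> i u * \<Gamma> j i k u = c i j k u * \<alpha> k u"
      proof -
        consider "i = 2" "j = 3" "k = 1" | "i = 1" "j = 3" "k = 2" | "i = 1" "j = 2" "k = 3"
          using cases_1_3[OF i] cases_1_3[OF j] cases_1_3[OF k] ij 3 by auto
        then show ?thesis
        proof cases
          case 1
          then show ?thesis using c321[OF u] by (simp add: \<alpha>_simps field_simps)
        next
          case 2
          then show ?thesis using rel by (simp add: row_relations_def u_def[symmetric] \<alpha>_simps(1,2) algebra_simps)
        next
          case 3
          then show ?thesis using rel by (simp add: row_relations_def u_def[symmetric] \<alpha>_simps(1,2) algebra_simps)
        qed
      qed
      then have "(\<alpha> j u * \<Gamma> i j k u - \<alpha> i u * \<Gamma> j i k u) * w = c i j k u * \<alpha> k u * w" by simp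
      then show ?thesis using 3 unfolding ce by (simp add: \<Lambda>_def algebra_simps)
    qed
  qed
  have "(\<Sum>k=1..3. (c i j k u * \<Lambda> k) *\<^sub>R r k u) = (\<Sum>k=1..3. (\<Lambda> j * \<Gamma> i j k u + (if k = j then ?g else 0)
      - (\<Lambda> i * \<Gamma> j i k u + (if k = i then ?h else 0))) *\<^sub>R r k u)"
    by (rule sum.cong) (simp_all only: coef)
  also have "\<dots> = (\<Lambda> j *\<^sub>R FD (r j) u (r i u) + ?g *\<^sub>R r j u) - (\<Lambda> i *\<^sub>R FD (r i) u (r j u) + ?h *\<^sub>R r i u)"
    unfolding nabla_\<Gamma>[OF i j ne(1) u] nabla_\<Gamma>[OF j i ne(2) u]
    by (simp only: scaleR_diff_left scaleR_add_left sum_subtractf sum.distrib sum_if_scaleR[OF i] sum_if_scaleR[OF j] scaleR_sum_right scaleR_scaleR)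
  finally have third: "(\<Lambda> j *\<^sub>R FD (r j) u (r i u) + ?g *\<^sub>R r j u) - (\<Lambda> i *\<^sub>R FD (r i) u (r j u) + ?h *\<^sub>R r i u)
      = (\<Sum>k=1..3. (c i j k u * \<Lambda> k) *\<^sub>R r k u)" by simp
  have Rk: "R k q = (r k u, \<phi> k 2 u * w, \<phi> k 3 u * w, \<Lambda> k *\<^sub>R r k u)" for k
    by (simp add: R_def flux_system_def \<Lambda>_def u_def[symmetric] w_def[symmetric])
  have "bracket (R i) (R j) q = (bracket (r i) (r j) u, (\<Sum>k=1..3. c i j k u * (\<phi> k 2 u * w)), (\<Sum>k=1..3. c i j k u * (\<phi> k 3 u * w)),
      (\<Sum>k=1..3. (c i j k u * \<Lambda> k) *\<^sub>R r k u))"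
    unfolding bracket_def[of "R i"] D[OF i j ne(1)] D[OF j i ne(2)] diff_Pair third
    using comp[of 2] comp[of 3] by (simp add: bracket_def)
  also have "\<dots> = (\<Sum>k=1..3. c i j k u *\<^sub>R R k q)"
    unfolding bracket_c[OF i j u] Rk by (simp add: sum_Pair)
  finally show "bracket (R i) (R j) q = (\<Sum>k=1..3. c i j k (fst q) *\<^sub>R R k q)" by (simp only: u_def)
qed

end

section \<open>From the connection to derivatives, and free determination by data on a
  transversal\<close>

lemma FD_vec_nth: "f differentiable (at u) \<Longrightarrow> FD (\<lambda>x. f x $ j) u v = FD f u v $ j"
  using FD_eq[OF bounded_linear.has_derivative[OF bounded_linear_vec_nth has_derivative_FD]] by metis

lemma nabla_eq_FD: "Y differentiable (at u) \<Longrightarrow> nabla X Y u = FD Y u (X u)"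
  by (simp add: nabla_def along_def vec_eq_iff FD_vec_nth)

lemma lie_bracket_eq_bracket:
  "X differentiable (at u) \<Longrightarrow> Y differentiable (at u) \<Longrightarrow> lie_bracket X Y u = bracket X Y u"
  by (simp add: nabla_symmetric[symmetric] nabla_eq_FD bracket_def)

text \<open>By independence of the frame the given coefficients coincide on \<open>\<Omega>\<close>
  with the smooth ones provided by the span.\<close>

lemma smooth_span_coefficients:
  assumes \<Omega>: "open \<Omega>" and frame: "partial_frame \<Omega> r {1..3}" and X: "X \<in> smooth_span \<Omega> r {1..3}"
    and b: "\<And>u. u \<in> \<Omega> \<Longrightarrow> X u = (\<Sum>k=1..3. b k u *\<^sub>R r k u)" and k: "k \<in> {1..3 :: nat}"
  shows "smooth_on \<Omega> (b k)"
proof -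
  obtain a where a: "\<And>i. i \<in> {1..3} \<Longrightarrow> smooth_on \<Omega> (a i)" and eq: "\<And>u. u \<in> \<Omega> \<Longrightarrow> X u = (\<Sum>i=1..3. a i u *\<^sub>R r i u)"
    using X unfolding smooth_span_def by blast
  have "b k u = a k u" if u: "u \<in> \<Omega>" for u
  proof -
    have "(\<Sum>i=1..3. (b i u - a i u) *\<^sub>R r i u) = 0"
      using b[OF u] eq[OF u] by (simp add: scaleR_diff_left sum_subtractf)
    then have "(\<Sum>i\<in>(UNIV :: 3 set). (b (idx i) u - a (idx i) u) *\<^sub>R r (idx i) u) = 0" by (simp add: sum_3 sum_1_3)
    then have "b (idx i) u - a (idx i) u = 0" for i by (rule frame_independent[OF frame u, of "\<lambda>i. b (idx i) u - a (idx i) u"])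
    from this[of 1] this[of 2] this[of 3] cases_1_3[OF k] show ?thesis by auto
  qed
  then show ?thesis using smooth_on_cong[OF \<Omega>, of "b k" "a k"] a[OF k] by simp
qed

lemma flux_with_eigenfunctions_iff:
  assumes "\<And>i. i \<in> I \<Longrightarrow> smooth_on \<Omega> (r i)"
  shows "flux_with_eigenfunctions \<Omega> r I p f lam \<longleftrightarrow>
    (\<exists>U. open U \<and> p \<in> U \<and> U \<subseteq> \<Omega> \<and> smooth_on U f \<and> (\<forall>i\<in>I. smooth_on U (lam i)) \<and>
      (\<forall>i\<in>I. \<forall>u\<in>U. FD f u (r i u) = lam i u *\<^sub>R r i u))"
proof -
  have "(\<forall>i\<in>I. \<forall>u\<in>U. nabla (r i) f u = lam i u *\<^sub>R r i u) \<longleftrightarrow> (\<forall>i\<in>I. \<forall>u\<in>U. FD f u (r i u) = lam i u *\<^sub>R r i u)"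
    if "smooth_on U f" for U
    using nabla_eq_FD[OF smooth_on_differentiable[OF that]] by simp
  then show ?thesis unfolding flux_with_eigenfunctions_def by (intro iff_exI) meson
qed

lemma strictly_hyperbolic_near_iff:
  fixes f :: "real^'n \<Rightarrow> real^'n"
  assumes U: "open U" "p \<in> U" "smooth_on U f"
  shows "strictly_hyperbolic_near p f \<longleftrightarrow> (\<forall>\<^sub>F u in nhds p. card {e::real. \<exists>v. v \<noteq> 0 \<and> FD f u v = e *\<^sub>R v} = CARD('n))"
  unfolding strictly_hyperbolic_near_def
proof (rule eventually_cong[OF eventually_nhds_in_open[OF U(1,2)]])
  fix u assume "u \<in> U"
  then have "nabla (\<lambda>_. v) f u = FD f u v" for v by (simp add: nabla_eq_FD smooth_on_differentiable[OF U(3)])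
  then show "card {e. \<exists>v. v \<noteq> 0 \<and> nabla (\<lambda>_. v) f u = e *\<^sub>R v} = CARD('n) \<longleftrightarrow> card {e. \<exists>v. v \<noteq> 0 \<and> FD f u v = e *\<^sub>R v} = CARD('n)"
    by simp
qed

text \<open>Assumptions \<open>E\<close> and \<open>U\<close> say that \<open>S\<close> and the
  local solutions of the linear system are the same germs at \<open>p\<close>. The transversal
  enters as the zero set of its defining function.\<close>

lemma freely_determined_linear_system:
  fixes \<Omega> :: "(real^'n) set" and B :: "3 \<Rightarrow> real^'n \<Rightarrow> 'b::euclidean_space \<Rightarrow> 'b"
  assumes n: "CARD('n) \<ge> 3" and \<Omega>: "open \<Omega>" and frame: "partial_frame \<Omega> r {1..3}"
    and \<Xi>: "\<Xi> \<in> transversals (CARD('n) - 3) \<Omega> r {1..3} p"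
    and \<Omega>': "open \<Omega>'" "p \<in> \<Omega>'" "\<Omega>' \<subseteq> \<Omega>"
    and B: "\<And>i. smooth_on (\<Omega>' \<times> UNIV) (\<lambda>q. B i (fst q) (snd q))" "\<And>i u. u \<in> \<Omega>' \<Longrightarrow> linear (B i u)"
    and inv: "\<And>i j q. q \<in> \<Omega>' \<times> UNIV \<Longrightarrow> bracket (\<lambda>q. (r (idx i) (fst q), B i (fst q) (snd q))) (\<lambda>q. (r (idx j) (fst q), B j (fst q) (snd q))) q
        \<in> span (range (\<lambda>k. (r (idx k) (fst q), B k (fst q) (snd q))))"
    and E: "\<And>W y. open W \<Longrightarrow> p \<in> W \<Longrightarrow> W \<subseteq> \<Omega>' \<Longrightarrow> smooth_on W y \<Longrightarrow> (\<And>u i. u \<in> W \<Longrightarrow> FD y u (r (idx i) u) = B i u (y u)) \<Longrightarrow>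
        \<exists>s\<in>S. \<forall>u\<in>W. s u = y u"
    and U: "\<And>s. s \<in> S \<Longrightarrow> \<exists>W. open W \<and> p \<in> W \<and> W \<subseteq> \<Omega>' \<and> smooth_on W s \<and> (\<forall>u\<in>W. \<forall>i. FD s u (r (idx i) u) = B i u (s u))"
  shows "freely_determined_along \<Xi> p S"
proof (rule transversal_defining_function[OF n \<Omega> frame \<Xi>])
  fix U and \<tau> :: "real^'n \<Rightarrow> real^3"
  assume U0: "open U" "p \<in> U" "U \<subseteq> \<Omega>" and \<tau>: "smooth_on U \<tau>" "\<tau> p = 0" and zero: "\<And>u. u \<in> U \<Longrightarrow> \<tau> u = 0 \<longleftrightarrow> u \<in> \<Xi>"
    and inj: "\<And>a :: real^3. (\<Sum>i\<in>UNIV. a $ i *\<^sub>R FD \<tau> p (r (idx i) p)) = 0 \<Longrightarrow> a = 0"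
  have r: "smooth_on T (r (idx i))" if "T \<subseteq> \<Omega>" for i T
    by (rule smooth_on_subset[OF _ that]) (use frame idx_range in \<open>auto simp: partial_frame_def\<close>)
  show ?thesis unfolding freely_determined_along_def
  proof (intro conjI allI impI ballI)
    fix d :: "real^'n \<Rightarrow> 'b" assume d: "smooth_along \<Xi> d"
    have "p \<in> \<Xi>" using zero[OF U0(2)] \<tau>(2) by simp
    from bspec[OF d[unfolded smooth_along_def] this] obtain U' h where U': "open U'" "p \<in> U'" and h: "smooth_on U' h" and hd: "\<And>x. x \<in> U' \<inter> \<Xi> \<Longrightarrow> h x = d x"
      by auto
    define S0 where "S0 = U \<inter> U' \<inter> \<Omega>'"
    have S0: "open S0" "p \<in> S0" "S0 \<subseteq> U" "S0 \<subseteq> U'" "S0 \<subseteq> \<Omega>'" "S0 \<times> UNIV \<subseteq> \<Omega>' \<times> (UNIV :: 'b set)"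
      using U0 U' \<Omega>' by (auto simp: S0_def)
    have "\<exists>W y. open W \<and> p \<in> W \<and> W \<subseteq> S0 \<and> smooth_on W y \<and>
        (\<forall>u\<in>W. \<forall>i. FD y u (r (idx i) u) = B i u (y u)) \<and> (\<forall>u\<in>W. \<tau> u = 0 \<longrightarrow> y u = h u)"
    proof (rule linear_system_exists[where r="\<lambda>i. r (idx i)" and B=B])
      show "open S0" "p \<in> S0" by fact+
      show "smooth_on S0 (r (idx i))" for i by (rule r) (use S0 U0 in blast)
      show "smooth_on S0 \<tau>" by (rule smooth_on_subset[OF \<tau>(1) S0(3)])
      show "\<tau> p = 0" by fact
      show "a = 0" if "(\<Sum>i\<in>UNIV. a $ i *\<^sub>R FD \<tau> p (r (idx i) p)) = 0" for a using inj[OF that] .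
      show "smooth_on (S0 \<times> UNIV) (\<lambda>q. B i (fst q) (snd q))" for i by (rule smooth_on_subset[OF B(1) S0(6)])
      show "linear (B i u)" if "u \<in> S0" for i u by (rule B(2)) (use that S0 in blast)
      show "bracket (\<lambda>q. (r (idx i) (fst q), B i (fst q) (snd q))) (\<lambda>q. (r (idx j) (fst q), B j (fst q) (snd q))) q
        \<in> span (range (\<lambda>k. (r (idx k) (fst q), B k (fst q) (snd q))))" if "q \<in> S0 \<times> UNIV" for i j q
        by (rule inv) (use that S0(6) in blast)
      show "smooth_on S0 h" by (rule smooth_on_subset[OF h S0(4)])
    qed
    then obtain W y where W: "open W" "p \<in> W" "W \<subseteq> S0" and y: "smooth_on W y"
      "\<forall>u\<in>W. \<forall>i. FD y u (r (idx i) u) = B i u (y u)" "\<forall>u\<in>W. \<tau> u = 0 \<longrightarrow> y u = h u" by auto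
    have "\<exists>s\<in>S. \<forall>u\<in>W. s u = y u" by (rule E[OF W(1,2) _ y(1)]) (use W S0 y in auto)
    then obtain s where s: "s \<in> S" "\<forall>u\<in>W. s u = y u" by blast
    have "\<forall>\<^sub>F x in nhds p. x \<in> \<Xi> \<longrightarrow> s x = d x"
    proof (rule eventually_mono[OF eventually_nhds_in_open[OF W(1,2)]], intro impI)
      fix x assume x: "x \<in> W" "x \<in> \<Xi>"
      then have "x \<in> U" "x \<in> U' \<inter> \<Xi>" using W(3) S0(3,4) by auto
      then show "s x = d x" using zero x hd s(2) y(3) by simp
    qed
    then show "\<exists>s\<in>S. \<forall>\<^sub>F x in nhds p. x \<in> \<Xi> \<longrightarrow> s x = d x" using s(1) by blast
  next
    fix s s' assume s: "s \<in> S" and s': "s' \<in> S" and ev: "\<forall>\<^sub>F x in nhds p. x \<in> \<Xi> \<longrightarrow> s x = s' x"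
    from ev[unfolded eventually_nhds] obtain N where "open N \<and> p \<in> N \<and> (\<forall>x\<in>N. x \<in> \<Xi> \<longrightarrow> s x = s' x)"
      by (rule exE)
    then have N: "open N" "p \<in> N" "\<And>x. x \<in> N \<Longrightarrow> x \<in> \<Xi> \<Longrightarrow> s x = s' x" by simp_all
    obtain W where W: "open W" "p \<in> W" "W \<subseteq> \<Omega>'" "smooth_on W s" "\<forall>u\<in>W. \<forall>i. FD s u (r (idx i) u) = B i u (s u)"
      using U[OF s] by blast
    obtain W' where W': "open W'" "p \<in> W'" "W' \<subseteq> \<Omega>'" "smooth_on W' s'" "\<forall>u\<in>W'. \<forall>i. FD s' u (r (idx i) u) = B i u (s' u)"
      using U[OF s'] by blast
    define S0 where "S0 = W \<inter> W' \<inter> N \<inter> U"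
    have S0: "open S0" "p \<in> S0" "S0 \<subseteq> W" "S0 \<subseteq> W'" "S0 \<subseteq> N" "S0 \<subseteq> U" "S0 \<subseteq> \<Omega>'" "S0 \<times> UNIV \<subseteq> \<Omega>' \<times> (UNIV :: 'b set)"
      using W W' N U0 by (auto simp: S0_def)
    \<comment> \<open>The difference of two solutions solves the same linear system with zero
      data.\<close>
    have "\<forall>\<^sub>F u in nhds p. s u - s' u = 0"
    proof (rule linear_system_unique[where r="\<lambda>i. r (idx i)" and B=B and \<tau>=\<tau>])
      show "open S0" "p \<in> S0" by fact+
      show "smooth_on S0 (r (idx i))" for i by (rule r) (use S0 U0 in blast)
      show "smooth_on S0 \<tau>" by (rule smooth_on_subset[OF \<tau>(1) S0(6)])
      show "\<tau> p = 0" by fact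
      show "a = 0" if "(\<Sum>i\<in>UNIV. a $ i *\<^sub>R FD \<tau> p (r (idx i) p)) = 0" for a using inj[OF that] .
      show "smooth_on (S0 \<times> UNIV) (\<lambda>q. B i (fst q) (snd q))" for i by (rule smooth_on_subset[OF B(1) S0(8)])
      show "linear (B i u)" if "u \<in> S0" for i u by (rule B(2)) (use that S0 in blast)
      show "bracket (\<lambda>q. (r (idx i) (fst q), B i (fst q) (snd q))) (\<lambda>q. (r (idx j) (fst q), B j (fst q) (snd q))) q
        \<in> span (range (\<lambda>k. (r (idx k) (fst q), B k (fst q) (snd q))))" if "q \<in> S0 \<times> UNIV" for i j q
        by (rule inv) (use that S0(8) in blast)
      show "open S0" "p \<in> S0" "S0 \<subseteq> S0" by (simp_all add: S0)
      show "smooth_on S0 (\<lambda>u. s u - s' u)"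
        by (rule smooth_on_diff[OF S0(1) smooth_on_subset[OF W(4) S0(3)] smooth_on_subset[OF W'(4) S0(4)]])
      show "FD (\<lambda>u. s u - s' u) u (r (idx i) u) = B i u (s u - s' u)" if u: "u \<in> S0" for u i
      proof -
        have uW: "u \<in> W" "u \<in> W'" "u \<in> \<Omega>'" using u S0 by auto
        have "FD (\<lambda>u. s u - s' u) u = (\<lambda>v. FD s u v - FD s' u v)"
          by (rule FD_eq[OF has_derivative_diff[OF smooth_on_has_derivative[OF W(4) uW(1)] smooth_on_has_derivative[OF W'(4) uW(2)]]])
        then show ?thesis using W(5) W'(5) uW by (simp add: linear_diff[OF B(2)])
      qed
      show "s u - s' u = 0" if "u \<in> S0" "\<tau> u = 0" for u
        using N(3)[of u] zero[of u] that S0 by auto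
    qed
    then show "\<forall>\<^sub>F x in nhds p. s x = s' x" by simp
  qed
qed

lemma nonzero_near:
  fixes g :: "'a::topological_space \<Rightarrow> real"
  assumes "open S" "p \<in> S" "continuous_on S g" "g p \<noteq> 0"
  obtains N where "open N" "p \<in> N" "N \<subseteq> S" "\<And>u. u \<in> N \<Longrightarrow> g u \<noteq> 0"
proof (rule that)
  show "open (S \<inter> g -` (- {0}))" by (rule continuous_open_preimage[OF assms(3,1) open_Compl[OF closed_singleton]])
qed (use assms in auto)

section \<open>The compatible and the incompatible case\<close>

context frame3
begin

lemma flux_iff: "flux_with_eigenfunctions \<Omega> r {1..3} p f lam \<longleftrightarrow>
    (\<exists>U. open U \<and> p \<in> U \<and> U \<subseteq> \<Omega> \<and> smooth_on U f \<and> (\<forall>i\<in>{1..3}. smooth_on U (lam i)) \<and>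
      (\<forall>i\<in>{1..3}. \<forall>u\<in>U. FD f u (r i u) = lam i u *\<^sub>R r i u))"
  by (rule flux_with_eigenfunctions_iff) (rule smooth_r)

text \<open>\<open>L\<close> is the orthogonal complement of the frame at \<open>p\<close>. The flat
  slice not only shows that transversals exist; it also allows data that are affine along it, as
  used for the strictly hyperbolic flux.\<close>

lemma transversal_slice:
  assumes n: "CARD('n) \<ge> 3" and p: "p \<in> \<Omega>"
  obtains L d where "subspace L" "dim L = CARD('n) - 3" "d > 0"
    "{x \<in> ball p d. x - p \<in> L} \<in> transversals (CARD('n) - 3) \<Omega> r {1..3} p"
proof -
  let ?R = "(\<lambda>i. r i p) ` {1..3}"
  define L where "L = {y \<in> UNIV. \<forall>x\<in>span ?R. orthogonal x y}"
  have ind: "inj_on (\<lambda>i. r i p) {1..3}" "independent ?R" using frame p unfolding partial_frame_def by blast+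
  have "dim (span ?R) = 3" using ind by (simp add: dim_eq_card_independent card_image)
  moreover have "dim L + dim (span ?R) = dim (UNIV :: (real^'n) set)"
    unfolding L_def by (rule dim_subspace_orthogonal_to_vectors) simp_all
  ultimately have dim: "dim L + 3 = CARD('n)" by simp
  have L: "subspace L" unfolding L_def using subspace_orthogonal_to_vectors[of "span ?R"] by simp
  obtain P :: "real^'n \<Rightarrow> real^3" where P: "bounded_linear P" "\<And>x. P x = 0 \<longleftrightarrow> x \<in> L"
    by (rule linear_map_with_kernel[where 'i=3, OF L]) (use dim in auto)
  have "a = 0" if a: "(\<Sum>i\<in>UNIV. a $ i *\<^sub>R P (r (idx i) p)) = 0" for a :: "real^3"
  proof -
    let ?v = "\<Sum>i\<in>UNIV. a $ i *\<^sub>R r (idx i) p"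
    have lin: "linear P" using P(1) by (rule bounded_linear.linear)
    have "P ?v = 0" using a by (simp add: linear_sum[OF lin] linear_scale[OF lin])
    then have "?v \<in> L" using P(2) by blast
    moreover have "?v \<in> span ?R"
      by (intro span_sum span_scale span_base) (use idx_range in auto)
    ultimately have "orthogonal ?v ?v" unfolding L_def by blast
    then have "?v = 0" by (simp only: orthogonal_self)
    then have "a $ i = 0" for i by (rule frame_independent[OF frame p])
    then show ?thesis by (simp add: vec_eq_iff)
  qed
  note inj = this
  have dim': "dim L = CARD('n) - 3" using dim by simp
  show ?thesis
    by (rule transversals_nonempty[OF n open_\<Omega> p frame P L dim' inj], assumption) (rule that[OF L dim'])
qed

lemma flux_of_solution:
  assumes W: "open W" "p \<in> W" "W \<subseteq> \<Omega>" and y: "smooth_on W y"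
    and eq: "\<And>u i. u \<in> W \<Longrightarrow> i \<in> {1..3} \<Longrightarrow> FD y u (r i u) = flux_system i u (y u)"
  shows "flux_with_eigenfunctions \<Omega> r {1..3} p (\<lambda>u. snd (snd (y u)))
    (\<lambda>i u. fst (snd (y u)) + \<alpha> i u * (fst (y u) - fst (snd (y u))))"
  unfolding flux_iff
proof (intro exI conjI ballI)
  note y1 = smooth_on_fst[OF W(1) y] and y2 = smooth_on_fst[OF W(1) smooth_on_snd[OF W(1) y]]
  show "open W" "p \<in> W" "W \<subseteq> \<Omega>" by fact+
  show f: "smooth_on W (\<lambda>u. snd (snd (y u)))" by (rule smooth_on_snd[OF W(1) smooth_on_snd[OF W(1) y]])
  show "smooth_on W (\<lambda>u. fst (snd (y u)) + \<alpha> i u * (fst (y u) - fst (snd (y u))))" if "i \<in> {1..3}" for i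
    by (rule smooth_on_add[OF W(1) y2 smooth_on_mult[OF W(1) smooth_on_subset[OF smooth_\<alpha>[OF that] W(3)] smooth_on_diff[OF W(1) y1 y2]]])
  show "FD (\<lambda>u. snd (snd (y u))) u (r i u) = (fst (snd (y u)) + \<alpha> i u * (fst (y u) - fst (snd (y u)))) *\<^sub>R r i u"
    if i: "i \<in> {1..3}" and u: "u \<in> W" for i u
  proof -
    have "FD (\<lambda>u. snd (snd (y u))) u = (\<lambda>v. snd (snd (FD y u v)))"
      by (rule FD_eq[OF has_derivative_snd[OF has_derivative_snd[OF smooth_on_has_derivative[OF y u]]]])
    then show ?thesis using eq[OF u i] by (simp add: flux_system_def)
  qed
qed

lemma solution_of_flux:
  assumes U: "open U" "U \<subseteq> \<Omega>" and f: "smooth_on U f" and lam: "\<And>i. i \<in> {1..3} \<Longrightarrow> smooth_on U (lam i)"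
    and flux: "\<And>i u. i \<in> {1..3} \<Longrightarrow> u \<in> U \<Longrightarrow> FD f u (r i u) = lam i u *\<^sub>R r i u"
    and i: "i \<in> {1..3}" and u: "u \<in> U"
  shows "FD (\<lambda>u. (lam 2 u, lam 3 u, f u)) u (r i u) = flux_system i u (lam 2 u, lam 3 u, f u)"
proof -
  have d: "(lam j has_derivative FD (lam j) u) (at u)" if "j \<in> {1..3}" for j
    using smooth_on_has_derivative[OF lam[OF that] u] .
  have "FD (\<lambda>u. (lam 2 u, lam 3 u, f u)) u = (\<lambda>v. (FD (lam 2) u v, FD (lam 3) u v, FD f u v))"
    by (rule FD_eq, intro has_derivative_Pair d smooth_on_has_derivative[OF f u]) simp_all
  moreover have "FD (lam s) u (r i u) = \<phi> i s u * (lam 2 u - lam 3 u)" if "s \<in> {2, 3}" for s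
    by (rule eigenfunction_system(2)[where U=U and f=f, OF U f lam flux i that u])
  moreover have "lam i u = lam 3 u + \<alpha> i u * (lam 2 u - lam 3 u)"
    by (rule eigenfunction_system(1)[where U=U and f=f, OF U f lam flux i u])
  ultimately show ?thesis using flux[OF i u] by (simp add: flux_system_def)
qed

lemma compatible_fluxes_freely_determined:
  assumes n: "CARD('n) \<ge> 3" and p: "p \<in> \<Omega>" and ev: "\<forall>\<^sub>F u in nhds p. rank (A_lambda c \<Gamma> u) = 1 \<and> conditions_C r c \<Gamma> u"
    and \<Xi>: "\<Xi> \<in> transversals (CARD('n) - 3) \<Omega> r {1..3} p"
  shows "freely_determined_along \<Xi> p {\<lambda>u. (lam 2 u, lam 3 u, f u) |f lam. flux_with_eigenfunctions \<Omega> r {1..3} p f lam}"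
    (is "freely_determined_along _ _ ?S")
proof -
  from ev[unfolded eventually_nhds] obtain N where N: "open N \<and> p \<in> N \<and> (\<forall>u\<in>N. rank (A_lambda c \<Gamma> u) = 1 \<and> conditions_C r c \<Gamma> u)"
    by (rule exE)
  define \<Omega>' where "\<Omega>' = N \<inter> \<Omega>"
  have \<Omega>': "open \<Omega>'" "p \<in> \<Omega>'" "\<Omega>' \<subseteq> \<Omega>" using N p open_\<Omega> by (auto simp: \<Omega>'_def)
  have good: "row_relations u" "conditions_C r c \<Gamma> u" if "u \<in> \<Omega>'" for u
    using that N rank_1_imp_row_relations[of u] by (auto simp: \<Omega>'_def)
  show ?thesis
  proof (rule freely_determined_linear_system[where B="\<lambda>i. flux_system (idx i)", OF n open_\<Omega> frame \<Xi> \<Omega>'])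
    show "smooth_on (\<Omega>' \<times> UNIV) (\<lambda>q. flux_system (idx i) (fst q) (snd q))" for i
      by (rule smooth_on_subset[OF smooth_flux_system[OF idx_range]]) (use \<Omega>' in blast)
    show "linear (flux_system (idx i) u)" for i u by (rule linear_flux_system)
    show "bracket (\<lambda>q. (r (idx i) (fst q), flux_system (idx i) (fst q) (snd q))) (\<lambda>q. (r (idx j) (fst q), flux_system (idx j) (fst q) (snd q))) q
        \<in> span (range (\<lambda>k. (r (idx k) (fst q), flux_system (idx k) (fst q) (snd q))))" if "q \<in> \<Omega>' \<times> UNIV" for i j q
    proof (rule flux_system_involutive)
      have "fst q \<in> \<Omega>'" using that by auto
      then show "q \<in> \<Omega> \<times> UNIV" "row_relations (fst q)" "conditions_C r c \<Gamma> (fst q)" using \<Omega>'(3) good by (auto simp: mem_Times_iff)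
    qed
  next
    fix W and y :: "real^'n \<Rightarrow> real \<times> real \<times> (real^'n)"
    assume W: "open W" "p \<in> W" "W \<subseteq> \<Omega>'" and y: "smooth_on W y" and eq: "\<And>u i. u \<in> W \<Longrightarrow> FD y u (r (idx i) u) = flux_system (idx i) u (y u)"
    have "flux_with_eigenfunctions \<Omega> r {1..3} p (\<lambda>u. snd (snd (y u))) (\<lambda>i u. fst (snd (y u)) + \<alpha> i u * (fst (y u) - fst (snd (y u))))"
    proof (rule flux_of_solution[OF W(1,2) _ y])
      show "W \<subseteq> \<Omega>" using W \<Omega>' by blast
      show "FD y u (r i u) = flux_system i u (y u)" if u: "u \<in> W" and "i \<in> {1..3}" for u i
        using that(2) eq[OF u] unfolding range_idx[symmetric] by auto
    qed
    \<comment> \<open>With \<open>\<alpha> 2\<close> equal to 1 and \<open>\<alpha> 3\<close> equal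
      to 0, the second and third of the rebuilt eigenfunctions are the first two components of
      \<open>y\<close>.\<close>
    then show "\<exists>s\<in>?S. \<forall>u\<in>W. s u = y u"
      by (intro bexI[where x="\<lambda>u. (fst (y u), fst (snd (y u)), snd (snd (y u)))"] CollectI exI conjI[rotated])
        (auto simp: \<alpha>_simps(1,2))
  next
    fix s assume "s \<in> ?S"
    then obtain f lam where s: "s = (\<lambda>u. (lam 2 u, lam 3 u, f u))" and "flux_with_eigenfunctions \<Omega> r {1..3} p f lam" by auto
    from this(2)[unfolded flux_iff] obtain U where "open U \<and> p \<in> U \<and> U \<subseteq> \<Omega> \<and> smooth_on U f \<and> (\<forall>i\<in>{1..3}. smooth_on U (lam i)) \<and>
      (\<forall>i\<in>{1..3}. \<forall>u\<in>U. FD f u (r i u) = lam i u *\<^sub>R r i u)" by (rule exE)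
    then have U: "open U" "p \<in> U" "U \<subseteq> \<Omega>" and f: "smooth_on U f" and lam: "\<And>i. i \<in> {1..3} \<Longrightarrow> smooth_on U (lam i)"
      and flux: "\<And>i u. i \<in> {1..3} \<Longrightarrow> u \<in> U \<Longrightarrow> FD f u (r i u) = lam i u *\<^sub>R r i u" by blast+
    show "\<exists>W. open W \<and> p \<in> W \<and> W \<subseteq> \<Omega>' \<and> smooth_on W s \<and> (\<forall>u\<in>W. \<forall>i. FD s u (r (idx i) u) = flux_system (idx i) u (s u))"
    proof (intro exI conjI ballI allI)
      show "open (U \<inter> \<Omega>')" "p \<in> U \<inter> \<Omega>'" "U \<inter> \<Omega>' \<subseteq> \<Omega>'" using U \<Omega>' by auto
      have "smooth_on U s" unfolding s by (intro smooth_on_Pair U(1) lam f) simp_all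
      then show "smooth_on (U \<inter> \<Omega>') s" by (rule smooth_on_subset) simp
      show "FD s u (r (idx i) u) = flux_system (idx i) u (s u)" if "u \<in> U \<inter> \<Omega>'" for u i
        unfolding s by (rule solution_of_flux[OF U(1,3) f lam flux idx_range]) (use that in auto)
    qed
  qed
qed

text \<open>All conditions are collected as smooth functions in \<open>G\<close> that should vanish;
  one that is nonzero at \<open>p\<close> stays nonzero nearby.\<close>

lemma incompatible_near:
  assumes p: "p \<in> \<Omega>" and bad: "\<not> (row_relations p \<and> conditions_C r c \<Gamma> p)"
  obtains N where "open N" "p \<in> N" "N \<subseteq> \<Omega>" "\<And>u. u \<in> N \<Longrightarrow> \<not> (row_relations u \<and> conditions_C r c \<Gamma> u)"
proof -
  define E where "E i j s u = FD (\<phi> j s) u (r i u) - FD (\<phi> i s) u (r j u) -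
    (\<phi> j 2 u * \<phi> i 3 u - \<phi> i 2 u * \<phi> j 3 u + (\<Sum>k=1..3. c i j k u * \<phi> k s u))" for i j s u
  define G where "G = {\<lambda>u. \<Gamma> 3 1 2 u * \<alpha> 1 u + c 1 3 2 u, \<lambda>u. \<Gamma> 2 1 3 u * \<alpha> 1 u - \<Gamma> 1 2 3 u} \<union>
    {E i j s |i j s. 1 \<le> i \<and> i < j \<and> j \<le> 3 \<and> s \<in> {2, 3}}"
  have iff: "row_relations u \<and> conditions_C r c \<Gamma> u \<longleftrightarrow> (\<forall>g\<in>G. g u = 0)" for u
  proof -
    have "conditions_C r c \<Gamma> u \<longleftrightarrow> (\<forall>i j s. 1 \<le> i \<and> i < j \<and> j \<le> 3 \<and> s \<in> {2, 3} \<longrightarrow> E i j s u = 0)"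
      unfolding conditions_C_def along_def E_def by simp
    then show ?thesis unfolding G_def row_relations_def by auto
  qed
  have E: "smooth_on \<Omega> (E i j s)" if "1 \<le> i \<and> i < j \<and> j \<le> 3 \<and> s \<in> {2, 3}" for i j s
  proof -
    have ij: "i \<in> {1..3}" "j \<in> {1..3}" "s \<in> {2, 3}" using that by auto
    show ?thesis unfolding E_def
      by (intro smooth_on_diff smooth_on_add smooth_on_sum smooth_on_mult smooth_on_FD open_\<Omega> smooth_phi smooth_r smooth_c ij) auto
  qed
  have smooth: "\<forall>g\<in>G. smooth_on \<Omega> g"
    unfolding G_def ball_Un
  proof (intro conjI ballI)
    fix g assume "g \<in> {\<lambda>u. \<Gamma> 3 1 2 u * \<alpha> 1 u + c 1 3 2 u, \<lambda>u. \<Gamma> 2 1 3 u * \<alpha> 1 u - \<Gamma> 1 2 3 u}"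
    then show "smooth_on \<Omega> g"
    proof (elim insertE emptyE)
      assume g: "g = (\<lambda>u. \<Gamma> 3 1 2 u * \<alpha> 1 u + c 1 3 2 u)"
      show ?thesis unfolding g by (intro smooth_on_add smooth_on_mult open_\<Omega> smooth_\<Gamma> smooth_c smooth_\<alpha>) simp_all
    next
      assume g: "g = (\<lambda>u. \<Gamma> 2 1 3 u * \<alpha> 1 u - \<Gamma> 1 2 3 u)"
      show ?thesis unfolding g by (intro smooth_on_diff smooth_on_mult open_\<Omega> smooth_\<Gamma> smooth_\<alpha>) simp_all
    qed
  next
    fix g assume "g \<in> {E i j s |i j s. 1 \<le> i \<and> i < j \<and> j \<le> 3 \<and> s \<in> {2, 3}}"
    then show "smooth_on \<Omega> g" using E by (elim CollectE exE conjE) simp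
  qed
  obtain g where g: "g \<in> G" "g p \<noteq> 0" using bad iff by blast
  show ?thesis
  proof (rule nonzero_near[OF open_\<Omega> p smooth_on_continuous_on[OF bspec[OF smooth g(1)]] g(2)])
    fix N assume N: "open N" "p \<in> N" "N \<subseteq> \<Omega>" "\<And>u. u \<in> N \<Longrightarrow> g u \<noteq> 0"
    show ?thesis by (rule that[OF N(1-3)]) (use N(4) g(1) iff in blast)
  qed
qed

text \<open>Wherever \<open>lam 2\<close> and \<open>lam 3\<close> differ, both compatibility
  conditions hold. So they agree on the entire neighbourhood of failure, and the closed system,
  proportional to their difference, makes all derivatives along the frame vanish.\<close>

lemma coinciding_eigenfunctions:
  assumes p: "p \<in> \<Omega>" and bad: "\<not> (row_relations p \<and> conditions_C r c \<Gamma> p)"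
    and flux: "flux_with_eigenfunctions \<Omega> r {1..3} p f lam"
  obtains V where "open V" "p \<in> V" "V \<subseteq> \<Omega>" "smooth_on V f" "smooth_on V (lam 1)"
    "\<And>i u. i \<in> {1..3} \<Longrightarrow> u \<in> V \<Longrightarrow> lam i u = lam 1 u"
    "\<And>i u. i \<in> {1..3} \<Longrightarrow> u \<in> V \<Longrightarrow> FD f u (r i u) = lam 1 u *\<^sub>R r i u"
    "\<And>i u. i \<in> {1..3} \<Longrightarrow> u \<in> V \<Longrightarrow> FD (lam 1) u (r i u) = 0"
proof (rule incompatible_near[OF p bad])
  fix N assume N: "open N" "p \<in> N" "N \<subseteq> \<Omega>" and badN: "\<And>u. u \<in> N \<Longrightarrow> \<not> (row_relations u \<and> conditions_C r c \<Gamma> u)"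
  from flux[unfolded flux_iff] obtain U where "open U \<and> p \<in> U \<and> U \<subseteq> \<Omega> \<and> smooth_on U f \<and> (\<forall>i\<in>{1..3}. smooth_on U (lam i)) \<and>
      (\<forall>i\<in>{1..3}. \<forall>u\<in>U. FD f u (r i u) = lam i u *\<^sub>R r i u)" by (rule exE)
  then have U: "open U" "p \<in> U" "U \<subseteq> \<Omega>" and f: "smooth_on U f" and lam: "\<And>i. i \<in> {1..3} \<Longrightarrow> smooth_on U (lam i)"
      and fl: "\<And>i u. i \<in> {1..3} \<Longrightarrow> u \<in> U \<Longrightarrow> FD f u (r i u) = lam i u *\<^sub>R r i u" by blast+
  have V: "open (U \<inter> N)" "p \<in> U \<inter> N" "U \<inter> N \<subseteq> \<Omega>" "U \<inter> N \<subseteq> U" using U N by auto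
  have w: "lam 2 u = lam 3 u" if "u \<in> U \<inter> N" for u
  proof (rule ccontr)
    assume ne: "lam 2 u \<noteq> lam 3 u"
    have u: "u \<in> U" "u \<in> N" using that by auto
    have "row_relations u" by (rule distinct_eigenfunctions_imp_row_relations[OF U(1,3) f lam fl u(1) ne])
    moreover have "conditions_C r c \<Gamma> u" by (rule distinct_eigenfunctions_imp_conditions_C[OF U(1,3) f lam fl u(1) ne])
    ultimately show False using badN[OF u(2)] by blast
  qed
  have eq3: "lam i u = lam 3 u" if "i \<in> {1..3}" "u \<in> U \<inter> N" for i u
  proof -
    have "lam i u = lam 3 u + \<alpha> i u * (lam 2 u - lam 3 u)"
      by (rule eigenfunction_system(1)[where U=U and f=f, OF U(1,3) f lam fl that(1)]) (use that in auto)
    then show ?thesis using w[OF that(2)] by simp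
  qed
  show ?thesis
  proof (rule that[OF V(1,2,3)])
    show "smooth_on (U \<inter> N) f" "smooth_on (U \<inter> N) (lam 1)"
      by (rule smooth_on_subset[OF f V(4)], rule smooth_on_subset[OF lam V(4)]) simp
    fix i :: nat and u assume i: "i \<in> {1..3}" and u: "u \<in> U \<inter> N"
    show e: "lam i u = lam 1 u" using eq3[OF i u] eq3[OF _ u, of 1] by simp
    show "FD f u (r i u) = lam 1 u *\<^sub>R r i u" using fl[OF i, of u] u e by simp
    have "FD (lam 1) u = FD (lam 3) u" by (rule FD_cong_open[OF V(1) u]) (use eq3[of 1] in auto)
    moreover have "FD (lam 3) u (r i u) = \<phi> i 3 u * (lam 2 u - lam 3 u)"
      by (rule eigenfunction_system(2)[where U=U and f=f, OF U(1,3) f lam fl i]) (use u in auto)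
    ultimately show "FD (lam 1) u (r i u) = 0" using w[OF u] by simp
  qed
qed

text \<open>Coincidence of the eigenfunctions turns each flux into a solution of the scalar system;
  conversely a solution is a flux with all three eigenfunctions equal to
  \<open>fst y\<close>.\<close>

lemma incompatible_fluxes_freely_determined:
  assumes n: "CARD('n) \<ge> 3" and p: "p \<in> \<Omega>" and bad: "\<not> (row_relations p \<and> conditions_C r c \<Gamma> p)"
    and \<Xi>: "\<Xi> \<in> transversals (CARD('n) - 3) \<Omega> r {1..3} p"
  shows "freely_determined_along \<Xi> p {\<lambda>u. (lam 1 u, f u) |f lam. flux_with_eigenfunctions \<Omega> r {1..3} p f lam}"
    (is "freely_determined_along _ _ ?S")
proof (rule freely_determined_linear_system[where B="\<lambda>i. scalar_flux_system (idx i)", OF n open_\<Omega> frame \<Xi> open_\<Omega> p subset_refl])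
  show "smooth_on (\<Omega> \<times> UNIV) (\<lambda>q. scalar_flux_system (idx i) (fst q) (snd q))" for i by (rule smooth_scalar_flux_system[OF idx_range])
  show "linear (scalar_flux_system (idx i) u)" for i u by (rule linear_scalar_flux_system)
  show "bracket (\<lambda>q. (r (idx i) (fst q), scalar_flux_system (idx i) (fst q) (snd q))) (\<lambda>q. (r (idx j) (fst q), scalar_flux_system (idx j) (fst q) (snd q))) q
      \<in> span (range (\<lambda>k. (r (idx k) (fst q), scalar_flux_system (idx k) (fst q) (snd q))))" if "q \<in> \<Omega> \<times> UNIV" for i j q
    by (rule scalar_flux_system_involutive[OF that])
next
  fix W and y :: "real^'n \<Rightarrow> real \<times> (real^'n)"
  assume W: "open W" "p \<in> W" "W \<subseteq> \<Omega>" and y: "smooth_on W y" and eq: "\<And>u i. u \<in> W \<Longrightarrow> FD y u (r (idx i) u) = scalar_flux_system (idx i) u (y u)"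
  have "flux_with_eigenfunctions \<Omega> r {1..3} p (\<lambda>u. snd (y u)) (\<lambda>i u. fst (y u))"
    unfolding flux_iff
  proof (intro exI conjI ballI)
    show "open W" "p \<in> W" "W \<subseteq> \<Omega>" by fact+
    show "smooth_on W (\<lambda>u. snd (y u))" "smooth_on W (\<lambda>u. fst (y u))"
      by (rule smooth_on_snd[OF W(1) y], rule smooth_on_fst[OF W(1) y])
    fix i :: nat and u assume i: "i \<in> {1..3}" and u: "u \<in> W"
    have "FD (\<lambda>u. snd (y u)) u = (\<lambda>v. snd (FD y u v))"
      by (rule FD_eq[OF has_derivative_snd[OF smooth_on_has_derivative[OF y u]]])
    moreover have "FD y u (r i u) = scalar_flux_system i u (y u)" using i eq[OF u] unfolding range_idx[symmetric] by auto
    ultimately show "FD (\<lambda>u. snd (y u)) u (r i u) = fst (y u) *\<^sub>R r i u" by (simp add: scalar_flux_system_def)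
  qed
  then show "\<exists>s\<in>?S. \<forall>u\<in>W. s u = y u"
    by (intro bexI[where x="\<lambda>u. (fst (y u), snd (y u))"] CollectI exI conjI[rotated]) auto
next
  fix s assume "s \<in> ?S"
  then obtain f lam where s: "s = (\<lambda>u. (lam 1 u, f u))" and flux: "flux_with_eigenfunctions \<Omega> r {1..3} p f lam" by auto
  show "\<exists>W. open W \<and> p \<in> W \<and> W \<subseteq> \<Omega> \<and> smooth_on W s \<and> (\<forall>u\<in>W. \<forall>i. FD s u (r (idx i) u) = scalar_flux_system (idx i) u (s u))"
  proof (rule coinciding_eigenfunctions[OF p bad flux])
    fix V assume V: "open V" "p \<in> V" "V \<subseteq> \<Omega>" and sm: "smooth_on V f" "smooth_on V (lam 1)"
      and f: "\<And>i u. i \<in> {1..3} \<Longrightarrow> u \<in> V \<Longrightarrow> FD f u (r i u) = lam 1 u *\<^sub>R r i u"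
      and l: "\<And>i u. i \<in> {1..3} \<Longrightarrow> u \<in> V \<Longrightarrow> FD (lam 1) u (r i u) = 0"
    have "FD s u (r (idx i) u) = scalar_flux_system (idx i) u (s u)" if u: "u \<in> V" for u i
    proof -
      have "FD s u = (\<lambda>v. (FD (lam 1) u v, FD f u v))"
        unfolding s by (rule FD_eq[OF has_derivative_Pair[OF smooth_on_has_derivative[OF sm(2) u] smooth_on_has_derivative[OF sm(1) u]]])
      then show ?thesis using f[OF idx_range u] l[OF idx_range u] by (simp add: s scalar_flux_system_def)
    qed
    moreover have "smooth_on V s" unfolding s by (rule smooth_on_Pair[OF V(1) sm(2,1)])
    ultimately show ?thesis using V by blast
  qed
qed

text \<open>\<open>r 1\<close> and \<open>r 2\<close> are independent eigenvectors for the same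
  eigenvalue at the base point.\<close>

lemma incompatible_fluxes_not_strictly_hyperbolic:
  assumes p: "p \<in> \<Omega>" and bad: "\<not> (row_relations p \<and> conditions_C r c \<Gamma> p)"
    and flux: "flux_with_eigenfunctions \<Omega> r {1..3} p f lam"
  shows "\<not> strictly_hyperbolic_near p f"
proof (rule coinciding_eigenfunctions[OF p bad flux])
  fix V assume V: "open V" "p \<in> V" and sm: "smooth_on V f"
    and f: "\<And>i u. i \<in> {1..3} \<Longrightarrow> u \<in> V \<Longrightarrow> FD f u (r i u) = lam 1 u *\<^sub>R r i u"
  have "card {e. \<exists>v. v \<noteq> 0 \<and> FD f p v = e *\<^sub>R v} \<noteq> DIM(real^'n)"
  proof (rule multiple_eigenvalue_card)
    show "linear (FD f p)" by (rule linear_FD[OF smooth_on_differentiable[OF sm V(2)]])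
    show "FD f p (r 1 p) = lam 1 p *\<^sub>R r 1 p" "FD f p (r 2 p) = lam 1 p *\<^sub>R r 2 p" by (rule f[OF _ V(2)], simp)+
    fix a b :: real assume "a *\<^sub>R r 1 p + b *\<^sub>R r 2 p = 0"
    then have "(\<Sum>k=1..3. (if k = 1 then a else if k = 2 then b else 0) *\<^sub>R r k p) = 0" by (simp add: sum_1_3)
    from coefficients_zero[OF p this, of 1] coefficients_zero[OF p this, of 2] show "a = 0 \<and> b = 0" by simp
  qed
  then show ?thesis
    unfolding strictly_hyperbolic_near_iff[OF V sm] by (auto dest: eventually_nhds_x_imp_x)
qed

text \<open>The three frame eigenvalues at \<open>p\<close> are fixed by the data for
  \<open>lam 2\<close> and \<open>lam 3\<close>. The remaining ones are prescribed by letting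
  \<open>f\<close> on the slice be linear and diagonal in a basis of \<open>L\<close>. Simplicity at
  \<open>p\<close> then extends to a neighbourhood.\<close>

lemma compatible_strictly_hyperbolic_flux:
  assumes n: "CARD('n) \<ge> 3" and p: "p \<in> \<Omega>" and ev: "\<forall>\<^sub>F u in nhds p. rank (A_lambda c \<Gamma> u) = 1 \<and> conditions_C r c \<Gamma> u"
  shows "\<exists>f \<in> fluxes \<Omega> r {1..3} p. strictly_hyperbolic_near p f"
proof (rule transversal_slice[OF n p])
  fix L d
  let ?\<Xi> = "{x \<in> ball p d. x - p \<in> L}"
  assume L: "subspace L" "dim L = CARD('n) - 3" and d: "d > 0" and \<Xi>: "?\<Xi> \<in> transversals (CARD('n) - 3) \<Omega> r {1..3} p"
  obtain C where C: "C \<subseteq> L" "independent C" "L \<subseteq> span C" "card C = dim L" using basis_exists[of L] by metis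
  have finC: "finite C" by (rule independent_imp_finite[OF C(2)])
  obtain k :: "real^'n \<Rightarrow> nat" where k: "inj_on k C" using finite_imp_inj_to_nat_seg[OF finC] by metis
  \<comment> \<open>Pairwise different by injectivity of \<open>k\<close> on \<open>C\<close>, and
    larger than 0, 1 and \<open>\<alpha> 1 p\<close>.\<close>
  define \<mu> where "\<mu> e = 2 + \<bar>\<alpha> 1 p\<bar> + real (k e)" for e
  have \<mu>: "inj_on \<mu> C" using k by (simp add: inj_on_def \<mu>_def)
  have \<mu>1: "\<mu> e \<noteq> 0" "\<mu> e \<noteq> 1" "\<mu> e \<noteq> \<alpha> 1 p" for e unfolding \<mu>_def by linarith+
  obtain Q where Q: "linear Q" "\<forall>e\<in>C. Q e = \<mu> e *\<^sub>R e"
    using linear_independent_extend[OF C(2), of "\<lambda>e. \<mu> e *\<^sub>R e"] by auto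
  have h: "smooth_along ?\<Xi> (\<lambda>x. (1 :: real, 0 :: real, Q (x - p)))"
    unfolding smooth_along_def
  proof (intro ballI exI conjI)
    have "smooth_on UNIV (\<lambda>x. Q (x - p))"
      by (rule bounded_linear.smooth_on[OF linear_conv_bounded_linear[THEN iffD1, OF Q(1)] open_UNIV
          smooth_on_diff[OF open_UNIV smooth_on_ident[OF open_UNIV] smooth_on_const]])
    then show "smooth_on UNIV (\<lambda>x. (1 :: real, 0 :: real, Q (x - p)))"
      by (intro smooth_on_Pair open_UNIV smooth_on_const)
  qed simp_all
  note free = compatible_fluxes_freely_determined[OF n p ev \<Xi>, unfolded freely_determined_along_def, THEN conjunct1]
  have "\<exists>s\<in>{\<lambda>u. (lam 2 u, lam 3 u, f u) |f lam. flux_with_eigenfunctions \<Omega> r {1..3} p f lam}.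
      \<forall>\<^sub>F x in nhds p. x \<in> ?\<Xi> \<longrightarrow> s x = (1, 0, Q (x - p))" by (rule mp[OF spec[OF free] h])
  then obtain f lam where flux: "flux_with_eigenfunctions \<Omega> r {1..3} p f lam"
    and data: "\<forall>\<^sub>F x in nhds p. x \<in> ?\<Xi> \<longrightarrow> (lam 2 x, lam 3 x, f x) = (1, 0, Q (x - p))" by (elim bexE CollectE exE conjE) simp
  from data[unfolded eventually_nhds] obtain N where
    "open N \<and> p \<in> N \<and> (\<forall>x\<in>N. x \<in> ?\<Xi> \<longrightarrow> (lam 2 x, lam 3 x, f x) = (1, 0, Q (x - p)))" by (rule exE)
  then have N: "open N" "p \<in> N" and on: "\<And>x. x \<in> N \<Longrightarrow> x \<in> ?\<Xi> \<Longrightarrow> lam 2 x = 1 \<and> lam 3 x = 0 \<and> f x = Q (x - p)" by simp_all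
  from flux[unfolded flux_iff] obtain U where "open U \<and> p \<in> U \<and> U \<subseteq> \<Omega> \<and> smooth_on U f \<and> (\<forall>i\<in>{1..3}. smooth_on U (lam i)) \<and>
      (\<forall>i\<in>{1..3}. \<forall>u\<in>U. FD f u (r i u) = lam i u *\<^sub>R r i u)" by (rule exE)
  then have U: "open U" "p \<in> U" "U \<subseteq> \<Omega>" and f: "smooth_on U f" and lam: "\<And>i. i \<in> {1..3} \<Longrightarrow> smooth_on U (lam i)"
      and fl: "\<And>i u. i \<in> {1..3} \<Longrightarrow> u \<in> U \<Longrightarrow> FD f u (r i u) = lam i u *\<^sub>R r i u" by blast+
  have "p \<in> ?\<Xi>" using d subspace_0[OF L(1)] by simp
  from on[OF N(2) this] have l: "lam 2 p = 1" "lam 3 p = 0" by simp_all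
  have "lam 1 p = lam 3 p + \<alpha> 1 p * (lam 2 p - lam 3 p)"
    by (rule eigenfunction_system(1)[where U=U and f=f, OF U(1,3) f lam fl _ U(2)]) simp_all
  then have l1: "lam 1 p = \<alpha> 1 p" by (simp add: l)
  have FDe: "FD f p e = \<mu> e *\<^sub>R e" if e: "e \<in> C" for e
  proof -
    \<comment> \<open>Times for which the line through \<open>p\<close> in direction
      \<open>e\<close> stays in the slice and in the region where the data are attained; on it
      \<open>f\<close> equals \<open>t *\<^sub>R Q e\<close>, which gives its derivative.\<close>
    define T where "T = (\<lambda>t. p + t *\<^sub>R e) -` (N \<inter> ball p d)"
    have T: "open T" unfolding T_def by (rule open_vimage) (use N in \<open>auto intro!: continuous_intros\<close>)
    have T0: "0 \<in> T" using N d by (simp add: T_def)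
    have "((\<lambda>t. f (p + t *\<^sub>R e)) has_vector_derivative FD f p e) (at 0)"
      using FD_along_line[of f p 0 e UNIV] smooth_on_differentiable[OF f U(2)] by simp
    then have "((\<lambda>t. t *\<^sub>R Q e) has_vector_derivative FD f p e) (at 0)"
    proof (rule has_vector_derivative_transform_within_open[OF _ T T0])
      fix t assume "t \<in> T"
      then have "p + t *\<^sub>R e \<in> N" "p + t *\<^sub>R e \<in> ball p d" by (simp_all add: T_def)
      moreover have "t *\<^sub>R e \<in> L" by (rule subspace_scale[OF L(1)]) (use e C in blast)
      ultimately show "f (p + t *\<^sub>R e) = t *\<^sub>R Q e" using on[of "p + t *\<^sub>R e"] by (simp add: linear_scale[OF Q(1)])
    qed
    moreover have "((\<lambda>t. t *\<^sub>R Q e) has_vector_derivative Q e) (at 0)" by (auto intro!: derivative_eq_intros)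
    ultimately have "FD f p e = Q e" by (rule vector_derivative_unique_at)
    then show ?thesis using Q(2) e by simp
  qed
  have rn: "r i p \<noteq> 0" if "i \<in> {1..3}" for i
  proof
    assume "r i p = 0"
    with imageI[OF that, of "\<lambda>i. r i p"] have "dependent ((\<lambda>i. r i p) ` {1..3})" by (intro dependent_zero) simp
    then show False using frame p by (simp add: partial_frame_def)
  qed
  let ?E = "{e. \<exists>v. v \<noteq> 0 \<and> FD f p v = e *\<^sub>R v}"
  have "{1, 0, \<alpha> 1 p} \<union> \<mu> ` C \<subseteq> ?E"
  proof -
    have "lam i p \<in> ?E" if "i \<in> {1..3}" for i using fl[OF that U(2)] rn[OF that] by blast
    from this[of 1] this[of 2] this[of 3] have "\<alpha> 1 p \<in> ?E" "1 \<in> ?E" "0 \<in> ?E" by (simp_all add: l l1)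
    moreover have "\<mu> e \<in> ?E" if "e \<in> C" for e
    proof -
      have "e \<noteq> 0" using that C(2) dependent_zero[of C] by auto
      then show ?thesis using FDe[OF that] by blast
    qed
    ultimately show ?thesis by blast
  qed
  moreover have "card ({1, 0, \<alpha> 1 p} \<union> \<mu> ` C) = CARD('n)"
  proof -
    have "card ({1, 0, \<alpha> 1 p} \<union> \<mu> ` C) = card {1, 0, \<alpha> 1 p} + card (\<mu> ` C)"
      by (rule card_Un_disjoint) (use finC \<mu>1 \<mu>1[symmetric] in auto)
    also have "card {1, 0, \<alpha> 1 p} = 3" using \<alpha>1[OF p] by simp
    also have "card (\<mu> ` C) = CARD('n) - 3" using card_image[OF \<mu>] C(4) L(2) by simp
    finally show ?thesis using n by simp
  qed
  ultimately have "strictly_hyperbolic_near p f"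
    unfolding strictly_hyperbolic_near_iff[OF U(1,2) f] by (rule distinct_eigenvalues_open[OF U(1,2) f])
  then show ?thesis using flux unfolding fluxes_def by blast
qed

end

theorem theorem5p9:
  fixes \<Omega> :: "(real^'n) set" and ubar :: "real^'n"
    and r :: "nat \<Rightarrow> real^'n \<Rightarrow> real^'n"
    and c \<Gamma> :: "nat \<Rightarrow> nat \<Rightarrow> nat \<Rightarrow> real^'n \<Rightarrow> real"
  assumes "CARD('n) \<ge> 3"
    and "open \<Omega>" and "ubar \<in> \<Omega>"
    and "partial_frame \<Omega> r {1..3}"
    and "in_involution \<Omega> r {1..3}"
    and "\<not> rich \<Omega> r {1..3}"
    and "\<And>i j. i \<in> {1..3} \<Longrightarrow> j \<in> {1..3} \<Longrightarrow> i \<noteq> j \<Longrightarrow>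
           nabla (r i) (r j) \<in> smooth_span \<Omega> r {i, j} \<longleftrightarrow>
           lie_bracket (r i) (r j) \<in> smooth_span \<Omega> r {i, j}"
    and "\<And>i j. i \<in> {1..3} \<Longrightarrow> j \<in> {1..3} \<Longrightarrow> i \<noteq> j \<Longrightarrow>
           nabla (r i) (r j) \<in> smooth_span \<Omega> r {1..3}"
    and "\<And>i j u. i \<in> {1..3} \<Longrightarrow> j \<in> {1..3} \<Longrightarrow> u \<in> \<Omega> \<Longrightarrow>
           lie_bracket (r i) (r j) u = (\<Sum>k=1..3. c i j k u *\<^sub>R r k u)"
    and "\<And>i j u. i \<in> {1..3} \<Longrightarrow> j \<in> {1..3} \<Longrightarrow> i \<noteq> j \<Longrightarrow> u \<in> \<Omega> \<Longrightarrow>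
           nabla (r i) (r j) u = (\<Sum>k=1..3. \<Gamma> i j k u *\<^sub>R r k u)"
    and "\<And>u. u \<in> \<Omega> \<Longrightarrow> c 2 3 1 u \<noteq> 0"
    and "\<And>u. u \<in> \<Omega> \<Longrightarrow> \<Gamma> 2 3 1 u \<noteq> 0 \<and> \<Gamma> 3 2 1 u \<noteq> 0"
  shows
    "((\<forall>\<^sub>F u in nhds ubar. rank (A_lambda c \<Gamma> u) = 1 \<and> conditions_C r c \<Gamma> u) \<longrightarrow>
        transversals (CARD('n) - 3) \<Omega> r {1..3} ubar \<noteq> {} \<and>
        (\<forall>\<Xi> \<in> transversals (CARD('n) - 3) \<Omega> r {1..3} ubar.
           freely_determined_along \<Xi> ubar
             {\<lambda>u. (lam 2 u, lam 3 u, f u) |f lam.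
                flux_with_eigenfunctions \<Omega> r {1..3} ubar f lam}) \<and>
        (\<exists>f \<in> fluxes \<Omega> r {1..3} ubar. strictly_hyperbolic_near ubar f))
     \<and>
     (rank (A_lambda c \<Gamma> ubar) = 2 \<or> \<not> conditions_C r c \<Gamma> ubar \<longrightarrow>
        (\<forall>f lam. flux_with_eigenfunctions \<Omega> r {1..3} ubar f lam \<longrightarrow>
           (\<exists>V l. open V \<and> ubar \<in> V \<and> V \<subseteq> \<Omega> \<and>
              (\<forall>u\<in>V. lam 1 u = l u \<and> lam 2 u = l u \<and> lam 3 u = l u) \<and>
              (\<forall>N. integral_manifold r {1..3} N \<and> N \<subseteq> V \<longrightarrow> l constant_on N))) \<and>
        transversals (CARD('n) - 3) \<Omega> r {1..3} ubar \<noteq> {} \<and>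
        (\<forall>\<Xi> \<in> transversals (CARD('n) - 3) \<Omega> r {1..3} ubar.
           freely_determined_along \<Xi> ubar
             {\<lambda>u. (lam 1 u, f u) |f lam.
                flux_with_eigenfunctions \<Omega> r {1..3} ubar f lam}) \<and>
        \<not> (\<exists>f \<in> fluxes \<Omega> r {1..3} ubar. strictly_hyperbolic_near ubar f))"
proof -
  have sr: "smooth_on \<Omega> (r i)" if "i \<in> {1..3}" for i using assms(4) that by (simp add: partial_frame_def)
  have dr: "r i differentiable (at u)" if "i \<in> {1..3}" "u \<in> \<Omega>" for i u by (rule smooth_on_differentiable[OF sr that(2)]) fact
  interpret frame3 \<Omega> r c \<Gamma>
  proof
    show "open \<Omega>" "partial_frame \<Omega> r {1..3}" by fact+
    fix i j :: nat assume i: "i \<in> {1..3}" and j: "j \<in> {1..3}"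
    show "bracket (r i) (r j) u = (\<Sum>k=1..3. c i j k u *\<^sub>R r k u)" if "u \<in> \<Omega>" for u
      using assms(9)[OF i j that] unfolding lie_bracket_eq_bracket[OF dr[OF i that] dr[OF j that]] .
    show "FD (r j) u (r i u) = (\<Sum>k=1..3. \<Gamma> i j k u *\<^sub>R r k u)" if "i \<noteq> j" "u \<in> \<Omega>" for u
      using assms(10)[OF i j that] unfolding nabla_eq_FD[OF dr[OF j that(2)]] .
    show "smooth_on \<Omega> (c i j k)" if "k \<in> {1..3}" for k
      by (rule smooth_span_coefficients[OF assms(2,4) assms(5)[unfolded in_involution_def, rule_format, OF i j] assms(9)[OF i j] that])
    show "smooth_on \<Omega> (\<Gamma> i j k)" if "k \<in> {1..3}" "i \<noteq> j" for k
      by (rule smooth_span_coefficients[OF assms(2,4) assms(8)[OF i j that(2)] assms(10)[OF i j that(2)] that(1)])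
  next
    show "c 2 3 1 u \<noteq> 0" "\<Gamma> 2 3 1 u \<noteq> 0" "\<Gamma> 3 2 1 u \<noteq> 0" if "u \<in> \<Omega>" for u using assms(11,12)[OF that] by blast+
  qed
  have nonempty: "transversals (CARD('n) - 3) \<Omega> r {1..3} ubar \<noteq> {}"
    by (rule transversal_slice[OF assms(1,3)]) blast
  show ?thesis
  proof (rule conjI; rule impI)
    assume ev: "\<forall>\<^sub>F u in nhds ubar. rank (A_lambda c \<Gamma> u) = 1 \<and> conditions_C r c \<Gamma> u"
    show "transversals (CARD('n) - 3) \<Omega> r {1..3} ubar \<noteq> {} \<and>
        (\<forall>\<Xi> \<in> transversals (CARD('n) - 3) \<Omega> r {1..3} ubar.
           freely_determined_along \<Xi> ubar
             {\<lambda>u. (lam 2 u, lam 3 u, f u) |f lam. flux_with_eigenfunctions \<Omega> r {1..3} ubar f lam}) \<and>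
        (\<exists>f \<in> fluxes \<Omega> r {1..3} ubar. strictly_hyperbolic_near ubar f)"
      by (intro conjI ballI nonempty compatible_fluxes_freely_determined[OF assms(1,3) ev]
          compatible_strictly_hyperbolic_flux[OF assms(1,3) ev])
  next
    assume "rank (A_lambda c \<Gamma> ubar) = 2 \<or> \<not> conditions_C r c \<Gamma> ubar"
    \<comment> \<open>Either hypothesis excludes compatibility at the base point, since the row
      relations rule out rank 2.\<close>
    then have bad: "\<not> (row_relations ubar \<and> conditions_C r c \<Gamma> ubar)"
      using row_relations_imp_rank[OF assms(3)] by blast
    have "\<exists>V l. open V \<and> ubar \<in> V \<and> V \<subseteq> \<Omega> \<and> (\<forall>u\<in>V. lam 1 u = l u \<and> lam 2 u = l u \<and> lam 3 u = l u) \<and>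
        (\<forall>N. integral_manifold r {1..3} N \<and> N \<subseteq> V \<longrightarrow> l constant_on N)"
      if flux: "flux_with_eigenfunctions \<Omega> r {1..3} ubar f lam" for f lam
    proof (rule coinciding_eigenfunctions[OF assms(3) bad flux])
      fix V assume V: "open V" "ubar \<in> V" "V \<subseteq> \<Omega>" and l: "smooth_on V (lam 1)"
        and eq: "\<And>i u. i \<in> {1..3} \<Longrightarrow> u \<in> V \<Longrightarrow> lam i u = lam 1 u"
        and zero: "\<And>i u. i \<in> {1..3} \<Longrightarrow> u \<in> V \<Longrightarrow> FD (lam 1) u (r i u) = 0"
      show ?thesis
      proof (intro exI conjI allI ballI impI)
        show "open V" "ubar \<in> V" "V \<subseteq> \<Omega>" by fact+
        show "lam 1 u = lam 1 u" "lam 2 u = lam 1 u" "lam 3 u = lam 1 u" if "u \<in> V" for u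
          using eq[OF _ that, of 2] eq[OF _ that, of 3] by simp_all
        show "lam 1 constant_on N" if "integral_manifold r {1..3} N \<and> N \<subseteq> V" for N
          by (rule constant_on_integral_manifold[OF V(1) l zero]) (use that in auto)
      qed
    qed
    moreover have "\<not> (\<exists>f \<in> fluxes \<Omega> r {1..3} ubar. strictly_hyperbolic_near ubar f)"
      unfolding fluxes_def using incompatible_fluxes_not_strictly_hyperbolic[OF assms(3) bad] by blast
    ultimately show "(\<forall>f lam. flux_with_eigenfunctions \<Omega> r {1..3} ubar f lam \<longrightarrow>
           (\<exists>V l. open V \<and> ubar \<in> V \<and> V \<subseteq> \<Omega> \<and>
              (\<forall>u\<in>V. lam 1 u = l u \<and> lam 2 u = l u \<and> lam 3 u = l u) \<and>
              (\<forall>N. integral_manifold r {1..3} N \<and> N \<subseteq> V \<longrightarrow> l constant_on N))) \<and>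
        transversals (CARD('n) - 3) \<Omega> r {1..3} ubar \<noteq> {} \<and>
        (\<forall>\<Xi> \<in> transversals (CARD('n) - 3) \<Omega> r {1..3} ubar.
           freely_determined_along \<Xi> ubar {\<lambda>u. (lam 1 u, f u) |f lam. flux_with_eigenfunctions \<Omega> r {1..3} ubar f lam}) \<and>
        \<not> (\<exists>f \<in> fluxes \<Omega> r {1..3} ubar. strictly_hyperbolic_near ubar f)"
      by (intro conjI allI impI ballI nonempty incompatible_fluxes_freely_determined[OF assms(1,3) bad]) assumption+
  qed
qed

end
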